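(* Let $k$ be a field of characteristic $p>0$ with $[k:k^p]<\infty$, let $R=k[x_0,\dots,x_n]$ with its standard grading, $\mathfrak m=(x_0,\dots,x_n)$, and let $f\in R$ be homogeneous of degree $d$. Assume that $(R/fR)_{\mathfrak m}$ is not F-pure. Then $R/fR$ has an isolated non-F-pure point at $\mathfrak m$ if and only if the Frobenius action $$F: H^n_{\mathfrak m}(R/fR)_{\le -n(d-1)}\to H^n_{\mathfrak m}(R/fR)_{\le -pn(d-1)}$$ is injective.
   Context: A ring $A$ of characteristic $p$ is F-pure if its Frobenius map $a\mapsto a^p$ is pure (the zero ring counts as F-pure). $R/fR$ has an isolated non-F-pure point at $\mathfrak m$ if $(R/fR)_{\mathfrak m}$ is not F-pure but $(R/fR)_{\mathfrak p}$ is F-pure for every prime $\mathfrak p\subsetneq\mathfrak m$. The local cohomology module $H^n_{\mathfrak m}(R/fR)$ is $\mathbb Z$-graded. The Frobenius action $F$ on it is the additive map induced by the Frobenius ring homomorphism $R/fR\to R/fR$, $a\mapsto a^p$; it sends degree $i$ to degree $pi$. For a graded module $H$, $H_{\le N}$ denotes the direct sum of its graded pieces of degree at most $N$. *)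

theory Defs
  imports "HOL-Algebra.Algebra" "HOL-Library.Poly_Mapping"
begin

section \<open>Polynomial rings\<close>

definition ring_on :: "'a::comm_ring_1 set \<Rightarrow> 'a ring" where
  "ring_on C = \<lparr>carrier = C, monoid.mult = (*), one = 1, ring.zero = 0, ring.add = (+)\<rparr>"

lemma cring_ring_on:
  assumes "0 \<in> C" "1 \<in> C" "\<And>a b. a \<in> C \<Longrightarrow> b \<in> C \<Longrightarrow> a + b \<in> C"
    "\<And>a b. a \<in> C \<Longrightarrow> b \<in> C \<Longrightarrow> a * b \<in> C" "\<And>a. a \<in> C \<Longrightarrow> - a \<in> C"
  shows "cring (ring_on C)"
proof (rule cringI)
  show "abelian_group (ring_on C)"
    by (rule abelian_groupI) (auto simp: ring_on_def assms algebra_simps intro!: bexI[of _ "- _"])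
  show "comm_monoid (ring_on C)"
    by (rule comm_monoidI) (auto simp: ring_on_def assms algebra_simps)
qed (auto simp: ring_on_def algebra_simps)

text \<open>
  Polynomials with coefficients in \<open>'k\<close> in the variables \<open>x\<^sub>0, x\<^sub>1, \<dots>\<close> are finitely supported
  functions from monomials (finitely supported exponent vectors) to \<open>'k\<close>; the library
  multiplication on them is convolution. The ring \<open>k[x\<^sub>0, \<dots>, x\<^sub>n]\<close> consists of those that only
  involve \<open>x\<^sub>0, \<dots>, x\<^sub>n\<close>, so it has \<open>n + 1\<close> variables.
\<close>

type_synonym 'k mpoly = "(nat \<Rightarrow>\<^sub>0 nat) \<Rightarrow>\<^sub>0 'k"

definition mpoly_ring :: "nat \<Rightarrow> 'k::comm_ring_1 mpoly ring" where
  "mpoly_ring n = ring_on {g. \<forall>m \<in> Poly_Mapping.keys g. Poly_Mapping.keys m \<subseteq> {..n}}"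

lemma cring_mpoly_ring: "cring (mpoly_ring n :: 'k::comm_ring_1 mpoly ring)"
  unfolding mpoly_ring_def
proof (rule cring_ring_on; clarsimp)
  fix a b :: "'k mpoly" and m i
  assume a: "\<forall>m\<in>Poly_Mapping.keys a. Poly_Mapping.keys m \<subseteq> {..n}"
    and b: "\<forall>m\<in>Poly_Mapping.keys b. Poly_Mapping.keys m \<subseteq> {..n}"
  show "i \<le> n" if "m \<in> Poly_Mapping.keys (a + b)" "i \<in> Poly_Mapping.keys m"
    using a b that keys_add[of a b] by blast
  show "i \<le> n" if m: "m \<in> Poly_Mapping.keys (a * b)" and i: "i \<in> Poly_Mapping.keys m"
  proof -
    obtain u v where "m = u + v" "u \<in> Poly_Mapping.keys a" "v \<in> Poly_Mapping.keys b"
      using m keys_mult[of a b] by blast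
    then show ?thesis using a b i keys_add[of u v] by blast
  qed
qed

definition mpoly_var :: "nat \<Rightarrow> 'k::comm_ring_1 mpoly" where
  "mpoly_var i = Poly_Mapping.single (Poly_Mapping.single i 1) 1"

definition monom_degree :: "(nat \<Rightarrow>\<^sub>0 nat) \<Rightarrow> nat" where
  "monom_degree m = (\<Sum>i \<in> Poly_Mapping.keys m. Poly_Mapping.lookup m i)"

text \<open>Degrees are integers; the only form of negative degree is \<open>0\<close>, which is homogeneous of every
  degree.\<close>

definition homogeneous :: "int \<Rightarrow> 'k::comm_ring_1 mpoly \<Rightarrow> bool" where
  "homogeneous i g \<longleftrightarrow> (\<forall>m \<in> Poly_Mapping.keys g. int (monom_degree m) = i)"

definition irrelevant_ideal :: "nat \<Rightarrow> 'k::comm_ring_1 mpoly set" where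
  "irrelevant_ideal n = Idl\<^bsub>mpoly_ring n\<^esub> (mpoly_var ` {..n})"


section \<open>Localization\<close>

definition frac_rel :: "('a, 'm) ring_scheme \<Rightarrow> 'a set \<Rightarrow> (('a \<times> 'a) \<times> ('a \<times> 'a)) set" where
  "frac_rel A S = {((a, s), (b, t)). a \<in> carrier A \<and> s \<in> S \<and> b \<in> carrier A \<and> t \<in> S \<and>
     (\<exists>u \<in> S. u \<otimes>\<^bsub>A\<^esub> (a \<otimes>\<^bsub>A\<^esub> t) = u \<otimes>\<^bsub>A\<^esub> (b \<otimes>\<^bsub>A\<^esub> s))}"

definition fraction :: "('a, 'm) ring_scheme \<Rightarrow> 'a set \<Rightarrow> 'a \<Rightarrow> 'a \<Rightarrow> ('a \<times> 'a) set" where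
  "fraction A S a s = frac_rel A S `` {(a, s)}"

definition localization :: "('a, 'm) ring_scheme \<Rightarrow> 'a set \<Rightarrow> ('a \<times> 'a) set ring" where
  "localization A S =
    \<lparr>carrier = (carrier A \<times> S) // frac_rel A S,
     monoid.mult = (\<lambda>U V. \<Union>(a, s) \<in> U. \<Union>(b, t) \<in> V. fraction A S (a \<otimes>\<^bsub>A\<^esub> b) (s \<otimes>\<^bsub>A\<^esub> t)),
     one = fraction A S \<one>\<^bsub>A\<^esub> \<one>\<^bsub>A\<^esub>,
     ring.zero = fraction A S \<zero>\<^bsub>A\<^esub> \<one>\<^bsub>A\<^esub>,
     ring.add = (\<lambda>U V. \<Union>(a, s) \<in> U. \<Union>(b, t) \<in> V.
              fraction A S (a \<otimes>\<^bsub>A\<^esub> t \<oplus>\<^bsub>A\<^esub> b \<otimes>\<^bsub>A\<^esub> s) (s \<otimes>\<^bsub>A\<^esub> t))\<rparr>"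

lemma refl_frac_rel:
  assumes "cring A" "submonoid S A" "a \<in> carrier A" "s \<in> S"
  shows "((a, s), (a, s)) \<in> frac_rel A S"
  using assms submonoid.one_closed by (fastforce simp: frac_rel_def)

lemma equiv_frac_rel:
  assumes "cring A" "submonoid S A"
  shows "equiv (carrier A \<times> S) (frac_rel A S)"
proof (rule equivI)
  interpret A: cring A by fact
  interpret S: submonoid S A by fact
  show "frac_rel A S \<subseteq> (carrier A \<times> S) \<times> carrier A \<times> S"
    by (auto simp: frac_rel_def)
  show "refl_on (carrier A \<times> S) (frac_rel A S)"
    using refl_frac_rel[OF assms] by (auto intro!: refl_onI)
  show "sym (frac_rel A S)"
    by (rule symI) (auto simp: frac_rel_def, metis)
  show "trans (frac_rel A S)"
  proof (rule transI, clarify)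
    fix a s b t c r
    assume "((a, s), (b, t)) \<in> frac_rel A S" "((b, t), (c, r)) \<in> frac_rel A S"
    then obtain u v where
      h: "a \<in> carrier A" "b \<in> carrier A" "c \<in> carrier A" "s \<in> S" "t \<in> S" "r \<in> S" "u \<in> S" "v \<in> S"
      and u: "u \<otimes>\<^bsub>A\<^esub> (a \<otimes>\<^bsub>A\<^esub> t) = u \<otimes>\<^bsub>A\<^esub> (b \<otimes>\<^bsub>A\<^esub> s)"
      and v: "v \<otimes>\<^bsub>A\<^esub> (b \<otimes>\<^bsub>A\<^esub> r) = v \<otimes>\<^bsub>A\<^esub> (c \<otimes>\<^bsub>A\<^esub> t)"
      by (auto simp: frac_rel_def)
    have hc: "s \<in> carrier A" "t \<in> carrier A" "r \<in> carrier A" "u \<in> carrier A" "v \<in> carrier A"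
      using h S.subset by auto
    have "(u \<otimes>\<^bsub>A\<^esub> v \<otimes>\<^bsub>A\<^esub> t) \<otimes>\<^bsub>A\<^esub> (a \<otimes>\<^bsub>A\<^esub> r) = (v \<otimes>\<^bsub>A\<^esub> r) \<otimes>\<^bsub>A\<^esub> (u \<otimes>\<^bsub>A\<^esub> (a \<otimes>\<^bsub>A\<^esub> t))"
      using h(1-3) hc by (simp add: A.m_ac)
    also have "\<dots> = (u \<otimes>\<^bsub>A\<^esub> s) \<otimes>\<^bsub>A\<^esub> (v \<otimes>\<^bsub>A\<^esub> (b \<otimes>\<^bsub>A\<^esub> r))"
      unfolding u using h(1-3) hc by (simp add: A.m_ac)
    also have "\<dots> = (u \<otimes>\<^bsub>A\<^esub> v \<otimes>\<^bsub>A\<^esub> t) \<otimes>\<^bsub>A\<^esub> (c \<otimes>\<^bsub>A\<^esub> s)"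
      unfolding v using h(1-3) hc by (simp add: A.m_ac)
    finally show "((a, s), (c, r)) \<in> frac_rel A S"
      using h by (auto simp: frac_rel_def intro!: bexI[of _ "u \<otimes>\<^bsub>A\<^esub> v \<otimes>\<^bsub>A\<^esub> t"])
  qed
qed

context
  fixes A :: "('a, 'm) ring_scheme" (structure) and S :: "'a set"
  assumes cring_A: "cring A" and submonoid_S: "submonoid S A"
begin

interpretation A: cring A by (rule cring_A)
interpretation S: submonoid S A by (rule submonoid_S)

lemma fraction_eq_iff:
  assumes "a \<in> carrier A" "b \<in> carrier A" "s \<in> S" "t \<in> S"
  shows "fraction A S a s = fraction A S b t \<longleftrightarrow> (\<exists>u \<in> S. u \<otimes> (a \<otimes> t) = u \<otimes> (b \<otimes> s))"
proof -
  have "fraction A S a s = fraction A S b t \<longleftrightarrow> ((a, s), (b, t)) \<in> frac_rel A S"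
    unfolding fraction_def
    by (rule eq_equiv_class_iff[OF equiv_frac_rel[OF cring_A submonoid_S]]) (use assms in auto)
  then show ?thesis
    using assms by (auto simp: frac_rel_def)
qed

lemma carrier_localization:
  "carrier (localization A S) = {fraction A S a s | a s. a \<in> carrier A \<and> s \<in> S}"
  by (auto simp: localization_def quotient_def fraction_def)

lemma mult_frac_respects:
  "(\<lambda>(a, s) (b, t). fraction A S (a \<otimes> b) (s \<otimes> t)) respects2 frac_rel A S"
proof (rule congruent2I'; clarsimp)
  fix a s a' s' b t b' t'
  assume "((a, s), (a', s')) \<in> frac_rel A S" "((b, t), (b', t')) \<in> frac_rel A S"
  then obtain u v where h: "a \<in> carrier A" "a' \<in> carrier A" "b \<in> carrier A" "b' \<in> carrier A"
      "s \<in> S" "s' \<in> S" "t \<in> S" "t' \<in> S" "u \<in> S" "v \<in> S"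
    and u: "u \<otimes> (a \<otimes> s') = u \<otimes> (a' \<otimes> s)" and v: "v \<otimes> (b \<otimes> t') = v \<otimes> (b' \<otimes> t)"
    by (auto simp: frac_rel_def)
  have hc: "s \<in> carrier A" "s' \<in> carrier A" "t \<in> carrier A" "t' \<in> carrier A"
      "u \<in> carrier A" "v \<in> carrier A"
    using h S.subset by auto
  have "(u \<otimes> v) \<otimes> (a \<otimes> b \<otimes> (s' \<otimes> t')) = (u \<otimes> (a \<otimes> s')) \<otimes> (v \<otimes> (b \<otimes> t'))"
    using h(1-4) hc by (simp add: A.m_ac)
  also have "\<dots> = (u \<otimes> v) \<otimes> (a' \<otimes> b' \<otimes> (s \<otimes> t))"
    unfolding u v using h(1-4) hc by (simp add: A.m_ac)
  finally show "fraction A S (a \<otimes> b) (s \<otimes> t) = fraction A S (a' \<otimes> b') (s' \<otimes> t')"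
    using h by (auto simp: fraction_eq_iff intro!: bexI[of _ "u \<otimes> v"])
qed

lemma add_frac_respects:
  "(\<lambda>(a, s) (b, t). fraction A S (a \<otimes> t \<oplus> b \<otimes> s) (s \<otimes> t)) respects2 frac_rel A S"
proof (rule congruent2I'; clarsimp)
  fix a s a' s' b t b' t'
  assume "((a, s), (a', s')) \<in> frac_rel A S" "((b, t), (b', t')) \<in> frac_rel A S"
  then obtain u v where h: "a \<in> carrier A" "a' \<in> carrier A" "b \<in> carrier A" "b' \<in> carrier A"
      "s \<in> S" "s' \<in> S" "t \<in> S" "t' \<in> S" "u \<in> S" "v \<in> S"
    and u: "u \<otimes> (a \<otimes> s') = u \<otimes> (a' \<otimes> s)" and v: "v \<otimes> (b \<otimes> t') = v \<otimes> (b' \<otimes> t)"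
    by (auto simp: frac_rel_def)
  have hc: "s \<in> carrier A" "s' \<in> carrier A" "t \<in> carrier A" "t' \<in> carrier A"
      "u \<in> carrier A" "v \<in> carrier A"
    using h S.subset by auto
  have "(u \<otimes> v) \<otimes> ((a \<otimes> t \<oplus> b \<otimes> s) \<otimes> (s' \<otimes> t')) =
      (u \<otimes> (a \<otimes> s')) \<otimes> (v \<otimes> (t \<otimes> t')) \<oplus> (v \<otimes> (b \<otimes> t')) \<otimes> (u \<otimes> (s \<otimes> s'))"
    using h(1-4) hc by (simp add: A.m_ac A.l_distr A.r_distr)
  also have "\<dots> = (u \<otimes> v) \<otimes> ((a' \<otimes> t' \<oplus> b' \<otimes> s') \<otimes> (s \<otimes> t))"
    unfolding u v using h(1-4) hc by (simp add: A.m_ac A.l_distr A.r_distr)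
  finally show "fraction A S (a \<otimes> t \<oplus> b \<otimes> s) (s \<otimes> t) = fraction A S (a' \<otimes> t' \<oplus> b' \<otimes> s') (s' \<otimes> t')"
    using h hc by (auto simp: fraction_eq_iff intro!: bexI[of _ "u \<otimes> v"])
qed

lemma mult_fraction:
  assumes "a \<in> carrier A" "b \<in> carrier A" "s \<in> S" "t \<in> S"
  shows "fraction A S a s \<otimes>\<^bsub>localization A S\<^esub> fraction A S b t = fraction A S (a \<otimes> b) (s \<otimes> t)"
  using UN_equiv_class2[OF equiv_frac_rel[OF cring_A submonoid_S]
      equiv_frac_rel[OF cring_A submonoid_S] mult_frac_respects, of "(a, s)" "(b, t)"] assms
  by (simp add: localization_def fraction_def case_prod_unfold)

lemma add_fraction:
  assumes "a \<in> carrier A" "b \<in> carrier A" "s \<in> S" "t \<in> S"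
  shows "fraction A S a s \<oplus>\<^bsub>localization A S\<^esub> fraction A S b t = fraction A S (a \<otimes> t \<oplus> b \<otimes> s) (s \<otimes> t)"
  using UN_equiv_class2[OF equiv_frac_rel[OF cring_A submonoid_S]
      equiv_frac_rel[OF cring_A submonoid_S] add_frac_respects, of "(a, s)" "(b, t)"] assms
  by (simp add: localization_def fraction_def case_prod_unfold)

lemma cring_localization: "cring (localization A S)"
proof -
  let ?L = "localization A S"
  note Sc = S.subset[THEN subsetD]
  have one: "\<one>\<^bsub>?L\<^esub> = fraction A S \<one> \<one>" and zero: "\<zero>\<^bsub>?L\<^esub> = fraction A S \<zero> \<one>"
    by (simp_all add: localization_def)
  have fracI: "fraction A S a s \<in> carrier ?L" if "a \<in> carrier A" "s \<in> S" for a s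
    using that by (auto simp: carrier_localization)
  have fracE: "\<exists>a s. U = fraction A S a s \<and> a \<in> carrier A \<and> s \<in> S" if "U \<in> carrier ?L" for U
    using that by (auto simp: carrier_localization)
  have eqI: "fraction A S a s = fraction A S b t"
    if "a \<in> carrier A" "b \<in> carrier A" "s \<in> S" "t \<in> S" "a \<otimes> t = b \<otimes> s" for a b s t
    using that by (auto simp: fraction_eq_iff intro!: bexI[of _ \<one>])
  show ?thesis
  proof (rule cringI)
    show "abelian_group ?L"
    proof (rule abelian_groupI)
      fix U V W assume U: "U \<in> carrier ?L" and V: "V \<in> carrier ?L" and W: "W \<in> carrier ?L"
      obtain a s where a: "U = fraction A S a s" "a \<in> carrier A" "s \<in> S" "s \<in> carrier A"
        using fracE[OF U] Sc by blast
      obtain b t where b: "V = fraction A S b t" "b \<in> carrier A" "t \<in> S" "t \<in> carrier A"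
        using fracE[OF V] Sc by blast
      obtain c r where c: "W = fraction A S c r" "c \<in> carrier A" "r \<in> S" "r \<in> carrier A"
        using fracE[OF W] Sc by blast
      show "U \<oplus>\<^bsub>?L\<^esub> V \<in> carrier ?L"
        using a b by (simp add: add_fraction fracI)
      show "U \<oplus>\<^bsub>?L\<^esub> V \<oplus>\<^bsub>?L\<^esub> W = U \<oplus>\<^bsub>?L\<^esub> (V \<oplus>\<^bsub>?L\<^esub> W)"
        using a b c by (auto simp: add_fraction A.m_ac A.l_distr A.r_distr A.a_ac intro!: eqI)
      show "U \<oplus>\<^bsub>?L\<^esub> V = V \<oplus>\<^bsub>?L\<^esub> U"
        using a b by (auto simp: add_fraction A.m_ac A.a_ac intro!: eqI)
      show "\<zero>\<^bsub>?L\<^esub> \<oplus>\<^bsub>?L\<^esub> U = U"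
        using a by (simp add: zero add_fraction)
      show "\<exists>V\<in>carrier ?L. V \<oplus>\<^bsub>?L\<^esub> U = \<zero>\<^bsub>?L\<^esub>"
      proof (rule bexI[of _ "fraction A S (\<ominus> a) s"])
        have "\<ominus> a \<otimes> s \<oplus> a \<otimes> s = \<zero>"
          using a by (simp add: A.l_minus A.l_neg)
        then have "fraction A S (\<ominus> a) s \<oplus>\<^bsub>?L\<^esub> U = fraction A S \<zero> (s \<otimes> s)"
          using a by (simp add: add_fraction)
        also have "\<dots> = \<zero>\<^bsub>?L\<^esub>"
          unfolding zero by (rule eqI) (use a in auto)
        finally show "fraction A S (\<ominus> a) s \<oplus>\<^bsub>?L\<^esub> U = \<zero>\<^bsub>?L\<^esub>" .
      qed (use a in \<open>simp add: fracI\<close>)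
    next
      show "\<zero>\<^bsub>?L\<^esub> \<in> carrier ?L" by (simp add: zero fracI)
    qed
  next
    show "comm_monoid ?L"
    proof (rule comm_monoidI)
      fix U V W assume U: "U \<in> carrier ?L" and V: "V \<in> carrier ?L" and W: "W \<in> carrier ?L"
      obtain a s where a: "U = fraction A S a s" "a \<in> carrier A" "s \<in> S" "s \<in> carrier A"
        using fracE[OF U] Sc by blast
      obtain b t where b: "V = fraction A S b t" "b \<in> carrier A" "t \<in> S" "t \<in> carrier A"
        using fracE[OF V] Sc by blast
      obtain c r where c: "W = fraction A S c r" "c \<in> carrier A" "r \<in> S" "r \<in> carrier A"
        using fracE[OF W] Sc by blast
      show "U \<otimes>\<^bsub>?L\<^esub> V \<in> carrier ?L"
        using a b by (simp add: mult_fraction fracI)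
      show "U \<otimes>\<^bsub>?L\<^esub> V \<otimes>\<^bsub>?L\<^esub> W = U \<otimes>\<^bsub>?L\<^esub> (V \<otimes>\<^bsub>?L\<^esub> W)"
        using a b c by (auto simp: mult_fraction A.m_ac intro!: eqI)
      show "U \<otimes>\<^bsub>?L\<^esub> V = V \<otimes>\<^bsub>?L\<^esub> U"
        using a b by (auto simp: mult_fraction A.m_ac intro!: eqI)
      show "\<one>\<^bsub>?L\<^esub> \<otimes>\<^bsub>?L\<^esub> U = U"
        using a by (simp add: one mult_fraction)
    next
      show "\<one>\<^bsub>?L\<^esub> \<in> carrier ?L" by (simp add: one fracI)
    qed
  next
    fix U V W assume U: "U \<in> carrier ?L" and V: "V \<in> carrier ?L" and W: "W \<in> carrier ?L"
    obtain a s where a: "U = fraction A S a s" "a \<in> carrier A" "s \<in> S" "s \<in> carrier A"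
      using fracE[OF U] Sc by blast
    obtain b t where b: "V = fraction A S b t" "b \<in> carrier A" "t \<in> S" "t \<in> carrier A"
      using fracE[OF V] Sc by blast
    obtain c r where c: "W = fraction A S c r" "c \<in> carrier A" "r \<in> S" "r \<in> carrier A"
      using fracE[OF W] Sc by blast
    show "(U \<oplus>\<^bsub>?L\<^esub> V) \<otimes>\<^bsub>?L\<^esub> W = U \<otimes>\<^bsub>?L\<^esub> W \<oplus>\<^bsub>?L\<^esub> V \<otimes>\<^bsub>?L\<^esub> W"
    proof -
      have "(U \<oplus>\<^bsub>?L\<^esub> V) \<otimes>\<^bsub>?L\<^esub> W = fraction A S ((a \<otimes> t \<oplus> b \<otimes> s) \<otimes> c) (s \<otimes> t \<otimes> r)"
        using a b c by (simp add: mult_fraction add_fraction)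
      also have "\<dots> = fraction A S (a \<otimes> c \<otimes> (t \<otimes> r) \<oplus> b \<otimes> c \<otimes> (s \<otimes> r)) (s \<otimes> r \<otimes> (t \<otimes> r))"
        by (rule eqI) (use a b c in \<open>simp_all add: A.m_ac A.l_distr A.r_distr\<close>)
      also have "\<dots> = U \<otimes>\<^bsub>?L\<^esub> W \<oplus>\<^bsub>?L\<^esub> V \<otimes>\<^bsub>?L\<^esub> W"
        using a b c by (simp add: mult_fraction add_fraction)
      finally show ?thesis .
    qed
  qed
qed

end


section \<open>Purity and F-purity\<close>

text \<open>
  \<open>M \<otimes>\<^sub>A B\<close>, for an \<open>A\<close>-module \<open>M\<close> and a ring \<open>B\<close> regarded as an \<open>A\<close>-module through the ring
  homomorphism \<open>h : A \<rightarrow> B\<close>: the free abelian group on \<open>M \<times> B\<close> modulo the bilinearity relations.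
\<close>

definition tensor_rels ::
  "('a, 'p) ring_scheme \<Rightarrow> ('a, 'm, 'q) module_scheme \<Rightarrow> ('b, 'r) ring_scheme \<Rightarrow> ('a \<Rightarrow> 'b)
    \<Rightarrow> ('m \<times> 'b \<Rightarrow>\<^sub>0 int) set" where
  "tensor_rels A M B h =
     {frag_of (x \<oplus>\<^bsub>M\<^esub> y, b) - frag_of (x, b) - frag_of (y, b) | x y b.
        x \<in> carrier M \<and> y \<in> carrier M \<and> b \<in> carrier B} \<union>
     {frag_of (x, b \<oplus>\<^bsub>B\<^esub> c) - frag_of (x, b) - frag_of (x, c) | x b c.
        x \<in> carrier M \<and> b \<in> carrier B \<and> c \<in> carrier B} \<union>
     {frag_of (r \<odot>\<^bsub>M\<^esub> x, b) - frag_of (x, h r \<otimes>\<^bsub>B\<^esub> b) | r x b.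
        r \<in> carrier A \<and> x \<in> carrier M \<and> b \<in> carrier B}"

definition tensor_null ::
  "('a, 'p) ring_scheme \<Rightarrow> ('a, 'm, 'q) module_scheme \<Rightarrow> ('b, 'r) ring_scheme \<Rightarrow> ('a \<Rightarrow> 'b)
    \<Rightarrow> ('m \<times> 'b \<Rightarrow>\<^sub>0 int) set" where
  "tensor_null A M B h =
     generate (free_Abelian_group (carrier M \<times> carrier B)) (tensor_rels A M B h)"

definition tensor_product ::
  "('a, 'p) ring_scheme \<Rightarrow> ('a, 'm, 'q) module_scheme \<Rightarrow> ('b, 'r) ring_scheme \<Rightarrow> ('a \<Rightarrow> 'b)
    \<Rightarrow> ('m \<times> 'b \<Rightarrow>\<^sub>0 int) set monoid" where
  "tensor_product A M B h =
     free_Abelian_group (carrier M \<times> carrier B) Mod tensor_null A M B h"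

definition pure_tensor ::
  "('a, 'p) ring_scheme \<Rightarrow> ('a, 'm, 'q) module_scheme \<Rightarrow> ('b, 'r) ring_scheme \<Rightarrow> ('a \<Rightarrow> 'b)
    \<Rightarrow> 'm \<Rightarrow> 'b \<Rightarrow> ('m \<times> 'b \<Rightarrow>\<^sub>0 int) set" where
  "pure_tensor A M B h x b =
     tensor_null A M B h #>\<^bsub>free_Abelian_group (carrier M \<times> carrier B)\<^esub> frag_of (x, b)"

text \<open>
  A ring homomorphism \<open>h : A \<rightarrow> B\<close> is pure if \<open>M \<rightarrow> M \<otimes>\<^sub>A B\<close>, \<open>x \<mapsto> x \<otimes> 1\<close> is injective for every
  \<open>A\<close>-module \<open>M\<close>. A definition cannot quantify over types, so the carrier type of \<open>M\<close> has to be
  fixed; \<open>'a list set\<close> has a copy of every finitely generated \<open>A\<close>-module (a quotient of \<open>A\<^sup>r\<close>).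
  The lemma \<open>pure_hom_all_modules\<close> below shows that the definition then covers modules over
  every carrier type.
\<close>

definition pure_hom ::
  "('a, 'p) ring_scheme \<Rightarrow> ('b, 'r) ring_scheme \<Rightarrow> ('a \<Rightarrow> 'b) \<Rightarrow> bool" where
  "pure_hom A B h \<longleftrightarrow> (\<forall>M :: ('a, 'a list set) module. module A M \<longrightarrow>
     inj_on (\<lambda>x. pure_tensor A M B h x \<one>\<^bsub>B\<^esub>) (carrier M))"

lemma tensor_relsE:
  assumes "g \<in> tensor_rels A M B h"
  obtains (1) x y b where "g = frag_of (x \<oplus>\<^bsub>M\<^esub> y, b) - frag_of (x, b) - frag_of (y, b)"
      "x \<in> carrier M" "y \<in> carrier M" "b \<in> carrier B"
    | (2) x b c where "g = frag_of (x, b \<oplus>\<^bsub>B\<^esub> c) - frag_of (x, b) - frag_of (x, c)"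
      "x \<in> carrier M" "b \<in> carrier B" "c \<in> carrier B"
    | (3) r x b where "g = frag_of (r \<odot>\<^bsub>M\<^esub> x, b) - frag_of (x, h r \<otimes>\<^bsub>B\<^esub> b)"
      "r \<in> carrier A" "x \<in> carrier M" "b \<in> carrier B"
  using assms unfolding tensor_rels_def
  apply (elim UnE CollectE exE conjE)
    apply (rule that(1); assumption)
   apply (rule that(2); assumption)
  apply (rule that(3); assumption)
  done

lemma tensor_relsI:
  "\<lbrakk>x \<in> carrier M; y \<in> carrier M; b \<in> carrier B\<rbrakk> \<Longrightarrow>
    frag_of (x \<oplus>\<^bsub>M\<^esub> y, b) - frag_of (x, b) - frag_of (y, b) \<in> tensor_rels A M B h"
  "\<lbrakk>x \<in> carrier M; b \<in> carrier B; c \<in> carrier B\<rbrakk> \<Longrightarrow>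
    frag_of (x, b \<oplus>\<^bsub>B\<^esub> c) - frag_of (x, b) - frag_of (x, c) \<in> tensor_rels A M B h"
  "\<lbrakk>r \<in> carrier A; x \<in> carrier M; b \<in> carrier B\<rbrakk> \<Longrightarrow>
    frag_of (r \<odot>\<^bsub>M\<^esub> x, b) - frag_of (x, h r \<otimes>\<^bsub>B\<^esub> b) \<in> tensor_rels A M B h"
  unfolding tensor_rels_def
    apply (rule UnI1, rule UnI1, rule CollectI, intro exI conjI; (rule refl | assumption))
   apply (rule UnI1, rule UnI2, rule CollectI, intro exI conjI; (rule refl | assumption))
  apply (rule UnI2, rule CollectI, intro exI conjI; (rule refl | assumption))
  done

lemma tensor_rels_carrier:
  assumes "module A M" "cring B" "h \<in> ring_hom A B"
  shows "tensor_rels A M B h \<subseteq> carrier (free_Abelian_group (carrier M \<times> carrier B))"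
proof -
  interpret M: module A M by fact
  interpret B: cring B by fact
  have *: "Poly_Mapping.keys (frag_of u - frag_of v) \<subseteq> D" if "u \<in> D" "v \<in> D"
    for u v :: "'x \<times> 'y" and D
    using that keys_diff[of "frag_of u" "frag_of v"] by auto
  have **: "Poly_Mapping.keys (frag_of u - frag_of v - frag_of w) \<subseteq> D"
    if "u \<in> D" "v \<in> D" "w \<in> D" for u v w :: "'x \<times> 'y" and D
    using that *[of u D v] keys_diff[of "frag_of u - frag_of v" "frag_of w"] by auto
  show ?thesis
  proof
    fix g assume "g \<in> tensor_rels A M B h"
    then show "g \<in> carrier (free_Abelian_group (carrier M \<times> carrier B))"
      unfolding carrier_free_Abelian_group_iff
      by (cases rule: tensor_relsE) (simp_all add: * ** ring_hom_closed[OF assms(3)])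
  qed
qed

lemma pure_tensor_in_tensor_product:
  assumes "x \<in> carrier M" "b \<in> carrier B"
  shows "pure_tensor A M B h x b \<in> carrier (tensor_product A M B h)"
  unfolding tensor_product_def pure_tensor_def carrier_FactGroup
  by (rule imageI) (use assms in simp)

lemma pure_tensor_eq_iff:
  assumes "module A M" "cring B" "h \<in> ring_hom A B"
    and "x \<in> carrier M" "y \<in> carrier M" "b \<in> carrier B" "c \<in> carrier B"
  shows "pure_tensor A M B h x b = pure_tensor A M B h y c \<longleftrightarrow>
    frag_of (x, b) - frag_of (y, c) \<in> tensor_null A M B h"
proof -
  let ?G = "free_Abelian_group (carrier M \<times> carrier B)"
  let ?K = "tensor_null A M B h"
  interpret G: comm_group ?G by (rule abelian_free_Abelian_group)
  have K: "subgroup ?K ?G"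
    unfolding tensor_null_def
    by (rule G.generate_is_subgroup) (rule tensor_rels_carrier[OF assms(1-3)])
  have x: "frag_of (x, b) \<in> carrier ?G" and y: "frag_of (y, c) \<in> carrier ?G"
    using assms by auto
  have "pure_tensor A M B h x b = pure_tensor A M B h y c \<longleftrightarrow>
      frag_of (x, b) \<in> ?K #>\<^bsub>?G\<^esub> frag_of (y, c)"
    unfolding pure_tensor_def
    using G.repr_independence[OF _ y K] G.rcos_self[OF x K] by blast
  also have "\<dots> \<longleftrightarrow> (\<exists>z \<in> ?K. frag_of (x, b) = z + frag_of (y, c))"
    by (auto simp: r_coset_def)
  also have "\<dots> \<longleftrightarrow> frag_of (x, b) - frag_of (y, c) \<in> ?K"
  proof
    assume "\<exists>z \<in> ?K. frag_of (x, b) = z + frag_of (y, c)"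
    then show "frag_of (x, b) - frag_of (y, c) \<in> ?K" by auto
  next
    assume "frag_of (x, b) - frag_of (y, c) \<in> ?K"
    then show "\<exists>z \<in> ?K. frag_of (x, b) = z + frag_of (y, c)"
      by (rule rev_bexI) simp
  qed
  finally show ?thesis .
qed

lemma tensor_null_finite_support:
  assumes "module A M" "cring B" "h \<in> ring_hom A B" "z \<in> tensor_null A M B h"
  shows "\<exists>F. finite F \<and> F \<subseteq> carrier M \<and>
    (\<forall>N. F \<subseteq> N \<and> submodule N A M \<longrightarrow> z \<in> tensor_null A (M\<lparr>carrier := N\<rparr>) B h)"
proof -
  let ?G = "free_Abelian_group (carrier M \<times> carrier B)"
  have rels: "\<exists>F. finite F \<and> F \<subseteq> carrier M \<and>
      (\<forall>N. F \<subseteq> N \<longrightarrow> g \<in> tensor_rels A (M\<lparr>carrier := N\<rparr>) B h)"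
    if "g \<in> tensor_rels A M B h" for g
  proof -
    show ?thesis
      using that
    proof (cases rule: tensor_relsE)
      case (1 x y b)
      have "g \<in> tensor_rels A (M\<lparr>carrier := N\<rparr>) B h" if "{x, y} \<subseteq> N" for N
        unfolding 1(1) using 1 that tensor_relsI(1)[of x "M\<lparr>carrier := N\<rparr>" y b B A h] by simp
      with 1 show ?thesis by (intro exI[of _ "{x, y}"]) simp
    next
      case (2 x b c)
      have "g \<in> tensor_rels A (M\<lparr>carrier := N\<rparr>) B h" if "{x} \<subseteq> N" for N
        unfolding 2(1) using 2 that tensor_relsI(2)[of x "M\<lparr>carrier := N\<rparr>" b B c A h] by simp
      with 2 show ?thesis by (intro exI[of _ "{x}"]) simp
    next
      case (3 r x b)
      have "g \<in> tensor_rels A (M\<lparr>carrier := N\<rparr>) B h" if "{x} \<subseteq> N" for N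
        unfolding 3(1) using 3 that tensor_relsI(3)[of r A x "M\<lparr>carrier := N\<rparr>" b B h] by simp
      with 3 show ?thesis by (intro exI[of _ "{x}"]) simp
    qed
  qed
  have N_inv: "inv\<^bsub>?G\<^esub> g = inv\<^bsub>free_Abelian_group (N \<times> carrier B)\<^esub> g"
    if "g \<in> tensor_rels A (M\<lparr>carrier := N\<rparr>) B h" "g \<in> tensor_rels A M B h" "submodule N A M" for g N
  proof -
    have "module A (M\<lparr>carrier := N\<rparr>)"
      using that(3) assms(1) by (rule submodule.submodule_is_module)
    from tensor_rels_carrier[OF this assms(2,3), THEN subsetD, OF that(1)]
      tensor_rels_carrier[OF assms(1-3), THEN subsetD, OF that(2)]
    show ?thesis by simp
  qed
  show ?thesis
    using assms(4) unfolding tensor_null_def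
  proof induction
    case one
    show ?case
      using generate.one[of "free_Abelian_group (_ \<times> _)"] by (intro exI[of _ "{}"]) auto
  next
    case (incl g)
    obtain F where F: "finite F" "F \<subseteq> carrier M"
        "\<forall>N. F \<subseteq> N \<longrightarrow> g \<in> tensor_rels A (M\<lparr>carrier := N\<rparr>) B h"
      using rels[OF incl] by blast
    then show ?case by (intro exI[of _ F]) (simp add: generate.incl)
  next
    case (inv g)
    obtain F where F: "finite F" "F \<subseteq> carrier M"
        "\<forall>N. F \<subseteq> N \<longrightarrow> g \<in> tensor_rels A (M\<lparr>carrier := N\<rparr>) B h"
      using rels[OF inv] by blast
    show ?case
    proof (intro exI[of _ F] conjI allI impI F(1,2))
      fix N assume N: "F \<subseteq> N \<and> submodule N A M"
      with F(3) have "g \<in> tensor_rels A (M\<lparr>carrier := N\<rparr>) B h" by blast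
      then show "inv\<^bsub>?G\<^esub> g \<in> generate (free_Abelian_group (carrier (M\<lparr>carrier := N\<rparr>) \<times> carrier B))
          (tensor_rels A (M\<lparr>carrier := N\<rparr>) B h)"
        using N_inv[OF _ inv] N by (simp add: generate.inv)
    qed
  next
    case (eng g1 g2)
    let ?P = "\<lambda>g N. g \<in> generate (free_Abelian_group (carrier (M\<lparr>carrier := N\<rparr>) \<times> carrier B))
      (tensor_rels A (M\<lparr>carrier := N\<rparr>) B h)"
    obtain F1 where F1: "finite F1" "F1 \<subseteq> carrier M"
        "\<And>N. F1 \<subseteq> N \<Longrightarrow> submodule N A M \<Longrightarrow> ?P g1 N"
      using eng.IH(1) by blast
    obtain F2 where F2: "finite F2" "F2 \<subseteq> carrier M"
        "\<And>N. F2 \<subseteq> N \<Longrightarrow> submodule N A M \<Longrightarrow> ?P g2 N"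
      using eng.IH(2) by blast
    show ?case
    proof (intro exI[of _ "F1 \<union> F2"] conjI allI impI)
      show "finite (F1 \<union> F2)" "F1 \<union> F2 \<subseteq> carrier M" using F1 F2 by auto
      fix N assume N: "F1 \<union> F2 \<subseteq> N \<and> submodule N A M"
      have "?P g1 N" by (rule F1(3)) (use N in auto)
      moreover have "?P g2 N" by (rule F2(3)) (use N in auto)
      ultimately show "?P (g1 \<otimes>\<^bsub>?G\<^esub> g2) N"
        using generate.eng[of g1 "free_Abelian_group (carrier (M\<lparr>carrier := N\<rparr>) \<times> carrier B)" _ g2]
        by simp
    qed
  qed
qed

lemma module_transport:
  fixes M :: "('a, 'm, 'q) module_scheme" and e :: "'m \<Rightarrow> 'n"
  assumes "module A M" "cring B" "h \<in> ring_hom A B" "inj_on e (carrier M)"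
  obtains M' :: "('a, 'n) module" where "module A M'" "carrier M' = e ` carrier M"
    "\<And>x y b. \<lbrakk>x \<in> carrier M; y \<in> carrier M; b \<in> carrier B;
        frag_of (x, b) - frag_of (y, b) \<in> tensor_null A M B h\<rbrakk> \<Longrightarrow>
      frag_of (e x, b) - frag_of (e y, b) \<in> tensor_null A M' B h"
proof -
  interpret M: module A M by fact
  define e' where "e' = the_inv_into (carrier M) e"
  have e'e [simp]: "e' (e x) = x" if "x \<in> carrier M" for x
    using the_inv_into_f_f[OF assms(4) that] by (simp add: e'_def)
  define M' :: "('a, 'n) module" where
    "M' = \<lparr>carrier = e ` carrier M, monoid.mult = undefined, one = undefined,
       ring.zero = e \<zero>\<^bsub>M\<^esub>, ring.add = (\<lambda>u v. e (e' u \<oplus>\<^bsub>M\<^esub> e' v)), smult = (\<lambda>r u. e (r \<odot>\<^bsub>M\<^esub> e' u))\<rparr>"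
  have M': "carrier M' = e ` carrier M" "\<zero>\<^bsub>M'\<^esub> = e \<zero>\<^bsub>M\<^esub>"
    "\<And>x y. x \<in> carrier M \<Longrightarrow> y \<in> carrier M \<Longrightarrow> e x \<oplus>\<^bsub>M'\<^esub> e y = e (x \<oplus>\<^bsub>M\<^esub> y)"
    "\<And>r x. x \<in> carrier M \<Longrightarrow> r \<odot>\<^bsub>M'\<^esub> e x = e (r \<odot>\<^bsub>M\<^esub> x)"
    by (simp_all add: M'_def)
  have mod: "module A M'"
  proof (rule moduleI)
    show "cring A" by (rule M.R.is_cring)
    show "abelian_group M'"
    proof (rule abelian_groupI)
      fix u assume "u \<in> carrier M'"
      then obtain x where x: "u = e x" "x \<in> carrier M" by (auto simp: M')
      show "\<exists>v\<in>carrier M'. v \<oplus>\<^bsub>M'\<^esub> u = \<zero>\<^bsub>M'\<^esub>"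
        using x by (intro bexI[of _ "e (\<ominus>\<^bsub>M\<^esub> x)"]) (auto simp: M' M.M.l_neg)
    qed (auto simp: M' M.M.a_ac)
  qed (auto simp: M' M.smult_l_distr M.smult_r_distr M.smult_assoc1)
  define \<phi> :: "('m \<times> 'c \<Rightarrow>\<^sub>0 int) \<Rightarrow> ('n \<times> 'c \<Rightarrow>\<^sub>0 int)"
    where "\<phi> = frag_extend (\<lambda>(x, b). frag_of (e x, b))"
  have \<phi>_of: "\<phi> (frag_of (x, b)) = frag_of (e x, b)" for x b
    by (simp add: \<phi>_def)
  have \<phi>_diff: "\<phi> (u - v) = \<phi> u - \<phi> v" for u v
    by (simp add: \<phi>_def frag_extend_diff)
  have \<phi>_rels: "\<phi> g \<in> tensor_rels A M' B h" if g: "g \<in> tensor_rels A M B h" for g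
  proof -
    show ?thesis
      using g
    proof (cases rule: tensor_relsE)
      case (1 x y b)
      then have "\<phi> g = frag_of (e x \<oplus>\<^bsub>M'\<^esub> e y, b) - frag_of (e x, b) - frag_of (e y, b)"
        by (simp add: \<phi>_diff \<phi>_of M')
      moreover have "e x \<in> carrier M'" "e y \<in> carrier M'" using 1 by (auto simp: M')
      ultimately show ?thesis using 1 tensor_relsI(1)[of "e x" M' "e y" b B A h] by simp
    next
      case (2 x b c)
      then have "\<phi> g = frag_of (e x, b \<oplus>\<^bsub>B\<^esub> c) - frag_of (e x, b) - frag_of (e x, c)"
        by (simp add: \<phi>_diff \<phi>_of)
      moreover have "e x \<in> carrier M'" using 2 by (auto simp: M')
      ultimately show ?thesis using 2 tensor_relsI(2)[of "e x" M' b B c A h] by simp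
    next
      case (3 r x b)
      then have "\<phi> g = frag_of (r \<odot>\<^bsub>M'\<^esub> e x, b) - frag_of (e x, h r \<otimes>\<^bsub>B\<^esub> b)"
        by (simp add: \<phi>_diff \<phi>_of M')
      moreover have "e x \<in> carrier M'" using 3 by (auto simp: M')
      ultimately show ?thesis using 3 tensor_relsI(3)[of r A "e x" M' b B h] by simp
    qed
  qed
  have \<phi>_null: "\<phi> z \<in> tensor_null A M' B h" if "z \<in> tensor_null A M B h" for z
    using that unfolding tensor_null_def
  proof induction
    case one
    show ?case
      using generate.one[of "free_Abelian_group (carrier M' \<times> carrier B)"] by (simp add: \<phi>_def)
  next
    case (incl g)
    then show ?case by (intro generate.incl \<phi>_rels)
  next
    case (inv g)
    then have 1: "Poly_Mapping.keys g \<subseteq> carrier M \<times> carrier B"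
      using tensor_rels_carrier[OF assms(1-3), THEN subsetD, of g] by simp
    have 2: "Poly_Mapping.keys (\<phi> g) \<subseteq> carrier M' \<times> carrier B"
      using tensor_rels_carrier[OF mod assms(2,3), THEN subsetD, OF \<phi>_rels[OF inv]] by simp
    show ?case
      using generate.inv[OF \<phi>_rels[OF inv], of "free_Abelian_group (carrier M' \<times> carrier B)"] 1 2
      by (simp add: \<phi>_def frag_extend_minus)
  next
    case (eng g1 g2)
    then show ?case
      using generate.eng[OF eng.IH] by (simp add: \<phi>_def frag_extend_add)
  qed
  show thesis
  proof (rule that[OF mod M'(1)])
    fix x y b assume "frag_of (x, b) - frag_of (y, b) \<in> tensor_null A M B h"
    from \<phi>_null[OF this]
    show "frag_of (e x, b) - frag_of (e y, b) \<in> tensor_null A M' B h"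
      by (simp only: \<phi>_diff \<phi>_of)
  qed
qed

lemma (in module) finite_subset_submodule:
  assumes "finite F" "F \<subseteq> carrier M"
  obtains N and e :: "'c \<Rightarrow> 'a list set" where "F \<subseteq> N" "submodule N R M" "inj_on e N"
proof -
  obtain xs where xs: "set xs = F" using finite_list[OF assms(1)] by blast
  let ?n = "length xs"
  have xs_c [simp]: "xs ! i \<in> carrier M" if "i < ?n" for i
    using assms(2) xs that nth_mem by blast
  define lc where "lc c = (\<Oplus>\<^bsub>M\<^esub>i\<in>{..<?n}. c i \<odot>\<^bsub>M\<^esub> xs ! i)" for c
  define C where "C = ({..<?n} \<rightarrow> carrier R)"
  define N where "N = lc ` C"
  define e where "e m = {map c [0..<?n] | c. c \<in> C \<and> lc c = m}" for m
  have C: "(\<lambda>i. c i \<odot>\<^bsub>M\<^esub> xs ! i) \<in> {..<?n} \<rightarrow> carrier M" if "c \<in> C" for c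
    using that by (auto simp: C_def)
  have smult_N: "a \<odot>\<^bsub>M\<^esub> x \<in> N" if a: "a \<in> carrier R" and x: "x \<in> N" for a x
  proof -
    obtain c where c: "c \<in> C" "x = lc c" using x by (auto simp: N_def)
    have "a \<odot>\<^bsub>M\<^esub> lc c = lc (\<lambda>i. a \<otimes> c i)"
      unfolding lc_def finsum_smult_ldistr[OF finite_lessThan a C[OF c(1)]]
      by (rule M.finsum_cong') (use a c(1) in \<open>auto simp: C_def smult_assoc1 Pi_def\<close>)
    moreover have "(\<lambda>i. a \<otimes> c i) \<in> C" using a c(1) by (auto simp: C_def)
    ultimately show ?thesis using c by (auto simp: N_def)
  qed
  have sub: "N \<subseteq> carrier M"
    using C by (auto simp: N_def lc_def intro!: M.finsum_closed)
  have N: "submodule N R M"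
  proof (rule submoduleI)
    show "N \<subseteq> carrier M" by fact
    have "lc (\<lambda>_. \<zero>) = \<zero>\<^bsub>M\<^esub>"
      unfolding lc_def by (rule M.add.finprod_one_eqI) simp
    then show "\<zero>\<^bsub>M\<^esub> \<in> N" unfolding N_def by (force simp: C_def)
    show "a \<odot>\<^bsub>M\<^esub> x \<in> N" if "a \<in> carrier R" "x \<in> N" for a x by (rule smult_N[OF that])
    show "\<ominus>\<^bsub>M\<^esub> x \<in> N" if "x \<in> N" for x
      using smult_N[of "\<ominus> \<one>", OF _ that] smult_l_minus[of \<one> x] that sub by auto
    fix x y assume "x \<in> N" "y \<in> N"
    then obtain c c' where c: "c \<in> C" "x = lc c" "c' \<in> C" "y = lc c'" by (auto simp: N_def)
    have "x \<oplus>\<^bsub>M\<^esub> y = lc (\<lambda>i. c i \<oplus> c' i)"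
      unfolding c lc_def M.finsum_addf[OF C[OF c(1)] C[OF c(3)], symmetric]
      by (rule M.finsum_cong') (use c(1,3) in \<open>auto simp: C_def smult_l_distr Pi_def\<close>)
    moreover have "(\<lambda>i. c i \<oplus> c' i) \<in> C" using c(1,3) by (auto simp: C_def)
    ultimately show "x \<oplus>\<^bsub>M\<^esub> y \<in> N" by (auto simp: N_def)
  qed
  have "F \<subseteq> N"
  proof
    fix x assume "x \<in> F"
    then obtain j where j: "j < ?n" "x = xs ! j" using xs by (metis in_set_conv_nth)
    have "lc (\<lambda>i. if j = i then \<one> else \<zero>) =
        (\<Oplus>\<^bsub>M\<^esub>i\<in>{..<?n}. if j = i then xs ! i else \<zero>\<^bsub>M\<^esub>)"
      unfolding lc_def by (rule M.finsum_cong') auto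
    also have "\<dots> = xs ! j"
      by (rule M.add.finprod_singleton) (use j in auto)
    finally have "x = lc (\<lambda>i. if j = i then \<one> else \<zero>)" using j by simp
    moreover have "(\<lambda>i. if j = i then \<one> else \<zero>) \<in> C" by (simp add: C_def)
    ultimately show "x \<in> N" unfolding N_def by (rule image_eqI)
  qed
  moreover have "inj_on e N"
  proof (rule inj_onI)
    fix x y assume "x \<in> N" "y \<in> N" and eq: "e x = e y"
    obtain c where c: "c \<in> C" "x = lc c" using \<open>x \<in> N\<close> unfolding N_def by blast
    then have "map c [0..<?n] \<in> e x" unfolding e_def by blast
    then obtain c' where c': "map c [0..<?n] = map c' [0..<?n]" "c' \<in> C" "lc c' = y"
      unfolding eq unfolding e_def by blast
    have "c i = c' i" if "i < ?n" for i
    proof -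
      have "map c [0..<?n] ! i = map c' [0..<?n] ! i" by (simp only: c'(1))
      then show ?thesis using that by simp
    qed
    then have "lc c = lc c'"
      unfolding lc_def using C[OF c'(2)] by (intro M.finsum_cong') auto
    then show "x = y" using c c' by simp
  qed
  ultimately show thesis using that N by blast
qed

lemma pure_hom_all_modules:
  fixes M :: "('a, 'm, 'q) module_scheme"
  assumes "pure_hom A B h" "cring B" "h \<in> ring_hom A B" "module A M"
  shows "inj_on (\<lambda>x. pure_tensor A M B h x \<one>\<^bsub>B\<^esub>) (carrier M)"
proof (rule inj_onI)
  interpret M: module A M by fact
  interpret B: cring B by fact
  fix x y assume xy: "x \<in> carrier M" "y \<in> carrier M"
    and eq: "pure_tensor A M B h x \<one>\<^bsub>B\<^esub> = pure_tensor A M B h y \<one>\<^bsub>B\<^esub>"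
  then have null_M: "frag_of (x, \<one>\<^bsub>B\<^esub>) - frag_of (y, \<one>\<^bsub>B\<^esub>) \<in> tensor_null A M B h"
    using pure_tensor_eq_iff[OF assms(4,2,3)] by simp
  obtain F where F: "finite F" "F \<subseteq> carrier M"
    "\<forall>N. F \<subseteq> N \<and> submodule N A M \<longrightarrow>
        frag_of (x, \<one>\<^bsub>B\<^esub>) - frag_of (y, \<one>\<^bsub>B\<^esub>) \<in> tensor_null A (M\<lparr>carrier := N\<rparr>) B h"
    using tensor_null_finite_support[OF assms(4,2,3) null_M] by (elim exE conjE) (rule that)
  obtain N and e :: "'m \<Rightarrow> 'a list set"
    where N: "F \<union> {x, y} \<subseteq> N" "submodule N A M" "inj_on e N"
    by (rule M.finite_subset_submodule[of "F \<union> {x, y}"]) (use F(1,2) xy in auto)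
  have mod: "module A (M\<lparr>carrier := N\<rparr>)"
    using N(2) assms(4) by (rule submodule.submodule_is_module)
  let ?N = "M\<lparr>carrier := N\<rparr>"
  have inj: "inj_on e (carrier ?N)" using N(3) by simp
  obtain M' :: "('a, 'a list set) module" where M': "module A M'" "carrier M' = e ` carrier ?N"
    "\<And>x y b. \<lbrakk>x \<in> carrier ?N; y \<in> carrier ?N; b \<in> carrier B;
        frag_of (x, b) - frag_of (y, b) \<in> tensor_null A ?N B h\<rbrakk> \<Longrightarrow>
      frag_of (e x, b) - frag_of (e y, b) \<in> tensor_null A M' B h"
    by (rule module_transport[OF mod assms(2,3) inj]) (rule that)
  have xyN: "x \<in> carrier ?N" "y \<in> carrier ?N" using N(1) by auto
  have null: "frag_of (x, \<one>\<^bsub>B\<^esub>) - frag_of (y, \<one>\<^bsub>B\<^esub>) \<in> tensor_null A ?N B h"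
    by (rule F(3)[rule_format]) (use N in auto)
  have ex: "e x \<in> carrier M'" "e y \<in> carrier M'" using xyN M'(2) by auto
  have "frag_of (e x, \<one>\<^bsub>B\<^esub>) - frag_of (e y, \<one>\<^bsub>B\<^esub>) \<in> tensor_null A M' B h"
    by (rule M'(3)[OF xyN B.one_closed null])
  then have "pure_tensor A M' B h (e x) \<one>\<^bsub>B\<^esub> = pure_tensor A M' B h (e y) \<one>\<^bsub>B\<^esub>"
    using pure_tensor_eq_iff[OF M'(1) assms(2,3) ex B.one_closed B.one_closed] by simp
  moreover have "inj_on (\<lambda>u. pure_tensor A M' B h u \<one>\<^bsub>B\<^esub>) (carrier M')"
    using assms(1) M'(1) by (simp add: pure_hom_def)
  ultimately have "e x = e y"
    using ex by (simp add: inj_on_def)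
  then show "x = y" using inj xyN by (simp add: inj_on_def)
qed

definition F_pure :: "nat \<Rightarrow> ('a, 'p) ring_scheme \<Rightarrow> bool" where
  "F_pure p A \<longleftrightarrow> pure_hom A A (\<lambda>a. a [^]\<^bsub>A\<^esub> p)"


section \<open>Local cohomology\<close>

text \<open>
  Local cohomology of a ring \<open>A\<close> with support in the ideal generated by elements
  \<open>x\<^sub>0, \<dots>, x\<^sub>n\<close>, as the cohomology of the Cech complex on these elements. Its term in
  cohomological degree \<open>j\<close> is the product, over the \<open>S \<subseteq> {0, \<dots>, n}\<close> with \<open>j\<close> elements, of the
  localization of \<open>A\<close> at the powers of \<open>\<Prod>\<^sub>i\<^sub>\<in>\<^sub>S x\<^sub>i\<close>.
\<close>

definition cech_elt :: "('a, 'p) ring_scheme \<Rightarrow> (nat \<Rightarrow> 'a) \<Rightarrow> nat set \<Rightarrow> 'a" where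
  "cech_elt A x S = finprod A x S"

definition cech_pows :: "('a, 'p) ring_scheme \<Rightarrow> (nat \<Rightarrow> 'a) \<Rightarrow> nat set \<Rightarrow> 'a set" where
  "cech_pows A x S = {cech_elt A x S [^]\<^bsub>A\<^esub> k | k :: nat. True}"

abbreviation cech_ring :: "('a, 'p) ring_scheme \<Rightarrow> (nat \<Rightarrow> 'a) \<Rightarrow> nat set \<Rightarrow> ('a \<times> 'a) set ring"
  where "cech_ring A x S \<equiv> localization A (cech_pows A x S)"

abbreviation cech_frac ::
  "('a, 'p) ring_scheme \<Rightarrow> (nat \<Rightarrow> 'a) \<Rightarrow> nat set \<Rightarrow> 'a \<Rightarrow> nat \<Rightarrow> ('a \<times> 'a) set" where
  "cech_frac A x S a k \<equiv> fraction A (cech_pows A x S) a (cech_elt A x S [^]\<^bsub>A\<^esub> k)"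

text \<open>For \<open>T \<subseteq> S\<close>, the further localization map, which sends \<open>a / x\<^sub>T\<^sup>k\<close> to
  \<open>a x\<^bsub>S-T\<^esub>\<^sup>k / x\<^sub>S\<^sup>k\<close>, where \<open>x\<^sub>S = \<Prod>\<^sub>i\<^sub>\<in>\<^sub>S x\<^sub>i\<close>. The union is over all ways of writing the given
  element as a fraction; its members all coincide.\<close>

definition cech_res ::
  "('a, 'p) ring_scheme \<Rightarrow> (nat \<Rightarrow> 'a) \<Rightarrow> nat set \<Rightarrow> nat set \<Rightarrow> ('a \<times> 'a) set \<Rightarrow> ('a \<times> 'a) set"
  where
  "cech_res A x T S z =
     \<Union>{cech_frac A x S (a \<otimes>\<^bsub>A\<^esub> cech_elt A x (S - T) [^]\<^bsub>A\<^esub> k) k | a k.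
         a \<in> carrier A \<and> z = cech_frac A x T a k}"

lemma cech_res_fraction:
  assumes "cring A" "finite S" "x \<in> S \<rightarrow> carrier A" "T \<subseteq> S" "a \<in> carrier A"
  shows "cech_res A x T S (cech_frac A x T a k) =
    cech_frac A x S (a \<otimes>\<^bsub>A\<^esub> cech_elt A x (S - T) [^]\<^bsub>A\<^esub> k) k"
proof -
  interpret A: cring A by fact
  let ?t = "cech_elt A x T" and ?y = "cech_elt A x (S - T)"
  have t: "?t \<in> carrier A" and y: "?y \<in> carrier A"
    unfolding cech_elt_def using assms(3,4) by (auto intro!: A.finprod_closed)
  have xS: "cech_elt A x S = ?t \<otimes>\<^bsub>A\<^esub> ?y"
  proof -
    have "finprod A x (T \<union> (S - T)) = finprod A x T \<otimes>\<^bsub>A\<^esub> finprod A x (S - T)"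
      by (rule A.finprod_Un_disjoint) (use assms(2-4) finite_subset in auto)
    moreover have "T \<union> (S - T) = S" using assms(4) by blast
    ultimately show ?thesis by (simp add: cech_elt_def)
  qed
  have sub: "submonoid (cech_pows A x V) A" if "V \<subseteq> S" for V
  proof
    have v: "cech_elt A x V \<in> carrier A"
      unfolding cech_elt_def using assms(3) that by (auto intro!: A.finprod_closed)
    show "cech_pows A x V \<subseteq> carrier A" using v by (auto simp: cech_pows_def)
    show "\<one>\<^bsub>A\<^esub> \<in> cech_pows A x V"
      unfolding cech_pows_def by (rule CollectI, rule exI[of _ 0]) simp
    fix u w assume "u \<in> cech_pows A x V" "w \<in> cech_pows A x V"
    then obtain i j :: nat where "u = cech_elt A x V [^]\<^bsub>A\<^esub> i" "w = cech_elt A x V [^]\<^bsub>A\<^esub> j"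
      by (auto simp: cech_pows_def)
    then have "u \<otimes>\<^bsub>A\<^esub> w = cech_elt A x V [^]\<^bsub>A\<^esub> (i + j)"
      using A.nat_pow_mult[OF v] by simp
    then show "u \<otimes>\<^bsub>A\<^esub> w \<in> cech_pows A x V" by (auto simp: cech_pows_def)
  qed
  have pow: "cech_elt A x V [^]\<^bsub>A\<^esub> i \<in> cech_pows A x V" for V and i :: nat
    by (auto simp: cech_pows_def)
  have wd: "cech_frac A x S (b \<otimes>\<^bsub>A\<^esub> ?y [^]\<^bsub>A\<^esub> l) l = cech_frac A x S (a \<otimes>\<^bsub>A\<^esub> ?y [^]\<^bsub>A\<^esub> k) k"
    if b: "b \<in> carrier A" and eq: "cech_frac A x T a k = cech_frac A x T b l" for b l
  proof -
    obtain m :: nat where m: "?t [^]\<^bsub>A\<^esub> m \<otimes>\<^bsub>A\<^esub> (a \<otimes>\<^bsub>A\<^esub> ?t [^]\<^bsub>A\<^esub> l) =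
        ?t [^]\<^bsub>A\<^esub> m \<otimes>\<^bsub>A\<^esub> (b \<otimes>\<^bsub>A\<^esub> ?t [^]\<^bsub>A\<^esub> k)"
      using eq fraction_eq_iff[OF assms(1) sub[OF assms(4)] assms(5) b pow pow]
      by (auto simp: cech_pows_def)
    let ?w = "?y [^]\<^bsub>A\<^esub> m \<otimes>\<^bsub>A\<^esub> (?y [^]\<^bsub>A\<^esub> k \<otimes>\<^bsub>A\<^esub> ?y [^]\<^bsub>A\<^esub> l)"
    have "cech_elt A x S [^]\<^bsub>A\<^esub> m \<otimes>\<^bsub>A\<^esub> (b \<otimes>\<^bsub>A\<^esub> ?y [^]\<^bsub>A\<^esub> l \<otimes>\<^bsub>A\<^esub> cech_elt A x S [^]\<^bsub>A\<^esub> k) =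
        ?w \<otimes>\<^bsub>A\<^esub> (?t [^]\<^bsub>A\<^esub> m \<otimes>\<^bsub>A\<^esub> (b \<otimes>\<^bsub>A\<^esub> ?t [^]\<^bsub>A\<^esub> k))"
      using t y b by (simp add: xS A.nat_pow_distrib A.m_ac)
    also have "\<dots> = cech_elt A x S [^]\<^bsub>A\<^esub> m \<otimes>\<^bsub>A\<^esub>
        (a \<otimes>\<^bsub>A\<^esub> ?y [^]\<^bsub>A\<^esub> k \<otimes>\<^bsub>A\<^esub> cech_elt A x S [^]\<^bsub>A\<^esub> l)"
      unfolding m[symmetric] using t y assms(5) by (simp add: xS A.nat_pow_distrib A.m_ac)
    finally show ?thesis
      using fraction_eq_iff[OF assms(1) sub[OF order_refl] _ _ pow pow] t y b assms(5) pow
      by (auto intro!: bexI[of _ "cech_elt A x S [^]\<^bsub>A\<^esub> m"])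
  qed
  have "{cech_frac A x S (b \<otimes>\<^bsub>A\<^esub> ?y [^]\<^bsub>A\<^esub> l) l | b l.
      b \<in> carrier A \<and> cech_frac A x T a k = cech_frac A x T b l} =
    {cech_frac A x S (a \<otimes>\<^bsub>A\<^esub> ?y [^]\<^bsub>A\<^esub> k) k}"
    (is "?L = {?r}")
  proof
    show "?L \<subseteq> {?r}" using wd by blast
    show "{?r} \<subseteq> ?L" using assms(5) by blast
  qed
  then show ?thesis unfolding cech_res_def by simp
qed

definition cech_index :: "nat \<Rightarrow> nat \<Rightarrow> nat set set" where
  "cech_index n j = {S. S \<subseteq> {..n} \<and> card S = j}"

definition cech_group ::
  "('a, 'p) ring_scheme \<Rightarrow> (nat \<Rightarrow> 'a) \<Rightarrow> nat \<Rightarrow> nat \<Rightarrow> (nat set \<Rightarrow> ('a \<times> 'a) set) monoid" where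
  "cech_group A x n j = product_group (cech_index n j) (\<lambda>S. add_monoid (cech_ring A x S))"

definition cech_diff ::
  "('a, 'p) ring_scheme \<Rightarrow> (nat \<Rightarrow> 'a) \<Rightarrow> nat \<Rightarrow> nat
    \<Rightarrow> (nat set \<Rightarrow> ('a \<times> 'a) set) \<Rightarrow> (nat set \<Rightarrow> ('a \<times> 'a) set)" where
  "cech_diff A x n j c =
     (\<lambda>S \<in> cech_index n (Suc j).
        finsum (cech_ring A x S)
          (\<lambda>i. let z = cech_res A x (S - {i}) S (c (S - {i}))
               in if even (card {l \<in> S. l < i}) then z else \<ominus>\<^bsub>cech_ring A x S\<^esub> z)
          S)"

definition cech_cocycles ::
  "('a, 'p) ring_scheme \<Rightarrow> (nat \<Rightarrow> 'a) \<Rightarrow> nat \<Rightarrow> nat \<Rightarrow> (nat set \<Rightarrow> ('a \<times> 'a) set) set" where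
  "cech_cocycles A x n j =
     kernel (cech_group A x n j) (cech_group A x n (Suc j)) (cech_diff A x n j)"

definition cech_coboundaries ::
  "('a, 'p) ring_scheme \<Rightarrow> (nat \<Rightarrow> 'a) \<Rightarrow> nat \<Rightarrow> nat \<Rightarrow> (nat set \<Rightarrow> ('a \<times> 'a) set) set" where
  "cech_coboundaries A x n j =
     (case j of 0 \<Rightarrow> {\<one>\<^bsub>cech_group A x n 0\<^esub>}
      | Suc i \<Rightarrow> cech_diff A x n i ` carrier (cech_group A x n i))"

definition local_cohomology ::
  "('a, 'p) ring_scheme \<Rightarrow> (nat \<Rightarrow> 'a) \<Rightarrow> nat \<Rightarrow> nat \<Rightarrow> (nat set \<Rightarrow> ('a \<times> 'a) set) set monoid" where
  "local_cohomology A x n j =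
     (cech_group A x n j)\<lparr>carrier := cech_cocycles A x n j\<rparr> Mod cech_coboundaries A x n j"

definition cohomology_class ::
  "('a, 'p) ring_scheme \<Rightarrow> (nat \<Rightarrow> 'a) \<Rightarrow> nat \<Rightarrow> nat
    \<Rightarrow> (nat set \<Rightarrow> ('a \<times> 'a) set) \<Rightarrow> (nat set \<Rightarrow> ('a \<times> 'a) set) set" where
  "cohomology_class A x n j c =
     cech_coboundaries A x n j
       #>\<^bsub>(cech_group A x n j)\<lparr>carrier := cech_cocycles A x n j\<rparr>\<^esub> c"

text \<open>
  The grading on local cohomology when \<open>A\<close> is graded, with piece \<open>A\<^sub>i = gr i\<close> in degree \<open>i\<close>, and
  all the \<open>x\<^sub>i\<close> have degree 1: then \<open>a / x\<^sub>S\<^sup>k\<close> has degree \<open>deg a - k |S|\<close>.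
\<close>

definition cech_ring_piece ::
  "('a, 'p) ring_scheme \<Rightarrow> (int \<Rightarrow> 'a set) \<Rightarrow> (nat \<Rightarrow> 'a) \<Rightarrow> nat set \<Rightarrow> int \<Rightarrow> ('a \<times> 'a) set set" where
  "cech_ring_piece A gr x S i = {cech_frac A x S a k | a k. a \<in> gr (i + int k * int (card S))}"

definition local_cohomology_piece ::
  "('a, 'p) ring_scheme \<Rightarrow> (int \<Rightarrow> 'a set) \<Rightarrow> (nat \<Rightarrow> 'a) \<Rightarrow> nat \<Rightarrow> nat \<Rightarrow> int
    \<Rightarrow> (nat set \<Rightarrow> ('a \<times> 'a) set) set set" where
  "local_cohomology_piece A gr x n j i =
     cohomology_class A x n j `
       {c \<in> cech_cocycles A x n j. \<forall>S \<in> cech_index n j. c S \<in> cech_ring_piece A gr x S i}"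

text \<open>As local cohomology is the internal direct sum of its graded pieces, the direct sum of those
  of degree at most \<open>N\<close> is the subgroup that they generate.\<close>

definition local_cohomology_le ::
  "('a, 'p) ring_scheme \<Rightarrow> (int \<Rightarrow> 'a set) \<Rightarrow> (nat \<Rightarrow> 'a) \<Rightarrow> nat \<Rightarrow> nat \<Rightarrow> int
    \<Rightarrow> (nat set \<Rightarrow> ('a \<times> 'a) set) set set" where
  "local_cohomology_le A gr x n j N =
     generate (local_cohomology A x n j) (\<Union>i \<in> {..N}. local_cohomology_piece A gr x n j i)"

text \<open>The Frobenius endomorphism of \<open>A\<close> induces that of each localization, \<open>a/s \<mapsto> a\<^sup>p/s\<^sup>p\<close>, hence
  an endomorphism of the Cech complex and of its cohomology. In \<open>frobenius_action\<close> the members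
  of the union all coincide.\<close>

definition cech_frobenius ::
  "nat \<Rightarrow> ('a, 'p) ring_scheme \<Rightarrow> (nat \<Rightarrow> 'a) \<Rightarrow> nat \<Rightarrow> nat
    \<Rightarrow> (nat set \<Rightarrow> ('a \<times> 'a) set) \<Rightarrow> (nat set \<Rightarrow> ('a \<times> 'a) set)" where
  "cech_frobenius p A x n j c = (\<lambda>S \<in> cech_index n j. c S [^]\<^bsub>cech_ring A x S\<^esub> p)"

definition frobenius_action ::
  "nat \<Rightarrow> ('a, 'p) ring_scheme \<Rightarrow> (nat \<Rightarrow> 'a) \<Rightarrow> nat \<Rightarrow> nat
    \<Rightarrow> (nat set \<Rightarrow> ('a \<times> 'a) set) set \<Rightarrow> (nat set \<Rightarrow> ('a \<times> 'a) set) set" where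
  "frobenius_action p A x n j U = (\<Union>c \<in> U. cohomology_class A x n j (cech_frobenius p A x n j c))"


section \<open>Hypersurfaces\<close>

text \<open>Throughout, \<open>R = k[x\<^sub>0, \<dots>, x\<^sub>n]\<close>; elements of \<open>R/fR\<close> are cosets of \<open>fR\<close>.\<close>

definition hypersurface_ring :: "nat \<Rightarrow> 'k::comm_ring_1 mpoly \<Rightarrow> 'k mpoly set ring" where
  "hypersurface_ring n f = mpoly_ring n Quot (PIdl\<^bsub>mpoly_ring n\<^esub> f)"

lemma cring_hypersurface_ring:
  assumes "f \<in> carrier (mpoly_ring n)"
  shows "cring (hypersurface_ring n f)"
proof -
  interpret R: cring "mpoly_ring n" by (rule cring_mpoly_ring)
  show ?thesis
    unfolding hypersurface_ring_def
    by (rule ideal.quotient_is_cring[OF R.cgenideal_ideal[OF assms] R.is_cring])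
qed

definition residue_class :: "nat \<Rightarrow> 'k::comm_ring_1 mpoly \<Rightarrow> 'k mpoly \<Rightarrow> 'k mpoly set" where
  "residue_class n f g = PIdl\<^bsub>mpoly_ring n\<^esub> f +>\<^bsub>mpoly_ring n\<^esub> g"

definition hypersurface_piece :: "nat \<Rightarrow> 'k::comm_ring_1 mpoly \<Rightarrow> int \<Rightarrow> 'k mpoly set set" where
  "hypersurface_piece n f i =
     residue_class n f ` {g \<in> carrier (mpoly_ring n). homogeneous i g}"

text \<open>\<open>(R/fR)\<^sub>P\<close> for a prime \<open>P\<close> of \<open>R\<close>: the image of \<open>R - P\<close> is inverted. This is the zero ring if
  \<open>f \<notin> P\<close>; otherwise it is the local ring of \<open>R/fR\<close> at the prime \<open>P/fR\<close>.\<close>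

definition hypersurface_local_ring ::
  "nat \<Rightarrow> 'k::comm_ring_1 mpoly \<Rightarrow> 'k mpoly set \<Rightarrow> ('k mpoly set \<times> 'k mpoly set) set ring" where
  "hypersurface_local_ring n f P =
     localization (hypersurface_ring n f) (residue_class n f ` (carrier (mpoly_ring n) - P))"

lemma cring_hypersurface_local_ring:
  assumes "f \<in> carrier (mpoly_ring n)" "primeideal P (mpoly_ring n)"
  shows "cring (hypersurface_local_ring n f P)"
  unfolding hypersurface_local_ring_def
proof (rule cring_localization[OF cring_hypersurface_ring[OF assms(1)]])
  interpret P: primeideal P "mpoly_ring n" by fact
  interpret I: ideal "PIdl\<^bsub>mpoly_ring n\<^esub> f" "mpoly_ring n"
    by (rule P.cgenideal_ideal[OF assms(1)])
  have hom: "residue_class n f \<in> ring_hom (mpoly_ring n) (hypersurface_ring n f)"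
    using I.rcos_ring_hom unfolding hypersurface_ring_def residue_class_def by simp
  have one: "\<one>\<^bsub>mpoly_ring n\<^esub> \<in> carrier (mpoly_ring n) - P"
    using P.I_notcarr P.one_imp_carrier by auto
  show "submonoid (residue_class n f ` (carrier (mpoly_ring n) - P)) (hypersurface_ring n f)"
  proof
    show "residue_class n f ` (carrier (mpoly_ring n) - P) \<subseteq> carrier (hypersurface_ring n f)"
      using ring_hom_closed[OF hom] by auto
    show "\<one>\<^bsub>hypersurface_ring n f\<^esub> \<in> residue_class n f ` (carrier (mpoly_ring n) - P)"
      using one ring_hom_one[OF hom] by (metis image_eqI)
    fix u v assume "u \<in> residue_class n f ` (carrier (mpoly_ring n) - P)"
      "v \<in> residue_class n f ` (carrier (mpoly_ring n) - P)"
    then obtain a b where ab: "a \<in> carrier (mpoly_ring n) - P" "b \<in> carrier (mpoly_ring n) - P"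
      "u = residue_class n f a" "v = residue_class n f b" by blast
    then have "u \<otimes>\<^bsub>hypersurface_ring n f\<^esub> v = residue_class n f (a \<otimes>\<^bsub>mpoly_ring n\<^esub> b)"
      using ring_hom_mult[OF hom] by auto
    moreover have "a \<otimes>\<^bsub>mpoly_ring n\<^esub> b \<in> carrier (mpoly_ring n) - P"
      using ab P.I_prime by auto
    ultimately show "u \<otimes>\<^bsub>hypersurface_ring n f\<^esub> v \<in> residue_class n f ` (carrier (mpoly_ring n) - P)"
      by blast
  qed
qed

definition isolated_non_F_pure_point :: "nat \<Rightarrow> nat \<Rightarrow> 'k::comm_ring_1 mpoly \<Rightarrow> bool" where
  "isolated_non_F_pure_point p n f \<longleftrightarrow>
     \<not> F_pure p (hypersurface_local_ring n f (irrelevant_ideal n)) \<and>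
     (\<forall>P. primeideal P (mpoly_ring n) \<and> P \<subset> irrelevant_ideal n \<longrightarrow>
        F_pure p (hypersurface_local_ring n f P))"

definition hypersurface_cohomology_le ::
  "nat \<Rightarrow> 'k::comm_ring_1 mpoly \<Rightarrow> nat \<Rightarrow> int
    \<Rightarrow> (nat set \<Rightarrow> ('k mpoly set \<times> 'k mpoly set) set) set set" where
  "hypersurface_cohomology_le n f j N =
     local_cohomology_le (hypersurface_ring n f) (hypersurface_piece n f)
       (\<lambda>i. residue_class n f (mpoly_var i)) n j N"

definition hypersurface_frobenius ::
  "nat \<Rightarrow> nat \<Rightarrow> 'k::comm_ring_1 mpoly \<Rightarrow> nat
    \<Rightarrow> (nat set \<Rightarrow> ('k mpoly set \<times> 'k mpoly set) set) set
    \<Rightarrow> (nat set \<Rightarrow> ('k mpoly set \<times> 'k mpoly set) set) set" where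
  "hypersurface_frobenius p n f j =
     frobenius_action p (hypersurface_ring n f) (\<lambda>i. residue_class n f (mpoly_var i)) n j"

end

theory Submission
  imports Defs "HOL-Computational_Algebra.Formal_Laurent_Series"
    "HOL-Computational_Algebra.Fraction_Field"
begin

text \<open>
  Let \<open>R = k[x\<^sub>0, \<dots>, x\<^sub>n]\<close> and let \<open>B\<close> be a finite basis of \<open>k\<close> over \<open>k\<^sup>p\<close> that contains \<open>1\<close>. Every
  element of \<open>R\<close> is uniquely \<open>\<Sum> e\<^sub>l g\<^sub>l\<^sup>p\<close>, where \<open>e\<^sub>l\<close> runs over the products \<open>b x\<^sup>a\<close> with \<open>b \<in> B\<close>
  and \<open>0 \<le> a\<^sub>i < p\<close>. The proof compares both sides of the equivalence with the ideal \<open>I\<close>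
  (\<open>gens_ideal\<close>, \<open>fedder_ideal\<close>) that the coordinates \<open>g\<^sub>l\<close> of \<open>f\<^sup>p\<^sup>-\<^sup>1\<close> generate.

  F-purity. The local ring of \<open>R/fR\<close> at \<open>P\<close> is F-pure iff \<open>I\<close> is not contained in \<open>P\<close> (\<open>fedder\<close>,
  for \<open>f \<noteq> 0\<close>). If \<open>g\<^sub>l \<notin> P\<close>, then \<open>x \<mapsto> (f\<^sup>p\<^sup>-\<^sup>1 x)\<^sub>l / g\<^sub>l\<close> maps \<open>fR\<close> to itself and splits Frobenius,
  and split homomorphisms are pure. If \<open>I \<subseteq> P\<close>, then Frobenius kills the nonzero class of \<open>f\<close> in the
  module \<open>P R\<^sub>P / f P R\<^sub>P\<close>, so it is not pure. Hence \<open>\<mm>\<close> is an isolated non-F-pure point iff no prime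
  strictly below \<open>\<mm>\<close> contains \<open>I\<close>, that is, iff \<open>I\<close> contains a power of every variable.

  A degree bound. An ideal that is generated by forms of degree at most \<open>e\<close> and contains a power of
  every variable contains all forms of degree at least \<open>(n+1)(e-1)+1\<close> (\<open>forms_bound\<close>). The \<open>g\<^sub>l\<close>
  are forms, and \<open>p deg g\<^sub>l \<le> (p-1)d\<close> gives \<open>deg g\<^sub>l \<le> d-1\<close>. So \<open>\<mm>\<close> is an isolated non-F-pure
  point iff \<open>I\<close> contains every monomial of degree at least \<open>N = (n+1)(d-1) - n\<close> (\<open>isolated_iff\<close>).

  Local cohomology. Multiplication by \<open>f\<close> on the Cech complex of \<open>R\<close> has a connecting homomorphism
  that identifies \<open>H\<^sup>n(R/fR)\<close> with the kernel of \<open>f\<close> on \<open>H\<^sup>n\<^sup>+\<^sup>1(R)\<close> and lowers degrees by \<open>d\<close>. The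
  latter module consists of the Laurent polynomials modulo those with no monomial all of whose
  exponents are negative (\<open>boundaries\<close>). Under this identification the Frobenius action becomes
  \<open>y \<mapsto> f\<^sup>p\<^sup>-\<^sup>1 y\<^sup>p = \<Sum> e\<^sub>l (g\<^sub>l y)\<^sup>p\<close>, which vanishes iff \<open>I y = 0\<close> (\<open>frobenius_zero_iff\<close>). As
  \<open>f \<in> I\<close>, the kernel of the Frobenius action is the whole annihilator of \<open>I\<close> in \<open>H\<^sup>n\<^sup>+\<^sup>1(R)\<close>. The
  pairing \<open>(g, y) \<mapsto>\<close> coefficient of \<open>1/(x\<^sub>0 \<cdots> x\<^sub>n)\<close> in \<open>g y\<close> makes the part of degree \<open>-j-n-1\<close> of this
  annihilator dual to the part of degree \<open>j\<close> of \<open>R/I\<close> (\<open>annihilator_boundary\<close>,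
  \<open>annihilator_exists\<close>). Degrees at most \<open>-n(d-1)\<close> in \<open>H\<^sup>n(R/fR)\<close> are degrees at most
  \<open>-n(d-1)-d = -N-n-1\<close> in \<open>H\<^sup>n\<^sup>+\<^sup>1(R)\<close>, so Frobenius is injective there iff \<open>I\<close> contains every
  monomial of degree at least \<open>N\<close> (\<open>frobenius_injective_iff\<close>).
\<close>

section \<open>Laurent polynomials\<close>

type_synonym 'k laurent = "(nat \<Rightarrow>\<^sub>0 int) \<Rightarrow>\<^sub>0 'k"

abbreviation (input) coef :: "('a \<Rightarrow>\<^sub>0 'b::zero) \<Rightarrow> 'a \<Rightarrow> 'b" where
  "coef \<equiv> Poly_Mapping.lookup"

abbreviation (input) monomial :: "'a \<Rightarrow> 'b \<Rightarrow> 'a \<Rightarrow>\<^sub>0 'b::zero" where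
  "monomial \<equiv> Poly_Mapping.single"

definition supported :: "('a \<Rightarrow> bool) \<Rightarrow> ('a \<Rightarrow>\<^sub>0 'b::zero) set" where
  "supported Q = {g. \<forall>m \<in> Poly_Mapping.keys g. Q m}"

lemma supported_iff: "g \<in> supported Q \<longleftrightarrow> (\<forall>m. \<not> Q m \<longrightarrow> coef g m = 0)"
  by (auto simp: supported_def in_keys_iff)

lemma supported_mono: "g \<in> supported Q \<Longrightarrow> (\<And>m. Q m \<Longrightarrow> Q' m) \<Longrightarrow> g \<in> supported Q'"
  by (auto simp: supported_def)

lemma supported_0 [simp]: "0 \<in> supported Q"
  by (simp add: supported_def)

lemma supported_add [intro]:
  "g \<in> supported Q \<Longrightarrow> h \<in> supported Q \<Longrightarrow> g + h \<in> supported Q" for g h :: "'a \<Rightarrow>\<^sub>0 'b::monoid_add"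
  by (auto simp: supported_iff lookup_add)

lemma supported_uminus [intro]:
  "g \<in> supported Q \<Longrightarrow> - g \<in> supported Q" for g :: "'a \<Rightarrow>\<^sub>0 'b::ab_group_add"
  by (auto simp: supported_iff)

lemma supported_diff [intro]:
  "g \<in> supported Q \<Longrightarrow> h \<in> supported Q \<Longrightarrow> g - h \<in> supported Q" for g h :: "'a \<Rightarrow>\<^sub>0 'b::ab_group_add"
  by (auto simp: supported_iff lookup_minus)

lemma supported_sum [intro]:
  "(\<And>i. i \<in> Z \<Longrightarrow> g i \<in> supported Q) \<Longrightarrow> sum g Z \<in> supported Q"
  for g :: "'i \<Rightarrow> 'a \<Rightarrow>\<^sub>0 'b::comm_monoid_add"
  by (induction Z rule: infinite_finite_induct) auto

lemma supported_single [simp]: "monomial m c \<in> supported Q \<longleftrightarrow> c = 0 \<or> Q m"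
  by (auto simp: supported_def)

lemma supported_mult:
  fixes g h :: "'a::monoid_add \<Rightarrow>\<^sub>0 'b::semiring_0"
  assumes "g \<in> supported Q" "h \<in> supported Q'" "\<And>u v. Q u \<Longrightarrow> Q' v \<Longrightarrow> Q'' (u + v)"
  shows "g * h \<in> supported Q''"
  using assms keys_mult[of g h] unfolding supported_def by blast

lemma poly_expand: "g = (\<Sum>m \<in> Poly_Mapping.keys g. monomial m (coef g m))"
  for g :: "'a \<Rightarrow>\<^sub>0 'b::comm_monoid_add"
  by (rule poly_mapping_eqI)
     (auto simp: lookup_sum lookup_single when_def in_keys_iff sum.delta cong: if_cong)

text \<open>
  Identities between expressions that are additive in a polynomial need to be checked on its terms
  only. Applied to each factor in turn, this yields most of the product formulas below.
\<close>

lemma additive_eqI: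
  fixes A B :: "('a \<Rightarrow>\<^sub>0 'b::comm_monoid_add) \<Rightarrow> 'c::cancel_comm_monoid_add"
  assumes "\<And>x y. A (x + y) = A x + A y" "\<And>x y. B (x + y) = B x + B y"
    and "\<And>m. m \<in> Poly_Mapping.keys g \<Longrightarrow> A (monomial m (coef g m)) = B (monomial m (coef g m))"
  shows "A g = B g"
proof -
  have 0: "A 0 = 0" "B 0 = 0"
    using assms(1)[of 0 0] assms(2)[of 0 0] by simp_all
  have "A (\<Sum>m \<in> Z. monomial m (coef g m)) = B (\<Sum>m \<in> Z. monomial m (coef g m))"
    if "Z \<subseteq> Poly_Mapping.keys g" for Z
    using finite_subset[OF that finite_keys] that
    by (induction Z rule: finite_induct) (auto simp: assms 0)
  from this[OF order_refl] show ?thesis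
    by (simp flip: poly_expand)
qed

lemma coef_mono_mult: "coef (monomial u c * h) (u + v) = c * coef h v"
  for h :: "'a::cancel_comm_monoid_add \<Rightarrow>\<^sub>0 'b::comm_ring_1"
proof (rule additive_eqI[of "\<lambda>h. coef (monomial u c * h) (u + v)" "\<lambda>h. c * coef h v" h])
qed (auto simp: lookup_add distrib_left mult_single lookup_single when_def)

lemma coef_mono_mult_laurent: "coef (monomial u c * h) v = c * coef h (v - u)"
  for h :: "'a::ab_group_add \<Rightarrow>\<^sub>0 'b::comm_ring_1"
  using coef_mono_mult[of u c h "v - u"] by (simp add: algebra_simps)

text \<open>
  The terms of a polynomial whose exponents satisfy a condition; homogeneous components are an
  instance.
\<close>

definition part :: "('a \<Rightarrow> bool) \<Rightarrow> ('a \<Rightarrow>\<^sub>0 'b::comm_monoid_add) \<Rightarrow> 'a \<Rightarrow>\<^sub>0 'b" where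
  "part Q g = Poly_Mapping.mapp (\<lambda>m c. c when Q m) g"

lemma coef_part [simp]: "coef (part Q g) m = (if Q m then coef g m else 0)"
  by (auto simp: part_def lookup_mapp when_def in_keys_iff)

lemma part_add: "part Q (g + h) = part Q g + part Q h"
  by (rule poly_mapping_eqI) (auto simp: lookup_add)

lemma part_0 [simp]: "part Q 0 = 0"
  by (rule poly_mapping_eqI) auto

lemma part_uminus: "part Q (- g) = - part Q g" for g :: "'a \<Rightarrow>\<^sub>0 'b::ab_group_add"
  by (rule poly_mapping_eqI) auto

lemma part_sum: "part Q (sum g Z) = (\<Sum>i\<in>Z. part Q (g i))"
  by (rule poly_mapping_eqI) (auto simp: lookup_sum)

lemma part_supported: "g \<in> supported Q \<Longrightarrow> part Q g = g"
  by (rule poly_mapping_eqI) (auto simp: supported_iff)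

lemma part_in: "part Q g \<in> supported Q"
  by (auto simp: supported_iff)

lemma part_in': "g \<in> supported Q' \<Longrightarrow> part Q g \<in> supported Q'"
  by (auto simp: supported_iff)

lemma power_monomial: "monomial m c ^ q = monomial (((+) m ^^ q) 0) (c ^ q)"
  for m :: "'a::comm_monoid_add" and c :: "'b::comm_semiring_1"
  by (induction q) (auto simp: mult_single)

definition scal :: "nat \<Rightarrow> (nat \<Rightarrow>\<^sub>0 int) \<Rightarrow> (nat \<Rightarrow>\<^sub>0 int)" where
  "scal q m = Poly_Mapping.map ((*) (int q)) m"

lemma coef_scal [simp]: "coef (scal q m) i = int q * coef m i"
  by (simp add: scal_def map.rep_eq when_def)

lemma power_laurent_mono: "monomial m c ^ q = monomial (scal q m) (c ^ q)" for c :: "'b::comm_semiring_1"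
proof -
  have "((+) m ^^ q) 0 = scal q m"
    by (rule poly_mapping_eqI, induction q) (auto simp: lookup_add algebra_simps)
  then show ?thesis by (simp add: power_monomial)
qed

lemma CHAR_poly_mapping [simp]: "CHAR(('a::comm_monoid_add \<Rightarrow>\<^sub>0 'k::comm_semiring_1)) = CHAR('k)"
proof (rule CHAR_eqI)
  have "of_nat m = (0 :: 'a \<Rightarrow>\<^sub>0 'k) \<longleftrightarrow> of_nat m = (0 :: 'k)" for m :: nat
  proof -
    have 1: "monomial (0 :: 'a) c = 0 \<longleftrightarrow> c = 0" for c :: 'k
      by (metis lookup_single_eq lookup_zero single_zero)
    show ?thesis using 1[of "of_nat m"] by simp
  qed
  then show "of_nat CHAR('k) = (0 :: 'a \<Rightarrow>\<^sub>0 'k)" "\<And>n. of_nat n = (0 :: 'a \<Rightarrow>\<^sub>0 'k) \<Longrightarrow> CHAR('k) dvd n"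
    by (simp_all add: of_nat_eq_0_iff_char_dvd)
qed

definition tdeg :: "nat \<Rightarrow> (nat \<Rightarrow>\<^sub>0 int) \<Rightarrow> int" where
  "tdeg n m = (\<Sum>i\<le>n. coef m i)"

lemma tdeg_add [simp]: "tdeg n (u + v) = tdeg n u + tdeg n v"
  by (simp add: tdeg_def lookup_add sum.distrib)

lemma tdeg_0 [simp]: "tdeg n 0 = 0"
  by (simp add: tdeg_def)

lemma tdeg_diff [simp]: "tdeg n (u - v) = tdeg n u - tdeg n v"
  by (simp add: tdeg_def lookup_minus sum_subtractf)

lemma tdeg_scal [simp]: "tdeg n (scal q u) = int q * tdeg n u"
  by (simp add: tdeg_def sum_distrib_left)

text \<open>
  The exponents of the monomials of \<open>k[x\<^sub>0, \<dots>, x\<^sub>n]\<close> with the variables \<open>x\<^sub>i\<close>, \<open>i \<in> S\<close>, inverted. With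
  \<open>laurents n S\<close> all terms of the Cech complex lie in one type.
\<close>

definition exponents :: "nat \<Rightarrow> nat set \<Rightarrow> (nat \<Rightarrow>\<^sub>0 int) set" where
  "exponents n S = {m. Poly_Mapping.keys m \<subseteq> {..n} \<and> (\<forall>i. i \<notin> S \<longrightarrow> coef m i \<ge> 0)}"

lemma exponents_iff:
  "m \<in> exponents n S \<longleftrightarrow> (\<forall>i>n. coef m i = 0) \<and> (\<forall>i\<le>n. i \<notin> S \<longrightarrow> coef m i \<ge> 0)"
  unfolding exponents_def by (auto simp: in_keys_iff subset_iff) (metis linorder_not_le order.refl)+

lemma exponents_mono: "m \<in> exponents n S \<Longrightarrow> S \<subseteq> T \<Longrightarrow> m \<in> exponents n T"
  by (auto simp: exponents_def)

lemma exponents_add [intro]: "u \<in> exponents n S \<Longrightarrow> v \<in> exponents n S \<Longrightarrow> u + v \<in> exponents n S"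
  by (auto simp: exponents_iff lookup_add)

lemma exponents_0 [simp]: "0 \<in> exponents n S"
  by (simp add: exponents_iff)

lemma exponents_scal: "u \<in> exponents n S \<Longrightarrow> scal q u \<in> exponents n S"
  by (auto simp: exponents_iff)

definition laurents :: "nat \<Rightarrow> nat set \<Rightarrow> 'k::zero laurent set" where
  "laurents n S = supported (\<lambda>m. m \<in> exponents n S)"

abbreviation (input) polys :: "nat \<Rightarrow> 'k::zero laurent set" where
  "polys n \<equiv> laurents n {}"

definition homog :: "nat \<Rightarrow> int \<Rightarrow> 'k::zero laurent set" where
  "homog n D = supported (\<lambda>m. tdeg n m = D)"

lemma laurents_0 [simp]: "0 \<in> laurents n S"
  by (simp add: laurents_def)

lemma laurents_1 [simp]: "1 \<in> laurents n S" for n :: nat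
  unfolding laurents_def by (simp flip: single_one)

lemma laurents_add [intro]: "g \<in> laurents n S \<Longrightarrow> h \<in> laurents n S \<Longrightarrow> g + h \<in> laurents n S"
  for g :: "'k::monoid_add laurent"
  unfolding laurents_def by blast

lemma laurents_uminus [intro]: "g \<in> laurents n S \<Longrightarrow> - g \<in> laurents n S"
  for g :: "'k::ab_group_add laurent"
  unfolding laurents_def by blast

lemma laurents_diff [intro]: "g \<in> laurents n S \<Longrightarrow> h \<in> laurents n S \<Longrightarrow> g - h \<in> laurents n S"
  for g :: "'k::ab_group_add laurent"
  unfolding laurents_def by blast

lemma laurents_sum [intro]: "(\<And>i. i \<in> Z \<Longrightarrow> g i \<in> laurents n S) \<Longrightarrow> sum g Z \<in> laurents n S"
  for g :: "'i \<Rightarrow> 'k::comm_monoid_add laurent"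
  unfolding laurents_def by blast

lemma laurents_mult [intro]: "g \<in> laurents n S \<Longrightarrow> h \<in> laurents n S \<Longrightarrow> g * h \<in> laurents n S"
  for g :: "'k::comm_semiring_1 laurent"
  unfolding laurents_def by (erule (1) supported_mult) auto

lemma laurents_power [intro]: "g \<in> laurents n S \<Longrightarrow> g ^ q \<in> laurents n S"
  for g :: "'k::comm_semiring_1 laurent"
  by (induction q) auto

lemma laurents_prod [intro]: "(\<And>i. i \<in> Z \<Longrightarrow> g i \<in> laurents n S) \<Longrightarrow> prod g Z \<in> laurents n S"
  for g :: "'i \<Rightarrow> 'k::comm_semiring_1 laurent"
  by (induction Z rule: infinite_finite_induct) auto

lemma laurents_mono: "g \<in> laurents n S \<Longrightarrow> S \<subseteq> T \<Longrightarrow> g \<in> laurents n T"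
  unfolding laurents_def by (erule supported_mono) (rule exponents_mono)

lemma laurents_single [simp]: "monomial m c \<in> laurents n S \<longleftrightarrow> c = 0 \<or> m \<in> exponents n S"
  by (simp add: laurents_def)

lemma homog_mult [intro]: "g \<in> homog n D \<Longrightarrow> h \<in> homog n E \<Longrightarrow> g * h \<in> homog n (D + E)"
  for g :: "'k::comm_semiring_1 laurent"
  unfolding homog_def by (erule supported_mult) auto

lemma homog_1 [simp]: "1 \<in> homog n 0"
  unfolding homog_def by (simp flip: single_one)

lemma homog_power: "g \<in> homog n D \<Longrightarrow> g ^ q \<in> homog n (int q * D)"
  for g :: "'k::comm_semiring_1 laurent"
  by (induction q) (auto simp: distrib_right)

lemma homog_single [simp]: "monomial m c \<in> homog n D \<longleftrightarrow> c = 0 \<or> tdeg n m = D"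
  by (simp add: homog_def)

abbreviation (input) component :: "nat \<Rightarrow> int \<Rightarrow> 'k::comm_monoid_add laurent \<Rightarrow> 'k laurent" where
  "component n D \<equiv> part (\<lambda>m. tdeg n m = D)"

text \<open>
  A homogeneous factor can be taken out of a homogeneous component. This is what makes solutions
  of homogeneous linear equations homogeneous.
\<close>

lemma component_mult:
  fixes g h :: "'k::comm_ring_1 laurent"
  assumes "h \<in> homog n E"
  shows "component n D (g * h) = component n (D - E) g * h"
proof (rule additive_eqI[of "\<lambda>g. component n D (g * h)" "\<lambda>g. component n (D - E) g * h" g])
  fix u :: "nat \<Rightarrow>\<^sub>0 int"
  show "component n D (monomial u (coef g u) * h) = component n (D - E) (monomial u (coef g u)) * h"
  proof (rule additive_eqI[of "\<lambda>h. component n D (monomial u (coef g u) * h)"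
        "\<lambda>h. component n (D - E) (monomial u (coef g u)) * h" h])
    fix v assume "v \<in> Poly_Mapping.keys h"
    then have v: "tdeg n v = E" using assms by (auto simp: homog_def supported_def)
    have 1: "part Q (monomial m c) = (if Q m then monomial m c else 0)" for Q and m :: "nat \<Rightarrow>\<^sub>0 int" and c :: 'k
      by (rule poly_mapping_eqI) (auto simp: lookup_single when_def)
    show "component n D (monomial u (coef g u) * monomial v (coef h v)) =
        component n (D - E) (monomial u (coef g u)) * monomial v (coef h v)"
      using v by (auto simp: 1 mult_single)
  qed (auto simp: part_add algebra_simps)
qed (auto simp: part_add algebra_simps)

section \<open>Cartier maps\<close>

text \<open>
  If \<open>q\<close> is a power of the characteristic, these are the \<open>q\<close>-th roots of linear forms: \<open>v \<mapsto> (\<pi> v)\<^sup>q\<close>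
  is linear over the subfield of \<open>q\<close>-th powers.
\<close>

definition frob_linear :: "nat \<Rightarrow> ('k::comm_semiring_1 \<Rightarrow> 'k) \<Rightarrow> bool" where
  "frob_linear q \<pi> \<longleftrightarrow> (\<forall>a b. \<pi> (a + b) = \<pi> a + \<pi> b) \<and> (\<forall>a b. \<pi> (a ^ q * b) = a * \<pi> b)"

text \<open>
  The coefficient of \<open>x\<^sup>a\<close> in a polynomial, regarded as a polynomial in the \<open>x\<^sub>i\<^sup>q\<close>: the term
  \<open>c x\<^sup>a\<^sup>+\<^sup>q\<^sup>m\<close> contributes \<open>\<pi>(c) x\<^sup>m\<close>, and terms with other exponents contribute nothing.
\<close>

definition cartier :: "nat \<Rightarrow> ('k::zero \<Rightarrow> 'k) \<Rightarrow> (nat \<Rightarrow>\<^sub>0 int) \<Rightarrow> 'k laurent \<Rightarrow> 'k laurent" where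
  "cartier q \<pi> a g = Poly_Mapping.map_key (\<lambda>m. a + scal q m) (Poly_Mapping.map \<pi> g)"

lemma frob_linear_0: "frob_linear q \<pi> \<Longrightarrow> \<pi> 0 = 0" for \<pi> :: "'k::comm_ring_1 \<Rightarrow> 'k"
  unfolding frob_linear_def by (metis add_cancel_left_left)

context
  fixes q :: nat and \<pi> :: "'k::comm_ring_1 \<Rightarrow> 'k"
  assumes q: "q > 0" and \<pi>: "frob_linear q \<pi>"
begin

lemma coef_cartier: "coef (cartier q \<pi> a g) m = \<pi> (coef g (a + scal q m))"
proof -
  have "inj (\<lambda>m. a + scal q m)"
  proof (rule injI)
    fix u v assume "a + scal q u = a + scal q v"
    then have "scal q u = scal q v" by simp
    then have "coef (scal q u) i = coef (scal q v) i" for i by simp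
    then show "u = v" using q by (intro poly_mapping_eqI) simp
  qed
  then show ?thesis
    unfolding cartier_def using frob_linear_0[OF \<pi>]
    by (simp add: map_key.rep_eq map.rep_eq when_def)
qed

lemma cartier_add: "cartier q \<pi> a (g + h) = cartier q \<pi> a g + cartier q \<pi> a h"
  using \<pi> by (intro poly_mapping_eqI) (simp add: coef_cartier lookup_add frob_linear_def)

lemma cartier_0 [simp]: "cartier q \<pi> a 0 = 0"
  using cartier_add[of a 0 0] by simp

lemma cartier_sum: "cartier q \<pi> a (sum g Z) = (\<Sum>i\<in>Z. cartier q \<pi> a (g i))"
  by (induction Z rule: infinite_finite_induct) (auto simp: cartier_add)

lemma cartier_mono_mult: "cartier q \<pi> a (monomial u c ^ q * h) = monomial u c * cartier q \<pi> a h"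
proof (rule poly_mapping_eqI)
  fix m
  have *: "a + scal q m - scal q u = a + scal q (m - u)"
    by (rule poly_mapping_eqI) (simp add: lookup_add lookup_minus algebra_simps)
  show "coef (cartier q \<pi> a (monomial u c ^ q * h)) m = coef (monomial u c * cartier q \<pi> a h) m"
    using \<pi> by (simp add: coef_cartier power_laurent_mono coef_mono_mult_laurent * frob_linear_def)
qed

lemma cartier_power_mult:
  assumes "Factorial_Ring.prime CHAR('k)" "q = CHAR('k) ^ e"
  shows "cartier q \<pi> a (g ^ q * h) = g * cartier q \<pi> a h"
proof (rule additive_eqI[of "\<lambda>g. cartier q \<pi> a (g ^ q * h)" "\<lambda>g. g * cartier q \<pi> a h"])
  show "cartier q \<pi> a ((x + y) ^ q * h) = cartier q \<pi> a (x ^ q * h) + cartier q \<pi> a (y ^ q * h)" for x y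
  proof -
    have "(x + y) ^ q = x ^ q + y ^ q"
      by (rule freshmans_dream'[where n = e]) (use assms in simp_all)
    then show ?thesis by (simp add: distrib_right cartier_add)
  qed
qed (auto simp: distrib_right cartier_mono_mult)

lemma cartier_supported:
  assumes "g \<in> supported Q" "\<And>m. Q (a + scal q m) \<Longrightarrow> Q' m"
  shows "cartier q \<pi> a g \<in> supported Q'"
  using assms frob_linear_0[OF \<pi>] unfolding supported_iff coef_cartier by metis

lemma cartier_homog:
  assumes "g \<in> homog n D"
  shows "cartier q \<pi> a g \<in> supported (\<lambda>m. tdeg n a + int q * tdeg n m = D)"
  using assms unfolding homog_def by (rule cartier_supported) simp

end

text \<open>
  The exponents \<open>a\<close> of the monomials \<open>x\<^sup>a\<close> that form a basis over the polynomials in the \<open>x\<^sub>i\<^sup>q\<close>.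
\<close>

definition box :: "nat \<Rightarrow> nat \<Rightarrow> (nat \<Rightarrow>\<^sub>0 int) set" where
  "box n q = {a. (\<forall>i>n. coef a i = 0) \<and> (\<forall>i. 0 \<le> coef a i \<and> coef a i < int q)}"

text \<open>
  Cartier maps with index in the box preserve polynomials and, with \<open>coord_boundaries\<close> below, the
  Laurent polynomials that represent zero: a negative exponent stays negative after multiplication by
  \<open>q\<close> and a shift by less than \<open>q\<close>.
\<close>

lemma add_scal_nonneg:
  assumes "a \<in> box n q" "coef (a + scal q m) i \<ge> 0"
  shows "coef m i \<ge> 0"
proof (rule ccontr)
  assume "\<not> coef m i \<ge> 0"
  then have "coef m i \<le> -1" by simp
  then have "int q * coef m i \<le> int q * -1" by (intro mult_left_mono) auto
  then show False using assms by (auto simp: box_def lookup_add not_le dest!: spec[of _ i])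
qed

lemma cartier_laurents:
  fixes g :: "'k::comm_ring_1 laurent"
  assumes "q > 0" "frob_linear q \<pi>" "a \<in> box n q" "g \<in> laurents n S"
  shows "cartier q \<pi> a g \<in> laurents n S"
  using assms(4) unfolding laurents_def
proof (rule cartier_supported[OF assms(1,2)])
  fix m assume "a + scal q m \<in> exponents n S"
  then show "m \<in> exponents n S"
    using assms(1,3) add_scal_nonneg[OF assms(3), of m] by (auto simp: exponents_iff box_def lookup_add)
qed

lemma finite_exponent_box:
  "finite {a :: nat \<Rightarrow>\<^sub>0 int. (\<forall>i>n. coef a i = 0) \<and> (\<forall>i. coef a i \<in> {b..c})}"
proof (rule finite_imageD[of "\<lambda>a. restrict (coef a) {..n}"])
  show "finite ((\<lambda>a. restrict (coef a) {..n}) `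
      {a :: nat \<Rightarrow>\<^sub>0 int. (\<forall>i>n. coef a i = 0) \<and> (\<forall>i. coef a i \<in> {b..c})})"
    by (rule finite_subset[of _ "{..n} \<rightarrow>\<^sub>E {b..c}"]) (auto intro!: finite_PiE)
  show "inj_on (\<lambda>a. restrict (coef a) {..n})
      {a :: nat \<Rightarrow>\<^sub>0 int. (\<forall>i>n. coef a i = 0) \<and> (\<forall>i. coef a i \<in> {b..c})}"
  proof (rule inj_onI, rule poly_mapping_eqI)
    fix x y :: "nat \<Rightarrow>\<^sub>0 int" and i
    assume x: "x \<in> {a. (\<forall>i>n. coef a i = 0) \<and> (\<forall>i. coef a i \<in> {b..c})}"
      and y: "y \<in> {a. (\<forall>i>n. coef a i = 0) \<and> (\<forall>i. coef a i \<in> {b..c})}"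
      and eq: "restrict (coef x) {..n} = restrict (coef y) {..n}"
    show "coef x i = coef y i"
    proof (cases "i \<le> n")
      case True
      then show ?thesis using fun_cong[OF eq, of i] by simp
    qed (use x y in auto)
  qed
qed

lemma finite_box: "finite (box n q)"
  by (rule finite_subset[OF _ finite_exponent_box[of n 0 "int q"]])
     (auto simp: box_def less_imp_le)

lemma functional_separates:
  fixes scale :: "'k::field \<Rightarrow> 'b::ab_group_add \<Rightarrow> 'b"
  assumes "vector_space scale" "module.subspace scale S" "x \<notin> S"
  obtains g where "\<And>a b. g (a + b) = g a + g b" "\<And>c a. g (scale c a) = c * g a"
    "g x = 1" "\<And>y. y \<in> S \<Longrightarrow> g y = 0"
proof -
  interpret k: vector_space "(*) :: 'k \<Rightarrow> 'k \<Rightarrow> 'k"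
    by unfold_locales (auto simp: algebra_simps)
  interpret V: vector_space scale by fact
  interpret vector_space_pair scale "(*) :: 'k \<Rightarrow> 'k \<Rightarrow> 'k" ..
  obtain B where B: "B \<subseteq> S" "V.independent B" "S \<subseteq> V.span B"
    using V.maximal_independent_subset by blast
  have "x \<notin> V.span B"
    using V.span_minimal[OF B(1) assms(2)] assms(3) by blast
  then have ind: "V.independent (insert x B)"
    using B(2) by (rule V.independent_insertI)
  obtain g where g: "Vector_Spaces.linear scale (*) g" "\<forall>y \<in> insert x B. g y = (if y = x then 1 else 0)"
    using linear_independent_extend[OF ind, of "\<lambda>y. if y = x then 1 else 0"] by blast
  have "x \<notin> B" using B(1) assms(3) by blast
  then have gB: "g b = 0" if "b \<in> B" for b
    using g(2) that by auto
  have "g y = 0" if "y \<in> S" for y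
    using linear_eq_0_on_span[OF g(1) gB subsetD[OF B(3) that]] .
  moreover have "g (a + b) = g a + g b" for a b by (rule linear_add[OF g(1)])
  moreover have "g (scale c a) = c * g a" for a c by (rule linear_scale[OF g(1)])
  moreover have "g x = 1" using g(2) by auto
  ultimately show thesis using that by blast
qed

text \<open>
  The field as a vector space over itself through \<open>a \<mapsto> a\<^sup>q\<close>. This replaces the vector space
  structure over the subfield of \<open>q\<close>-th powers and lets the scalars stay a type.
\<close>

lemma vector_space_frobenius:
  assumes "Factorial_Ring.prime CHAR('k::field)" "q = CHAR('k::field) ^ e"
  shows "vector_space (\<lambda>a b :: 'k::field. a ^ q * b)"
  by unfold_locales (auto simp: algebra_simps power_mult_distrib freshmans_dream'[OF assms])

text \<open>
  The line of \<open>q\<close>-th powers has a complement in the field.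
\<close>

lemma frob_linear_unital_exists:
  assumes "Factorial_Ring.prime CHAR('k::field)" "q = CHAR('k::field) ^ e"
  obtains \<pi> :: "'k::field \<Rightarrow> 'k" where "frob_linear q \<pi>" "\<pi> 1 = 1"
proof -
  interpret V: vector_space "\<lambda>a b :: 'k. a ^ q * b"
    by (rule vector_space_frobenius[OF assms])
  have "V.subspace {0}" by simp
  show thesis
  proof (rule functional_separates[OF V.vector_space_axioms \<open>V.subspace {0}\<close>, of 1])
    fix g :: "'k \<Rightarrow> 'k"
    assume "\<And>a b. g (a + b) = g a + g b" "\<And>c a. g (c ^ q * a) = c * g a" "g 1 = 1"
    then show thesis by (intro that[of g]) (auto simp: frob_linear_def)
  qed simp
qed

text \<open>
  A tower of one-dimensional extensions gives a finite spanning set; \<open>1\<close> is extended to a basis, and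
  \<open>\<pi> b\<close> is the \<open>p\<close>-th root of the coordinate that belongs to \<open>b\<close>.
\<close>

lemma frobenius_basis:
  fixes p :: nat
  assumes p: "Factorial_Ring.prime p" "CHAR('k::field) = p"
    and fin: "ring.finite_dimension (ring_on (UNIV :: 'k::field set)) (Set.range (\<lambda>a. a ^ p)) UNIV"
  obtains B :: "'k::field set" and \<pi> :: "'k \<Rightarrow> 'k \<Rightarrow> 'k"
  where "finite B" "1 \<in> B" "\<And>b. frob_linear p (\<pi> b)" "\<And>v. v = (\<Sum>b\<in>B. \<pi> b v ^ p * b)"
    "\<And>b. b \<in> B \<Longrightarrow> \<pi> b 1 = (if b = 1 then 1 else 0)"
proof -
  interpret V: vector_space "\<lambda>a b :: 'k. a ^ p * b"
    by (rule vector_space_frobenius[of p 1]) (use p in simp_all)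
  interpret K: cring "ring_on (UNIV :: 'k set)"
    by (rule cring_ring_on) auto
  have "\<exists>T. finite T \<and> E \<subseteq> V.span T" 
    if "K.dimension m F E" "F = Set.range (\<lambda>a. a ^ p)" for m E F
    using that
  proof induction
    case zero_dim
    then show ?case by (intro exI[of _ "{}"]) (simp add: ring_on_def)
  next
    case (Suc_dim v E m F)
    then obtain T where T: "finite T" "E \<subseteq> V.span T" by blast
    have "a ^ p * v + u \<in> V.span (insert v T)" if "u \<in> E" for a u
      by (rule V.span_add, rule V.span_scale, rule V.span_base)
         (use T that V.span_mono[of T "insert v T"] in auto)
    then have "K.line_extension (Set.range (\<lambda>a. a ^ p)) v E \<subseteq> V.span (insert v T)"
      by (auto simp: K.line_extension_mem_iff) (auto simp: ring_on_def)
    with T(1) Suc_dim.prems show ?case by (intro exI[of _ "insert v T"]) simp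
  qed
  then obtain T where T: "finite T" "V.span T = UNIV"
    using fin unfolding K.finite_dimension_def by blast
  define B where "B = V.extend_basis {1}"
  have one: "V.independent {1}" by simp
  note B = V.extend_basis_superset[OF one, folded B_def] V.independent_extend_basis[OF one, folded B_def]
    V.span_extend_basis[OF one, folded B_def]
  have finB: "finite B"
    using V.independent_span_bound[OF T(1) B(2)] T(2) by simp
  define \<pi> where "\<pi> b v = V.representation B v b" for b v
  show thesis
  proof (rule that[OF finB, of \<pi>])
    show "1 \<in> B" using B(1) by simp
    show "frob_linear p (\<pi> b)" for b
      by (auto simp: frob_linear_def \<pi>_def V.representation_add V.representation_scale B)
    show "v = (\<Sum>b\<in>B. \<pi> b v ^ p * b)" for v
      unfolding \<pi>_def using V.sum_representation_eq[OF B(2) _ finB order_refl, of v] B(3) by simp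
    show "\<pi> b 1 = (if b = 1 then 1 else 0)" for b
      using B(1) V.representation_basis[OF B(2), of 1] by (simp add: \<pi>_def)
  qed
qed

lemma single_sum: "monomial v (sum f B) = (\<Sum>b\<in>B. monomial v (f b))"
  for f :: "'i \<Rightarrow> 'b::comm_monoid_add"
  by (induction B rule: infinite_finite_induct) (auto simp: single_add)

text \<open>
  Freeness over the ring of \<open>p\<close>-th powers. On a single term \<open>c x\<^sup>v\<close> division of \<open>v\<close> by \<open>p\<close> with
  remainder finds the only box exponent that contributes, and the expansion of \<open>c\<close> over \<open>B\<close> does the
  rest.
\<close>

lemma cartier_decomposition:
  fixes g :: "'k::field laurent"
  assumes p: "Factorial_Ring.prime p" "CHAR('k) = p"
    and B: "finite B" "\<And>b. frob_linear p (\<pi> b)" "\<And>v. v = (\<Sum>b\<in>B. \<pi> b v ^ p * b)"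
    and g: "g \<in> laurents n {..n}"
  shows "g = (\<Sum>b\<in>B. \<Sum>a\<in>box n p. monomial a b * cartier p (\<pi> b) a g ^ p)"
proof (rule additive_eqI[of "\<lambda>g. g" "\<lambda>g. \<Sum>b\<in>B. \<Sum>a\<in>box n p. monomial a b * cartier p (\<pi> b) a g ^ p"])
  have p0: "p > 0" using p(1) prime_gt_0_nat by blast
  have fd: "(x + y) ^ p = x ^ p + y ^ p" for x y :: "'k laurent"
    by (rule freshmans_dream) (use p in simp_all)
  show "(\<Sum>b\<in>B. \<Sum>a\<in>box n p. monomial a b * cartier p (\<pi> b) a (x + y) ^ p) =
      (\<Sum>b\<in>B. \<Sum>a\<in>box n p. monomial a b * cartier p (\<pi> b) a x ^ p) +
      (\<Sum>b\<in>B. \<Sum>a\<in>box n p. monomial a b * cartier p (\<pi> b) a y ^ p)" for x y :: "'k laurent"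
    by (simp add: cartier_add[OF p0 B(2)] fd distrib_left sum.distrib)
  fix v assume v: "v \<in> Poly_Mapping.keys g"
  define c where "c = coef g v"
  \<comment> \<open>\<open>x\<^sup>v = x\<^sup>r (x\<^sup>m)\<^sup>p\<close> with \<open>r\<close> in the box.\<close>
  define r where "r = Poly_Mapping.map (\<lambda>x. x mod int p) v"
  define m where "m = Poly_Mapping.map (\<lambda>x. x div int p) v"
  have r: "coef r i = coef v i mod int p" and m: "coef m i = coef v i div int p" for i
    by (simp_all add: r_def m_def map.rep_eq when_def)
  have v_eq: "v = r + scal p m"
    by (rule poly_mapping_eqI) (simp add: lookup_add r m)
  have rbox: "r \<in> box n p"
    using v g p0 by (auto simp: box_def r laurents_def supported_def exponents_iff)
  have uniq: "v = a + scal p u \<longleftrightarrow> a = r \<and> u = m" if a: "a \<in> box n p" for a u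
  proof
    assume eq: "v = a + scal p u"
    have "coef a i = coef r i \<and> coef u i = coef m i" for i
    proof -
      have "coef v i = coef a i + int p * coef u i"
        by (simp add: lookup_add eq)
      then show ?thesis using a p0 by (auto simp: r m box_def)
    qed
    then show "a = r \<and> u = m" by (auto intro!: poly_mapping_eqI)
  qed (use v_eq in auto)
  have \<pi>0: "\<pi> b 0 = 0" for b by (rule frob_linear_0[OF B(2)])
  have cart: "cartier p (\<pi> b) a (monomial v c) = (if a = r then monomial m (\<pi> b c) else 0)"
    if "a \<in> box n p" for a b
    by (rule poly_mapping_eqI)
       (use uniq[OF that] \<pi>0 in \<open>auto simp: coef_cartier[OF p0 B(2)] lookup_single when_def\<close>)
  have "(\<Sum>a\<in>box n p. monomial a b * cartier p (\<pi> b) a (monomial v c) ^ p) =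
      monomial v (\<pi> b c ^ p * b)" for b
  proof -
    have "(\<Sum>a\<in>box n p. monomial a b * cartier p (\<pi> b) a (monomial v c) ^ p) =
        (\<Sum>a\<in>box n p. if a = r then monomial v (\<pi> b c ^ p * b) else 0)"
      by (rule sum.cong)
         (use p0 in \<open>auto simp: cart power_laurent_mono mult_single mult.commute power_0_left simp flip: v_eq\<close>)
    then show ?thesis using rbox finite_box by (simp add: sum.delta)
  qed
  then have "(\<Sum>b\<in>B. \<Sum>a\<in>box n p. monomial a b * cartier p (\<pi> b) a (monomial v c) ^ p) =
      monomial v (\<Sum>b\<in>B. \<pi> b c ^ p * b)"
    by (simp add: single_sum)
  then show "monomial v (coef g v) =
      (\<Sum>b\<in>B. \<Sum>a\<in>box n p. monomial a b * cartier p (\<pi> b) a (monomial v (coef g v)) ^ p)"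
    using B(3)[of c] by (simp add: c_def)
qed auto

section \<open>Ideals of forms that contain a power of the irrelevant ideal\<close>

text \<open>
  The ideal of \<open>k[x\<^sub>0, \<dots>, x\<^sub>n]\<close> generated by the family \<open>v\<close>.
\<close>

definition combos :: "nat \<Rightarrow> ('i \<Rightarrow> 'k::comm_ring_1 laurent) \<Rightarrow> 'i set \<Rightarrow> 'k laurent set" where
  "combos n v J = {\<Sum>i\<in>J. a i * v i | a. \<forall>i\<in>J. a i \<in> polys n}"

lemma combosI: "(\<And>i. i \<in> J \<Longrightarrow> a i \<in> polys n) \<Longrightarrow> (\<Sum>i\<in>J. a i * v i) \<in> combos n v J"
  by (auto simp: combos_def)

lemma combos_add: "x \<in> combos n v J \<Longrightarrow> y \<in> combos n v J \<Longrightarrow> x + y \<in> combos n v J"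
  unfolding combos_def
proof clarify
  fix a b :: "'b \<Rightarrow> 'a laurent" assume "\<forall>i\<in>J. a i \<in> polys n" "\<forall>i\<in>J. b i \<in> polys n"
  then show "\<exists>c. (\<Sum>i\<in>J. a i * v i) + (\<Sum>i\<in>J. b i * v i) = (\<Sum>i\<in>J. c i * v i) \<and> (\<forall>i\<in>J. c i \<in> polys n)"
    by (intro exI[of _ "\<lambda>i. a i + b i"]) (auto simp: distrib_right sum.distrib)
qed

lemma combos_mult: "g \<in> polys n \<Longrightarrow> x \<in> combos n v J \<Longrightarrow> g * x \<in> combos n v J"
  unfolding combos_def
proof clarify
  fix a :: "'b \<Rightarrow> 'a laurent" assume "g \<in> polys n" "\<forall>i\<in>J. a i \<in> polys n"
  then show "\<exists>c. g * (\<Sum>i\<in>J. a i * v i) = (\<Sum>i\<in>J. c i * v i) \<and> (\<forall>i\<in>J. c i \<in> polys n)"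
    by (intro exI[of _ "\<lambda>i. g * a i"]) (auto simp: sum_distrib_left mult.assoc)
qed

lemma combos_0 [simp]: "0 \<in> combos n v J"
  using combosI[of J "\<lambda>_. 0" n v] by simp

lemma combos_uminus: "x \<in> combos n v J \<Longrightarrow> - x \<in> combos n v J"
  using combos_mult[OF laurents_uminus[OF laurents_1], of x n v J] by simp

lemma combos_diff: "x \<in> combos n v J \<Longrightarrow> y \<in> combos n v J \<Longrightarrow> x - y \<in> combos n v J"
  using combos_add[of x n v J "- y"] combos_uminus[of y n v J] by simp

lemma combos_sum: "(\<And>i. i \<in> K \<Longrightarrow> x i \<in> combos n v J) \<Longrightarrow> sum x K \<in> combos n v J"
  by (induction K rule: infinite_finite_induct) (auto intro: combos_add)

lemma combos_base: "finite J \<Longrightarrow> i \<in> J \<Longrightarrow> v i \<in> combos n v J"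
  using combosI[of J "\<lambda>j. if j = i then 1 else 0" n v]
  by (simp add: if_distrib[of "\<lambda>x. x * _"] sum.delta cong: if_cong)

lemma combos_trans:
  assumes "x \<in> combos n v J" "\<And>i. i \<in> J \<Longrightarrow> v i \<in> combos n w K"
  shows "x \<in> combos n w K"
  using assms unfolding combos_def[of n v J] by (auto intro!: combos_sum combos_mult)

lemma combos_monomial:
  assumes "monomial m 1 \<in> combos n v J"
  shows "monomial m c \<in> combos n v J"
proof -
  have "monomial 0 c * monomial m 1 \<in> combos n v J"
    using assms by (intro combos_mult) auto
  then show ?thesis by (simp add: mult_single)
qed

lemma combos_forms:
  assumes "\<And>m. m \<in> exponents n {} \<Longrightarrow> tdeg n m \<ge> M \<Longrightarrow> monomial m 1 \<in> combos n v J"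
    and "g \<in> polys n" "g \<in> homog n D" "D \<ge> M"
  shows "g \<in> combos n v J"
proof -
  have "(\<Sum>m \<in> Poly_Mapping.keys g. monomial m (coef g m)) \<in> combos n v J"
    by (rule combos_sum, rule combos_monomial, rule assms(1))
       (use assms(2-4) in \<open>auto simp: homog_def laurents_def supported_def\<close>)
  then show ?thesis by (simp flip: poly_expand)
qed

text \<open>
  A form in an ideal generated by forms is a combination with forms as coefficients: take
  components of the given coefficients.
\<close>

lemma combos_homog:
  assumes "x \<in> combos n v J" "x \<in> homog n D" "\<And>i. i \<in> J \<Longrightarrow> v i \<in> homog n (E i)"
  obtains a where "\<And>i. i \<in> J \<Longrightarrow> a i \<in> polys n" "\<And>i. i \<in> J \<Longrightarrow> a i \<in> homog n (D - E i)"
    "x = (\<Sum>i\<in>J. a i * v i)"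
proof -
  obtain a where a: "\<And>i. i \<in> J \<Longrightarrow> a i \<in> polys n" "x = (\<Sum>i\<in>J. a i * v i)"
    using assms(1) by (auto simp: combos_def)
  have "x = component n D x"
    using assms(2) by (simp add: part_supported homog_def)
  also have "\<dots> = (\<Sum>i\<in>J. component n D (a i * v i))"
    unfolding a(2) part_sum ..
  also have "\<dots> = (\<Sum>i\<in>J. component n (D - E i) (a i) * v i)"
    by (rule sum.cong) (auto intro!: component_mult assms(3))
  finally show thesis
    by (intro that[of "\<lambda>i. component n (D - E i) (a i)"])
       (use a(1) in \<open>auto simp: homog_def part_in laurents_def intro: part_in'\<close>)
qed

lemma homog_diff: "g \<in> homog n D \<Longrightarrow> h \<in> homog n D \<Longrightarrow> g - h \<in> homog n D"
  for g :: "'k::comm_ring_1 laurent"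
  unfolding homog_def by blast

lemma homog_add: "g \<in> homog n D \<Longrightarrow> h \<in> homog n D \<Longrightarrow> g + h \<in> homog n D"
  for g :: "'k::comm_ring_1 laurent"
  unfolding homog_def by blast

lemma homog_sum: "(\<And>i. i \<in> J \<Longrightarrow> g i \<in> homog n D) \<Longrightarrow> sum g J \<in> homog n D"
  for g :: "'i \<Rightarrow> 'k::comm_ring_1 laurent"
  unfolding homog_def by blast

lemma laurent_add_power:
  fixes x y :: "'k::comm_ring_1 laurent"
  assumes "Factorial_Ring.prime CHAR('k)" "q = CHAR('k) ^ e"
  shows "(x + y) ^ q = x ^ q + y ^ q"
  by (rule freshmans_dream'[where n = e]) (use assms in simp_all)

subsection \<open>As many generators as variables\<close>

definition full_exponent :: "nat \<Rightarrow> int \<Rightarrow> (nat \<Rightarrow>\<^sub>0 int)" where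
  "full_exponent n c = (\<Sum>i\<le>n. Poly_Mapping.single i c)"

lemma coef_full_exponent [simp]: "coef (full_exponent n c) i = (if i \<le> n then c else 0)"
  by (auto simp: full_exponent_def lookup_sum lookup_single when_def sum.delta)

lemma tdeg_full_exponent [simp]: "tdeg n (full_exponent n c) = (int n + 1) * c"
  by (simp add: tdeg_def)

lemma tdeg_nonneg: "m \<in> exponents n {} \<Longrightarrow> tdeg n m \<ge> 0"
  unfolding tdeg_def exponents_iff by (intro sum_nonneg) auto

text \<open>
  The sharp bound for \<open>n+1\<close> forms of degree \<open>e\<close>. For a large power \<open>q\<close> of the characteristic let
  \<open>x\<^sup>w\<close> be the product of all \<open>x\<^sub>i\<^sup>q\<^sup>-\<^sup>1\<close>. The form \<open>x\<^sup>w (x\<^sup>u)\<^sup>q\<close> has so large a degree that, by repeated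
  use of the crude bound \<open>M\<close>, it is a combination of monomials of degree \<open>T = (n+1)(q-1)+1\<close> in the
  \<open>v\<^sub>i\<close>. Each of these contains some \<open>v\<^sub>i\<^sup>q\<close> by the pigeonhole principle, so \<open>x\<^sup>w (x\<^sup>u)\<^sup>q\<close> lies in the
  ideal of the \<open>v\<^sub>i\<^sup>q\<close>. The Cartier map of index \<open>w\<close> takes \<open>q\<close>-th roots: it sends \<open>x\<^sup>w (x\<^sup>u)\<^sup>q\<close> to \<open>x\<^sup>u\<close>
  and the ideal of the \<open>v\<^sub>i\<^sup>q\<close> into that of the \<open>v\<^sub>i\<close>.
\<close>

lemma forms_bound_few_generators:
  fixes v :: "nat \<Rightarrow> 'k::field laurent" and M :: nat
  assumes char: "Factorial_Ring.prime CHAR('k)"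
    and v: "\<And>i. i \<le> n \<Longrightarrow> v i \<in> polys n" "\<And>i. i \<le> n \<Longrightarrow> v i \<in> homog n (int e)"
    and M: "\<And>m. m \<in> exponents n {} \<Longrightarrow> tdeg n m \<ge> int M \<Longrightarrow> monomial m 1 \<in> combos n v {..n}"
    and u: "u \<in> exponents n {}" "tdeg n u \<ge> (int n + 1) * (int e - 1) + 1"
  shows "monomial u 1 \<in> combos n v {..n}"
proof -
  \<comment> \<open>The degree estimate needs \<open>q \<ge> n + 1 + M\<close>, and any power of the characteristic that large will do.\<close>
  define q where "q = CHAR('k) ^ (n + 1 + M)"
  have "2 ^ (n + 1 + M) \<le> q"
    unfolding q_def using prime_ge_2_nat[OF char] by (rule Power.power_mono) simp
  then have q: "q \<ge> n + 1 + M"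
    using less_exp[of "n + 1 + M"] by linarith
  define T where "T = (n + 1) * (q - 1) + 1"
  let ?Q = "combos n (\<lambda>i. v i ^ q) {..n}"
  \<comment> \<open>\<open>t\<close> counts how many more factors \<open>v\<^sub>i\<close> have to be split off from \<open>g\<close>; each lowers its degree
    by \<open>e\<close>, and the crude bound applies as long as the degree is at least \<open>M\<close>.\<close>
  have key: "g * (\<Prod>i\<le>n. v i ^ \<beta> i) \<in> ?Q"
    if "g \<in> polys n" "g \<in> homog n D" "D \<ge> int M + int e * int t" "sum \<beta> {..n} + t = T" for g D t \<beta>
    using that
  proof (induction t arbitrary: g D \<beta>)
    case 0
    have "\<exists>i\<le>n. \<beta> i \<ge> q"
    proof (rule ccontr)
      assume "\<not> ?thesis"
      then have "\<beta> i \<le> q - 1" if "i \<in> {..n}" for i using that by force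
      then have "sum \<beta> {..n} \<le> card {..n} * (q - 1)"
        using sum_bounded_above[of "{..n}" \<beta> "q - 1"] by simp
      then show False using 0 by (simp add: T_def)
    qed
    then obtain i where i: "i \<le> n" "\<beta> i \<ge> q" by blast
    have "g * (\<Prod>i\<le>n. v i ^ \<beta> i) =
        (g * v i ^ (\<beta> i - q) * (\<Prod>j\<in>{..n} - {i}. v j ^ \<beta> j)) * v i ^ q"
      using i by (subst prod.remove[of _ i]) (auto simp flip: power_add)
    also have "\<dots> \<in> ?Q"
    proof (rule combos_mult)
      show "v i ^ q \<in> ?Q"
        using i combos_base[of "{..n}" i "\<lambda>i. v i ^ q" n] by simp
      have "(\<Prod>j\<in>{..n} - {i}. v j ^ \<beta> j) \<in> polys n"
        by (rule laurents_prod, rule laurents_power) (use v(1) in auto)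
      then show "g * v i ^ (\<beta> i - q) * (\<Prod>j\<in>{..n} - {i}. v j ^ \<beta> j) \<in> polys n"
        using 0(1) v(1)[OF i(1)] by (intro laurents_mult laurents_power)
    qed
    finally show ?case .
  next
    case (Suc t)
    have "0 \<le> int e * int (Suc t)" by (intro mult_nonneg_nonneg of_nat_0_le_iff)
    then have "int M \<le> D"
      using Suc.prems(3) by linarith
    then have "g \<in> combos n v {..n}"
      using combos_forms[OF M Suc.prems(1,2)] by simp
    then obtain a where a: "\<And>i. i \<in> {..n} \<Longrightarrow> a i \<in> polys n"
        "\<And>i. i \<in> {..n} \<Longrightarrow> a i \<in> homog n (D - int e)" "g = (\<Sum>i\<le>n. a i * v i)"
      using Suc.prems(2) by (rule combos_homog[where E = "\<lambda>_. int e"]) (use v in auto)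
    have "g * (\<Prod>i\<le>n. v i ^ \<beta> i) = (\<Sum>i\<le>n. a i * (v i * (\<Prod>i\<le>n. v i ^ \<beta> i)))"
      unfolding a(3) by (simp add: sum_distrib_right mult.assoc)
    also have "\<dots> \<in> ?Q"
    proof (rule combos_sum)
      fix i assume i: "i \<in> {..n}"
      have "v i * (\<Prod>j\<le>n. v j ^ \<beta> j) = (\<Prod>j\<le>n. v j ^ (\<beta>(i := Suc (\<beta> i))) j)"
        using i by (subst (1 2) prod.remove[of _ i]) (auto intro!: prod.cong)
      moreover have "a i * (\<Prod>j\<le>n. v j ^ (\<beta>(i := Suc (\<beta> i))) j) \<in> ?Q"
      proof (rule Suc.IH[OF a(1,2)[OF i]])
        show "int M + int e * int t \<le> D - int e"
          using Suc.prems(3) by (simp add: algebra_simps)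
        have "sum (\<beta>(i := Suc (\<beta> i))) {..n} = Suc (sum \<beta> {..n})"
          using i by (subst (1 2) sum.remove[of _ i]) (auto intro!: sum.cong)
        then show "sum (\<beta>(i := Suc (\<beta> i))) {..n} + t = T"
          using Suc.prems(4) by simp
      qed
      ultimately show "a i * (v i * (\<Prod>j\<le>n. v j ^ \<beta> j)) \<in> ?Q" by simp
    qed
    finally show ?case .
  qed
  define w where "w = full_exponent n (int q - 1)"
  have q0: "q > 0" using q by simp
  have w: "w \<in> box n q" "w \<in> exponents n {}"
    using q0 by (auto simp: box_def w_def exponents_iff)
  have "monomial w (1 :: 'k) * monomial u 1 ^ q \<in> homog n (tdeg n w + int q * tdeg n u)"
    unfolding power_laurent_mono mult_single homog_single by simp
  moreover have "int M + int e * int T \<le> tdeg n w + int q * tdeg n u"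
  proof -
    have 1: "int q * ((int n + 1) * (int e - 1) + 1) \<le> int q * tdeg n u"
      using u(2) by (rule mult_left_mono) simp
    have "int (q - 1) = int q - 1" using q0 by simp
    then have 2: "int T = (int n + 1) * (int q - 1) + 1"
      unfolding T_def of_nat_add of_nat_mult by simp
    have 3: "int q \<ge> int n + 1 + int M" using q by linarith
    have 4: "int e * int n \<ge> 0" by (rule mult_nonneg_nonneg) simp_all
    have "int M + int e * int T + int e * int n = int M + int q * ((int n + 1) * (int e - 1) + 1) + (int n + 1) * int q - int q"
      unfolding 2 by (simp add: algebra_simps)
    also have "\<dots> \<le> (int n + 1) * (int q - 1) + int q * tdeg n u"
      using 1 3 by (simp add: algebra_simps)
    finally show ?thesis using 4 unfolding w_def tdeg_full_exponent by linarith
  qed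
  moreover have "monomial w (1 :: 'k) * monomial u 1 ^ q \<in> polys n"
    using w(2) u(1) by (auto simp: power_laurent_mono mult_single exponents_scal)
  ultimately have "monomial w (1 :: 'k) * monomial u 1 ^ q \<in> ?Q"
    using key[of "monomial w 1 * monomial u 1 ^ q" _ T "\<lambda>_. 0"] by simp
  then obtain a where a: "\<And>i. i \<le> n \<Longrightarrow> a i \<in> polys n"
      "monomial u 1 ^ q * monomial w 1 = (\<Sum>i\<le>n. v i ^ q * a i)"
    by (auto simp: combos_def mult.commute)
  obtain \<pi> :: "'k \<Rightarrow> 'k" where \<pi>: "frob_linear q \<pi>" "\<pi> 1 = 1"
    using frob_linear_unital_exists[OF char q_def] by blast
  note cart = cartier_power_mult[OF q0 \<pi>(1) char q_def]
  have scal0: "scal q m = 0 \<longleftrightarrow> m = 0" for m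
    using q0 by (auto simp: poly_mapping_eq_iff fun_eq_iff)
  have "cartier q \<pi> w (monomial w 1) = (1 :: 'k laurent)"
    by (rule poly_mapping_eqI)
       (use \<pi> frob_linear_0[OF \<pi>(1)] in \<open>auto simp: coef_cartier[OF q0 \<pi>(1)] lookup_single lookup_one when_def scal0\<close>)
  then have "monomial u 1 = cartier q \<pi> w (monomial u 1 ^ q * monomial w 1)"
    by (simp add: cart)
  also have "\<dots> = (\<Sum>i\<le>n. cartier q \<pi> w (a i) * v i)"
    unfolding a(2) by (simp only: cartier_sum[OF q0 \<pi>(1)] cart) (simp only: mult.commute)
  also have "\<dots> \<in> combos n v {..n}"
    using a(1) cartier_laurents[OF q0 \<pi>(1) w(1)] by (intro combosI) auto
  finally show ?thesis .
qed

subsection \<open>Reducing the number of generators\<close>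

text \<open>
  More unknowns than equations, by elimination of one unknown; a plain form of linear dependence
  that fits the families of coefficients below.
\<close>

lemma homogeneous_system_nontrivial:
  fixes A :: "'a \<Rightarrow> 't \<Rightarrow> 'k::field"
  assumes "finite T" "card T < card U"
  shows "\<exists>c. (\<exists>a\<in>U. c a \<noteq> 0) \<and> (\<forall>t\<in>T. (\<Sum>a\<in>U. c a * A a t) = 0)"
  using assms
proof (induction T arbitrary: U A rule: finite_induct)
  case empty
  then have "U \<noteq> {}" by auto
  then show ?case by (intro exI[of _ "\<lambda>_. 1"]) auto
next
  case (insert t T)
  have finU: "finite U" using insert.prems card_ge_0_finite[of U] by linarith
  show ?case
  proof (cases "\<forall>a\<in>U. A a t = 0")
    case True
    then show ?thesis using insert.IH[of U A] insert.prems insert.hyps by auto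
  next
    case False
    then obtain a0 where a0: "a0 \<in> U" "A a0 t \<noteq> 0" by blast
    let ?U = "U - {a0}"
    define A' where "A' a s = A a s - A a t / A a0 t * A a0 s" for a s
    have "card T < card ?U" using insert.prems insert.hyps a0 finU by simp
    then obtain c where c: "\<exists>a\<in>?U. c a \<noteq> 0" "\<And>s. s \<in> T \<Longrightarrow> (\<Sum>a\<in>?U. c a * A' a s) = 0"
      using insert.IH[of ?U A'] by blast
    define S where "S = (\<Sum>a\<in>?U. c a * A a t)"
    define c' where "c' = c(a0 := - S / A a0 t)"
    have split: "(\<Sum>a\<in>U. c' a * A a s) = - S / A a0 t * A a0 s + (\<Sum>a\<in>?U. c a * A a s)" for s
      using a0(1) finU by (subst sum.remove[of _ a0]) (auto simp: c'_def intro!: sum.cong)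
    have "(\<Sum>a\<in>U. c' a * A a s) = 0" if "s \<in> insert t T" for s
    proof (cases "s = t")
      case True
      then show ?thesis using a0(2) by (simp add: split S_def)
    next
      case False
      then have "0 = (\<Sum>a\<in>?U. c a * A' a s)" using c(2) that by simp
      also have "\<dots> = (\<Sum>a\<in>?U. c a * A a s) - S / A a0 t * A a0 s"
        by (simp add: A'_def S_def algebra_simps sum_subtractf sum_distrib_left sum_distrib_right sum_divide_distrib)
      finally show ?thesis by (simp add: split)
    qed
    moreover have "\<exists>a\<in>U. c' a \<noteq> 0" using c(1) by (auto simp: c'_def)
    ultimately show ?thesis by blast
  qed
qed

lemma sum_digits:
  fixes a b :: nat
  shows "(\<Sum>i<k. (a div b ^ i mod b) * b ^ i) = a mod b ^ k"
proof (induction k)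
  case (Suc k)
  have "a mod b ^ Suc k = b ^ k * (a div b ^ k mod b) + a mod b ^ k"
    using mod_mult2_eq[of a "b ^ k" b] by (simp add: mult.commute)
  then show ?case using Suc by simp
qed simp

text \<open>
  A crude bound with the right growth: the first \<open>n\<close> exponents determine the last one.
\<close>

lemma card_monomials_le:
  "finite {m \<in> exponents n {}. tdeg n m = int D}" (is "finite ?S")
  "card {m \<in> exponents n {}. tdeg n m = int D} \<le> (D + 1) ^ n"
proof -
  let ?r = "\<lambda>m :: nat \<Rightarrow>\<^sub>0 int. restrict (coef m) {..<n}"
  have inj: "inj_on ?r ?S"
  proof (rule inj_onI, rule poly_mapping_eqI)
    fix x y i assume x: "x \<in> ?S" and y: "y \<in> ?S" and eq: "?r x = ?r y"
    have lt: "coef x j = coef y j" if "j < n" for j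
      using fun_cong[OF eq, of j] that by simp
    then have "(\<Sum>j<n. coef x j) = (\<Sum>j<n. coef y j)" by simp
    moreover have "(\<Sum>j<n. coef m j) + coef m n = tdeg n m" for m
      by (simp add: tdeg_def flip: lessThan_Suc_atMost)
    ultimately have "coef x n = coef y n" using x y by (metis (mono_tags) add_left_cancel mem_Collect_eq)
    then show "coef x i = coef y i"
      using x y lt by (cases i n rule: linorder_cases) (auto simp: exponents_iff)
  qed
  have sub: "?r ` ?S \<subseteq> {..<n} \<rightarrow>\<^sub>E {0..int D}"
  proof (rule image_subsetI)
    fix m assume m: "m \<in> ?S"
    have "coef m i \<le> tdeg n m" if "i \<le> n" for i
      unfolding tdeg_def using m that by (intro member_le_sum) (auto simp: exponents_iff)
    then show "?r m \<in> {..<n} \<rightarrow>\<^sub>E {0..int D}" using m by (auto simp: exponents_iff)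
  qed
  have fin: "finite ({..<n} \<rightarrow>\<^sub>E {0..int D})" by (auto intro!: finite_PiE)
  show "finite ?S" using finite_subset[OF sub fin] inj by (rule finite_imageD)
  have "card ?S = card (?r ` ?S)" using inj by (simp add: card_image)
  also have "\<dots> \<le> card ({..<n} \<rightarrow>\<^sub>E {0..int D})" by (rule card_mono[OF fin sub])
  also have "\<dots> = (D + 1) ^ n" by (simp add: card_PiE nat_add_distrib)
  finally show "card ?S \<le> (D + 1) ^ n" .
qed

lemma prod_congruent:
  assumes "\<And>i. i \<in> K \<Longrightarrow> x i \<in> polys n \<and> y i \<in> polys n \<and> x i - y i \<in> combos n v J"
  shows "prod x K - prod y K \<in> combos n v J"
  using assms
proof (induction K rule: infinite_finite_induct)
  case (insert i K)
  have "prod x (insert i K) - prod y (insert i K) =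
      prod x K * (x i - y i) + y i * (prod x K - prod y K)"
    using insert.hyps by (simp add: algebra_simps)
  also have "\<dots> \<in> combos n v J"
    using insert by (intro combos_add combos_mult laurents_prod) auto
  finally show ?case .
qed auto

lemma power_congruent:
  assumes "x \<in> polys n" "y \<in> polys n" "x - y \<in> combos n v J"
  shows "x ^ k - y ^ k \<in> combos n v J"
  using prod_congruent[of "{..<k}" "\<lambda>_. x" n "\<lambda>_. y" v J] assms by simp

text \<open>
  Noether normalization for the generators: with \<open>z\<close> the last of at least \<open>n+2\<close> generators, replacing
  \<open>v\<^sub>i\<close> by \<open>v\<^sub>i - \<gamma>\<^sub>i z\<close> for \<open>i \<le> n\<close> and dropping \<open>z\<close> still leaves an ideal that contains all forms of
  large degree, for suitable constants \<open>\<gamma>\<^sub>i\<close>.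
  
  The reason is that \<open>v\<^sub>0, \<dots>, v\<^sub>n, z\<close> are too many forms to be algebraically independent. There are
  more of the products \<open>w\<^sub>a\<close>, all of degree \<open>eD\<close>, than monomials of that degree, so
  \<open>\<Sum> c\<^sub>a w\<^sub>a = 0\<close> for constants \<open>c\<^sub>a\<close> that are not all zero. The exponents of the \<open>v\<^sub>i\<close> in \<open>w\<^sub>a\<close> are
  the digits of \<open>a\<close> in base \<open>b\<close>. With \<open>\<gamma>\<^sub>i = \<tau>\<close> to the power \<open>b\<^sup>i\<close>, therefore, \<open>w\<^sub>a\<close> is congruent to
  \<open>\<tau>\<^sup>a z\<^sup>D\<close> modulo the new ideal \<open>J\<close>, and \<open>J\<close> contains \<open>Q(\<tau>) z\<^sup>D\<close> with
  \<open>Q = \<Sum> c\<^sub>a X\<^sup>a \<noteq> 0\<close>. Over an infinite field some \<open>\<tau>\<close> is not a root of \<open>Q\<close>, and then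
  \<open>z\<^sup>D \<in> J\<close>. Modulo \<open>J\<close> every old generator is a multiple of \<open>z\<close>, so forms of large degree are
  multiples of \<open>z\<^sup>D\<close> modulo \<open>J\<close>, hence in \<open>J\<close>.
\<close>

lemma reduce_generators:
  fixes v :: "nat \<Rightarrow> 'k::field laurent" and M :: nat
  assumes inf: "infinite (UNIV :: 'k set)"
    and r: "r \<ge> n + 2" and e: "e > 0"
    and v: "\<And>i. i < r \<Longrightarrow> v i \<in> polys n" "\<And>i. i < r \<Longrightarrow> v i \<in> homog n (int e)"
    and M: "\<And>m. m \<in> exponents n {} \<Longrightarrow> tdeg n m \<ge> int M \<Longrightarrow> monomial m 1 \<in> combos n v {..<r}"
  obtains v' and M' :: nat where "\<And>i. i < r - 1 \<Longrightarrow> v' i \<in> polys n"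
    "\<And>i. i < r - 1 \<Longrightarrow> v' i \<in> homog n (int e)" "\<And>i. i < r - 1 \<Longrightarrow> v' i \<in> combos n v {..<r}"
    "\<And>m. m \<in> exponents n {} \<Longrightarrow> tdeg n m \<ge> int M' \<Longrightarrow> monomial m 1 \<in> combos n v' {..<r - 1}"
proof -
  \<comment> \<open>\<open>s\<close> is chosen such that \<open>(eD+1)\<^sup>n \<le> s b\<^sup>n < b\<^sup>n\<^sup>+\<^sup>1 = N\<close>, which makes the \<open>N\<close> products \<open>w\<^sub>a\<close> linearly
    dependent; \<open>D\<close> bounds the sum of the \<open>n+1\<close> digits.\<close>
  define s where "s = (e * (n + 1)) ^ n"
  define b where "b = s + 1"
  define D where "D = (n + 1) * s"
  define N where "N = b ^ (n + 1)"
  define \<alpha> where "\<alpha> a i = a div b ^ i mod b" for a i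
  define z where "z = v (r - 1)"
  have z: "z \<in> polys n" "z \<in> homog n (int e)" using v r by (auto simp: z_def)
  have vn: "v i \<in> polys n" "v i \<in> homog n (int e)" if "i \<le> n" for i
    using v[of i] r that by auto
  define w where "w a = (\<Prod>i\<le>n. v i ^ \<alpha> a i) * z ^ (D - sum (\<alpha> a) {..n})" for a
  let ?T = "{m \<in> exponents n {}. tdeg n m = int (e * D)}"
  have sum_\<alpha>: "sum (\<alpha> a) {..n} \<le> D" for a
  proof -
    have "\<alpha> a i \<le> s" for i
      using mod_less_divisor[of b "a div b ^ i"] by (simp add: \<alpha>_def b_def)
    then show ?thesis using sum_bounded_above[of "{..n}" "\<alpha> a" s] by (simp add: D_def)
  qed
  have w: "w a \<in> polys n" "w a \<in> homog n (int (e * D))" for a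
  proof -
    show "w a \<in> polys n"
      unfolding w_def using vn z by (intro laurents_mult laurents_prod laurents_power) auto
    have "(\<Prod>i\<in>K. v i ^ \<alpha> a i) \<in> homog n (int e * int (sum (\<alpha> a) K))" if "K \<subseteq> {..n}" for K
      using finite_subset[OF that finite_atMost] that
    proof (induction K rule: finite_induct)
      case (insert i K)
      have "v i ^ \<alpha> a i * (\<Prod>i\<in>K. v i ^ \<alpha> a i) \<in> homog n (int (\<alpha> a i) * int e + int e * int (sum (\<alpha> a) K))"
        by (rule homog_mult[OF homog_power[OF vn(2)] insert.IH]) (use insert.prems in auto)
      then show ?case
        using insert.hyps by (simp add: distrib_left mult.commute)
    qed simp
    from homog_mult[OF this[OF order_refl] homog_power[OF z(2), of "D - sum (\<alpha> a) {..n}"]]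
    show "w a \<in> homog n (int (e * D))"
      using sum_\<alpha>[of a] by (simp add: w_def of_nat_diff algebra_simps)
  qed
  have "card ?T \<le> (e * D + 1) ^ n" by (rule card_monomials_le)
  also have "\<dots> \<le> (e * (n + 1) * b) ^ n"
    using e by (intro Power.power_mono) (auto simp: D_def b_def algebra_simps)
  also have "\<dots> = s * b ^ n" by (simp add: s_def power_mult_distrib)
  also have "\<dots> < N" by (simp add: N_def b_def)
  finally have "card ?T < card {..<N}" by simp
  then obtain c where c: "\<exists>a\<in>{..<N}. c a \<noteq> 0" "\<And>m. m \<in> ?T \<Longrightarrow> (\<Sum>a<N. c a * coef (w a) m) = 0"
    using homogeneous_system_nontrivial[OF card_monomials_le(1), of n "e * D" "{..<N}" "\<lambda>a m. coef (w a) m"]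
    by blast
  have rel: "(\<Sum>a<N. monomial 0 (c a) * w a) = 0"
  proof (rule poly_mapping_eqI)
    fix m
    have 1: "coef (\<Sum>a<N. monomial 0 (c a) * w a) m = (\<Sum>a<N. c a * coef (w a) m)"
      by (simp add: lookup_sum coef_mono_mult_laurent)
    show "coef (\<Sum>a<N. monomial 0 (c a) * w a) m = coef 0 m"
    proof (cases "m \<in> ?T")
      case False
      then have "coef (w a) m = 0" for a
        using w[of a] by (auto simp: laurents_def homog_def supported_iff)
      then show ?thesis by (simp add: 1)
    qed (use c(2) in \<open>simp add: 1\<close>)
  qed
  define Q where "Q = (\<Sum>a<N. Polynomial.monom (c a) a)"
  have "poly.coeff Q a = c a" if "a < N" for a
    using that by (simp add: Q_def coeff_sum sum.delta)
  then have "Q \<noteq> 0" using c(1) by force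
  then have "finite {\<tau>. poly Q \<tau> = 0}" by (rule poly_roots_finite)
  then obtain \<tau> where \<tau>: "poly Q \<tau> \<noteq> 0"
    using inf by (metis (mono_tags, lifting) UNIV_I finite_subset mem_Collect_eq subsetI)
  have Q\<tau>: "poly Q \<tau> = (\<Sum>a<N. c a * \<tau> ^ a)"
    by (simp add: Q_def poly_sum poly_monom)
  define \<gamma> where "\<gamma> i = \<tau> ^ (b ^ i)" for i
  have \<gamma>: "(\<Prod>i\<le>n. \<gamma> i ^ \<alpha> a i) = \<tau> ^ a" if "a < N" for a
  proof -
    have "(\<Prod>i\<le>n. \<gamma> i ^ \<alpha> a i) = \<tau> ^ (\<Sum>i\<le>n. \<alpha> a i * b ^ i)"
      by (simp add: \<gamma>_def power_sum mult.commute flip: power_mult)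
    also have "(\<Sum>i\<le>n. \<alpha> a i * b ^ i) = a"
      using sum_digits[of a b "n + 1"] that by (simp add: \<alpha>_def N_def flip: lessThan_Suc_atMost)
    finally show ?thesis .
  qed
  define v' where "v' i = (if i \<le> n then v i - monomial 0 (\<gamma> i) * z else v i)" for i
  let ?J = "combos n v' {..<r - 1}"
  have const: "monomial 0 c' \<in> polys n" "monomial 0 c' \<in> homog n 0" for c' :: 'k by simp_all
  have v': "v' i \<in> polys n" "v' i \<in> homog n (int e)" if "i < r - 1" for i
    using v[of i] that z const homog_mult[OF const(2) z(2)]
    by (auto simp: v'_def intro!: homog_diff laurents_diff laurents_mult)
  have v'v: "v' i \<in> combos n v {..<r}" if "i < r - 1" for i
  proof -
    have "v i \<in> combos n v {..<r}" "z \<in> combos n v {..<r}"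
      unfolding z_def using that r by (auto intro!: combos_base)
    then show ?thesis using const by (auto simp: v'_def intro!: combos_diff combos_mult)
  qed
  have v'J: "v' i \<in> ?J" if "i < r - 1" for i
    using that by (intro combos_base) auto
  have cong: "v i - monomial 0 (\<gamma> i) * z \<in> ?J" if "i \<le> n" for i
    using v'J[of i] that r by (simp add: v'_def)
  have "w a - monomial 0 (\<tau> ^ a) * z ^ D \<in> ?J" if "a < N" for a
  proof -
    let ?k = "D - sum (\<alpha> a) {..n}"
    have "(\<Prod>i\<le>n. v i ^ \<alpha> a i) - (\<Prod>i\<le>n. (monomial 0 (\<gamma> i) * z) ^ \<alpha> a i) \<in> ?J"
      using vn z const cong
      by (intro prod_congruent conjI power_congruent laurents_power laurents_mult) auto
    then have "z ^ ?k * ((\<Prod>i\<le>n. v i ^ \<alpha> a i) - (\<Prod>i\<le>n. (monomial 0 (\<gamma> i) * z) ^ \<alpha> a i)) \<in> ?J"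
      using z by (intro combos_mult laurents_power)
    moreover have "(\<Prod>i\<le>n. (monomial 0 (\<gamma> i) * z) ^ \<alpha> a i) = monomial 0 (\<tau> ^ a) * z ^ sum (\<alpha> a) {..n}"
    proof -
      have "(\<Prod>i\<le>n. monomial (0 :: nat \<Rightarrow>\<^sub>0 int) (\<gamma> i) ^ \<alpha> a i) = monomial 0 (\<Prod>i\<le>n. \<gamma> i ^ \<alpha> a i)"
      proof -
        have *: "monomial (0 :: nat \<Rightarrow>\<^sub>0 int) x ^ k = monomial 0 (x ^ k)" for x :: 'k and k
          by (induction k) (auto simp: mult_single)
        show ?thesis
          by (induction n) (auto simp: * mult_single)
      qed
      then show ?thesis
        using \<gamma>[OF that] by (simp add: power_mult_distrib prod.distrib power_sum)
    qed
    ultimately have "w a - monomial 0 (\<tau> ^ a) * (z ^ sum (\<alpha> a) {..n} * z ^ ?k) \<in> ?J"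
      by (simp add: w_def algebra_simps)
    then show ?thesis using sum_\<alpha>[of a] by (simp flip: power_add)
  qed
  then have "(\<Sum>a<N. monomial 0 (c a) * (w a - monomial 0 (\<tau> ^ a) * z ^ D)) \<in> ?J"
    using const by (intro combos_sum combos_mult) auto
  moreover have "(\<Sum>a<N. monomial 0 (c a) * (w a - monomial 0 (\<tau> ^ a) * z ^ D)) =
      - (monomial 0 (poly Q \<tau>) * z ^ D)"
    using rel by (simp add: right_diff_distrib sum_subtractf Q\<tau> single_sum sum_distrib_right
        mult_single flip: mult.assoc)
  ultimately have "monomial 0 (- inverse (poly Q \<tau>)) * - (monomial 0 (poly Q \<tau>) * z ^ D) \<in> ?J"
    using const by (metis combos_mult)
  moreover have "monomial 0 (- inverse (poly Q \<tau>)) * - (monomial 0 (poly Q \<tau>) * z ^ D) = z ^ D"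
    using \<tau> by (simp add: mult_single single_uminus flip: mult.assoc)
  ultimately have zD: "z ^ D \<in> ?J" by simp
  \<comment> \<open>A form of degree at least \<open>M + et\<close> is congruent to a multiple of \<open>z\<^sup>t\<close>.\<close>
  have step: "\<exists>h. h \<in> polys n \<and> h \<in> homog n (L - int e * int t) \<and> g - h * z ^ t \<in> ?J"
    if "g \<in> polys n" "g \<in> homog n L" "L \<ge> int M + int e * int t" for g L t
    using that(3)
  proof (induction t)
    case 0
    then show ?case using that by (intro exI[of _ g]) simp
  next
    case (Suc t)
    have "L \<ge> int M + int e * int t" using Suc.prems by (simp add: algebra_simps)
    then obtain h where h: "h \<in> polys n" "h \<in> homog n (L - int e * int t)" "g - h * z ^ t \<in> ?J"
      using Suc.IH by blast
    have "h \<in> combos n v {..<r}"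
      using combos_forms[OF M h(1,2)] Suc.prems by (simp add: algebra_simps)
    then obtain a where a: "\<And>i. i \<in> {..<r} \<Longrightarrow> a i \<in> polys n"
        "\<And>i. i \<in> {..<r} \<Longrightarrow> a i \<in> homog n (L - int e * int t - int e)" "h = (\<Sum>i<r. a i * v i)"
      using h(2) by (rule combos_homog[where E = "\<lambda>_. int e"]) (use v in auto)
    define h' where "h' = (\<Sum>i\<le>n. a i * monomial 0 (\<gamma> i)) + a (r - 1)"
    have "h' \<in> polys n"
      unfolding h'_def using a(1) r const by (intro laurents_add laurents_sum laurents_mult) auto
    moreover have "h' \<in> homog n (L - int e * int t - int e)"
      unfolding h'_def
    proof (rule homog_add, rule homog_sum)
      show "a i * monomial 0 (\<gamma> i) \<in> homog n (L - int e * int t - int e)" if "i \<in> {..n}" for i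
        using homog_mult[OF a(2)[of i] const(2)[of "\<gamma> i"]] that r by simp
      show "a (r - 1) \<in> homog n (L - int e * int t - int e)"
        using a(2)[of "r - 1"] r by simp
    qed
    moreover have "h - h' * z \<in> ?J"
    proof -
      have "{..<r} = insert (r - 1) {..<r - 1}" using r by auto
      then have "h = (\<Sum>i<r - 1. a i * v i) + a (r - 1) * z"
        unfolding a(3) by (simp add: z_def)
      moreover have "(\<Sum>i<r - 1. a i * v i) =
          (\<Sum>i<r - 1. a i * v' i) + (\<Sum>i<r - 1. if i \<le> n then a i * monomial 0 (\<gamma> i) * z else 0)"
        unfolding sum.distrib[symmetric] by (rule sum.cong) (auto simp: v'_def algebra_simps)
      moreover have "(\<Sum>i<r - 1. if i \<le> n then a i * monomial 0 (\<gamma> i) * z else 0) =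
          (\<Sum>i\<le>n. a i * monomial 0 (\<gamma> i)) * z"
      proof -
        have "{i \<in> {..<r - 1}. i \<le> n} = {..n}" using r by auto
        then show ?thesis by (simp add: sum_distrib_right flip: sum.inter_filter)
      qed
      ultimately have "h - h' * z = (\<Sum>i<r - 1. a i * v' i)"
        by (simp add: h'_def algebra_simps)
      also have "\<dots> \<in> ?J" using a(1) by (intro combosI) auto
      finally show ?thesis .
    qed
    then have "z ^ t * (h - h' * z) \<in> ?J"
      using z by (intro combos_mult laurents_power)
    from combos_add[OF h(3) this] have "g - h' * z ^ Suc t \<in> ?J"
      by (simp add: algebra_simps)
    ultimately show ?case by (intro exI[of _ h']) (simp add: algebra_simps)
  qed
  show thesis
  proof (rule that[of v' "M + e * D"])
    fix m assume m: "m \<in> exponents n {}" "tdeg n m \<ge> int (M + e * D)"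
    obtain h where h: "h \<in> polys n" "monomial m 1 - h * z ^ D \<in> ?J"
      using step[of "monomial m 1" "tdeg n m" D] m by auto
    have "h * z ^ D \<in> ?J" using h(1) zD by (rule combos_mult)
    from combos_add[OF h(2) this] show "monomial m 1 \<in> ?J" by simp
  qed (use v' v'v in auto)
qed

text \<open>
  Fewer than \<open>n+1\<close> generators are filled up with zeros, more are reduced one at a time.
\<close>

lemma forms_bound_infinite_field:
  fixes v :: "nat \<Rightarrow> 'k::field laurent" and M :: nat
  assumes inf: "infinite (UNIV :: 'k set)" and char: "Factorial_Ring.prime CHAR('k)" and e: "e > 0"
    and v: "\<And>i. i < r \<Longrightarrow> v i \<in> polys n" "\<And>i. i < r \<Longrightarrow> v i \<in> homog n (int e)"
    and M: "\<And>m. m \<in> exponents n {} \<Longrightarrow> tdeg n m \<ge> int M \<Longrightarrow> monomial m 1 \<in> combos n v {..<r}"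
    and u: "u \<in> exponents n {}" "tdeg n u \<ge> (int n + 1) * (int e - 1) + 1"
  shows "monomial u 1 \<in> combos n v {..<r}"
  using v M
proof (induction r arbitrary: v M rule: less_induct)
  case (less r)
  show ?case
  proof (cases "r \<le> n + 1")
    case True
    define v' where "v' i = (if i < r then v i else 0)" for i
    have v'v: "combos n v' {..n} \<subseteq> combos n v {..<r}"
    proof
      fix x assume "x \<in> combos n v' {..n}"
      then show "x \<in> combos n v {..<r}"
        by (rule combos_trans) (auto simp: v'_def intro!: combos_base)
    qed
    have vv': "combos n v {..<r} \<subseteq> combos n v' {..n}"
    proof
      fix x assume "x \<in> combos n v {..<r}"
      then show "x \<in> combos n v' {..n}"
      proof (rule combos_trans)
        fix i assume "i \<in> {..<r}"
        then show "v i \<in> combos n v' {..n}"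
          using True combos_base[of "{..n}" i v' n] by (simp add: v'_def)
      qed
    qed
    have "monomial u 1 \<in> combos n v' {..n}"
    proof (rule forms_bound_few_generators[OF char _ _ _ u])
      show "v' i \<in> polys n" for i using less.prems by (simp add: v'_def)
      show "v' i \<in> homog n (int e)" for i using less.prems by (simp add: v'_def homog_def)
      show "monomial m 1 \<in> combos n v' {..n}" if "m \<in> exponents n {}" "int M \<le> tdeg n m" for m
        using less.prems(3)[OF that] vv' by blast
    qed
    then show ?thesis using v'v by blast
  next
    case False
    then have r: "n + 2 \<le> r" by simp
    obtain v' and M' :: nat where v': "\<And>i. i < r - 1 \<Longrightarrow> v' i \<in> polys n"
      "\<And>i. i < r - 1 \<Longrightarrow> v' i \<in> homog n (int e)" "\<And>i. i < r - 1 \<Longrightarrow> v' i \<in> combos n v {..<r}"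
      "\<And>m. m \<in> exponents n {} \<Longrightarrow> tdeg n m \<ge> int M' \<Longrightarrow> monomial m 1 \<in> combos n v' {..<r - 1}"
      using reduce_generators[OF inf r e less.prems] by metis
    have "monomial u 1 \<in> combos n v' {..<r - 1}"
      using less.IH[of "r - 1" v' M'] v' r by simp
    then show ?thesis by (rule combos_trans) (use v' in auto)
  qed
qed

lemma combos_component:
  assumes "x \<in> combos n v J" "\<And>i. i \<in> J \<Longrightarrow> v i \<in> homog n (E i)"
  shows "component n D x \<in> combos n v J"
proof -
  obtain a where a: "\<And>i. i \<in> J \<Longrightarrow> a i \<in> polys n" "x = (\<Sum>i\<in>J. a i * v i)"
    using assms(1) by (auto simp: combos_def)
  have "component n D x = (\<Sum>i\<in>J. component n (D - E i) (a i) * v i)"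
    unfolding a(2) part_sum by (rule sum.cong) (auto intro!: component_mult assms(2))
  also have "\<dots> \<in> combos n v J"
    using a(1) by (intro combosI) (auto simp: laurents_def intro: part_in')
  finally show ?thesis .
qed

subsection \<open>Arbitrary fields and generators of lower degree\<close>

lemma coef_map: "h 0 = 0 \<Longrightarrow> coef (Poly_Mapping.map h g) m = h (coef g m)"
  by (simp add: map.rep_eq when_def)

text \<open>
  Membership in an ideal does not depend on the coefficient field, so the field may be replaced by
  the infinite field of formal Laurent series over it. Coefficients descend along the linear map
  \<open>\<rho>\<close> that takes the constant term of each series and is linear over the old field.
\<close>

lemma forms_bound_same_degree:
  fixes v :: "nat \<Rightarrow> 'k::field laurent" and M :: nat
  assumes char: "Factorial_Ring.prime CHAR('k)" and e: "e > 0"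
    and v: "\<And>i. i < r \<Longrightarrow> v i \<in> polys n" "\<And>i. i < r \<Longrightarrow> v i \<in> homog n (int e)"
    and M: "\<And>m. m \<in> exponents n {} \<Longrightarrow> tdeg n m \<ge> int M \<Longrightarrow> monomial m 1 \<in> combos n v {..<r}"
    and u: "u \<in> exponents n {}" "tdeg n u \<ge> (int n + 1) * (int e - 1) + 1"
  shows "monomial u 1 \<in> combos n v {..<r}"
proof -
  define C :: "'k laurent \<Rightarrow> 'k fls laurent" where "C = Poly_Mapping.map fls_const"
  define \<rho> :: "'k fls laurent \<Rightarrow> 'k laurent" where "\<rho> = Poly_Mapping.map (\<lambda>x. fls_nth x 0)"
  have C: "coef (C g) m = fls_const (coef g m)" for g m by (simp add: C_def coef_map)
  have \<rho>: "coef (\<rho> g) m = fls_nth (coef g m) 0" for g m by (simp add: \<rho>_def coef_map)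
  have C_add: "C (x + y) = C x + C y" for x y
    by (rule poly_mapping_eqI) (simp add: C lookup_add fls_plus_const)
  have \<rho>_add: "\<rho> (x + y) = \<rho> x + \<rho> y" for x y
    by (rule poly_mapping_eqI) (simp add: \<rho> lookup_add)
  have C_0: "C 0 = 0" and \<rho>_0: "\<rho> 0 = 0"
    by (auto intro!: poly_mapping_eqI simp: C \<rho>)
  have C_monomial: "C (monomial m c) = monomial m (fls_const c)" for m c
    by (rule poly_mapping_eqI) (simp add: C lookup_single when_def)
  have \<rho>_monomial: "\<rho> (monomial m c) = monomial m (fls_nth c 0)" for m c
    by (rule poly_mapping_eqI) (simp add: \<rho> lookup_single when_def)
  have C_mult: "C (g * h) = C g * C h" for g h
  proof (rule additive_eqI[of "\<lambda>g. C (g * h)" "\<lambda>g. C g * C h"])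
    fix u
    show "C (monomial u (coef g u) * h) = C (monomial u (coef g u)) * C h"
    proof (rule additive_eqI[of "\<lambda>h. C (monomial u (coef g u) * h)" "\<lambda>h. C (monomial u (coef g u)) * C h"])
    qed (simp_all add: C_add C_monomial distrib_left mult_single)
  qed (simp_all add: C_add distrib_right)
  have \<rho>_mult: "\<rho> (h * C g) = \<rho> h * g" for g h
  proof (rule additive_eqI[of "\<lambda>g. \<rho> (h * C g)" "\<lambda>g. \<rho> h * g"])
    fix u
    show "\<rho> (h * C (monomial u (coef g u))) = \<rho> h * monomial u (coef g u)"
    proof (rule additive_eqI[of "\<lambda>h. \<rho> (h * C (monomial u (coef g u)))" "\<lambda>h. \<rho> h * monomial u (coef g u)"])
    qed (simp_all add: \<rho>_add C_monomial \<rho>_monomial distrib_right mult_single fls_mult_const_nth)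
  qed (simp_all add: C_add \<rho>_add distrib_left)
  have C_sum: "C (sum g J) = (\<Sum>i\<in>J. C (g i))" for g and J :: "nat set"
    by (induction J rule: infinite_finite_induct) (auto simp: C_add C_0)
  have \<rho>_sum: "\<rho> (sum g J) = (\<Sum>i\<in>J. \<rho> (g i))" for g and J :: "nat set"
    by (induction J rule: infinite_finite_induct) (auto simp: \<rho>_add \<rho>_0)
  have C_polys: "C g \<in> polys n" if "g \<in> polys n" for g
    using that by (auto simp: laurents_def supported_iff C)
  have \<rho>_polys: "\<rho> g \<in> polys n" if "g \<in> polys n" for g
    using that by (auto simp: laurents_def supported_iff \<rho>)
  have "monomial u 1 \<in> combos n (\<lambda>i. C (v i)) {..<r}"
  proof (rule forms_bound_infinite_field[OF _ _ e _ _ _ u])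
    have "inj (\<lambda>i. (fls_X :: 'k fls) ^ i)"
      by (rule injI) (metis fls_X_power_nth of_nat_eq_iff zero_neq_one)
    then show "infinite (UNIV :: 'k fls set)"
      by (meson finite_imageD finite_subset infinite_UNIV_nat subset_UNIV)
    show "Factorial_Ring.prime CHAR('k fls)" using char by simp
    show "C (v i) \<in> polys n" if "i < r" for i using C_polys v that by blast
    show "C (v i) \<in> homog n (int e)" if "i < r" for i
      using v(2)[OF that] by (auto simp: homog_def supported_iff C)
    fix m assume "m \<in> exponents n {}" "int M \<le> tdeg n m"
    then obtain a where a: "\<forall>i\<in>{..<r}. a i \<in> polys n" "monomial m 1 = (\<Sum>i<r. a i * v i)"
      using M by (auto simp: combos_def)
    have "monomial m 1 = C (monomial m 1)" by (simp add: C_monomial)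
    also have "\<dots> = (\<Sum>i<r. C (a i) * C (v i))"
      unfolding a(2) by (simp add: C_sum C_mult)
    also have "\<dots> \<in> combos n (\<lambda>i. C (v i)) {..<r}"
      using a(1) by (intro combosI C_polys) auto
    finally show "monomial m 1 \<in> combos n (\<lambda>i. C (v i)) {..<r}" .
  qed
  then obtain a where a: "\<forall>i\<in>{..<r}. a i \<in> polys n" "monomial u 1 = (\<Sum>i<r. a i * C (v i))"
    by (auto simp: combos_def)
  have "monomial u 1 = \<rho> (monomial u 1)" by (simp add: \<rho>_monomial)
  also have "\<dots> = (\<Sum>i<r. \<rho> (a i) * v i)" unfolding a(2) by (simp add: \<rho>_sum \<rho>_mult)
  also have "\<dots> \<in> combos n v {..<r}" using a(1) by (intro combosI \<rho>_polys) auto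
  finally show ?thesis .
qed

lemma exponent_of_lower_degree:
  assumes "m \<in> exponents n {}" "int k \<le> tdeg n m"
  shows "\<exists>w \<in> exponents n {}. tdeg n w = int k \<and> m - w \<in> exponents n {}"
  using assms(2)
proof (induction k)
  case 0
  then show ?case using assms(1) by (intro bexI[of _ 0]) auto
next
  case (Suc k)
  then obtain w where w: "w \<in> exponents n {}" "tdeg n w = int k" "m - w \<in> exponents n {}" by auto
  have "tdeg n (m - w) > 0" using w(2) Suc.prems by simp
  then obtain i where i: "i \<le> n" "coef (m - w) i > 0"
    unfolding tdeg_def by (metis atMost_iff linorder_not_le sum_nonpos)
  let ?w = "w + monomial i 1"
  have "?w \<in> exponents n {}" "m - ?w \<in> exponents n {}"
    using w i by (auto simp: exponents_iff lookup_add lookup_minus lookup_single when_def)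
  moreover have "tdeg n ?w = int (Suc k)"
    using w(2) i(1) by (simp add: tdeg_def[of n "monomial i 1"] lookup_single when_def)
  ultimately show ?case by blast
qed

text \<open>
  Generators of degree less than \<open>e\<close> are replaced by all their multiples of degree \<open>e\<close> by monomials.
  This does not change the ideal in degrees at least \<open>e\<close>. A crude bound on the degrees of monomials
  outside the ideal exists because every monomial of large degree is divisible by one of the given
  powers of variables.
\<close>

lemma forms_bound:
  fixes g :: "'i \<Rightarrow> 'k::field laurent"
  assumes char: "Factorial_Ring.prime CHAR('k)" and e: "e > 0" and J: "finite J"
    and g: "\<And>i. i \<in> J \<Longrightarrow> g i \<in> polys n" "\<And>i. i \<in> J \<Longrightarrow> g i \<in> homog n (\<delta> i)"
      "\<And>i. i \<in> J \<Longrightarrow> \<delta> i \<le> int e"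
    and pow: "\<And>i. i \<le> n \<Longrightarrow> \<exists>M::nat. monomial (monomial i (int M)) 1 \<in> combos n g J"
    and u: "u \<in> exponents n {}" "tdeg n u \<ge> (int n + 1) * (int e - 1) + 1"
  shows "monomial u 1 \<in> combos n g J"
proof -
  \<comment> \<open>The pairs \<open>(i, w)\<close> index the multiples \<open>x\<^sup>w g\<^sub>i\<close> of degree \<open>e\<close>.\<close>
  define W where "W = (SIGMA i:J. {w \<in> exponents n {}. tdeg n w = int (nat (int e - \<delta> i))})"
  define V where "V = (\<lambda>(i, w). monomial w 1 * g i)"
  have "finite W" unfolding W_def by (intro finite_SigmaI J card_monomials_le(1))
  then obtain h r where h: "bij_betw h {..<r :: nat} W"
    using ex_bij_betw_nat_finite[of W] by (auto simp: atLeast0LessThan)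
  have hW: "h j \<in> W" if "j < r" for j using h that by (auto simp: bij_betw_def)
  have Vcombos: "V w \<in> combos n (V \<circ> h) {..<r}" if "w \<in> W" for w
  proof -
    have "w \<in> h ` {..<r}" using h that by (simp add: bij_betw_def)
    then obtain j where "j < r" "w = h j" by blast
    then show ?thesis using combos_base[of "{..<r}" j "V \<circ> h" n] by simp
  qed
  have V: "V w \<in> polys n" "V w \<in> homog n (int e)" "V w \<in> combos n g J" if "w \<in> W" for w
  proof -
    obtain i m where w: "w = (i, m)" "i \<in> J" "m \<in> exponents n {}" "tdeg n m = int e - \<delta> i"
    proof -
      obtain i m where "w = (i, m)" by (cases w)
      then show ?thesis using that[of i m] \<open>w \<in> W\<close> g(3)[of i] by (simp add: W_def)
    qed
    then show "V w \<in> polys n" using g(1) by (auto simp: V_def)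
    have "monomial m 1 * g i \<in> homog n ((int e - \<delta> i) + \<delta> i)"
      using w g(2) by (intro homog_mult) auto
    then show "V w \<in> homog n (int e)" using w by (simp add: V_def)
    show "V w \<in> combos n g J"
      using w J by (auto simp: V_def intro!: combos_mult combos_base)
  qed
  have "\<exists>K::nat. \<forall>i\<le>n. monomial (monomial i (int K)) 1 \<in> combos n g J"
  proof -
    obtain F where F: "\<And>i. i \<le> n \<Longrightarrow> monomial (monomial i (int (F i))) 1 \<in> combos n g J"
      using pow by metis
    have "monomial (monomial i (int (sum F {..n}))) 1 \<in> combos n g J" if i: "i \<le> n" for i
    proof -
      have le: "F i \<le> sum F {..n}" by (rule member_le_sum) (use i in auto)
      have "monomial (monomial i (int (sum F {..n} - F i))) 1 * monomial (monomial i (int (F i))) 1 \<in> combos n g J"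
        using F[OF i] i by (intro combos_mult) (auto simp: exponents_iff lookup_single when_def)
      then show ?thesis using le by (simp add: mult_single of_nat_diff flip: single_add)
    qed
    then show ?thesis by blast
  qed
  then obtain K :: nat where K: "\<And>i. i \<le> n \<Longrightarrow> monomial (monomial i (int K)) 1 \<in> combos n g J" by blast
  have "monomial u 1 \<in> combos n (V \<circ> h) {..<r}"
  proof (rule forms_bound_same_degree[OF char e _ _ _ u])
    show "(V \<circ> h) i \<in> polys n" "(V \<circ> h) i \<in> homog n (int e)" if "i < r" for i
      using V hW that by auto
    fix m assume m: "m \<in> exponents n {}" "int ((n + 1) * K + e) \<le> tdeg n m"
    have "\<exists>i\<le>n. coef m i \<ge> int K"
    proof (rule ccontr)
      assume "\<not> ?thesis"
      then have "tdeg n m \<le> (\<Sum>i\<le>n. int K)"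
        unfolding tdeg_def by (intro sum_mono) (metis atMost_iff linorder_le_cases)
      then show False using m(2) e by (simp add: algebra_simps)
    qed
    then obtain i where i: "i \<le> n" "coef m i \<ge> int K" by blast
    have "monomial (m - monomial i (int K)) 1 * monomial (monomial i (int K)) 1 \<in> combos n g J"
      using K[OF i(1)] m(1) i
      by (intro combos_mult) (auto simp: exponents_iff lookup_minus lookup_single when_def)
    then have "monomial m 1 \<in> combos n g J" by (simp add: mult_single)
    then obtain a where a: "\<And>i. i \<in> J \<Longrightarrow> a i \<in> polys n"
        "\<And>i. i \<in> J \<Longrightarrow> a i \<in> homog n (tdeg n m - \<delta> i)" "monomial m 1 = (\<Sum>i\<in>J. a i * g i)"
      by (rule combos_homog[where D = "tdeg n m" and E = \<delta>]) (use g in auto)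
    have "a i * g i \<in> combos n (V \<circ> h) {..<r}" if i: "i \<in> J" for i
    proof -
      have "monomial l (coef (a i) l) * g i \<in> combos n (V \<circ> h) {..<r}" if "l \<in> Poly_Mapping.keys (a i)" for l
      proof -
        have l: "l \<in> exponents n {}" "tdeg n l = tdeg n m - \<delta> i"
          using a(1,2)[OF i] that by (auto simp: laurents_def homog_def supported_def)
        have "int e \<le> tdeg n m"
          using m(2) of_nat_0_le_iff[of "(n + 1) * K", where 'a = int] unfolding of_nat_add by linarith
        then have "int e - \<delta> i \<le> tdeg n l" using l(2) by simp
        then have "int (nat (int e - \<delta> i)) \<le> tdeg n l" using g(3)[OF i] by simp
        then obtain w where w: "w \<in> exponents n {}" "tdeg n w = int (nat (int e - \<delta> i))" "l - w \<in> exponents n {}"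
          using exponent_of_lower_degree[OF l(1)] by blast
        have "monomial (l - w) (coef (a i) l) * V (i, w) \<in> combos n (V \<circ> h) {..<r}"
          using w i by (intro combos_mult Vcombos) (auto simp: W_def)
        then show ?thesis by (simp add: V_def mult_single flip: mult.assoc)
      qed
      then have "(\<Sum>l\<in>Poly_Mapping.keys (a i). monomial l (coef (a i) l) * g i) \<in> combos n (V \<circ> h) {..<r}"
        by (rule combos_sum)
      then show ?thesis by (simp flip: sum_distrib_right poly_expand)
    qed
    then show "monomial m 1 \<in> combos n (V \<circ> h) {..<r}"
      unfolding a(3) by (rule combos_sum)
  qed
  then show ?thesis by (rule combos_trans) (use V hW in auto)
qed

section \<open>The ideal of a hypersurface and the kernel of Frobenius\<close>

text \<open>
  The Laurent polynomials in \<open>x\<^sub>0, \<dots>, x\<^sub>n\<close> without a term all of whose exponents are negative are the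
  sums of elements in which some variable is not inverted, that is, the image of the last
  differential of the Cech complex of \<open>k[x\<^sub>0, \<dots>, x\<^sub>n]\<close>. Modulo them, Laurent polynomials form the top
  local cohomology of this ring.
\<close>

definition boundaries :: "nat \<Rightarrow> 'k::zero laurent set" where
  "boundaries n = supported (\<lambda>m. (\<forall>i>n. coef m i = 0) \<and> (\<exists>i\<le>n. 0 \<le> coef m i))"

lemma boundaries_sum: "(\<And>i. i \<in> J \<Longrightarrow> x i \<in> boundaries n) \<Longrightarrow> sum x J \<in> boundaries n"
  for x :: "'i \<Rightarrow> 'k::comm_ring_1 laurent"
  unfolding boundaries_def by blast

lemma boundaries_mult: "g \<in> polys n \<Longrightarrow> x \<in> boundaries n \<Longrightarrow> g * x \<in> boundaries n"
  for x :: "'k::comm_ring_1 laurent"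
  unfolding boundaries_def laurents_def
proof (erule (1) supported_mult)
  fix u v :: "nat \<Rightarrow>\<^sub>0 int"
  assume u: "u \<in> exponents n {}" and v: "(\<forall>i>n. coef v i = 0) \<and> (\<exists>i\<le>n. 0 \<le> coef v i)"
  then obtain i where "i \<le> n" "0 \<le> coef v i" by blast
  then show "(\<forall>i>n. coef (u + v) i = 0) \<and> (\<exists>i\<le>n. 0 \<le> coef (u + v) i)"
    using u v by (auto simp: exponents_iff lookup_add intro!: exI[of _ i])
qed

lemma boundaries_power:
  fixes x :: "'k::comm_ring_1 laurent"
  assumes "Factorial_Ring.prime p" "CHAR('k) = p" "x \<in> boundaries n"
  shows "x ^ p \<in> boundaries n"
proof -
  have "x ^ p = (\<Sum>m\<in>Poly_Mapping.keys x. monomial m (coef x m)) ^ p"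
    by (simp flip: poly_expand)
  also have "\<dots> = (\<Sum>m\<in>Poly_Mapping.keys x. monomial m (coef x m) ^ p)"
    by (rule freshmans_dream_sum) (use assms in simp_all)
  also have "\<dots> \<in> boundaries n"
    using assms(3) by (intro boundaries_sum) (auto simp: power_laurent_mono boundaries_def supported_def zero_le_mult_iff)
  finally show ?thesis .
qed

lemma boundaries_iff:
  assumes "x \<in> laurents n {..n}"
  shows "x \<in> boundaries n \<longleftrightarrow> (\<forall>m. (\<forall>i>n. coef m i = 0) \<longrightarrow> (\<forall>i\<le>n. coef m i < 0) \<longrightarrow> coef x m = 0)"
proof
  assume h: "\<forall>m. (\<forall>i>n. coef m i = 0) \<longrightarrow> (\<forall>i\<le>n. coef m i < 0) \<longrightarrow> coef x m = 0"
  show "x \<in> boundaries n"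
    unfolding boundaries_def supported_iff
  proof (intro allI impI)
    fix m :: "nat \<Rightarrow>\<^sub>0 int" assume m: "\<not> ((\<forall>i>n. coef m i = 0) \<and> (\<exists>i\<le>n. 0 \<le> coef m i))"
    show "coef x m = 0"
    proof (cases "\<forall>i>n. coef m i = 0")
      case True
      then have "\<forall>i\<le>n. coef m i < 0" using m by (meson not_le)
      then show ?thesis using h True by blast
    next
      case False
      then show ?thesis using assms by (auto simp: laurents_def supported_iff exponents_iff)
    qed
  qed
next
  assume "x \<in> boundaries n"
  then show "\<forall>m. (\<forall>i>n. coef m i = 0) \<longrightarrow> (\<forall>i\<le>n. coef m i < 0) \<longrightarrow> coef x m = 0"
    unfolding boundaries_def supported_iff by (meson not_le)
qed

text \<open>
  \<open>\<pi> b v\<close> is the \<open>p\<close>-th root of the coordinate of \<open>v\<close> at \<open>b\<close> for a basis \<open>B\<close> of the field over its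
  \<open>p\<close>-th powers that contains \<open>1\<close>.
\<close>

locale field_p_basis =
  fixes p :: nat and B :: "'k::field set" and \<pi> :: "'k \<Rightarrow> 'k \<Rightarrow> 'k"
  assumes prime_p: "Factorial_Ring.prime p" and char_p: "CHAR('k) = p"
    and finite_B: "finite B" and one_B: "1 \<in> B" and \<pi>_lin: "\<And>b. frob_linear p (\<pi> b)"
    and \<pi>_expand: "\<And>v. v = (\<Sum>b\<in>B. \<pi> b v ^ p * b)"
    and \<pi>_one: "\<And>b. b \<in> B \<Longrightarrow> \<pi> b 1 = (if b = 1 then 1 else 0)"
begin

lemma p_pos: "p > 0" using prime_p prime_gt_0_nat by blast

definition indices :: "nat \<Rightarrow> ('k \<times> (nat \<Rightarrow>\<^sub>0 int)) set" where
  "indices n = B \<times> box n p"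

definition basis_elt :: "'k \<times> (nat \<Rightarrow>\<^sub>0 int) \<Rightarrow> 'k laurent" where
  "basis_elt l = monomial (snd l) (fst l)"

text \<open>
  The \<open>p\<close>-th roots of the coordinates with respect to the basis \<open>b x\<^sup>a\<close> over the ring of \<open>p\<close>-th powers.
\<close>

definition coord :: "'k \<times> (nat \<Rightarrow>\<^sub>0 int) \<Rightarrow> 'k laurent \<Rightarrow> 'k laurent" where
  "coord l = cartier p (\<pi> (fst l)) (snd l)"

lemma finite_indices: "finite (indices n)"
  by (simp add: indices_def finite_B finite_box)

lemma unit_index: "(1, 0) \<in> indices n"
  using one_B p_pos by (simp add: indices_def box_def)

lemma basis_elt_polys: "l \<in> indices n \<Longrightarrow> basis_elt l \<in> polys n"
  by (auto simp: indices_def basis_elt_def box_def exponents_iff)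

lemma laurent_power_p_add: "(x + y) ^ p = x ^ p + y ^ p" for x y :: "'k laurent"
  by (rule laurent_add_power[where e = 1]) (use prime_p char_p in simp_all)

lemma coord_add: "coord l (x + y) = coord l x + coord l y"
  unfolding coord_def by (rule cartier_add[OF p_pos \<pi>_lin])

lemma coord_sum: "coord l (sum x J) = (\<Sum>i\<in>J. coord l (x i))"
  unfolding coord_def by (rule cartier_sum[OF p_pos \<pi>_lin])

lemma coord_power_mult: "coord l (x ^ p * y) = x * coord l y"
  unfolding coord_def by (rule cartier_power_mult[OF p_pos \<pi>_lin, where e = 1]) (use prime_p char_p in simp_all)

lemma coord_laurents: "l \<in> indices n \<Longrightarrow> x \<in> laurents n S \<Longrightarrow> coord l x \<in> laurents n S"
  unfolding coord_def indices_def by (rule cartier_laurents[OF p_pos \<pi>_lin]) auto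

lemma coord_expand: "x \<in> laurents n {..n} \<Longrightarrow> x = (\<Sum>l\<in>indices n. basis_elt l * coord l x ^ p)"
  using cartier_decomposition[OF prime_p char_p finite_B \<pi>_lin \<pi>_expand, of x n]
  by (simp add: indices_def basis_elt_def coord_def sum.cartesian_product case_prod_unfold)

lemma coord_one:
  assumes "l \<in> indices n"
  shows "coord l 1 = (if l = (1, 0) then 1 else 0)"
proof (rule poly_mapping_eqI)
  fix m
  obtain b a where l: "l = (b, a)" "b \<in> B" "a \<in> box n p" using assms by (auto simp: indices_def)
  have eq0: "a + scal p m = 0 \<longleftrightarrow> a = 0 \<and> m = 0"
  proof
    assume eq: "a + scal p m = 0"
    have "coef a i = 0 \<and> coef m i = 0" for i
    proof -
      have "coef a i + int p * coef m i = 0"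
        using arg_cong[OF eq, of "\<lambda>x. coef x i"] by (simp add: lookup_add)
      moreover have "0 \<le> coef a i" "coef a i < int p" using l(3) by (auto simp: box_def)
      moreover have "int p dvd coef a i"
        using \<open>coef a i + int p * coef m i = 0\<close> by (intro dvdI[of _ _ "- coef m i"]) simp
      ultimately have "coef a i = 0" by (metis order_le_less zdvd_not_zless)
      then show ?thesis using \<open>coef a i + int p * coef m i = 0\<close> p_pos by simp
    qed
    then show "a = 0 \<and> m = 0" by (auto intro!: poly_mapping_eqI)
  next
    have "scal p 0 = 0" by (rule poly_mapping_eqI) simp
    then show "a = 0 \<and> m = 0 \<Longrightarrow> a + scal p m = 0" by simp
  qed
  show "coef (coord l 1) m = coef (if l = (1, 0) then 1 else 0) m"
    using l \<pi>_one[OF l(2)] frob_linear_0[OF \<pi>_lin, of b]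
    by (auto simp: coord_def coef_cartier[OF p_pos \<pi>_lin] lookup_one eq0 when_def)
qed

lemma coord_boundaries:
  assumes "l \<in> indices n" "x \<in> boundaries n"
  shows "coord l x \<in> boundaries n"
  using assms(2) unfolding boundaries_def coord_def
proof (rule cartier_supported[OF p_pos \<pi>_lin])
  fix m
  assume h: "(\<forall>i>n. coef (snd l + scal p m) i = 0) \<and> (\<exists>i\<le>n. 0 \<le> coef (snd l + scal p m) i)"
  have a: "snd l \<in> box n p" using assms(1) by (auto simp: indices_def)
  show "(\<forall>i>n. coef m i = 0) \<and> (\<exists>i\<le>n. 0 \<le> coef m i)"
    using h a p_pos add_scal_nonneg[OF a, of m] by (auto simp: box_def lookup_add)
qed

end

locale laurent_hypersurface = field_p_basis p B \<pi>
  for p :: nat and B :: "'k::field set" and \<pi> :: "'k \<Rightarrow> 'k \<Rightarrow> 'k" +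
  fixes n d :: nat and F :: "'k laurent"
  assumes F_polys: "F \<in> polys n" and F_homog: "F \<in> homog n (int d)"
begin

definition gen :: "'k \<times> (nat \<Rightarrow>\<^sub>0 int) \<Rightarrow> 'k laurent" where
  "gen l = coord l (F ^ (p - 1))"

text \<open>
  The smallest ideal whose Frobenius power, generated by the \<open>p\<close>-th powers of its elements, contains
  \<open>F\<^sup>p\<^sup>-\<^sup>1\<close>.
\<close>

definition gens_ideal :: "'k laurent set" where
  "gens_ideal = combos n gen (indices n)"

lemma F_power: "F * F ^ (p - 1) = F ^ p"
  using p_pos by (metis One_nat_def Suc_pred power_Suc)

lemma gen_polys: "l \<in> indices n \<Longrightarrow> gen l \<in> polys n"
  unfolding gen_def using F_polys by (intro coord_laurents) auto

lemma gen_in: "l \<in> indices n \<Longrightarrow> gen l \<in> gens_ideal"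
  unfolding gens_ideal_def by (rule combos_base[OF finite_indices])

lemma gens_ideal_polys: "x \<in> gens_ideal \<Longrightarrow> x \<in> polys n"
  unfolding gens_ideal_def combos_def using gen_polys by (auto intro!: laurents_sum laurents_mult)

lemma power_expand: "F ^ (p - 1) = (\<Sum>l\<in>indices n. basis_elt l * gen l ^ p)"
  unfolding gen_def
  by (rule coord_expand, rule laurents_mono[OF laurents_power[OF F_polys]]) simp

text \<open>
  \<open>F\<^sup>p = F F\<^sup>p\<^sup>-\<^sup>1\<close> lies in the ideal of the \<open>p\<close>-th powers of the generators, and the coordinate at
  \<open>1\<close> takes this down to \<open>F\<close> itself.
\<close>

lemma F_in_ideal: "F \<in> gens_ideal"
proof -
  have "F = F * coord (1, 0) 1" using coord_one[OF unit_index] by simp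
  also have "\<dots> = coord (1, 0) (F ^ p * 1)" by (rule coord_power_mult[symmetric])
  also have "F ^ p * 1 = F * F ^ (p - 1)" unfolding F_power by simp
  also have "\<dots> = (\<Sum>l\<in>indices n. gen l ^ p * (F * basis_elt l))"
    unfolding power_expand by (simp add: sum_distrib_left mult_ac)
  also have "coord (1, 0) \<dots> = (\<Sum>l\<in>indices n. coord (1, 0) (F * basis_elt l) * gen l)"
    unfolding coord_sum coord_power_mult by (simp add: mult.commute)
  also have "\<dots> \<in> gens_ideal"
    unfolding gens_ideal_def
    by (rule combosI, rule coord_laurents[OF unit_index], rule laurents_mult[OF F_polys basis_elt_polys])
  finally show ?thesis .
qed

text \<open>
  A coordinate of \<open>F\<^sup>p\<^sup>-\<^sup>1\<close> is a form \<open>g\<close> with \<open>|a| + p deg g = (p-1)d\<close>, where \<open>x\<^sup>a\<close> is the monomial of its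
  index. As \<open>|a| \<ge> 0\<close>, its degree is less than \<open>d\<close>.
\<close>

lemma gen_degree:
  assumes "d > 0" "l \<in> indices n"
  shows "\<exists>\<delta>. \<delta> \<le> int d - 1 \<and> gen l \<in> homog n \<delta>"
proof (cases "gen l = 0")
  case True
  then show ?thesis using assms(1) by (intro exI[of _ 0]) (auto simp: homog_def)
next
  case False
  have h: "gen l \<in> supported (\<lambda>m. tdeg n (snd l) + int p * tdeg n m = int (p - 1) * int d)"
    unfolding gen_def coord_def by (rule cartier_homog[OF p_pos \<pi>_lin homog_power[OF F_homog]])
  from False obtain m where m: "m \<in> Poly_Mapping.keys (gen l)"
    by (metis ex_in_conv keys_eq_empty)
  then have eq: "tdeg n (snd l) + int p * tdeg n m = int (p - 1) * int d"
    using h by (auto simp: supported_def)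
  have "tdeg n (snd l) \<ge> 0"
    using assms(2) by (intro tdeg_nonneg) (auto simp: indices_def box_def exponents_iff)
  then have "int p * tdeg n m \<le> int (p - 1) * int d" using eq by simp
  also have "\<dots> < int p * int d" using p_pos assms(1) by (intro mult_strict_right_mono) auto
  finally have "tdeg n m < int d" using p_pos by (simp add: mult_less_cancel_left)
  moreover have "gen l \<in> homog n (tdeg n m)"
    unfolding homog_def using h
  proof (rule supported_mono)
    fix m' assume "tdeg n (snd l) + int p * tdeg n m' = int (p - 1) * int d"
    then have "int p * tdeg n m' = int p * tdeg n m" using eq by linarith
    then show "tdeg n m' = tdeg n m" using p_pos by simp
  qed
  ultimately show ?thesis by (intro exI[of _ "tdeg n m"]) simp
qed

lemma ideal_mult: "g \<in> polys n \<Longrightarrow> x \<in> gens_ideal \<Longrightarrow> g * x \<in> gens_ideal"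
  unfolding gens_ideal_def by (rule combos_mult)

text \<open>
  The coordinates of \<open>F\<^sup>p\<^sup>-\<^sup>1 y\<^sup>p\<close> are \<open>g\<^sub>l y\<close>, and both taking coordinates and recovering an element
  from them respect boundaries.
\<close>

lemma frobenius_zero_iff:
  assumes "y \<in> laurents n {..n}"
  shows "F ^ (p - 1) * y ^ p \<in> boundaries n \<longleftrightarrow> (\<forall>x\<in>gens_ideal. x * y \<in> boundaries n)"
proof
  assume "F ^ (p - 1) * y ^ p \<in> boundaries n"
  then have "coord l (y ^ p * F ^ (p - 1)) \<in> boundaries n" if "l \<in> indices n" for l
    using coord_boundaries[OF that] by (simp add: mult.commute)
  then have gen: "gen l * y \<in> boundaries n" if "l \<in> indices n" for l
    using that by (simp add: coord_power_mult gen_def mult.commute)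
  show "\<forall>x\<in>gens_ideal. x * y \<in> boundaries n"
  proof
    fix x assume "x \<in> gens_ideal"
    then obtain a where a: "\<And>l. l \<in> indices n \<Longrightarrow> a l \<in> polys n" "x = (\<Sum>l\<in>indices n. a l * gen l)"
      by (auto simp: gens_ideal_def combos_def)
    have "x * y = (\<Sum>l\<in>indices n. a l * (gen l * y))"
      by (simp add: a(2) sum_distrib_right mult.assoc)
    also have "\<dots> \<in> boundaries n" 
      by (rule boundaries_sum, rule boundaries_mult[OF a(1) gen])
    finally show "x * y \<in> boundaries n" .
  qed
next
  assume h: "\<forall>x\<in>gens_ideal. x * y \<in> boundaries n"
  have "F ^ (p - 1) * y ^ p = (\<Sum>l\<in>indices n. basis_elt l * (gen l * y) ^ p)"
    unfolding power_expand by (simp add: sum_distrib_right mult.assoc power_mult_distrib)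
  also have "\<dots> \<in> boundaries n"
    by (rule boundaries_sum, rule boundaries_mult[OF basis_elt_polys boundaries_power[OF prime_p char_p]])
       (use h gen_in in auto)
  finally show "F ^ (p - 1) * y ^ p \<in> boundaries n" .
qed

text \<open>
  If \<open>y\<close> has a term at an exponent \<open>m < 0\<close>, then multiplication by the monomial \<open>u = (-1, \<dots>, -1) - m\<close>
  moves it to \<open>1/(x\<^sub>0 \<cdots> x\<^sub>n)\<close>, where it cannot be a boundary; and \<open>u\<close> has degree at least \<open>N\<close>.
\<close>

lemma annihilator_boundary:
  assumes "\<And>u. u \<in> exponents n {} \<Longrightarrow> tdeg n u \<ge> N \<Longrightarrow> monomial u 1 \<in> gens_ideal"
    and y: "y \<in> laurents n {..n}" "y \<in> supported (\<lambda>m. tdeg n m \<le> - N - int n - 1)"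
    and ann: "\<And>x. x \<in> gens_ideal \<Longrightarrow> x * y \<in> boundaries n"
  shows "y \<in> boundaries n"
  unfolding boundaries_iff[OF y(1)]
proof (intro allI impI)
  fix m :: "nat \<Rightarrow>\<^sub>0 int"
  assume m: "\<forall>i>n. coef m i = 0" "\<forall>i\<le>n. coef m i < 0"
  show "coef y m = 0"
  proof (cases "tdeg n m \<le> - N - int n - 1")
    case True
    define u where "u = full_exponent n (- 1) - m"
    have u: "u \<in> exponents n {}" "tdeg n u \<ge> N"
      using m True by (auto simp: u_def exponents_iff lookup_minus)
    have "monomial u 1 * y \<in> boundaries n" by (rule ann, rule assms(1)[OF u])
    moreover have "monomial u 1 * y \<in> laurents n {..n}"
      by (rule laurents_mult[OF _ y(1)]) (use exponents_mono[OF u(1)] in simp)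
    moreover have "\<forall>i>n. coef (u + m) i = 0" "\<forall>i\<le>n. coef (u + m) i < 0"
      by (auto simp: u_def)
    ultimately have "coef (monomial u 1 * y) (u + m) = 0"
      using boundaries_iff by blast
    then show ?thesis by (simp add: coef_mono_mult)
  next
    case False
    then show ?thesis using y(2) by (auto simp: supported_iff)
  qed
qed

text \<open>
  The converse half of the duality. A linear form \<open>\<xi>\<close> that vanishes on the ideal but not at \<open>x\<^sup>u\<close> is
  written as \<open>g \<mapsto>\<close> coefficient of \<open>1/(x\<^sub>0 \<cdots> x\<^sub>n)\<close> in \<open>g y\<close>, for \<open>g\<close> of the degree of \<open>x\<^sup>u\<close>; then \<open>y\<close> is
  annihilated by the ideal.
\<close>

lemma annihilator_exists:
  assumes d: "d > 0" and u: "u \<in> exponents n {}" "monomial u 1 \<notin> gens_ideal"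
  obtains y where "y \<in> laurents n {..n}" "y \<in> homog n (- tdeg n u - int n - 1)"
    "\<And>x. x \<in> gens_ideal \<Longrightarrow> x * y \<in> boundaries n" "y \<notin> boundaries n"
proof -
  define scale where "scale c g = monomial (0 :: nat \<Rightarrow>\<^sub>0 int) c * g" for c :: 'k and g
  interpret V: vector_space scale
    by unfold_locales (auto simp: scale_def algebra_simps mult_single single_add simp flip: mult.assoc)
  have "V.subspace gens_ideal"
    unfolding V.subspace_def scale_def gens_ideal_def by (auto intro!: combos_add combos_mult)
  then obtain \<xi> where \<xi>: "\<And>a b. \<xi> (a + b) = \<xi> a + \<xi> b" "\<And>c a. \<xi> (scale c a) = c * \<xi> a"
    "\<xi> (monomial u 1) = 1" "\<And>x. x \<in> gens_ideal \<Longrightarrow> \<xi> x = 0"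
    using functional_separates[OF V.vector_space_axioms, of gens_ideal "monomial u 1"] u(2) by metis
  have \<xi>_monomial: "\<xi> (monomial w c) = c * \<xi> (monomial w 1)" for w c
    using \<xi>(2)[of c "monomial w 1"] by (simp add: scale_def mult_single)
  have \<xi>0: "\<xi> 0 = 0" using \<xi>(2)[of 0 0] by (simp add: scale_def)
  have \<xi>_sum: "\<xi> (sum g J) = (\<Sum>i\<in>J. \<xi> (g i))" for g and J :: "(nat \<Rightarrow>\<^sub>0 int) set"
    by (induction J rule: infinite_finite_induct) (auto simp: \<xi> \<xi>0)
  define T where "T = {w \<in> exponents n {}. tdeg n w = tdeg n u}"
  have T: "finite T"
    using card_monomials_le(1)[of n "nat (tdeg n u)"] tdeg_nonneg[OF u(1)] by (simp add: T_def)
  define e where "e = full_exponent n (- 1)"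
  define y where "y = (\<Sum>w\<in>T. monomial (e - w) (\<xi> (monomial w 1)))"
  have y1: "y \<in> laurents n {..n}"
    unfolding y_def by (intro laurents_sum) (auto simp: exponents_iff T_def e_def lookup_minus)
  have coef_y: "coef y (e - w) = \<xi> (monomial w 1)" if "w \<in> T" for w
    using T that by (simp add: y_def lookup_sum lookup_single when_def sum.delta)
  have "coef y (e - u) = 1" using coef_y[of u] u(1) \<xi>(3) by (simp add: T_def)
  moreover have "\<forall>i>n. coef (e - u) i = 0" "\<forall>i\<le>n. coef (e - u) i < 0"
    using u(1) by (auto simp: e_def lookup_minus exponents_iff intro!: add_strict_mono)
  ultimately have y2: "y \<notin> boundaries n"
    unfolding boundaries_iff[OF y1] by (metis zero_neq_one)
  have "x * y \<in> boundaries n" if x: "x \<in> gens_ideal" for x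
  proof -
    have "x * y \<in> laurents n {..n}"
      using gens_ideal_polys[OF x] y1 laurents_mono[of x n "{}" "{..n}"] by auto
    from boundaries_iff[OF this] show ?thesis
    proof (rule iffD2)
      show "\<forall>m. (\<forall>i>n. coef m i = 0) \<longrightarrow> (\<forall>i\<le>n. coef m i < 0) \<longrightarrow> coef (x * y) m = 0"
    proof (intro allI impI)
      fix m :: "nat \<Rightarrow>\<^sub>0 int"
      assume m: "\<forall>i>n. coef m i = 0" "\<forall>i\<le>n. coef m i < 0"
      \<comment> \<open>A coefficient of \<open>x y\<close> at a negative exponent \<open>m\<close> is the value of \<open>\<xi>\<close> on a form in the ideal,
        namely on a component of the multiple \<open>z\<close> of \<open>x\<close>.\<close>
      define z where "z = monomial (e - m) 1 * x"
      have z: "z \<in> gens_ideal"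
        unfolding z_def using m x
        by (intro ideal_mult) (auto simp: e_def exponents_iff lookup_minus)
      have coef_z: "coef z w = coef x (m - (e - w))" for w
        unfolding z_def coef_mono_mult_laurent by (simp add: algebra_simps)
      have "component n (tdeg n u) z \<in> gens_ideal"
      proof -
        obtain E where "\<And>l. l \<in> indices n \<Longrightarrow> gen l \<in> homog n (E l)"
          using gen_degree[OF d] by metis
        then show ?thesis
          using z unfolding gens_ideal_def by (rule combos_component[rotated])
      qed
      moreover have "component n (tdeg n u) z = (\<Sum>w\<in>T. monomial w (coef z w))"
      proof (rule poly_mapping_eqI)
        fix w
        have "coef z w = 0" if "w \<notin> T" "tdeg n w = tdeg n u"
          using gens_ideal_polys[OF z] that by (auto simp: laurents_def supported_iff T_def)
        then show "coef (component n (tdeg n u) z) w = coef (\<Sum>w\<in>T. monomial w (coef z w)) w"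
          using T by (auto simp: lookup_sum lookup_single when_def sum.delta T_def)
      qed
      ultimately have "\<xi> (\<Sum>w\<in>T. monomial w (coef z w)) = 0" using \<xi>(4) by metis
      then have "(\<Sum>w\<in>T. coef z w * \<xi> (monomial w 1)) = 0"
        by (simp add: \<xi>_sum \<xi>_monomial[of _ "coef z _"])
      moreover have "coef (x * y) m = (\<Sum>w\<in>T. coef z w * \<xi> (monomial w 1))"
      proof -
        have "coef (x * y) m = (\<Sum>w\<in>T. coef (monomial (e - w) (\<xi> (monomial w 1)) * x) m)"
          by (simp add: y_def sum_distrib_left lookup_sum mult.commute)
        also have "\<dots> = (\<Sum>w\<in>T. coef z w * \<xi> (monomial w 1))"
          unfolding coef_mono_mult_laurent coef_z by (simp add: mult.commute)
        finally show ?thesis .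
      qed
      ultimately show "coef (x * y) m = 0" by simp
    qed
    qed
  qed
  moreover have "y \<in> homog n (- tdeg n u - int n - 1)"
    unfolding y_def by (intro homog_sum) (auto simp: T_def e_def)
  ultimately show thesis using that y1 y2 by blast
qed

text \<open>
  The degree bound with \<open>e = d - 1\<close>, where \<open>(n+1)(e-1)+1 = (n+1)(d-1)-n\<close>.
\<close>

lemma ideal_contains_high_degree:
  assumes d: "d > 1" and pow: "\<And>i. i \<le> n \<Longrightarrow> \<exists>M::nat. monomial (monomial i (int M)) 1 \<in> gens_ideal"
    and u: "u \<in> exponents n {}" "tdeg n u \<ge> (int n + 1) * (int d - 1) - int n"
  shows "monomial u 1 \<in> gens_ideal"
proof -
  have "d > 0" using d by simp
  then obtain \<delta> where "\<And>l. l \<in> indices n \<Longrightarrow> \<delta> l \<le> int d - 1 \<and> gen l \<in> homog n (\<delta> l)"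
    using gen_degree by metis
  then have \<delta>: "\<And>l. l \<in> indices n \<Longrightarrow> \<delta> l \<le> int (d - 1)" "\<And>l. l \<in> indices n \<Longrightarrow> gen l \<in> homog n (\<delta> l)"
    using d by (auto simp: of_nat_diff)
  show ?thesis
    unfolding gens_ideal_def
  proof (rule forms_bound[where e = "d - 1" and \<delta> = \<delta>])
    show "(int n + 1) * (int (d - 1) - 1) + 1 \<le> tdeg n u"
      using u(2) d by (simp add: of_nat_diff algebra_simps)
  qed (use prime_p char_p d finite_indices gen_polys \<delta> u(1) pow in \<open>auto simp: gens_ideal_def\<close>)
qed

end

section \<open>Polynomials as Laurent polynomials\<close>

definition int_exponent :: "(nat \<Rightarrow>\<^sub>0 nat) \<Rightarrow> (nat \<Rightarrow>\<^sub>0 int)" where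
  "int_exponent m = Poly_Mapping.map int m"

lemma coef_int_exponent [simp]: "coef (int_exponent m) i = int (coef m i)"
  by (simp add: int_exponent_def coef_map)

lemma inj_int_exponent: "inj int_exponent"
proof (rule injI)
  fix u v assume "int_exponent u = int_exponent v"
  then have "coef (int_exponent u) i = coef (int_exponent v) i" for i by simp
  then show "u = v" by (intro poly_mapping_eqI) simp
qed

lemma int_exponent_add: "int_exponent (u + v) = int_exponent u + int_exponent v"
  by (rule poly_mapping_eqI) (simp add: lookup_add)

lemma int_exponent_0 [simp]: "int_exponent 0 = 0"
  by (rule poly_mapping_eqI) simp

lemma int_exponent_range: "(\<And>i. coef v i \<ge> 0) \<Longrightarrow> v = int_exponent (Poly_Mapping.map nat v)"
  by (rule poly_mapping_eqI) (simp add: coef_map)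

definition to_laurent :: "'k::comm_ring_1 mpoly \<Rightarrow> 'k laurent" where
  "to_laurent g = (\<Sum>m\<in>Poly_Mapping.keys g. monomial (int_exponent m) (coef g m))"

definition of_laurent :: "'k::comm_ring_1 laurent \<Rightarrow> 'k mpoly" where
  "of_laurent g = Poly_Mapping.map_key int_exponent g"

lemma coef_of_laurent [simp]: "coef (of_laurent g) m = coef g (int_exponent m)"
  by (simp add: of_laurent_def map_key.rep_eq inj_int_exponent)

lemma coef_to_laurent [simp]: "coef (to_laurent g) (int_exponent m) = coef g m"
  by (auto simp: to_laurent_def lookup_sum lookup_single when_def sum.delta in_keys_iff
      inj_eq[OF inj_int_exponent] cong: if_cong)

lemma coef_to_laurent_0: "v \<notin> Set.range int_exponent \<Longrightarrow> coef (to_laurent g) v = 0"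
  by (auto simp: to_laurent_def lookup_sum lookup_single when_def intro!: sum.neutral)

lemma of_laurent_add: "of_laurent (g + h) = of_laurent g + of_laurent h"
  by (rule poly_mapping_eqI) (simp add: lookup_add)

lemma to_laurent_add: "to_laurent (g + h) = to_laurent g + to_laurent h"
proof (rule poly_mapping_eqI)
  fix v show "coef (to_laurent (g + h)) v = coef (to_laurent g + to_laurent h) v"
    by (cases "v \<in> Set.range int_exponent") (auto simp: lookup_add coef_to_laurent_0)
qed

lemma of_to_laurent [simp]: "of_laurent (to_laurent g) = g"
  by (rule poly_mapping_eqI) simp

lemma to_laurent_eq_iff [simp]: "to_laurent g = to_laurent h \<longleftrightarrow> g = h"
  by (metis of_to_laurent)

lemma to_of_laurent: "g \<in> polys n \<Longrightarrow> to_laurent (of_laurent g) = g"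
proof (rule poly_mapping_eqI)
  fix v assume g: "g \<in> polys n"
  show "coef (to_laurent (of_laurent g)) v = coef g v"
  proof (cases "v \<in> Set.range int_exponent")
    case False
    then have "\<not> (\<forall>i. coef v i \<ge> 0)" using int_exponent_range by (metis rangeI)
    then have "v \<notin> exponents n {}" by (auto simp: exponents_def)
    then show ?thesis using g False by (simp add: coef_to_laurent_0 laurents_def supported_iff)
  qed auto
qed

lemma to_laurent_0 [simp]: "to_laurent 0 = 0"
  by (simp add: to_laurent_def)

lemma to_laurent_monomial: "to_laurent (monomial m c) = monomial (int_exponent m) c"
  by (cases "c = 0") (auto simp: to_laurent_def)

lemma to_laurent_mult: "to_laurent (g * h) = to_laurent g * to_laurent h"
proof (rule additive_eqI[of "\<lambda>g. to_laurent (g * h)" "\<lambda>g. to_laurent g * to_laurent h"])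
  fix u
  show "to_laurent (monomial u (coef g u) * h) = to_laurent (monomial u (coef g u)) * to_laurent h"
  proof (rule additive_eqI[of "\<lambda>h. to_laurent (monomial u (coef g u) * h)"
        "\<lambda>h. to_laurent (monomial u (coef g u)) * to_laurent h"])
  qed (simp_all add: to_laurent_add to_laurent_monomial distrib_left mult_single int_exponent_add)
qed (simp_all add: to_laurent_add distrib_right)

lemma to_laurent_1 [simp]: "to_laurent 1 = 1"
  using to_laurent_monomial[of 0 1] by simp

lemma to_laurent_power: "to_laurent (g ^ q) = to_laurent g ^ q"
  by (induction q) (auto simp: to_laurent_mult)

lemma to_laurent_uminus: "to_laurent (- g) = - to_laurent g"
  using to_laurent_add[of g "- g"] by (simp add: eq_neg_iff_add_eq_0 add.commute)

lemma to_laurent_diff: "to_laurent (g - h) = to_laurent g - to_laurent h"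
  using to_laurent_add[of g "- h"] by (simp add: to_laurent_uminus)

lemma of_laurent_mult: "g \<in> polys n \<Longrightarrow> h \<in> polys n \<Longrightarrow> of_laurent (g * h) = of_laurent g * of_laurent h"
  by (metis of_to_laurent to_laurent_mult to_of_laurent)

abbreviation (input) Rc :: "nat \<Rightarrow> 'k::comm_ring_1 mpoly set" where
  "Rc n \<equiv> carrier (mpoly_ring n)"

lemma mpoly_ring_simps [simp]:
  "monoid.mult (mpoly_ring n) = (*)" "ring.add (mpoly_ring n) = (+)"
  "one (mpoly_ring n) = 1" "ring.zero (mpoly_ring n) = 0"
  by (simp_all add: mpoly_ring_def ring_on_def)

lemma Rc_iff: "g \<in> Rc n \<longleftrightarrow> to_laurent g \<in> polys n"
proof -
  have "Poly_Mapping.keys (int_exponent m) = Poly_Mapping.keys m" for m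
    by (auto simp: in_keys_iff)
  then have "int_exponent m \<in> exponents n {} \<longleftrightarrow> Poly_Mapping.keys m \<subseteq> {..n}" for m
    by (simp add: exponents_def)
  moreover have "Poly_Mapping.keys (to_laurent g) = int_exponent ` Poly_Mapping.keys g"
  proof (intro Set.set_eqI iffI)
    fix v assume v: "v \<in> Poly_Mapping.keys (to_laurent g)"
    then obtain m where "v = int_exponent m" using coef_to_laurent_0[of v g] by (auto simp: in_keys_iff)
    then show "v \<in> int_exponent ` Poly_Mapping.keys g" using v by (auto simp: in_keys_iff)
  qed (auto simp: in_keys_iff)
  ultimately show ?thesis
    by (auto simp: mpoly_ring_def ring_on_def laurents_def supported_def)
qed

lemma of_laurent_Rc: "g \<in> polys n \<Longrightarrow> of_laurent g \<in> Rc n"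
  by (simp add: Rc_iff to_of_laurent)

lemma Rc_closed [intro]:
  "g \<in> Rc n \<Longrightarrow> h \<in> Rc n \<Longrightarrow> g + h \<in> Rc n" "g \<in> Rc n \<Longrightarrow> h \<in> Rc n \<Longrightarrow> g * h \<in> Rc n"
  "g \<in> Rc n \<Longrightarrow> h \<in> Rc n \<Longrightarrow> g - h \<in> Rc n" "g \<in> Rc n \<Longrightarrow> - g \<in> Rc n" "g \<in> Rc n \<Longrightarrow> g ^ q \<in> Rc n"
  by (auto simp: Rc_iff to_laurent_add to_laurent_mult to_laurent_diff to_laurent_uminus to_laurent_power)

lemma Rc_0_1 [simp]: "0 \<in> Rc n" "1 \<in> Rc n"
  by (simp_all add: Rc_iff)

lemma Rc_sum: "(\<And>i. i \<in> J \<Longrightarrow> x i \<in> Rc n) \<Longrightarrow> sum x J \<in> Rc n"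
  by (induction J rule: infinite_finite_induct) auto

section \<open>Residue classes and local rings of a hypersurface\<close>

lemma mpoly_minus: "g \<in> Rc n \<Longrightarrow> \<ominus>\<^bsub>mpoly_ring n\<^esub> g = - g"
proof -
  interpret R: cring "mpoly_ring n :: 'a mpoly ring" by (rule cring_mpoly_ring)
  assume "g \<in> Rc n"
  then show ?thesis using R.minus_equality[of "- g" g] by auto
qed

context
  fixes n :: nat and f :: "'k::comm_ring_1 mpoly"
  assumes f: "f \<in> Rc n"
begin

lemma residue_hom: "residue_class n f \<in> ring_hom (mpoly_ring n) (hypersurface_ring n f)"
proof -
  interpret R: cring "mpoly_ring n :: 'k mpoly ring" by (rule cring_mpoly_ring)
  interpret I: ideal "PIdl\<^bsub>mpoly_ring n\<^esub> f" "mpoly_ring n" by (rule R.cgenideal_ideal[OF f])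
  show ?thesis
    using I.rcos_ring_hom unfolding hypersurface_ring_def residue_class_def by simp
qed

lemma residue_closed: "g \<in> Rc n \<Longrightarrow> residue_class n f g \<in> carrier (hypersurface_ring n f)"
  by (rule ring_hom_closed[OF residue_hom])

lemma residue_mult: "g \<in> Rc n \<Longrightarrow> h \<in> Rc n \<Longrightarrow>
    residue_class n f g \<otimes>\<^bsub>hypersurface_ring n f\<^esub> residue_class n f h = residue_class n f (g * h)"
  using ring_hom_mult[OF residue_hom, of g h] by simp

lemma residue_add: "g \<in> Rc n \<Longrightarrow> h \<in> Rc n \<Longrightarrow>
    residue_class n f g \<oplus>\<^bsub>hypersurface_ring n f\<^esub> residue_class n f h = residue_class n f (g + h)"
  using ring_hom_add[OF residue_hom, of g h] by simp

lemma residue_one: "\<one>\<^bsub>hypersurface_ring n f\<^esub> = residue_class n f 1"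
  using ring_hom_one[OF residue_hom] by simp

lemma residue_pow: "g \<in> Rc n \<Longrightarrow> residue_class n f g [^]\<^bsub>hypersurface_ring n f\<^esub> (q :: nat) = residue_class n f (g ^ q)"
  by (induction q) (auto simp: residue_one residue_mult Rc_closed mult.commute)

lemma carrier_hypersurface: "carrier (hypersurface_ring n f) = residue_class n f ` Rc n"
  by (auto simp: hypersurface_ring_def residue_class_def FactRing_def A_RCOSETS_def')

lemma residue_eq_iff:
  assumes "g \<in> Rc n" "h \<in> Rc n"
  shows "residue_class n f g = residue_class n f h \<longleftrightarrow> (\<exists>a\<in>Rc n. g - h = a * f)"
proof -
  interpret R: cring "mpoly_ring n :: 'k mpoly ring" by (rule cring_mpoly_ring)
  interpret I: ideal "PIdl\<^bsub>mpoly_ring n\<^esub> f" "mpoly_ring n" by (rule R.cgenideal_ideal[OF f])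
  have "residue_class n f g = residue_class n f h \<longleftrightarrow> g \<ominus>\<^bsub>mpoly_ring n\<^esub> h \<in> PIdl\<^bsub>mpoly_ring n\<^esub> f"
    unfolding residue_class_def 
    using R.quotient_eq_iff_same_a_r_cos[OF I.is_ideal assms] by simp
  also have "g \<ominus>\<^bsub>mpoly_ring n\<^esub> h = g - h"
    using assms by (simp add: a_minus_def mpoly_minus)
  also have "g - h \<in> PIdl\<^bsub>mpoly_ring n\<^esub> f \<longleftrightarrow> (\<exists>a\<in>Rc n. g - h = a * f)"
    unfolding cgenideal_def mpoly_ring_simps by blast
  finally show ?thesis .
qed

lemma residue_zero: "\<zero>\<^bsub>hypersurface_ring n f\<^esub> = residue_class n f 0"
proof -
  interpret R: cring "mpoly_ring n :: 'k mpoly ring" by (rule cring_mpoly_ring)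
  interpret A: cring "hypersurface_ring n f" by (rule cring_hypersurface_ring[OF f])
  show ?thesis
    using ring_hom_zero[OF residue_hom R.ring_axioms A.ring_axioms] by simp
qed

end

section \<open>Split homomorphisms are pure\<close>

text \<open>
  \<open>x \<otimes> b \<mapsto> \<Theta>(b) x\<close> is well defined on \<open>M \<otimes>\<^sub>A B\<close>, because it kills the three kinds of
  relations, and it sends \<open>x \<otimes> 1\<close> back to \<open>x\<close>.
\<close>

lemma split_imp_pure_hom:
  assumes "cring A" "cring B" "h \<in> ring_hom A B"
    and \<Theta>: "\<And>b. b \<in> carrier B \<Longrightarrow> \<Theta> b \<in> carrier A"
      "\<And>b c. b \<in> carrier B \<Longrightarrow> c \<in> carrier B \<Longrightarrow> \<Theta> (b \<oplus>\<^bsub>B\<^esub> c) = \<Theta> b \<oplus>\<^bsub>A\<^esub> \<Theta> c"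
      "\<And>r b. r \<in> carrier A \<Longrightarrow> b \<in> carrier B \<Longrightarrow> \<Theta> (h r \<otimes>\<^bsub>B\<^esub> b) = r \<otimes>\<^bsub>A\<^esub> \<Theta> b"
      "\<Theta> \<one>\<^bsub>B\<^esub> = \<one>\<^bsub>A\<^esub>"
  shows "pure_hom A B h"
  unfolding pure_hom_def
proof (intro allI impI inj_onI)
  fix M :: "('a, 'a list set) module" and x y
  assume M: "module A M" and xy: "x \<in> carrier M" "y \<in> carrier M"
    and eq: "pure_tensor A M B h x \<one>\<^bsub>B\<^esub> = pure_tensor A M B h y \<one>\<^bsub>B\<^esub>"
  interpret M: module A M by fact
  interpret B: cring B by fact
  interpret G: comm_group "add_monoid M" by (rule M.a_comm_group)
  let ?S = "carrier M \<times> carrier B"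
  let ?T = "free_Abelian_group ?S"
  interpret T: comm_group ?T by (rule abelian_free_Abelian_group)
  have "(\<lambda>(x, b). \<Theta> b \<odot>\<^bsub>M\<^esub> x) ` ?S \<subseteq> carrier (add_monoid M)"
    using \<Theta>(1) by auto
  then obtain \<phi> where \<phi>: "\<phi> \<in> hom ?T (add_monoid M)" "\<And>s. s \<in> ?S \<Longrightarrow> \<phi> (frag_of s) = (\<lambda>(x, b). \<Theta> b \<odot>\<^bsub>M\<^esub> x) s"
    using comm_group.free_Abelian_group_universal[OF M.a_comm_group] by metis
  interpret \<phi>: group_hom ?T "add_monoid M" \<phi>
    by (simp add: group_hom_def group_hom_axioms_def \<phi>(1) T.group_axioms comm_group.axioms(2)[OF M.a_comm_group])
  have \<phi>_frag: "\<phi> (frag_of (x, b)) = \<Theta> b \<odot>\<^bsub>M\<^esub> x" if "x \<in> carrier M" "b \<in> carrier B" for x b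
    using \<phi>(2)[of "(x, b)"] that by simp
  have diff_c: "u - v \<in> carrier ?T" if "u \<in> carrier ?T" "v \<in> carrier ?T" for u v :: "'a list set \<times> 'c \<Rightarrow>\<^sub>0 int"
    using that keys_diff[of u v] by (auto simp: carrier_free_Abelian_group_iff)
  have \<phi>_diff: "\<phi> (u - v) = \<phi> u \<ominus>\<^bsub>M\<^esub> \<phi> v" if "u \<in> carrier ?T" "v \<in> carrier ?T" for u v
  proof -
    have c: "\<phi> (u - v) \<in> carrier M" "\<phi> v \<in> carrier M"
      using \<phi>.hom_closed[OF diff_c[OF that]] \<phi>.hom_closed[OF that(2)] by simp_all
    have "\<phi> u = \<phi> (u - v) \<oplus>\<^bsub>M\<^esub> \<phi> v"
      using \<phi>.hom_mult[OF diff_c[OF that] that(2)] by simp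
    then show ?thesis using c by (simp add: a_minus_def M.a_assoc M.r_neg)
  qed
  have frag_c: "frag_of (x, b) \<in> carrier ?T" if "x \<in> carrier M" "b \<in> carrier B" for x b
    using that by simp
  have \<Theta>M: "\<Theta> b \<odot>\<^bsub>M\<^esub> x \<in> carrier M" if "x \<in> carrier M" "b \<in> carrier B" for x b
    using that \<Theta>(1) by simp
  have cancel: "a \<oplus>\<^bsub>M\<^esub> b \<ominus>\<^bsub>M\<^esub> a \<ominus>\<^bsub>M\<^esub> b = \<zero>\<^bsub>M\<^esub>" if "a \<in> carrier M" "b \<in> carrier M" for a b
  proof -
    have "a \<oplus>\<^bsub>M\<^esub> b \<ominus>\<^bsub>M\<^esub> a = b \<oplus>\<^bsub>M\<^esub> a \<ominus>\<^bsub>M\<^esub> a" using that by (simp add: M.a_comm)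
    also have "\<dots> = b" using that by (simp add: a_minus_def M.a_assoc M.r_neg)
    finally show ?thesis using that by (simp add: a_minus_def M.r_neg)
  qed
  have rels: "\<phi> g = \<zero>\<^bsub>M\<^esub>" if "g \<in> tensor_rels A M B h" for g
    using that
  proof (cases rule: tensor_relsE)
    case (1 x y b)
    note fc = frag_c[OF M.a_closed[OF 1(2,3)] 1(4)] frag_c[OF 1(2,4)] frag_c[OF 1(3,4)]
    have "\<phi> g = \<Theta> b \<odot>\<^bsub>M\<^esub> (x \<oplus>\<^bsub>M\<^esub> y) \<ominus>\<^bsub>M\<^esub> \<Theta> b \<odot>\<^bsub>M\<^esub> x \<ominus>\<^bsub>M\<^esub> \<Theta> b \<odot>\<^bsub>M\<^esub> y"
      unfolding 1(1) \<phi>_diff[OF diff_c[OF fc(1,2)] fc(3)] \<phi>_diff[OF fc(1,2)]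
      using 1 by (simp add: \<phi>_frag)
    also have "\<dots> = \<zero>\<^bsub>M\<^esub>"
    proof -
      have "\<Theta> b \<odot>\<^bsub>M\<^esub> (x \<oplus>\<^bsub>M\<^esub> y) = \<Theta> b \<odot>\<^bsub>M\<^esub> x \<oplus>\<^bsub>M\<^esub> \<Theta> b \<odot>\<^bsub>M\<^esub> y"
        using 1 \<Theta>(1) by (simp add: M.smult_r_distr)
      then show ?thesis
        using cancel[OF \<Theta>M[OF 1(2,4)] \<Theta>M[OF 1(3,4)]] by simp
    qed
    finally show ?thesis .
  next
    case (2 x b c)
    note fc = frag_c[OF 2(2) B.a_closed[OF 2(3,4)]] frag_c[OF 2(2,3)] frag_c[OF 2(2,4)]
    have "\<phi> g = \<Theta> (b \<oplus>\<^bsub>B\<^esub> c) \<odot>\<^bsub>M\<^esub> x \<ominus>\<^bsub>M\<^esub> \<Theta> b \<odot>\<^bsub>M\<^esub> x \<ominus>\<^bsub>M\<^esub> \<Theta> c \<odot>\<^bsub>M\<^esub> x"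
      unfolding 2(1) \<phi>_diff[OF diff_c[OF fc(1,2)] fc(3)] \<phi>_diff[OF fc(1,2)]
      using 2 by (simp add: \<phi>_frag)
    also have "\<dots> = \<zero>\<^bsub>M\<^esub>"
    proof -
      have "\<Theta> (b \<oplus>\<^bsub>B\<^esub> c) \<odot>\<^bsub>M\<^esub> x = \<Theta> b \<odot>\<^bsub>M\<^esub> x \<oplus>\<^bsub>M\<^esub> \<Theta> c \<odot>\<^bsub>M\<^esub> x"
        using 2 \<Theta> by (simp add: M.smult_l_distr)
      then show ?thesis
        using cancel[OF \<Theta>M[OF 2(2,3)] \<Theta>M[OF 2(2,4)]] by simp
    qed
    finally show ?thesis .
  next
    case (3 r x b)
    then have hr: "h r \<otimes>\<^bsub>B\<^esub> b \<in> carrier B" using assms(3) ring_hom_closed by fastforce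
    have "\<phi> g = \<Theta> b \<odot>\<^bsub>M\<^esub> (r \<odot>\<^bsub>M\<^esub> x) \<ominus>\<^bsub>M\<^esub> \<Theta> (h r \<otimes>\<^bsub>B\<^esub> b) \<odot>\<^bsub>M\<^esub> x"
      unfolding 3(1) \<phi>_diff[OF frag_c[OF M.smult_closed[OF 3(2,3)] 3(4)] frag_c[OF 3(3) hr]]
      using 3 hr by (simp add: \<phi>_frag)
    also have "\<dots> = \<zero>\<^bsub>M\<^esub>"
    proof -
      have "\<Theta> (h r \<otimes>\<^bsub>B\<^esub> b) \<odot>\<^bsub>M\<^esub> x = \<Theta> b \<odot>\<^bsub>M\<^esub> (r \<odot>\<^bsub>M\<^esub> x)"
        unfolding \<Theta>(3)[OF 3(2,4)] M.R.m_comm[OF 3(2) \<Theta>(1)[OF 3(4)]]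
        by (rule M.smult_assoc1[OF \<Theta>(1)[OF 3(4)] 3(2,3)])
      then show ?thesis using \<Theta>M[of "r \<odot>\<^bsub>M\<^esub> x" b] 3 by (simp add: a_minus_def M.r_neg)
    qed
    finally show ?thesis .
  qed
  have "\<phi> z = \<zero>\<^bsub>M\<^esub>" if "z \<in> tensor_null A M B h" for z
  proof -
    have "subgroup (kernel ?T (add_monoid M) \<phi>) ?T" by (rule \<phi>.subgroup_kernel)
    moreover have "tensor_rels A M B h \<subseteq> kernel ?T (add_monoid M) \<phi>"
    proof
      fix g assume g: "g \<in> tensor_rels A M B h"
      then have "\<phi> g = \<one>\<^bsub>add_monoid M\<^esub>" using rels by simp
      then show "g \<in> kernel ?T (add_monoid M) \<phi>"
        unfolding kernel_def using subsetD[OF tensor_rels_carrier[OF M assms(2,3)] g] by blast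
    qed
    ultimately have "tensor_null A M B h \<subseteq> kernel ?T (add_monoid M) \<phi>"
      unfolding tensor_null_def by (rule T.generate_subgroup_incl[rotated])
    then show ?thesis using that by (auto simp: kernel_def)
  qed
  then have "\<phi> (frag_of (x, \<one>\<^bsub>B\<^esub>) - frag_of (y, \<one>\<^bsub>B\<^esub>)) = \<zero>\<^bsub>M\<^esub>"
    using eq pure_tensor_eq_iff[OF M assms(2,3) xy B.one_closed B.one_closed] by simp
  then have "x \<ominus>\<^bsub>M\<^esub> y = \<zero>\<^bsub>M\<^esub>"
    using \<phi>_diff[OF frag_c[OF xy(1) B.one_closed] frag_c[OF xy(2) B.one_closed]] xy \<Theta>(4)
    by (simp add: \<phi>_frag M.smult_one)
  then have "\<ominus>\<^bsub>M\<^esub> (\<ominus>\<^bsub>M\<^esub> y) = x"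
    using xy by (intro M.minus_equality) (auto simp: a_minus_def)
  then show "x = y" using xy by simp
qed

section \<open>Compatible Cartier maps and F-purity\<close>

context
  fixes n :: nat and f :: "'k::field mpoly" and P :: "'k mpoly set"
  assumes f: "f \<in> Rc n" and P: "primeideal P (mpoly_ring n)"
begin

interpretation P: primeideal P "mpoly_ring n" by (rule P)

private abbreviation (input) A where "A \<equiv> hypersurface_ring n f"
private abbreviation (input) S where "S \<equiv> residue_class n f ` (Rc n - P)"

lemma P_sub: "P \<subseteq> Rc n"
  using P.a_subset by auto

lemma P_add: "x \<in> P \<Longrightarrow> y \<in> P \<Longrightarrow> x + y \<in> P"
  using additive_subgroup.a_closed[OF P.is_additive_subgroup, of x y] by simp

lemma P_mult: "x \<in> P \<Longrightarrow> y \<in> Rc n \<Longrightarrow> y * x \<in> P"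
  using P.I_l_closed by simp

lemma one_notin_P: "1 \<notin> P"
  using P.one_imp_carrier P.I_notcarr by auto

lemma notin_P_mult: "s \<in> Rc n - P \<Longrightarrow> t \<in> Rc n - P \<Longrightarrow> s * t \<in> Rc n - P"
  using P.I_prime[of s t] by (auto intro: Rc_closed)

lemma notin_P_power: "s \<in> Rc n - P \<Longrightarrow> s ^ q \<in> Rc n - P"
proof (induction q)
  case (Suc q)
  then show ?case using notin_P_mult[of s "s ^ q"] by simp
qed (simp add: one_notin_P)

lemma submonoid_S: "submonoid S A"
proof
  show "S \<subseteq> carrier A" using residue_closed[OF f] by auto
  show "\<one>\<^bsub>A\<^esub> \<in> S" using one_notin_P by (auto simp: residue_one[OF f])
  fix x y assume "x \<in> S" "y \<in> S"
  then show "x \<otimes>\<^bsub>A\<^esub> y \<in> S" using notin_P_mult by (auto simp: residue_mult[OF f] intro!: imageI)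
qed

lemma cring_A: "cring A" by (rule cring_hypersurface_ring[OF f])

text \<open>
  Numerator and denominator are polynomials that represent residue classes, so that computations in
  the local ring of the hypersurface become computations with polynomials.
\<close>

definition lfrac :: "'k mpoly \<Rightarrow> 'k mpoly \<Rightarrow> ('k mpoly set \<times> 'k mpoly set) set" where
  "lfrac g s = fraction A S (residue_class n f g) (residue_class n f s)"

private abbreviation (input) AP where "AP \<equiv> hypersurface_local_ring n f P"

lemma AP_def: "AP = localization A S"
  by (simp add: hypersurface_local_ring_def)

lemma cring_AP: "cring AP"
  by (rule cring_hypersurface_local_ring[OF f P])

lemma lfrac_eq_iff:
  assumes "g \<in> Rc n" "h \<in> Rc n" "s \<in> Rc n - P" "t \<in> Rc n - P"
  shows "lfrac g s = lfrac h t \<longleftrightarrow> (\<exists>u\<in>Rc n - P. \<exists>a\<in>Rc n. u * (g * t - h * s) = a * f)"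
proof -
  have "lfrac g s = lfrac h t \<longleftrightarrow> (\<exists>u\<in>Rc n - P. residue_class n f (u * (g * t)) = residue_class n f (u * (h * s)))"
    unfolding lfrac_def
    by (subst fraction_eq_iff[OF cring_A submonoid_S])
       (use assms in \<open>auto simp: residue_closed[OF f] residue_mult[OF f] Rc_closed\<close>)
  also have "\<dots> \<longleftrightarrow> (\<exists>u\<in>Rc n - P. \<exists>a\<in>Rc n. u * (g * t) - u * (h * s) = a * f)"
    using assms by (intro bex_cong refl residue_eq_iff[OF f]) (auto intro!: Rc_closed)
  finally show ?thesis by (simp add: right_diff_distrib)
qed

lemma lfrac_eqI:
  assumes "g \<in> Rc n" "h \<in> Rc n" "s \<in> Rc n - P" "t \<in> Rc n - P" "g * t = h * s"
  shows "lfrac g s = lfrac h t"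
  unfolding lfrac_eq_iff[OF assms(1-4)]
  by (rule bexI[of _ 1], rule bexI[of _ 0]) (use assms(5) one_notin_P in auto)

lemma lfrac_carrier: "g \<in> Rc n \<Longrightarrow> s \<in> Rc n - P \<Longrightarrow> lfrac g s \<in> carrier AP"
  unfolding AP_def carrier_localization[OF cring_A submonoid_S] lfrac_def
  using residue_closed[OF f] by blast

lemma AP_E:
  assumes "U \<in> carrier AP"
  obtains g s where "g \<in> Rc n" "s \<in> Rc n - P" "U = lfrac g s"
  using assms unfolding AP_def carrier_localization[OF cring_A submonoid_S] lfrac_def
    carrier_hypersurface[OF f] by blast

lemma lfrac_mult:
  assumes "g \<in> Rc n" "h \<in> Rc n" "s \<in> Rc n - P" "t \<in> Rc n - P"
  shows "lfrac g s \<otimes>\<^bsub>AP\<^esub> lfrac h t = lfrac (g * h) (s * t)"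
  unfolding AP_def lfrac_def using assms
  by (subst mult_fraction[OF cring_A submonoid_S])
     (auto simp: residue_closed[OF f] residue_mult[OF f])

lemma lfrac_add:
  assumes "g \<in> Rc n" "h \<in> Rc n" "s \<in> Rc n - P" "t \<in> Rc n - P"
  shows "lfrac g s \<oplus>\<^bsub>AP\<^esub> lfrac h t = lfrac (g * t + h * s) (s * t)"
  unfolding AP_def lfrac_def using assms
  by (subst add_fraction[OF cring_A submonoid_S])
     (auto simp: residue_closed[OF f] residue_mult[OF f] residue_add[OF f] Rc_closed)

lemma lfrac_one: "\<one>\<^bsub>AP\<^esub> = lfrac 1 1"
  by (simp add: AP_def lfrac_def localization_def residue_one[OF f])

lemma lfrac_pow:
  assumes "g \<in> Rc n" "s \<in> Rc n - P"
  shows "lfrac g s [^]\<^bsub>AP\<^esub> (q :: nat) = lfrac (g ^ q) (s ^ q)"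
proof (induction q)
  case 0
  then show ?case by (simp add: lfrac_one)
next
  case (Suc q)
  interpret L: cring AP by (rule cring_AP)
  have "lfrac g s [^]\<^bsub>AP\<^esub> Suc q = lfrac (g ^ q) (s ^ q) \<otimes>\<^bsub>AP\<^esub> lfrac g s"
    using Suc by simp
  also have "\<dots> = lfrac (g ^ Suc q) (s ^ Suc q)"
    using assms notin_P_power[OF assms(2)] by (subst lfrac_mult) (auto simp: mult.commute Rc_closed)
  finally show ?case .
qed

lemma frobenius_ring_hom:
  assumes "Factorial_Ring.prime p" "CHAR('k) = p"
  shows "(\<lambda>U. U [^]\<^bsub>AP\<^esub> p) \<in> ring_hom AP AP"
proof -
  interpret L: cring AP by (rule cring_AP)
  have fd: "(x + y) ^ p = x ^ p + y ^ p" for x y :: "'k mpoly"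
    by (rule freshmans_dream) (use assms in simp_all)
  show ?thesis
  proof (rule ring_hom_memI)
    fix U V assume "U \<in> carrier AP" "V \<in> carrier AP"
    then obtain g s h t where *: "g \<in> Rc n" "s \<in> Rc n - P" "U = lfrac g s" "h \<in> Rc n" "t \<in> Rc n - P" "V = lfrac h t"
      by (metis AP_E)
    show "(U \<otimes>\<^bsub>AP\<^esub> V) [^]\<^bsub>AP\<^esub> p = U [^]\<^bsub>AP\<^esub> p \<otimes>\<^bsub>AP\<^esub> V [^]\<^bsub>AP\<^esub> p"
      using \<open>U \<in> carrier AP\<close> \<open>V \<in> carrier AP\<close> by (rule L.nat_pow_distrib)
    have "(U \<oplus>\<^bsub>AP\<^esub> V) [^]\<^bsub>AP\<^esub> p = lfrac ((g * t + h * s) ^ p) ((s * t) ^ p)"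
      unfolding * by (subst lfrac_add, use * in simp_all)
        (rule lfrac_pow, use * notin_P_mult in \<open>auto intro: Rc_closed\<close>)
    also have "\<dots> = lfrac (g ^ p) (s ^ p) \<oplus>\<^bsub>AP\<^esub> lfrac (h ^ p) (t ^ p)"
      using * notin_P_power by (subst lfrac_add) (auto simp: Rc_closed fd power_mult_distrib)
    also have "\<dots> = U [^]\<^bsub>AP\<^esub> p \<oplus>\<^bsub>AP\<^esub> V [^]\<^bsub>AP\<^esub> p"
      using * by (simp add: lfrac_pow)
    finally show "(U \<oplus>\<^bsub>AP\<^esub> V) [^]\<^bsub>AP\<^esub> p = U [^]\<^bsub>AP\<^esub> p \<oplus>\<^bsub>AP\<^esub> V [^]\<^bsub>AP\<^esub> p" .
  qed auto
qed

text \<open>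
  Sending \<open>g/s = g s\<^sup>p\<^sup>-\<^sup>1 / s\<^sup>p\<close> to \<open>\<theta>(g s\<^sup>p\<^sup>-\<^sup>1) / s\<close> extends \<open>\<theta>\<close> to the local ring; it is well defined
  because \<open>\<theta>\<close> maps the multiples of \<open>f\<close> to themselves. Division by the unit \<open>\<theta>(1)\<close> makes it a
  splitting of Frobenius.
\<close>

lemma F_pure_if_compatible_splitting:
  assumes p: "Factorial_Ring.prime p" "CHAR('k) = p"
    and \<theta>: "\<And>x. x \<in> Rc n \<Longrightarrow> \<theta> x \<in> Rc n" "\<And>x y. \<theta> (x + y) = \<theta> x + \<theta> y"
      "\<And>x y. x \<in> Rc n \<Longrightarrow> y \<in> Rc n \<Longrightarrow> \<theta> (x ^ p * y) = x * \<theta> y"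
      "\<And>x. x \<in> Rc n \<Longrightarrow> \<exists>a\<in>Rc n. \<theta> (x * f) = a * f"
    and unit: "\<theta> 1 \<notin> P"
  shows "F_pure p AP"
proof -
  have p0: "p > 0" using p(1) prime_gt_0_nat by blast
  have pow: "x * x ^ (p - 1) = x ^ p" for x :: "'k mpoly"
    using p0 by (metis One_nat_def Suc_pred power_Suc)
  define e where "e = \<theta> 1"
  have e: "e \<in> Rc n - P" using unit \<theta>(1)[of 1] by (simp add: e_def)
  have \<theta>_diff: "\<theta> (x - y) = \<theta> x - \<theta> y" for x y
    using \<theta>(2)[of "x - y" y] by simp
  \<comment> \<open>The splitting is defined through an arbitrary representation of a fraction; that the choice does
    not matter is the fact \<open>\<Theta>\<close> below.\<close>
  define \<Theta> where "\<Theta> U = (SOME V. \<exists>g s. g \<in> Rc n \<and> s \<in> Rc n - P \<and> U = lfrac g s \<and> V = lfrac (\<theta> (g * s ^ (p - 1))) (s * e))" for U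
  have \<Theta>: "\<Theta> (lfrac g s) = lfrac (\<theta> (g * s ^ (p - 1))) (s * e)" if gs: "g \<in> Rc n" "s \<in> Rc n - P" for g s
  proof -
    have "\<exists>V g' s'. g' \<in> Rc n \<and> s' \<in> Rc n - P \<and> lfrac g s = lfrac g' s' \<and> V = lfrac (\<theta> (g' * s' ^ (p - 1))) (s' * e)"
      using gs by blast
    from someI_ex[OF this] obtain h t where ht: "h \<in> Rc n" "t \<in> Rc n - P" "lfrac g s = lfrac h t"
      "\<Theta> (lfrac g s) = lfrac (\<theta> (h * t ^ (p - 1))) (t * e)"
      unfolding \<Theta>_def by blast
    obtain u a where ua: "u \<in> Rc n - P" "a \<in> Rc n" "u * (g * t - h * s) = a * f"
      using ht(3) gs ht(1,2) by (auto simp: lfrac_eq_iff)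
    define c where "c = u ^ (p - 1) * (s * t) ^ (p - 1) * a"
    have c: "c \<in> Rc n" using ua gs ht unfolding c_def by (auto intro!: Rc_closed)
    have "u * (\<theta> (g * s ^ (p - 1)) * t - \<theta> (h * t ^ (p - 1)) * s) = \<theta> (c * f)"
    proof -
      have "\<theta> (c * f) = \<theta> (u ^ p * (t ^ p * (g * s ^ (p - 1)) - s ^ p * (h * t ^ (p - 1))))"
        unfolding c_def mult.assoc ua(3)[symmetric]
        by (rule arg_cong[of _ _ \<theta>]) (simp only: pow[symmetric] power_mult_distrib algebra_simps)
      also have "\<dots> = u * \<theta> (t ^ p * (g * s ^ (p - 1)) - s ^ p * (h * t ^ (p - 1)))"
        using ua gs ht by (intro \<theta>(3)) (auto intro!: Rc_closed)
      also have "\<theta> (t ^ p * (g * s ^ (p - 1)) - s ^ p * (h * t ^ (p - 1))) =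
          t * \<theta> (g * s ^ (p - 1)) - s * \<theta> (h * t ^ (p - 1))"
        unfolding \<theta>_diff using ua gs ht by (subst (1 2) \<theta>(3)) (auto intro!: Rc_closed)
      finally show ?thesis by (simp add: mult.commute)
    qed
    moreover obtain b where b: "b \<in> Rc n" "\<theta> (c * f) = b * f" using \<theta>(4)[OF c] by blast
    ultimately have eq: "u * (\<theta> (g * s ^ (p - 1)) * (t * e) - \<theta> (h * t ^ (p - 1)) * (s * e)) = (e * b) * f"
    proof -
      assume 1: "u * (\<theta> (g * s ^ (p - 1)) * t - \<theta> (h * t ^ (p - 1)) * s) = \<theta> (c * f)" and 2: "\<theta> (c * f) = b * f"
      have "u * (\<theta> (g * s ^ (p - 1)) * (t * e) - \<theta> (h * t ^ (p - 1)) * (s * e)) =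
          e * (u * (\<theta> (g * s ^ (p - 1)) * t - \<theta> (h * t ^ (p - 1)) * s))"
        by (simp only: right_diff_distrib mult_ac)
      then show ?thesis unfolding 1 2 by (simp only: mult.assoc)
    qed
    have "lfrac (\<theta> (g * s ^ (p - 1))) (s * e) = lfrac (\<theta> (h * t ^ (p - 1))) (t * e)"
    proof (subst lfrac_eq_iff)
      show "\<exists>u\<in>Rc n - P. \<exists>a\<in>Rc n. u * (\<theta> (g * s ^ (p - 1)) * (t * e) - \<theta> (h * t ^ (p - 1)) * (s * e)) = a * f"
        by (rule bexI[OF _ ua(1)], rule bexI[of _ "e * b"], rule eq) (use e b in \<open>auto intro!: Rc_closed\<close>)
    qed (use gs ht notin_P_mult[OF gs(2) e] notin_P_mult[OF ht(2) e] in \<open>auto intro!: \<theta>(1) Rc_closed\<close>)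
    then show ?thesis using ht(4) by simp
  qed
  show ?thesis
    unfolding F_pure_def
  proof (rule split_imp_pure_hom[OF cring_AP cring_AP frobenius_ring_hom[OF p], of \<Theta>])
    show "\<Theta> b \<in> carrier AP" if b: "b \<in> carrier AP" for b
    proof -
      obtain g s where gs: "g \<in> Rc n" "s \<in> Rc n - P" "b = lfrac g s" using b by (rule AP_E)
      then show ?thesis
        using notin_P_mult[OF gs(2) e] by (auto simp: \<Theta> intro!: lfrac_carrier \<theta>(1) Rc_closed)
    qed
    show "\<Theta> \<one>\<^bsub>AP\<^esub> = \<one>\<^bsub>AP\<^esub>"
    proof -
      have "\<Theta> (lfrac 1 1) = lfrac (\<theta> (1 * 1 ^ (p - 1))) (1 * e)"
        using one_notin_P by (intro \<Theta>) auto
      also have "\<dots> = lfrac 1 1"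
        by (rule lfrac_eqI) (use e one_notin_P in \<open>auto simp: e_def\<close>)
      finally show ?thesis by (simp add: lfrac_one)
    qed
    fix U V assume "U \<in> carrier AP" "V \<in> carrier AP"
    then obtain g s h t where *: "g \<in> Rc n" "s \<in> Rc n - P" "U = lfrac g s" "h \<in> Rc n" "t \<in> Rc n - P" "V = lfrac h t"
      by (metis AP_E)
    note st1 = notin_P_mult[OF *(2) *(5)]
    note st = st1 notin_P_mult[OF *(2) e] notin_P_mult[OF *(5) e] notin_P_mult[OF st1 e]
    have c: "\<theta> (g * s ^ (p - 1)) \<in> Rc n" "\<theta> (h * t ^ (p - 1)) \<in> Rc n"
      using * by (auto intro!: \<theta>(1) Rc_closed)
    have "\<theta> ((g * t + h * s) * (s * t) ^ (p - 1)) = t * \<theta> (g * s ^ (p - 1)) + s * \<theta> (h * t ^ (p - 1))"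
    proof -
      have "(g * t + h * s) * (s * t) ^ (p - 1) = t ^ p * (g * s ^ (p - 1)) + s ^ p * (h * t ^ (p - 1))"
        by (simp only: pow[symmetric] power_mult_distrib algebra_simps)
      then show ?thesis using * by (simp add: \<theta>(2,3) Rc_closed)
    qed
    then have "\<Theta> (U \<oplus>\<^bsub>AP\<^esub> V) = lfrac (t * \<theta> (g * s ^ (p - 1)) + s * \<theta> (h * t ^ (p - 1))) (s * t * e)"
      using * st by (simp add: lfrac_add \<Theta> Rc_closed)
    also have "\<dots> = lfrac (\<theta> (g * s ^ (p - 1))) (s * e) \<oplus>\<^bsub>AP\<^esub> lfrac (\<theta> (h * t ^ (p - 1))) (t * e)"
    proof (subst lfrac_add)
      show "lfrac (t * \<theta> (g * s ^ (p - 1)) + s * \<theta> (h * t ^ (p - 1))) (s * t * e) =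
          lfrac (\<theta> (g * s ^ (p - 1)) * (t * e) + \<theta> (h * t ^ (p - 1)) * (s * e)) (s * e * (t * e))"
        by (rule lfrac_eqI) (use * st e c notin_P_mult[OF st(2,3)] in \<open>auto simp: algebra_simps intro!: Rc_closed\<close>)
    qed (use c st in auto)
    finally show "\<Theta> (U \<oplus>\<^bsub>AP\<^esub> V) = \<Theta> U \<oplus>\<^bsub>AP\<^esub> \<Theta> V" using * by (simp add: \<Theta>)
    note sp1 = notin_P_power[OF *(2), of p]
    note sp2 = notin_P_mult[OF sp1 *(5)]
    note sp = sp1 sp2 notin_P_mult[OF sp2 e] notin_P_mult[OF *(2) notin_P_mult[OF *(5) e]]
    have "U [^]\<^bsub>AP\<^esub> p \<otimes>\<^bsub>AP\<^esub> V = lfrac (g ^ p * h) (s ^ p * t)"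
      using * sp by (simp add: lfrac_pow lfrac_mult Rc_closed)
    then have "\<Theta> (U [^]\<^bsub>AP\<^esub> p \<otimes>\<^bsub>AP\<^esub> V) = lfrac (\<theta> (g ^ p * h * (s ^ p * t) ^ (p - 1))) (s ^ p * t * e)"
      using * sp by (simp add: \<Theta> Rc_closed)
    also have "g ^ p * h * (s ^ p * t) ^ (p - 1) = (g * s ^ (p - 1)) ^ p * (h * t ^ (p - 1))"
    proof -
      have "(s ^ p) ^ (p - 1) = (s ^ (p - 1)) ^ p" by (metis power_mult mult.commute)
      then show ?thesis by (simp only: power_mult_distrib mult_ac)
    qed
    also have "\<theta> \<dots> = g * s ^ (p - 1) * \<theta> (h * t ^ (p - 1))"
      using * by (intro \<theta>(3)) (auto intro!: Rc_closed)
    also have "lfrac (g * s ^ (p - 1) * \<theta> (h * t ^ (p - 1))) (s ^ p * t * e) =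
        lfrac (g * \<theta> (h * t ^ (p - 1))) (s * (t * e))"
    proof (rule lfrac_eqI)
      show "g * s ^ (p - 1) * \<theta> (h * t ^ (p - 1)) * (s * (t * e)) = g * \<theta> (h * t ^ (p - 1)) * (s ^ p * t * e)"
        unfolding pow[of s, symmetric] by (simp only: mult_ac)
    qed (use * c sp in \<open>auto intro!: Rc_closed\<close>)
    also have "\<dots> = U \<otimes>\<^bsub>AP\<^esub> \<Theta> V"
      using * c st by (simp add: \<Theta> lfrac_mult)
    finally show "\<Theta> (U [^]\<^bsub>AP\<^esub> p \<otimes>\<^bsub>AP\<^esub> V) = U \<otimes>\<^bsub>AP\<^esub> \<Theta> V" .
  qed
qed

end

context
  fixes n :: nat and f :: "'k::field mpoly" and P :: "'k mpoly set"
  assumes f: "f \<in> Rc n" and P: "primeideal P (mpoly_ring n)"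
begin

private abbreviation (input) "lfr \<equiv> lfrac n f P"
private abbreviation (input) "L \<equiv> hypersurface_local_ring n f P"

lemmas P_facts = P_sub[OF f P] P_add[OF f P] P_mult[OF f P] one_notin_P[OF f P] notin_P_mult[OF f P]

text \<open>
  The maximal ideal of the localization of the polynomial ring at \<open>P\<close>, inside the fraction field.
\<close>

private definition PP :: "'k mpoly fract set" where
  "PP = {Fract a s | a s. a \<in> P \<and> s \<in> Rc n - P}"

private definition \<phi> :: "'k mpoly fract" where "\<phi> = Fract f 1"

private definition cls :: "'k mpoly fract \<Rightarrow> 'k mpoly fract set" where
  "cls v = {v + \<phi> * w | w. w \<in> PP}"

text \<open>
  The module \<open>P R\<^sub>P / f P R\<^sub>P\<close> over the local ring of the hypersurface. Its elements are cosets, and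
  a product of a scalar and a coset collects the products of all representatives.
\<close>

private definition MM :: "(('k mpoly set \<times> 'k mpoly set) set, 'k mpoly fract set) module" where
  "MM = \<lparr>carrier = cls ` PP, monoid.mult = undefined, one = undefined, ring.zero = cls 0,
     ring.add = (\<lambda>Z Y. {z + y | z y. z \<in> Z \<and> y \<in> Y}),
     module.smult = (\<lambda>U Z. {Fract g s * z + \<phi> * w | g s z w.
       g \<in> Rc n \<and> s \<in> Rc n - P \<and> U = lfr g s \<and> z \<in> Z \<and> w \<in> PP})\<rparr>"

lemma nonzero_outside_P: "s \<in> Rc n - P \<Longrightarrow> s \<noteq> 0"
proof -
  interpret P: primeideal P "mpoly_ring n" by (rule P)
  have "0 \<in> P" using additive_subgroup.zero_closed[OF P.is_additive_subgroup] by simp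
  then show "s \<in> Rc n - P \<Longrightarrow> s \<noteq> 0" by auto
qed

lemma P_zero: "0 \<in> P"
proof -
  interpret P: primeideal P "mpoly_ring n" by (rule P)
  show ?thesis using additive_subgroup.zero_closed[OF P.is_additive_subgroup] by simp
qed

private lemma PPI: "a \<in> P \<Longrightarrow> s \<in> Rc n - P \<Longrightarrow> Fract a s \<in> PP"
  by (auto simp: PP_def)

private lemma PPE: assumes "v \<in> PP" obtains a s where "a \<in> P" "s \<in> Rc n - P" "v = Fract a s"
  using assms by (auto simp: PP_def)

private lemma PP_0: "0 \<in> PP"
  using PPI[OF P_zero, of 1] P_facts(4) by (simp add: Zero_fract_def)

private lemma PP_add: "v \<in> PP \<Longrightarrow> w \<in> PP \<Longrightarrow> v + w \<in> PP"
proof -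
  assume "v \<in> PP" "w \<in> PP"
  then obtain a s b t where *: "a \<in> P" "s \<in> Rc n - P" "v = Fract a s" "b \<in> P" "t \<in> Rc n - P" "w = Fract b t"
    by (metis PPE)
  have "v + w = Fract (a * t + b * s) (s * t)"
    unfolding * by (rule add_fract) (use * nonzero_outside_P in auto)
  moreover have "a * t + b * s \<in> P"
    using P_facts(2)[OF P_facts(3)[of a t] P_facts(3)[of b s]] * by (simp add: mult.commute)
  ultimately show ?thesis using PPI P_facts(5)[OF *(2,5)] by simp
qed

private lemma PP_smult: "g \<in> Rc n \<Longrightarrow> s \<in> Rc n - P \<Longrightarrow> v \<in> PP \<Longrightarrow> Fract g s * v \<in> PP"
proof -
  assume g: "g \<in> Rc n" and s: "s \<in> Rc n - P" and "v \<in> PP"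
  then obtain a t where v: "a \<in> P" "t \<in> Rc n - P" "v = Fract a t" by (metis PPE)
  show "Fract g s * v \<in> PP"
    using PPI[OF P_facts(3)[OF v(1) g] P_facts(5)[OF s v(2)]] by (simp add: v(3))
qed

private lemma PP_uminus: "v \<in> PP \<Longrightarrow> - v \<in> PP"
proof -
  assume "v \<in> PP"
  then have "Fract (- 1) 1 * v \<in> PP"
    using P_facts(4) by (intro PP_smult Rc_closed(4)) simp_all
  moreover have "Fract (- 1) 1 = (- 1 :: 'k mpoly fract)"
    by (simp add: One_fract_def)
  ultimately show "- v \<in> PP" by simp
qed

private lemma PP_diff: "v \<in> PP \<Longrightarrow> w \<in> PP \<Longrightarrow> v - w \<in> PP"
  using PP_add[of v "- w"] PP_uminus[of w] by simp

private lemma PP_sum: "(\<And>i. i \<in> J \<Longrightarrow> v i \<in> PP) \<Longrightarrow> sum v J \<in> PP"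
  by (induction J rule: infinite_finite_induct) (auto simp: PP_0 PP_add)

private lemma cls_eq_iff: "cls v = cls w \<longleftrightarrow> (\<exists>z\<in>PP. v - w = \<phi> * z)"
proof
  assume "cls v = cls w"
  moreover have "v \<in> cls v" using PP_0 by (force simp: cls_def)
  ultimately show "\<exists>z\<in>PP. v - w = \<phi> * z" by (auto simp: cls_def)
next
  assume "\<exists>z\<in>PP. v - w = \<phi> * z"
  then obtain z where z: "z \<in> PP" "v = w + \<phi> * z" by (auto simp: algebra_simps)
  have "v + \<phi> * x = w + \<phi> * (z + x)" "w + \<phi> * x = v + \<phi> * (x - z)" for x
    by (simp_all add: z algebra_simps)
  then show "cls v = cls w" using z(1) PP_add PP_diff unfolding cls_def by blast
qed

private lemma cls_add: "cls v \<oplus>\<^bsub>MM\<^esub> cls w = cls (v + w)"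
proof -
  have "cls v \<oplus>\<^bsub>MM\<^esub> cls w = {z + y | z y. z \<in> cls v \<and> y \<in> cls w}" by (simp add: MM_def)
  also have "\<dots> = cls (v + w)"
  proof (intro equalityI subsetI)
    fix x assume "x \<in> {z + y | z y. z \<in> cls v \<and> y \<in> cls w}"
    then obtain a b where "x = (v + \<phi> * a) + (w + \<phi> * b)" "a \<in> PP" "b \<in> PP" by (auto simp: cls_def)
    then have "x = (v + w) + \<phi> * (a + b)" "a + b \<in> PP" by (auto simp: algebra_simps PP_add)
    then show "x \<in> cls (v + w)" unfolding cls_def by blast
  next
    fix x assume "x \<in> cls (v + w)"
    then obtain a where "x = (v + \<phi> * a) + (w + \<phi> * 0)" "a \<in> PP" by (auto simp: cls_def algebra_simps)
    then show "x \<in> {z + y | z y. z \<in> cls v \<and> y \<in> cls w}" using PP_0 unfolding cls_def by blast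
  qed
  finally show ?thesis .
qed

private lemma cls_smult:
  assumes gs: "g \<in> Rc n" "s \<in> Rc n - P" and v: "v \<in> PP"
  shows "lfr g s \<odot>\<^bsub>MM\<^esub> cls v = cls (Fract g s * v)"
proof -
  have "lfr g s \<odot>\<^bsub>MM\<^esub> cls v = {Fract h t * z + \<phi> * w | h t z w.
       h \<in> Rc n \<and> t \<in> Rc n - P \<and> lfr g s = lfr h t \<and> z \<in> cls v \<and> w \<in> PP}" by (simp add: MM_def)
  also have "\<dots> = cls (Fract g s * v)"
  proof (intro equalityI subsetI)
    fix x assume "x \<in> {Fract h t * z + \<phi> * w | h t z w.
       h \<in> Rc n \<and> t \<in> Rc n - P \<and> lfr g s = lfr h t \<and> z \<in> cls v \<and> w \<in> PP}"
    then obtain h t y w where ht: "h \<in> Rc n" "t \<in> Rc n - P" "lfr g s = lfr h t" "y \<in> PP" "w \<in> PP"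
      "x = Fract h t * (v + \<phi> * y) + \<phi> * w" by (auto simp: cls_def)
    obtain u a where ua: "u \<in> Rc n - P" "a \<in> Rc n" "u * (h * s - g * t) = a * f"
      using ht(3) lfrac_eq_iff[OF f P ht(1) gs(1) ht(2) gs(2)] by auto
    have nz: "u \<noteq> 0" "s \<noteq> 0" "t \<noteq> 0" using ua gs ht nonzero_outside_P by auto
    have ust: "u * (s * t) \<in> Rc n - P" using P_facts(5) ua gs ht by blast
    have "Fract h t - Fract g s = Fract (h * s - g * t) (t * s)"
      using nz by (simp add: diff_fract)
    also have "\<dots> = \<phi> * Fract a (u * (s * t))"
      unfolding \<phi>_def using nz ua(3) by (simp add: eq_fract mult_ac)
    finally have "x = Fract g s * v + \<phi> * (Fract a (u * (s * t)) * v + Fract h t * y + w)"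
      unfolding ht(6) by (simp add: algebra_simps)
    moreover have "Fract a (u * (s * t)) * v + Fract h t * y + w \<in> PP"
      using PP_smult[OF ua(2) ust v] PP_smult[OF ht(1,2,4)] ht(5) by (intro PP_add)
    ultimately show "x \<in> cls (Fract g s * v)" unfolding cls_def by blast
  next
    fix x assume "x \<in> cls (Fract g s * v)"
    then obtain w where "w \<in> PP" "x = Fract g s * v + \<phi> * w" by (auto simp: cls_def)
    moreover have "v \<in> cls v" using PP_0 by (force simp: cls_def)
    ultimately show "x \<in> {Fract h t * z + \<phi> * w | h t z w.
       h \<in> Rc n \<and> t \<in> Rc n - P \<and> lfr g s = lfr h t \<and> z \<in> cls v \<and> w \<in> PP}"
      using gs by blast
  qed
  finally show ?thesis .
qed

private lemma MM_carrier: "carrier MM = cls ` PP" "\<zero>\<^bsub>MM\<^esub> = cls 0"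
  by (simp_all add: MM_def)

private lemma module_MM: "module L MM"
proof (rule moduleI)
  show "cring L" by (rule cring_AP[OF f P])
  show "abelian_group MM"
  proof (rule abelian_groupI)
    fix x assume "x \<in> carrier MM"
    then obtain v where "v \<in> PP" "x = cls v" by (auto simp: MM_carrier)
    then show "\<exists>y\<in>carrier MM. y \<oplus>\<^bsub>MM\<^esub> x = \<zero>\<^bsub>MM\<^esub>"
      by (intro bexI[of _ "cls (- v)"]) (auto simp: MM_carrier cls_add PP_uminus)
  qed (auto simp: MM_carrier cls_add PP_add PP_0 add_ac)
next
  fix U x assume "U \<in> carrier L" "x \<in> carrier MM"
  then show "U \<odot>\<^bsub>MM\<^esub> x \<in> carrier MM"
    by (auto elim!: AP_E[OF f P] simp: MM_carrier cls_smult PP_smult)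
next
  fix U V x assume UVx: "U \<in> carrier L" "V \<in> carrier L" "x \<in> carrier MM"
  obtain g s where gs: "g \<in> Rc n" "s \<in> Rc n - P" "U = lfr g s" using AP_E[OF f P UVx(1)] .
  obtain h t where ht: "h \<in> Rc n" "t \<in> Rc n - P" "V = lfr h t" using AP_E[OF f P UVx(2)] .
  obtain v where v: "v \<in> PP" "x = cls v" using UVx(3) by (auto simp: MM_carrier)
  note * = gs ht v
  have nz: "s \<noteq> 0" "t \<noteq> 0" using * nonzero_outside_P by auto
  have st: "s * t \<in> Rc n - P" using * P_facts(5) by blast
  show "(U \<oplus>\<^bsub>L\<^esub> V) \<odot>\<^bsub>MM\<^esub> x = U \<odot>\<^bsub>MM\<^esub> x \<oplus>\<^bsub>MM\<^esub> V \<odot>\<^bsub>MM\<^esub> x"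
  proof -
    have "(U \<oplus>\<^bsub>L\<^esub> V) \<odot>\<^bsub>MM\<^esub> x = cls (Fract (g * t + h * s) (s * t) * v)"
      unfolding * lfrac_add[OF f P *(1,4,2,5)] using * st by (intro cls_smult) (auto intro!: Rc_closed)
    also have "Fract (g * t + h * s) (s * t) = Fract g s + Fract h t" using nz by simp
    finally show ?thesis using * by (simp add: cls_smult cls_add distrib_right)
  qed
  show "(U \<otimes>\<^bsub>L\<^esub> V) \<odot>\<^bsub>MM\<^esub> x = U \<odot>\<^bsub>MM\<^esub> (V \<odot>\<^bsub>MM\<^esub> x)"
  proof -
    have "(U \<otimes>\<^bsub>L\<^esub> V) \<odot>\<^bsub>MM\<^esub> x = cls (Fract (g * h) (s * t) * v)"
      unfolding * lfrac_mult[OF f P *(1,4,2,5)] using * st by (intro cls_smult) (auto intro!: Rc_closed)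
    also have "Fract (g * h) (s * t) = Fract g s * Fract h t" by simp
    finally show ?thesis using * PP_smult by (simp add: cls_smult mult.assoc del: mult_fract)
  qed
next
  fix U x y assume "U \<in> carrier L" "x \<in> carrier MM" "y \<in> carrier MM"
  then show "U \<odot>\<^bsub>MM\<^esub> (x \<oplus>\<^bsub>MM\<^esub> y) = U \<odot>\<^bsub>MM\<^esub> x \<oplus>\<^bsub>MM\<^esub> U \<odot>\<^bsub>MM\<^esub> y"
    by (auto elim!: AP_E[OF f P] simp: MM_carrier cls_smult cls_add PP_add distrib_left)
next
  fix x assume "x \<in> carrier MM"
  then obtain v where v: "v \<in> PP" "x = cls v" by (auto simp: MM_carrier)
  have "lfr 1 1 \<odot>\<^bsub>MM\<^esub> cls v = cls (Fract 1 1 * v)"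
    by (rule cls_smult) (use P_facts(4) v in auto)
  then show "\<one>\<^bsub>L\<^esub> \<odot>\<^bsub>MM\<^esub> x = x" by (simp add: lfrac_one[OF f P] v One_fract_def[symmetric])
qed

text \<open>
  The class of \<open>f\<close> in \<open>P R\<^sub>P / f P R\<^sub>P\<close> is not zero, but Frobenius kills it. Let \<open>g\<^sub>j \<in> P\<close> be the
  coordinates of \<open>f\<^sup>p\<^sup>-\<^sup>1\<close> and \<open>r\<^sub>j\<^sub>l\<close> those of \<open>f e\<^sub>j\<close>. Comparing coordinates in
  \<open>f\<^sup>p = \<Sum> f e\<^sub>j g\<^sub>j\<^sup>p\<close> gives \<open>\<Sum>\<^sub>j r\<^sub>j\<^sub>l g\<^sub>j = f\<close> for \<open>e\<^sub>l = 1\<close>, and \<open>0\<close> for the other \<open>l\<close>. Hence,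
  in the tensor product with the local ring through Frobenius,
  \<open>f \<otimes> 1 = \<Sum>\<^sub>l \<Sum>\<^sub>j r\<^sub>j\<^sub>l g\<^sub>j \<otimes> e\<^sub>l = \<Sum>\<^sub>j g\<^sub>j \<otimes> (\<Sum>\<^sub>l r\<^sub>j\<^sub>l\<^sup>p e\<^sub>l) = \<Sum>\<^sub>j g\<^sub>j \<otimes> f e\<^sub>j = 0\<close>.
  It is essential that the \<open>g\<^sub>j\<close> are elements of the module, that is, of \<open>P\<close>.
\<close>

lemma not_F_pure_if_coordinates_in_prime:
  fixes \<Lambda> :: "'i set" and e :: "'i \<Rightarrow> 'k mpoly" and c :: "'i \<Rightarrow> 'k mpoly \<Rightarrow> 'k mpoly"
  assumes p: "Factorial_Ring.prime p" "CHAR('k) = p" and f0: "f \<noteq> 0" and fP: "f \<in> P"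
    and \<Lambda>: "finite \<Lambda>" "l0 \<in> \<Lambda>" "e l0 = 1" "\<And>l. l \<in> \<Lambda> \<Longrightarrow> e l \<in> Rc n"
    and c: "\<And>l x. l \<in> \<Lambda> \<Longrightarrow> x \<in> Rc n \<Longrightarrow> c l x \<in> Rc n"
      "\<And>l x y. l \<in> \<Lambda> \<Longrightarrow> c l (x + y) = c l x + c l y"
      "\<And>l x y. l \<in> \<Lambda> \<Longrightarrow> x \<in> Rc n \<Longrightarrow> y \<in> Rc n \<Longrightarrow> c l (x ^ p * y) = x * c l y"
      "\<And>x. x \<in> Rc n \<Longrightarrow> x = (\<Sum>l\<in>\<Lambda>. e l * c l x ^ p)"
      "\<And>l. l \<in> \<Lambda> \<Longrightarrow> c l 1 = (if l = l0 then 1 else 0)"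
    and cP: "\<And>l. l \<in> \<Lambda> \<Longrightarrow> c l (f ^ (p - 1)) \<in> P"
  shows "\<not> F_pure p L"
proof
  assume pure: "F_pure p L"
  let ?F = "\<lambda>U. U [^]\<^bsub>L\<^esub> p"
  interpret L: cring L by (rule cring_AP[OF f P])
  interpret M: module L MM by (rule module_MM)
  have hom: "?F \<in> ring_hom L L" by (rule frobenius_ring_hom[OF f P p])
  let ?N = "tensor_null L MM L ?F"
  let ?G = "free_Abelian_group (carrier MM \<times> carrier L)"
  interpret G: comm_group ?G by (rule abelian_free_Abelian_group)
  have sub: "subgroup ?N ?G"
    unfolding tensor_null_def
    by (rule G.generate_is_subgroup) (rule tensor_rels_carrier[OF module_MM L.is_cring hom])
  have N_c: "x \<in> ?N \<Longrightarrow> x \<in> carrier ?G" for x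
    using subgroup.subset[OF sub] by blast
  have N_0: "0 \<in> ?N" using subgroup.one_closed[OF sub] by simp
  have N_add: "x + y \<in> ?N" if "x \<in> ?N" "y \<in> ?N" for x y
    using subgroup.m_closed[OF sub that] by simp
  have N_uminus: "- x \<in> ?N" if "x \<in> ?N" for x
    using subgroup.m_inv_closed[OF sub that] N_c[OF that] by simp
  have N_diff: "x - y \<in> ?N" if "x \<in> ?N" "y \<in> ?N" for x y
    using N_add[OF that(1) N_uminus[OF that(2)]] by simp
  have N_sum: "sum x J \<in> ?N" if "\<And>i. i \<in> J \<Longrightarrow> x i \<in> ?N" for x and J :: "'i set"
    using that by (induction J rule: infinite_finite_induct) (auto simp: N_0 N_add)
  have N_rel: "x \<in> ?N" if "x \<in> tensor_rels L MM L ?F" for x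
    unfolding tensor_null_def by (rule generate.incl[OF that])
  define \<iota> where "\<iota> x = lfr x 1" for x
  have one: "1 \<in> Rc n - P" using P_facts(4) by simp
  have \<iota>_c: "\<iota> x \<in> carrier L" if "x \<in> Rc n" for x
    unfolding \<iota>_def by (rule lfrac_carrier[OF f P that one])
  have \<iota>_add: "\<iota> (x + y) = \<iota> x \<oplus>\<^bsub>L\<^esub> \<iota> y" if "x \<in> Rc n" "y \<in> Rc n" for x y
    unfolding \<iota>_def using lfrac_add[OF f P that one one] by simp
  \<comment> \<open>\<open>T v x\<close> represents \<open>v \<otimes> x\<close> before division by the relations; equality of tensors is membership of
    a difference in \<open>?N\<close>.\<close>
  define T where "T v x = frag_of (cls v, \<iota> x)" for v x
  have cls_c: "cls v \<in> carrier MM" if "v \<in> PP" for v using that by (simp add: MM_carrier)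
  have T1: "T (v + w) x - T v x - T w x \<in> ?N" if "v \<in> PP" "w \<in> PP" "x \<in> Rc n" for v w x
    using tensor_relsI(1)[OF cls_c[OF that(1)] cls_c[OF that(2)] \<iota>_c[OF that(3)], of L ?F]
    unfolding T_def cls_add by (rule N_rel)
  have T2: "T v (x + y) - T v x - T v y \<in> ?N" if "v \<in> PP" "x \<in> Rc n" "y \<in> Rc n" for v x y
    using tensor_relsI(2)[OF cls_c[OF that(1)] \<iota>_c[OF that(2)] \<iota>_c[OF that(3)], of L ?F]
    unfolding T_def \<iota>_add[OF that(2,3)] by (rule N_rel)
  have T3: "T (Fract r 1 * v) x - T v (r ^ p * x) \<in> ?N" if "r \<in> Rc n" "v \<in> PP" "x \<in> Rc n" for r v x
  proof -
    have "?F (\<iota> r) \<otimes>\<^bsub>L\<^esub> \<iota> x = \<iota> (r ^ p * x)"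
      unfolding \<iota>_def using that one
      by (simp add: lfrac_pow[OF f P that(1) one] lfrac_mult[OF f P _ that(3) one one] Rc_closed)
    moreover have "\<iota> r \<odot>\<^bsub>MM\<^esub> cls v = cls (Fract r 1 * v)"
      unfolding \<iota>_def by (rule cls_smult[OF that(1) one that(2)])
    ultimately show ?thesis
      using tensor_relsI(3)[OF \<iota>_c[OF that(1)] cls_c[OF that(2)] \<iota>_c[OF that(3)], of ?F]
      unfolding T_def by (metis N_rel)
  qed
  have T_0: "T 0 x \<in> ?N" if "x \<in> Rc n" for x
    using N_uminus[OF T1[OF PP_0 PP_0 that]] by simp
  have T_0': "T v 0 \<in> ?N" if "v \<in> PP" for v
    using N_uminus[OF T2[OF that, of 0 0]] by simp
  have T1_sum: "T (sum v J) x - (\<Sum>j\<in>J. T (v j) x) \<in> ?N"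
    if "finite J" "\<And>j. j \<in> J \<Longrightarrow> v j \<in> PP" "x \<in> Rc n" for J :: "'i set" and v x
    using that
  proof (induction J rule: finite_induct)
    case (insert j J)
    have "T (v j + sum v J) x - T (v j) x - T (sum v J) x + (T (sum v J) x - (\<Sum>j\<in>J. T (v j) x)) \<in> ?N"
      using insert by (intro N_add T1 PP_sum) auto
    then show ?case using insert by (simp add: algebra_simps)
  qed (simp add: T_0)
  have T2_sum: "T v (sum x J) - (\<Sum>j\<in>J. T v (x j)) \<in> ?N"
    if "finite J" "\<And>j. j \<in> J \<Longrightarrow> x j \<in> Rc n" "v \<in> PP" for J :: "'i set" and v x
    using that
  proof (induction J rule: finite_induct)
    case (insert j J)
    have "T v (x j + sum x J) - T v (x j) - T v (sum x J) + (T v (sum x J) - (\<Sum>j\<in>J. T v (x j))) \<in> ?N"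
      using insert by (intro N_add T2 Rc_sum) auto
    then show ?case using insert by (simp add: algebra_simps)
  qed (simp add: T_0')
  define g where "g j = c j (f ^ (p - 1))" for j
  define \<gamma> where "\<gamma> j = Fract (g j) 1" for j
  define r where "r j l = c l (f * e j)" for j l
  have fpow: "f * f ^ (p - 1) = f ^ p"
    using prime_gt_0_nat[OF p(1)] by (metis One_nat_def Suc_pred power_Suc)
  have g: "g j \<in> P" "g j \<in> Rc n" "\<gamma> j \<in> PP" if "j \<in> \<Lambda>" for j
    using cP[OF that] P_facts(1) PPI[OF cP[OF that] one] by (auto simp: g_def \<gamma>_def)
  have r: "r j l \<in> Rc n" if "j \<in> \<Lambda>" "l \<in> \<Lambda>" for j l
    unfolding r_def by (rule c(1)[OF that(2) Rc_closed(2)[OF f \<Lambda>(4)[OF that(1)]]])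
  have c_0: "c l 0 = 0" if "l \<in> \<Lambda>" for l using c(3)[OF that Rc_0_1(1) Rc_0_1(1)] by simp
  have c_sum: "c l (sum x J) = (\<Sum>j\<in>J. c l (x j))" if "l \<in> \<Lambda>" for l x and J :: "'i set"
    by (induction J rule: infinite_finite_induct) (auto simp: c(2)[OF that] c_0[OF that])
  have rg: "(\<Sum>j\<in>\<Lambda>. r j l * g j) = (if l = l0 then f else 0)" if l: "l \<in> \<Lambda>" for l
  proof -
    have "(\<Sum>j\<in>\<Lambda>. r j l * g j) = (\<Sum>j\<in>\<Lambda>. c l (g j ^ p * (f * e j)))"
    proof (rule sum.cong[OF refl])
      fix j assume j: "j \<in> \<Lambda>"
      show "r j l * g j = c l (g j ^ p * (f * e j))"
        unfolding c(3)[OF l g(2)[OF j] Rc_closed(2)[OF f \<Lambda>(4)[OF j]]] r_def by (rule mult.commute)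
    qed
    also have "\<dots> = c l (f * (\<Sum>j\<in>\<Lambda>. e j * g j ^ p))"
      by (simp add: c_sum[OF l] sum_distrib_left mult_ac)
    also have "(\<Sum>j\<in>\<Lambda>. e j * g j ^ p) = f ^ (p - 1)"
      unfolding g_def using c(4)[of "f ^ (p - 1)"] f by (simp add: Rc_closed)
    also have "c l (f * f ^ (p - 1)) = f * c l 1"
      unfolding fpow using c(3)[OF l f Rc_0_1(2)] by simp
    finally show ?thesis using c(5)[OF l] by simp
  qed
  have Fadd: "Fract (a + b) 1 = Fract a 1 + Fract b 1" for a b :: "'k mpoly" by simp
  have Fsum: "Fract (sum x J) 1 = (\<Sum>j\<in>J. Fract (x j) 1)" for x :: "'i \<Rightarrow> 'k mpoly" and J
    by (induction J rule: infinite_finite_induct) (simp_all add: Fadd Zero_fract_def del: add_fract)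
  have F\<gamma>: "(\<Sum>j\<in>\<Lambda>. Fract (r j l) 1 * \<gamma> j) = (if l = l0 then \<phi> else 0)" if "l \<in> \<Lambda>" for l
    using Fsum[of "\<lambda>j. r j l * g j" \<Lambda>] rg[OF that] by (simp add: \<gamma>_def \<phi>_def Zero_fract_def split: if_splits)
  have \<phi>PP: "\<phi> \<in> PP" unfolding \<phi>_def by (rule PPI[OF fP one])
  have r\<gamma>: "Fract (r j l) 1 * \<gamma> j \<in> PP" if "j \<in> \<Lambda>" "l \<in> \<Lambda>" for j l
    by (rule PP_smult[OF r[OF that] one g(3)[OF that(1)]])
  have 1: "(\<Sum>l\<in>\<Lambda>. T (\<Sum>j\<in>\<Lambda>. Fract (r j l) 1 * \<gamma> j) (e l)) - T \<phi> 1 \<in> ?N"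
  proof -
    have "(\<Sum>l\<in>\<Lambda>. T (\<Sum>j\<in>\<Lambda>. Fract (r j l) 1 * \<gamma> j) (e l)) =
        (\<Sum>l\<in>\<Lambda>. T (if l = l0 then \<phi> else 0) (e l))"
      by (rule sum.cong) (simp_all only: F\<gamma>)
    also have "\<dots> = T \<phi> 1 + (\<Sum>l\<in>\<Lambda> - {l0}. T 0 (e l))"
      using \<Lambda> by (subst sum.remove[of _ l0]) (auto intro!: sum.cong)
    finally show ?thesis using N_sum[of "\<Lambda> - {l0}" "\<lambda>l. T 0 (e l)"] T_0[OF \<Lambda>(4)] by simp
  qed
  have 2: "(\<Sum>l\<in>\<Lambda>. T (\<Sum>j\<in>\<Lambda>. Fract (r j l) 1 * \<gamma> j) (e l)) -
      (\<Sum>l\<in>\<Lambda>. \<Sum>j\<in>\<Lambda>. T (Fract (r j l) 1 * \<gamma> j) (e l)) \<in> ?N"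
    unfolding sum_subtractf[symmetric]
    by (intro N_sum T1_sum \<Lambda>(1,4) r\<gamma>)
  have 3: "(\<Sum>l\<in>\<Lambda>. \<Sum>j\<in>\<Lambda>. T (Fract (r j l) 1 * \<gamma> j) (e l)) -
      (\<Sum>l\<in>\<Lambda>. \<Sum>j\<in>\<Lambda>. T (\<gamma> j) (r j l ^ p * e l)) \<in> ?N"
    unfolding sum_subtractf[symmetric] by (intro N_sum T3 r g \<Lambda>)
  have "T (\<gamma> j) (\<Sum>l\<in>\<Lambda>. r j l ^ p * e l) - (\<Sum>l\<in>\<Lambda>. T (\<gamma> j) (r j l ^ p * e l)) \<in> ?N" if "j \<in> \<Lambda>" for j
    using \<Lambda> r[OF that] g[OF that] by (intro T2_sum) (auto intro!: Rc_closed)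
  moreover have "T (\<gamma> j) (\<Sum>l\<in>\<Lambda>. r j l ^ p * e l) \<in> ?N" if j: "j \<in> \<Lambda>" for j
  proof -
    have fe: "f * e j \<in> Rc n" using f \<Lambda>(4)[OF j] by (auto intro: Rc_closed)
    have "(\<Sum>l\<in>\<Lambda>. r j l ^ p * e l) = f * e j"
      using c(4)[OF fe] by (simp add: r_def mult.commute)
    moreover have "\<iota> (f * e j) = \<iota> 0"
      unfolding \<iota>_def lfrac_eq_iff[OF f P fe Rc_0_1(1) one one]
      by (rule bexI[OF _ one], rule bexI[of _ "e j"]) (use \<Lambda>(4)[OF j] in \<open>simp_all add: mult.commute\<close>)
    ultimately show ?thesis using T_0'[OF g(3)[OF j]] by (simp add: T_def)
  qed
  ultimately have "(\<Sum>l\<in>\<Lambda>. T (\<gamma> j) (r j l ^ p * e l)) \<in> ?N" if "j \<in> \<Lambda>" for j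
    using N_diff[of "T (\<gamma> j) (\<Sum>l\<in>\<Lambda>. r j l ^ p * e l)"
        "T (\<gamma> j) (\<Sum>l\<in>\<Lambda>. r j l ^ p * e l) - (\<Sum>l\<in>\<Lambda>. T (\<gamma> j) (r j l ^ p * e l))"] that by simp
  then have 4: "(\<Sum>l\<in>\<Lambda>. \<Sum>j\<in>\<Lambda>. T (\<gamma> j) (r j l ^ p * e l)) \<in> ?N"
    by (subst sum.swap) (rule N_sum)
  from N_diff[OF N_add[OF N_add[OF 2 3] 4] 1] have "T \<phi> 1 \<in> ?N" by simp
  then have "T \<phi> 1 - T 0 1 \<in> ?N" using T_0[of 1] by (intro N_diff) auto
  then have "frag_of (cls \<phi>, \<one>\<^bsub>L\<^esub>) - frag_of (cls 0, \<one>\<^bsub>L\<^esub>) \<in> ?N"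
    by (simp add: T_def \<iota>_def lfrac_one[OF f P])
  then have "pure_tensor L MM L ?F (cls \<phi>) \<one>\<^bsub>L\<^esub> = pure_tensor L MM L ?F (cls 0) \<one>\<^bsub>L\<^esub>"
    using pure_tensor_eq_iff[OF module_MM L.is_cring hom cls_c[OF \<phi>PP] cls_c[OF PP_0] L.one_closed L.one_closed] by blast
  then have "cls \<phi> = cls 0"
    using pure_hom_all_modules[OF pure[unfolded F_pure_def] L.is_cring hom module_MM]
      cls_c[OF \<phi>PP] cls_c[OF PP_0] by (simp add: inj_on_def)
  then obtain z where z: "z \<in> PP" "\<phi> = \<phi> * z" by (auto simp: cls_eq_iff)
  moreover have "\<phi> \<noteq> 0" using f0 by (simp add: \<phi>_def Zero_fract_def eq_fract)
  ultimately have "z = 1" by simp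
  then obtain a s where as: "a \<in> P" "s \<in> Rc n - P" "1 = Fract a s" using z(1) PPE by metis
  then have "a = s" using nonzero_outside_P[OF as(2)] by (simp add: One_fract_def eq_fract)
  then show False using as by simp
qed

end

section \<open>Primes of the polynomial ring\<close>

lemma mpoly_idealI:
  fixes K :: "'k::comm_ring_1 mpoly set"
  assumes "K \<subseteq> Rc n" "0 \<in> K" "\<And>x y. x \<in> K \<Longrightarrow> y \<in> K \<Longrightarrow> x + y \<in> K"
    "\<And>x y. x \<in> K \<Longrightarrow> y \<in> Rc n \<Longrightarrow> y * x \<in> K"
  shows "ideal K (mpoly_ring n)"
proof -
  interpret R: cring "mpoly_ring n :: 'k mpoly ring" by (rule cring_mpoly_ring)
  have uminus: "- x \<in> K" if "x \<in> K" for x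
    using assms(4)[OF that, of "- 1"] Rc_closed(4)[OF Rc_0_1(2)] by fastforce
  show ?thesis
  proof (rule idealI[OF R.ring_axioms])
    show "subgroup K (add_monoid (mpoly_ring n))"
    proof (rule subgroup.intro)
      fix x assume x: "x \<in> K"
      have "inv\<^bsub>add_monoid (mpoly_ring n)\<^esub> x = - x"
        using mpoly_minus[of x n] x assms(1) by (auto simp: a_inv_def)
      then show "inv\<^bsub>add_monoid (mpoly_ring n)\<^esub> x \<in> K" using uminus[OF x] by simp
    qed (use assms in auto)
  next
    fix a x :: "'k mpoly" assume "a \<in> K" "x \<in> Rc n"
    then show "x \<otimes>\<^bsub>mpoly_ring n\<^esub> a \<in> K" "a \<otimes>\<^bsub>mpoly_ring n\<^esub> x \<in> K"
      using assms(4)[of a x] by (simp_all add: mult.commute)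
  qed
qed

lemma mpoly_idealD:
  fixes K :: "'k::comm_ring_1 mpoly set"
  assumes "ideal K (mpoly_ring n)"
  shows "K \<subseteq> Rc n" "0 \<in> K" "\<And>x y. x \<in> K \<Longrightarrow> y \<in> K \<Longrightarrow> x + y \<in> K"
    "\<And>x y. x \<in> K \<Longrightarrow> y \<in> Rc n \<Longrightarrow> y * x \<in> K"
proof -
  interpret K: ideal K "mpoly_ring n" by fact
  note S = K.is_additive_subgroup
  show "K \<subseteq> Rc n" by (rule additive_subgroup.a_subset[OF S])
  show "0 \<in> K" using additive_subgroup.zero_closed[OF S] by simp
  show "x + y \<in> K" if "x \<in> K" "y \<in> K" for x y using additive_subgroup.a_closed[OF S that] by simp
  show "y * x \<in> K" if "x \<in> K" "y \<in> Rc n" for x y using K.I_l_closed[OF that] by simp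
qed

text \<open>
  Krull's lemma: an ideal that is maximal among those disjoint from \<open>T\<close> is prime.
\<close>

lemma prime_avoiding:
  fixes J T :: "'k::comm_ring_1 mpoly set"
  assumes J: "ideal J (mpoly_ring n)" and T: "1 \<in> T" "\<And>x y. x \<in> T \<Longrightarrow> y \<in> T \<Longrightarrow> x * y \<in> T"
    and JT: "J \<inter> T = {}"
  obtains P where "primeideal P (mpoly_ring n)" "J \<subseteq> P" "P \<inter> T = {}"
proof -
  let ?A = "{K. ideal K (mpoly_ring n) \<and> J \<subseteq> K \<and> K \<inter> T = {}}"
  have "\<exists>P\<in>?A. \<forall>K\<in>?A. P \<subseteq> K \<longrightarrow> K = P"
  proof (rule subset_Zorn_nonempty)
    show "?A \<noteq> {}" using J JT by blast
    fix C assume C: "C \<noteq> {}" "subset.chain ?A C"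
    have CA: "K \<in> ?A" if "K \<in> C" for K using C(2) that unfolding subset_chain_def by (elim conjE) (rule subsetD)
    have cmp: "K \<subseteq> K' \<or> K' \<subseteq> K" if "K \<in> C" "K' \<in> C" for K K'
      using C(2) that by (simp add: subset_chain_def)
    have "ideal (\<Union>C) (mpoly_ring n)"
    proof (rule mpoly_idealI)
      show "\<Union>C \<subseteq> Rc n" using mpoly_idealD(1) CA by blast
      show "0 \<in> \<Union>C" using C(1) mpoly_idealD(2) CA by blast
      show "y * x \<in> \<Union>C" if "x \<in> \<Union>C" "y \<in> Rc n" for x y
        using mpoly_idealD(4) CA that by blast
      fix x y assume "x \<in> \<Union>C" "y \<in> \<Union>C"
      then obtain K K' where "K \<in> C" "x \<in> K" "K' \<in> C" "y \<in> K'" by blast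
      then obtain K where "K \<in> C" "x \<in> K" "y \<in> K" using cmp by blast
      then show "x + y \<in> \<Union>C" using mpoly_idealD(3) CA by blast
    qed
    then show "\<Union>C \<in> ?A" using CA C(1) by blast
  qed
  then obtain P where P: "ideal P (mpoly_ring n)" "J \<subseteq> P" "P \<inter> T = {}"
    and max: "\<And>K. ideal K (mpoly_ring n) \<Longrightarrow> P \<subseteq> K \<Longrightarrow> K \<inter> T = {} \<Longrightarrow> K = P"
  proof -
    assume "\<exists>P\<in>?A. \<forall>K\<in>?A. P \<subseteq> K \<longrightarrow> K = P"
    then obtain P where P: "P \<in> ?A" "\<forall>K\<in>?A. P \<subseteq> K \<longrightarrow> K = P" by (elim bexE)
    show thesis
    proof (rule that[of P])
      fix K assume K: "ideal K (mpoly_ring n)" "P \<subseteq> K" "K \<inter> T = {}"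
      then have "K \<in> ?A" using P(1) by auto
      then show "K = P" using P(2) K(2) by simp
    qed (use P(1) in auto)
  qed
  note PD = mpoly_idealD[OF P(1)]
  have meets: "\<exists>x\<in>P. \<exists>r\<in>Rc n. x + r * a \<in> T" if a: "a \<in> Rc n" "a \<notin> P" for a
  proof -
    let ?K = "{x + r * a | x r. x \<in> P \<and> r \<in> Rc n}"
    have "ideal ?K (mpoly_ring n)"
    proof (rule mpoly_idealI)
      show "?K \<subseteq> Rc n" using PD(1) a by (auto intro!: Rc_closed)
      show "0 \<in> ?K" using PD(2) by (intro CollectI exI[of _ 0]) simp
      fix x y assume "x \<in> ?K"
      then obtain u r where x: "x = u + r * a" "u \<in> P" "r \<in> Rc n" by blast
      show "x + y \<in> ?K" if "y \<in> ?K"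
      proof -
        obtain v s where y: "y = v + s * a" "v \<in> P" "s \<in> Rc n" using \<open>y \<in> ?K\<close> by blast
        have "x + y = (u + v) + (r + s) * a" by (simp add: x y algebra_simps)
        moreover have "u + v \<in> P" "r + s \<in> Rc n" using x y PD(3) by auto
        ultimately show ?thesis by blast
      qed
      show "y * x \<in> ?K" if "y \<in> Rc n"
      proof -
        have "y * x = y * u + (y * r) * a" by (simp add: x algebra_simps)
        moreover have "y * u \<in> P" "y * r \<in> Rc n" using x that PD(4) by auto
        ultimately show ?thesis by blast
      qed
    qed
    moreover have "P \<subseteq> ?K"
    proof
      fix x assume "x \<in> P"
      then show "x \<in> ?K" by (intro CollectI exI[of _ x] exI[of _ 0]) simp
    qed
    moreover have "a \<in> ?K" using PD(2) by (intro CollectI exI[of _ 0] exI[of _ 1]) simp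
    ultimately have "?K \<inter> T \<noteq> {}" using max a(2) by blast
    then show ?thesis by blast
  qed
  have "primeideal P (mpoly_ring n)"
  proof (rule primeidealI[OF P(1) cring_mpoly_ring])
    show "Rc n \<noteq> P" using P(3) T(1) Rc_0_1(2) by blast
    fix a b assume ab: "a \<in> Rc n" "b \<in> Rc n" "a \<otimes>\<^bsub>mpoly_ring n\<^esub> b \<in> P"
    show "a \<in> P \<or> b \<in> P"
    proof (rule ccontr)
      assume "\<not> ?thesis"
      then obtain x r y s where *: "x \<in> P" "r \<in> Rc n" "x + r * a \<in> T" "y \<in> P" "s \<in> Rc n" "y + s * b \<in> T"
        using meets ab(1,2) by metis
      have "(x + r * a) * (y + s * b) = ((y + s * b) * x + (r * a) * y) + (r * s) * (a * b)"
        by (simp add: algebra_simps)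
      also have "\<dots> \<in> P"
      proof (rule PD(3)[OF PD(3)])
        show "(y + s * b) * x \<in> P" using * ab PD(1) by (intro PD(4)) (auto intro!: Rc_closed)
        show "(r * a) * y \<in> P" using * ab by (intro PD(4)) (auto intro!: Rc_closed)
        have "a * b \<in> P" using ab(3) by simp
        then show "(r * s) * (a * b) \<in> P" by (rule PD(4)[OF _ Rc_closed(2)[OF *(2,5)]])
      qed
      finally show False using T(2)[OF *(3,6)] P(3) by blast
    qed
  qed
  then show thesis using that P by blast
qed

lemma coef_mult_0: "coef (x * y) 0 = coef x 0 * coef y 0" for x y :: "'k::comm_ring_1 mpoly"
proof (rule additive_eqI[of "\<lambda>x. coef (x * y) 0" "\<lambda>x. coef x 0 * coef y 0"])
  have nat0: "u + v = 0 \<longleftrightarrow> u = 0 \<and> v = 0" for u v :: "nat \<Rightarrow>\<^sub>0 nat"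
    by (auto simp: poly_mapping_eq_iff fun_eq_iff lookup_add)
  fix u
  show "coef (monomial u (coef x u) * y) 0 = coef (monomial u (coef x u)) 0 * coef y 0"
    by (rule additive_eqI[of "\<lambda>y. coef (monomial u (coef x u) * y) 0" "\<lambda>y. coef (monomial u (coef x u)) 0 * coef y 0"])
       (auto simp: lookup_add distrib_left mult_single lookup_single when_def nat0)
qed (auto simp: lookup_add distrib_right)

lemma ideal_zero_constant: "ideal {g \<in> Rc n. coef g 0 = (0 :: 'k::comm_ring_1)} (mpoly_ring n)"
proof (rule mpoly_idealI)
  fix x y :: "'k mpoly"
  assume x: "x \<in> {g \<in> Rc n. coef g 0 = 0}"
  show "x + y \<in> {g \<in> Rc n. coef g 0 = 0}" if "y \<in> {g \<in> Rc n. coef g 0 = 0}"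
    using x that Rc_closed(1)[of x n y] by (simp add: lookup_add)
  show "y * x \<in> {g \<in> Rc n. coef g 0 = 0}" if "y \<in> Rc n"
    using x that Rc_closed(2)[of y n x] by (simp add: coef_mult_0)
qed auto

lemma mpoly_var_Rc: "i \<le> n \<Longrightarrow> mpoly_var i \<in> Rc n"
  by (auto simp: mpoly_var_def mpoly_ring_def ring_on_def)

lemma irrelevant_ideal_eq: "irrelevant_ideal n = {g \<in> Rc n. coef g 0 = 0}"
  for n :: nat
proof -
  interpret R: cring "mpoly_ring n :: 'a mpoly ring" by (rule cring_mpoly_ring)
  have vars: "mpoly_var ` {..n} \<subseteq> Rc n" using mpoly_var_Rc by blast
  have id: "ideal (irrelevant_ideal n :: 'a mpoly set) (mpoly_ring n)"
    unfolding irrelevant_ideal_def by (rule R.genideal_ideal[OF vars])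
  note D = mpoly_idealD[OF id]
  have var: "(mpoly_var i :: 'a mpoly) \<in> irrelevant_ideal n" if "i \<le> n" for i
    unfolding irrelevant_ideal_def using subsetD[OF R.genideal_self[OF vars], of "mpoly_var i"] that by simp
  show ?thesis
  proof (rule equalityI)
    have "ideal {g \<in> Rc n. coef g 0 = (0 :: 'a)} (mpoly_ring n)"
      by (rule ideal_zero_constant)
    moreover have "coef (mpoly_var i) 0 = (0 :: 'a)" for i
    proof -
      have "monomial i (1 :: nat) \<noteq> 0" by (metis lookup_single_eq lookup_zero zero_neq_one)
      then show ?thesis by (simp add: mpoly_var_def lookup_single when_def)
    qed
    ultimately show "irrelevant_ideal n \<subseteq> {g \<in> Rc n. coef g 0 = (0 :: 'a)}"
      unfolding irrelevant_ideal_def using vars by (intro R.genideal_minimal) auto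
    show "{g \<in> Rc n. coef g 0 = (0 :: 'a)} \<subseteq> irrelevant_ideal n"
    proof
      fix g :: "'a mpoly" assume g: "g \<in> {g \<in> Rc n. coef g 0 = 0}"
      have sum: "(\<Sum>m\<in>M. h m) \<in> irrelevant_ideal n" if "\<And>m. m \<in> M \<Longrightarrow> h m \<in> irrelevant_ideal n"
        for M and h :: "(nat \<Rightarrow>\<^sub>0 nat) \<Rightarrow> 'a mpoly"
        using that by (induction M rule: infinite_finite_induct) (auto simp: D)
      have "monomial m (coef g m) \<in> irrelevant_ideal n" if m: "m \<in> Poly_Mapping.keys g" for m
      proof -
        have "m \<noteq> 0" using m g by (auto simp: in_keys_iff)
        then obtain i where i: "i \<in> Poly_Mapping.keys m" 
          by (metis ex_in_conv in_keys_iff lookup_zero poly_mapping_eqI)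
        have sub: "Poly_Mapping.keys m \<subseteq> {..n}" using m g by (auto simp: mpoly_ring_def ring_on_def)
        have eq: "m - monomial i 1 + monomial i 1 = m"
          using i by (intro poly_mapping_eqI) (auto simp: lookup_add lookup_minus lookup_single when_def in_keys_iff)
        have "Poly_Mapping.keys (m - monomial i 1) \<subseteq> {..n}"
          using sub by (auto simp: in_keys_iff lookup_minus subset_iff)
        then have "monomial (m - monomial i 1) (coef g m) \<in> Rc n"
          by (auto simp: mpoly_ring_def ring_on_def)
        then have "monomial (m - monomial i 1) (coef g m) * mpoly_var i \<in> irrelevant_ideal n"
          using D(4)[OF var[of i]] i sub by blast
        then show ?thesis using eq by (simp only: mpoly_var_def mult_single mult_1_right)
      qed
      then show "g \<in> irrelevant_ideal n"
        using sum[of "Poly_Mapping.keys g" "\<lambda>m. monomial m (coef g m)"] by (simp flip: poly_expand)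
    qed
  qed
qed

lemma primeideal_irrelevant: "primeideal (irrelevant_ideal n :: 'k::field mpoly set) (mpoly_ring n)"
proof (rule primeidealI)
  show "ideal (irrelevant_ideal n :: 'k mpoly set) (mpoly_ring n)"
    unfolding irrelevant_ideal_eq by (rule ideal_zero_constant)
  show "carrier (mpoly_ring n) \<noteq> (irrelevant_ideal n :: 'k mpoly set)"
  proof
    assume "Rc n = (irrelevant_ideal n :: 'k mpoly set)"
    then have "(1 :: 'k mpoly) \<in> irrelevant_ideal n" using Rc_0_1(2) by blast
    then show False by (simp add: irrelevant_ideal_eq lookup_one)
  qed
qed (auto simp: cring_mpoly_ring irrelevant_ideal_eq coef_mult_0)

section \<open>Fedder's criterion and the punctured spectrum\<close>

lemma tdeg_int_exponent:
  "Poly_Mapping.keys m \<subseteq> {..n} \<Longrightarrow> tdeg n (int_exponent m) = int (monom_degree m)"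
  unfolding tdeg_def monom_degree_def
  by (simp add: sum.mono_neutral_left[of "{..n}" "Poly_Mapping.keys m"] in_keys_iff)

lemma to_laurent_homog: "a \<in> Rc n \<Longrightarrow> homogeneous D a \<Longrightarrow> to_laurent a \<in> homog n D"
  unfolding homog_def supported_iff
proof (intro allI impI)
  fix v assume a: "a \<in> Rc n" "homogeneous D a" and v: "tdeg n v \<noteq> D"
  show "coef (to_laurent a) v = 0"
  proof (rule ccontr)
    assume nz: "coef (to_laurent a) v \<noteq> 0"
    then obtain m where m: "v = int_exponent m" using coef_to_laurent_0[of v a] by auto
    with nz have "m \<in> Poly_Mapping.keys a" by (simp add: in_keys_iff)
    then have "int (monom_degree m) = D" "Poly_Mapping.keys m \<subseteq> {..n}"
      using a by (auto simp: homogeneous_def mpoly_ring_def ring_on_def)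
    then show False using v tdeg_int_exponent m by simp
  qed
qed

locale hypersurface = field_p_basis p B \<pi>
  for p :: nat and B :: "'k::field set" and \<pi> :: "'k \<Rightarrow> 'k \<Rightarrow> 'k" +
  fixes n d :: nat and f :: "'k mpoly"
  assumes f_Rc: "f \<in> Rc n" and f_homogeneous: "homogeneous (int d) f"
begin

sublocale laurent_hypersurface p B \<pi> n d "to_laurent f"
proof
  show "to_laurent f \<in> polys n" using f_Rc by (simp add: Rc_iff)
  show "to_laurent f \<in> homog n (int d)" using f_Rc f_homogeneous by (rule to_laurent_homog)
qed

lemma of_laurent_0 [simp]: "of_laurent 0 = 0"
  by (rule poly_mapping_eqI) simp

text \<open>
  The coordinate maps on the polynomial ring itself.
\<close>

definition mcoord :: "'k \<times> (nat \<Rightarrow>\<^sub>0 int) \<Rightarrow> 'k mpoly \<Rightarrow> 'k mpoly" where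
  "mcoord l x = of_laurent (coord l (to_laurent x))"

lemma mcoord_Rc: "l \<in> indices n \<Longrightarrow> x \<in> Rc n \<Longrightarrow> mcoord l x \<in> Rc n"
  unfolding mcoord_def by (intro of_laurent_Rc coord_laurents) (simp_all add: Rc_iff)

lemma to_laurent_mcoord: "l \<in> indices n \<Longrightarrow> x \<in> Rc n \<Longrightarrow> to_laurent (mcoord l x) = coord l (to_laurent x)"
  unfolding mcoord_def by (intro to_of_laurent coord_laurents) (simp_all add: Rc_iff)

lemma mcoord_add: "mcoord l (x + y) = mcoord l x + mcoord l y"
  by (simp add: mcoord_def to_laurent_add coord_add of_laurent_add)

lemma mcoord_power_mult:
  assumes "l \<in> indices n" "x \<in> Rc n" "y \<in> Rc n"
  shows "mcoord l (x ^ p * y) = x * mcoord l y"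
proof -
  have "to_laurent (mcoord l (x ^ p * y)) = to_laurent (x * mcoord l y)"
    using assms by (simp add: to_laurent_mcoord Rc_closed to_laurent_mult to_laurent_power coord_power_mult)
  then show ?thesis by simp
qed

lemma mcoord_one: "l \<in> indices n \<Longrightarrow> mcoord l 1 = (if l = (1, 0) then 1 else 0)"
proof -
  assume l: "l \<in> indices n"
  have "to_laurent (mcoord l 1) = to_laurent (if l = (1, 0) then 1 else 0)"
    unfolding to_laurent_mcoord[OF l Rc_0_1(2)] to_laurent_1 coord_one[OF l] by simp
  then show ?thesis unfolding to_laurent_eq_iff .
qed

lemma of_laurent_sum: "of_laurent (sum x J) = (\<Sum>i\<in>J. of_laurent (x i))" for x :: "'i \<Rightarrow> 'k laurent"
  by (rule poly_mapping_eqI) (simp add: lookup_sum)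

lemma mcoord_expand:
  assumes "x \<in> Rc n"
  shows "x = (\<Sum>l\<in>indices n. of_laurent (basis_elt l) * mcoord l x ^ p)"
proof -
  have "to_laurent x \<in> laurents n {..n}"
    using assms laurents_mono[of "to_laurent x" n "{}" "{..n}"] by (simp add: Rc_iff)
  from arg_cong[OF coord_expand[OF this], of of_laurent]
  have "x = of_laurent (\<Sum>l\<in>indices n. basis_elt l * coord l (to_laurent x) ^ p)"
    unfolding of_to_laurent .
  also have "\<dots> = (\<Sum>l\<in>indices n. of_laurent (basis_elt l) * mcoord l x ^ p)"
    unfolding of_laurent_sum
  proof (rule sum.cong[OF refl])
    fix l assume l: "l \<in> indices n"
    have "to_laurent (of_laurent (basis_elt l) * mcoord l x ^ p) = basis_elt l * coord l (to_laurent x) ^ p"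
      using l assms by (simp add: to_laurent_mult to_laurent_power to_laurent_mcoord to_of_laurent[OF basis_elt_polys])
    from arg_cong[OF this, of of_laurent]
    show "of_laurent (basis_elt l * coord l (to_laurent x) ^ p) = of_laurent (basis_elt l) * mcoord l x ^ p"
      unfolding of_to_laurent by (rule sym)
  qed
  finally show ?thesis .
qed

definition fedder_ideal :: "'k mpoly set" where
  "fedder_ideal = {x \<in> Rc n. to_laurent x \<in> gens_ideal}"

lemma ideal_fedder: "ideal fedder_ideal (mpoly_ring n)"
proof (rule mpoly_idealI)
  show "y * x \<in> fedder_ideal" if "x \<in> fedder_ideal" "y \<in> Rc n" for x y
    using that ideal_mult by (auto simp: fedder_ideal_def to_laurent_mult Rc_iff)
qed (auto simp: fedder_ideal_def to_laurent_add gens_ideal_def intro: combos_add Rc_closed)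

lemma mcoord_fedder: "l \<in> indices n \<Longrightarrow> mcoord l (f ^ (p - 1)) \<in> fedder_ideal"
  using f_Rc gen_in[of l]
  by (simp add: fedder_ideal_def mcoord_Rc to_laurent_mcoord Rc_closed to_laurent_power gen_def)

lemma fedder_ideal_subset:
  assumes "ideal P (mpoly_ring n)" "\<And>l. l \<in> indices n \<Longrightarrow> mcoord l (f ^ (p - 1)) \<in> P"
  shows "fedder_ideal \<subseteq> P"
proof
  note D = mpoly_idealD[OF assms(1)]
  fix x assume x: "x \<in> fedder_ideal"
  then obtain a where a: "\<And>l. l \<in> indices n \<Longrightarrow> a l \<in> polys n" "to_laurent x = (\<Sum>l\<in>indices n. a l * gen l)"
    by (auto simp: fedder_ideal_def gens_ideal_def combos_def)
  have sum: "sum h J \<in> P" if "\<And>i. i \<in> J \<Longrightarrow> h i \<in> P" for h and J :: "('k \<times> (nat \<Rightarrow>\<^sub>0 int)) set"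
    using that by (induction J rule: infinite_finite_induct) (auto simp: D)
  have "x = (\<Sum>l\<in>indices n. of_laurent (a l * gen l))"
    using arg_cong[OF a(2), of of_laurent] unfolding of_laurent_sum of_to_laurent .
  also have "\<dots> \<in> P"
  proof (rule sum)
    fix l assume l: "l \<in> indices n"
    have "of_laurent (gen l) = mcoord l (f ^ (p - 1))" by (simp add: gen_def mcoord_def to_laurent_power)
    then show "of_laurent (a l * gen l) \<in> P"
      using D(4)[OF assms(2)[OF l] of_laurent_Rc[OF a(1)[OF l]]]
      by (simp add: of_laurent_mult[OF a(1)[OF l] gen_polys[OF l]])
  qed
  finally show "x \<in> P" .
qed

text \<open>
  Fedder's criterion. For a coordinate of \<open>f\<^sup>p\<^sup>-\<^sup>1\<close> outside \<open>P\<close>, the map \<open>\<theta>(x) = (f\<^sup>p\<^sup>-\<^sup>1 x)\<^sub>l\<close>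
  satisfies \<open>\<theta>(f x) = f x\<^sub>l\<close> and so is compatible with \<open>f\<close>.
\<close>

lemma fedder:
  assumes P: "primeideal P (mpoly_ring n)" and f0: "f \<noteq> 0"
  shows "F_pure p (hypersurface_local_ring n f P) \<longleftrightarrow> \<not> fedder_ideal \<subseteq> P"
proof
  interpret P: primeideal P "mpoly_ring n" by (rule P)
  assume "\<not> fedder_ideal \<subseteq> P"
  then obtain l where l: "l \<in> indices n" "mcoord l (f ^ (p - 1)) \<notin> P"
    using fedder_ideal_subset[OF P.is_ideal] by blast
  have fpow: "f ^ (p - 1) * (x * f) = f ^ p * x" for x
  proof -
    have "f * f ^ (p - 1) = f ^ p" using p_pos by (metis One_nat_def Suc_pred power_Suc)
    then show ?thesis by (metis (no_types) mult.left_commute mult.commute)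
  qed
  show "F_pure p (hypersurface_local_ring n f P)"
  proof (rule F_pure_if_compatible_splitting[OF f_Rc P prime_p char_p, of "\<lambda>x. mcoord l (f ^ (p - 1) * x)"])
    show "mcoord l (f ^ (p - 1) * x) \<in> Rc n" if "x \<in> Rc n" for x
      using that l f_Rc by (intro mcoord_Rc) auto
    show "mcoord l (f ^ (p - 1) * (x + y)) = mcoord l (f ^ (p - 1) * x) + mcoord l (f ^ (p - 1) * y)" for x y
      by (simp add: distrib_left mcoord_add)
    show "mcoord l (f ^ (p - 1) * (x ^ p * y)) = x * mcoord l (f ^ (p - 1) * y)" if "x \<in> Rc n" "y \<in> Rc n" for x y
    proof -
      have "f ^ (p - 1) * (x ^ p * y) = x ^ p * (f ^ (p - 1) * y)" by (rule mult.left_commute)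
      then show ?thesis
        using mcoord_power_mult[OF l(1) that(1) Rc_closed(2)[OF Rc_closed(5)[OF f_Rc] that(2)], of "p - 1"] by (simp only:)
    qed
    show "\<exists>a\<in>Rc n. mcoord l (f ^ (p - 1) * (x * f)) = a * f" if "x \<in> Rc n" for x
      unfolding fpow mcoord_power_mult[OF l(1) f_Rc that] using mcoord_Rc[OF l(1) that] by (auto simp: mult.commute)
    show "mcoord l (f ^ (p - 1) * 1) \<notin> P" using l(2) by simp
  qed
next
  assume pure: "F_pure p (hypersurface_local_ring n f P)"
  show "\<not> fedder_ideal \<subseteq> P"
  proof
    assume sub: "fedder_ideal \<subseteq> P"
    have "f \<in> fedder_ideal" using F_in_ideal f_Rc by (simp add: fedder_ideal_def)
    then have fP: "f \<in> P" using sub by blast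
    have "\<not> F_pure p (hypersurface_local_ring n f P)"
    proof (rule not_F_pure_if_coordinates_in_prime[OF f_Rc P prime_p char_p f0 fP finite_indices unit_index])
      show "of_laurent (basis_elt (1, 0)) = (1 :: 'k mpoly)"
        using of_to_laurent[of "1 :: 'k mpoly"] by (simp add: basis_elt_def)
      show "of_laurent (basis_elt l) \<in> Rc n" if "l \<in> indices n" for l
        by (rule of_laurent_Rc[OF basis_elt_polys[OF that]])
      show "mcoord l (f ^ (p - 1)) \<in> P" if "l \<in> indices n" for l
        using mcoord_fedder[OF that] sub by blast
    qed (erule (1) mcoord_Rc, rule mcoord_add, erule (2) mcoord_power_mult, erule mcoord_expand, erule mcoord_one)
    then show False using pure by blast
  qed
qed

text \<open>
  The polynomial ring itself is F-pure, by the coordinate map at \<open>1\<close>. Fedder's criterion does not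
  cover this case: \<open>0\<close> to the power \<open>p - 1\<close> generates the zero ideal.
\<close>

lemma F_pure_zero:
  assumes P: "primeideal P (mpoly_ring n)" and f0: "f = 0"
  shows "F_pure p (hypersurface_local_ring n f P)"
  by (rule F_pure_if_compatible_splitting[OF f_Rc P prime_p char_p, of "mcoord (1, 0)"])
     (use mcoord_Rc[OF unit_index] mcoord_add mcoord_power_mult[OF unit_index] mcoord_one[OF unit_index]
        one_notin_P[OF f_Rc P] f0 in \<open>auto simp: mcoord_def coord_def cartier_0[OF p_pos \<pi>_lin] intro!: bexI[of _ 0]\<close>)

lemma to_laurent_var_power: "to_laurent (mpoly_var i ^ M) = monomial (monomial i (int M)) 1"
proof -
  have "scal M (monomial i 1) = monomial i (int M)"
    by (rule poly_mapping_eqI) (simp add: lookup_single when_def)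
  moreover have "int_exponent (monomial i 1) = monomial i 1"
    by (rule poly_mapping_eqI) (simp add: lookup_single when_def)
  ultimately show ?thesis
    by (simp add: to_laurent_power mpoly_var_def to_laurent_monomial power_laurent_mono)
qed

text \<open>
  If some variable had no power in the ideal, there would be a prime containing the ideal and
  disjoint from the products of powers of that variable with polynomials of nonzero constant term.
  Such a prime is strictly smaller than the irrelevant ideal and is not an F-pure point. The ideal is
  disjoint from these products since, being generated by forms, it would otherwise contain the
  component \<open>c x\<^sub>i\<^sup>M\<close> of \<open>x\<^sub>i\<^sup>M s\<close>, where \<open>c\<close> is the constant term of \<open>s\<close>.
  
  The ideal lies in the irrelevant ideal, so it has no nonzero form of degree at most \<open>0\<close>. As it
  contains \<open>f\<close> and has generators of degree less than \<open>d\<close>, this excludes \<open>d \<le> 1\<close>.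
\<close>

lemma isolated_iff:
  assumes not_pure: "\<not> F_pure p (hypersurface_local_ring n f (irrelevant_ideal n))"
  shows "f \<noteq> 0" "d > 1"
    "isolated_non_F_pure_point p n f \<longleftrightarrow>
      (\<forall>u\<in>exponents n {}. tdeg n u \<ge> (int n + 1) * (int d - 1) - int n \<longrightarrow> monomial u 1 \<in> gens_ideal)"
proof -
  show f0: "f \<noteq> 0" using F_pure_zero[OF primeideal_irrelevant] not_pure by blast
  have sub: "fedder_ideal \<subseteq> irrelevant_ideal n"
    using fedder[OF primeideal_irrelevant f0] not_pure by blast
  have coef0: "coef x 0 = 0" if "x \<in> gens_ideal" for x
  proof -
    have "of_laurent x \<in> fedder_ideal"
      using that gens_ideal_polys[OF that] by (simp add: fedder_ideal_def of_laurent_Rc to_of_laurent)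
    then show ?thesis using sub by (auto simp: irrelevant_ideal_eq)
  qed
  have exp0: "m = 0" if "m \<in> exponents n {}" "tdeg n m \<le> 0" for m
  proof -
    have s: "sum (coef m) {..n} = 0"
      using that(2) tdeg_nonneg[OF that(1)] unfolding tdeg_def by simp
    have nn: "0 \<le> coef m i" if "i \<in> {..n}" for i
      using \<open>m \<in> exponents n {}\<close> that by (simp add: exponents_iff)
    have zero: "coef m i = 0" if "i \<le> n" for i
      using iffD1[OF sum_nonneg_eq_0_iff[OF finite_atMost nn] s] that by (simp only: atMost_iff)
    show ?thesis
    proof (rule poly_mapping_eqI)
      fix i show "coef m i = coef 0 i"
      proof (cases "i \<le> n")
        case True
        then show ?thesis using zero by simp
      next
        case False
        then show ?thesis using \<open>m \<in> exponents n {}\<close> unfolding exponents_iff by simp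
      qed
    qed
  qed
  have low_zero: "x = 0" if "x \<in> gens_ideal" "x \<in> homog n \<delta>" "\<delta> \<le> 0" for x \<delta>
  proof (rule poly_mapping_eqI)
    fix m
    show "coef x m = coef 0 m"
    proof (cases "m \<in> exponents n {} \<and> tdeg n m = \<delta>")
      case True
      then have "m = 0" using exp0[of m] that(3) by simp
      then show ?thesis using coef0[OF that(1)] by simp
    next
      case False
      then show ?thesis
        using that(2) gens_ideal_polys[OF that(1)] by (auto simp: homog_def laurents_def supported_iff)
    qed
  qed
  have F0: "to_laurent f \<noteq> 0" using f0 by (metis to_laurent_0 to_laurent_eq_iff)
  show d: "d > 1"
  proof (rule ccontr)
    assume "\<not> d > 1"
    then consider "d = 0" | "d = 1" by linarith
    then show False
    proof cases
      case 1
      then show ?thesis using low_zero[OF F_in_ideal F_homog] F0 by simp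
    next
      case 2
      have "gen l = 0" if l: "l \<in> indices n" for l
        using gen_degree[OF _ l] low_zero[OF gen_in[OF l]] 2 by fastforce
      then have "x = 0" if "x \<in> gens_ideal" for x
        using that by (auto simp: gens_ideal_def combos_def)
      then show ?thesis using F_in_ideal F0 by blast
    qed
  qed
  show "isolated_non_F_pure_point p n f \<longleftrightarrow>
      (\<forall>u\<in>exponents n {}. tdeg n u \<ge> (int n + 1) * (int d - 1) - int n \<longrightarrow> monomial u 1 \<in> gens_ideal)"
  proof
    assume iso: "isolated_non_F_pure_point p n f"
    have "\<exists>M::nat. monomial (monomial i (int M)) 1 \<in> gens_ideal" if i: "i \<le> n" for i
    proof (rule ccontr)
      assume none: "\<not> ?thesis"
      define T :: "'k mpoly set" where "T = {mpoly_var i ^ M * s | M s. s \<in> Rc n \<and> s \<notin> irrelevant_ideal n}"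
      have T_mem: "mpoly_var i ^ M * s \<in> T" if "s \<in> Rc n" "coef s 0 \<noteq> 0" for M s
        using that by (auto simp: T_def irrelevant_ideal_eq)
      have "fedder_ideal \<inter> T = {}"
      proof (rule ccontr)
        assume "fedder_ideal \<inter> T \<noteq> {}"
        then obtain M s where s: "s \<in> Rc n" "coef s 0 \<noteq> 0" "mpoly_var i ^ M * s \<in> fedder_ideal"
          by (auto simp: T_def irrelevant_ideal_eq)
        let ?x = "monomial (monomial i (int M)) (1 :: 'k)"
        obtain E where E: "\<And>l. l \<in> indices n \<Longrightarrow> gen l \<in> homog n (E l)"
          using gen_degree d by (metis order_less_trans zero_less_one)
        have "?x * to_laurent s \<in> gens_ideal"
          using s(3) by (simp add: fedder_ideal_def to_laurent_mult to_laurent_var_power)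
        then have "component n (int M) (to_laurent s * ?x) \<in> gens_ideal"
          unfolding gens_ideal_def mult.commute[of ?x] by (rule combos_component[OF _ E])
        moreover have "?x \<in> homog n (int M)"
          using i by (simp add: tdeg_def lookup_single when_def)
        ultimately have "component n 0 (to_laurent s) * ?x \<in> gens_ideal"
          using component_mult[of ?x n "int M" "int M" "to_laurent s"] by simp
        moreover have "component n 0 (to_laurent s) = monomial 0 (coef s 0)"
        proof (rule poly_mapping_eqI)
          fix m
          have "to_laurent s \<in> polys n" using s(1) by (simp add: Rc_iff)
          moreover have "coef (to_laurent s) 0 = coef s 0" using coef_to_laurent[of s 0] by simp
          ultimately show "coef (component n 0 (to_laurent s)) m = coef (monomial 0 (coef s 0)) m"
            using exp0[of m]
            by (cases "m = 0"; cases "m \<in> exponents n {}") (auto simp: lookup_single laurents_def supported_iff)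
        qed
        ultimately have "monomial 0 (coef s 0) * ?x \<in> gens_ideal" by simp
        then have "monomial 0 (inverse (coef s 0)) * (monomial 0 (coef s 0) * ?x) \<in> gens_ideal"
          by (rule ideal_mult[rotated]) simp
        moreover have "monomial 0 (inverse (coef s 0)) * (monomial 0 (coef s 0) * ?x) = ?x"
          using s(2) by (simp add: mult_single)
        ultimately have "?x \<in> gens_ideal" by simp
        then show False using none by blast
      qed
      moreover have "1 \<in> T" using T_mem[of 1 0] by (simp add: lookup_one)
      moreover have "x * y \<in> T" if xy: "x \<in> T" "y \<in> T" for x y
      proof -
        obtain M s M' s' where *: "x = mpoly_var i ^ M * s" "s \<in> Rc n" "coef s 0 \<noteq> 0"
          "y = mpoly_var i ^ M' * s'" "s' \<in> Rc n" "coef s' 0 \<noteq> 0"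
          using xy by (auto simp: T_def irrelevant_ideal_eq)
        then have "mpoly_var i ^ (M + M') * (s * s') \<in> T"
          by (intro T_mem) (auto simp: coef_mult_0)
        then show ?thesis by (simp add: * power_add mult_ac)
      qed
      ultimately obtain P where P: "primeideal P (mpoly_ring n)" "fedder_ideal \<subseteq> P" "P \<inter> T = {}"
        using prime_avoiding[OF ideal_fedder] by metis
      interpret P: primeideal P "mpoly_ring n" by (rule P(1))
      have "P \<subseteq> irrelevant_ideal n"
      proof
        fix x assume x: "x \<in> P"
        then have "x \<in> Rc n" using mpoly_idealD(1)[OF P.is_ideal] by blast
        then show "x \<in> irrelevant_ideal n"
          using T_mem[of x 0] x P(3) by (auto simp: irrelevant_ideal_eq)
      qed
      moreover have "mpoly_var i \<in> T" using T_mem[of 1 1] by (simp add: lookup_one)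
      moreover have "mpoly_var i \<in> irrelevant_ideal n"
      proof -
        have "monomial i (1 :: nat) \<noteq> 0" by (metis lookup_single_eq lookup_zero zero_neq_one)
        then show ?thesis using mpoly_var_Rc[OF i]
          by (simp add: irrelevant_ideal_eq mpoly_var_def lookup_single when_def)
      qed
      ultimately have "P \<subset> irrelevant_ideal n" using P(3) by blast
      then have "F_pure p (hypersurface_local_ring n f P)"
        using iso P(1) by (auto simp: isolated_non_F_pure_point_def)
      then show False using fedder[OF P(1) f0] P(2) by blast
    qed
    then show "\<forall>u\<in>exponents n {}. tdeg n u \<ge> (int n + 1) * (int d - 1) - int n \<longrightarrow> monomial u 1 \<in> gens_ideal"
      using ideal_contains_high_degree[OF d] by blast
  next
    assume high: "\<forall>u\<in>exponents n {}. tdeg n u \<ge> (int n + 1) * (int d - 1) - int n \<longrightarrow> monomial u 1 \<in> gens_ideal"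
    have "F_pure p (hypersurface_local_ring n f P)"
      if P: "primeideal P (mpoly_ring n)" "P \<subset> irrelevant_ideal n" for P
    proof (rule ccontr)
      assume "\<not> ?thesis"
      then have IP: "fedder_ideal \<subseteq> P" using fedder[OF P(1) f0] by blast
      interpret P: primeideal P "mpoly_ring n" by (rule P(1))
      have var: "mpoly_var i \<in> P" if i: "i \<le> n" for i
      proof (rule ccontr)
        assume notin: "mpoly_var i \<notin> P"
        define M where "M = nat ((int n + 1) * (int d - 1) - int n)"
        have "monomial (monomial i (int M)) 1 \<in> gens_ideal"
          using high i by (auto simp: exponents_iff lookup_single when_def tdeg_def M_def)
        then have "mpoly_var i ^ M \<in> P"
          using IP mpoly_var_Rc[OF i] by (auto simp: fedder_ideal_def to_laurent_var_power Rc_closed)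
        then show False
          using notin_P_power[OF f_Rc P(1), of "mpoly_var i" M] notin mpoly_var_Rc[OF i] by blast
      qed
      have "irrelevant_ideal n \<subseteq> P"
        unfolding irrelevant_ideal_def
        by (rule P.genideal_minimal[OF P.is_ideal]) (use var in auto)
      then show False using P(2) by blast
    qed
    then show "isolated_non_F_pure_point p n f"
      using not_pure by (auto simp: isolated_non_F_pure_point_def)
  qed
qed

end

section \<open>Laurent polynomials represent the terms of the Cech complex\<close>

lemma of_laurent_homogeneous: "g \<in> polys n \<Longrightarrow> g \<in> homog n D \<Longrightarrow> homogeneous D (of_laurent g)"
  unfolding homogeneous_def
proof
  fix m assume g: "g \<in> polys n" "g \<in> homog n D" and m: "m \<in> Poly_Mapping.keys (of_laurent g)"
  have "Poly_Mapping.keys m \<subseteq> {..n}"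
    using of_laurent_Rc[OF g(1)] m by (auto simp: mpoly_ring_def ring_on_def)
  then have "tdeg n (int_exponent m) = int (monom_degree m)" by (rule tdeg_int_exponent)
  then show "int (monom_degree m) = D"
    using g(2) m by (auto simp: homog_def supported_def in_keys_iff)
qed

definition ind :: "nat set \<Rightarrow> (nat \<Rightarrow>\<^sub>0 int)" where
  "ind S = (\<Sum>i\<in>S. monomial i 1)"

lemma coef_ind: "finite S \<Longrightarrow> coef (ind S) i = (if i \<in> S then 1 else 0)"
  by (simp add: ind_def lookup_sum lookup_single when_def sum.delta)

text \<open>
  The power \<open>x\<^sub>S\<^sup>k\<close> of the product \<open>x\<^sub>S\<close> of the variables with index in \<open>S\<close>; \<open>ind S\<close> is the exponent of
  \<open>x\<^sub>S\<close>.
\<close>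

definition den :: "nat set \<Rightarrow> nat \<Rightarrow> 'k::comm_ring_1 laurent" where
  "den S k = monomial (scal k (ind S)) 1"

definition den_inv :: "nat set \<Rightarrow> nat \<Rightarrow> 'k::comm_ring_1 laurent" where
  "den_inv S k = monomial (- scal k (ind S)) 1"

lemma den_inv: "den S k * den_inv S k = 1" "den_inv S k * den S k = 1"
  by (simp_all add: den_def den_inv_def mult_single)

lemma den_add: "den S (k + l) = den S k * den S l"
proof -
  have "scal (k + l) (ind S) = scal k (ind S) + scal l (ind S)"
    by (rule poly_mapping_eqI) (simp add: lookup_add distrib_right)
  then show ?thesis by (simp add: den_def mult_single)
qed

lemma den_0 [simp]: "den S 0 = 1"
proof -
  have "scal 0 (ind S) = 0" by (rule poly_mapping_eqI) simp
  then show ?thesis by (simp add: den_def)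
qed

lemma inverse_exponent: "S \<subseteq> {..n} \<Longrightarrow> - scal k (ind S) \<in> exponents n S"
proof -
  assume S: "S \<subseteq> {..n}"
  then have "finite S" using finite_subset by blast
  moreover have "i \<notin> S" if "n < i" for i using S that by auto
  ultimately show ?thesis unfolding exponents_iff lookup_uminus coef_scal by (simp add: coef_ind)
qed

lemma den_inv_laurents: "S \<subseteq> {..n} \<Longrightarrow> den_inv S k \<in> laurents n S"
  by (simp add: den_inv_def inverse_exponent)

lemma tdeg_ind: "S \<subseteq> {..n} \<Longrightarrow> tdeg n (ind S) = int (card S)"
proof -
  assume S: "S \<subseteq> {..n}"
  then have fin: "finite S" using finite_subset by blast
  have "(\<Sum>i\<le>n. if i \<in> S then 1 else (0 :: int)) = int (card ({..n} \<inter> S))"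
    by (simp add: sum.If_cases Int_def)
  then show ?thesis using S by (simp add: tdeg_def coef_ind[OF fin] Int_absorb1)
qed

lemma den_homog: "S \<subseteq> {..n} \<Longrightarrow> den S k \<in> homog n (int k * int (card S))"
  by (simp add: den_def tdeg_ind)

lemma den_inv_homog: "S \<subseteq> {..n} \<Longrightarrow> den_inv S k \<in> homog n (- (int k * int (card S)))"
proof -
  assume "S \<subseteq> {..n}"
  then have "tdeg n (- scal k (ind S)) = - (int k * int (card S))"
    using tdeg_diff[of n 0 "scal k (ind S)"] by (simp add: tdeg_ind)
  then show ?thesis by (simp add: den_inv_def)
qed

lemma clear_denominators:
  fixes g :: "'k::comm_ring_1 laurent"
  assumes S: "S \<subseteq> {..n}" and g: "g \<in> laurents n S"
  shows "\<exists>k0. \<forall>k\<ge>k0. den S k * g \<in> polys n"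
proof -
  define k0 where "k0 = (\<Sum>m\<in>Poly_Mapping.keys g. \<Sum>i\<le>n. nat (- coef m i))"
  have fin: "finite S" using S finite_subset by blast
  have "den S k * g \<in> polys n" if k: "k \<ge> k0" for k
    unfolding laurents_def supported_iff den_def
  proof (intro allI impI)
    fix v assume v: "v \<notin> exponents n {}"
    show "coef (monomial (scal k (ind S)) 1 * g) v = 0"
    proof (rule ccontr)
      define m where "m = v - scal k (ind S)"
      assume "coef (monomial (scal k (ind S)) 1 * g) v \<noteq> 0"
      then have m: "m \<in> Poly_Mapping.keys g"
        by (simp add: m_def coef_mono_mult_laurent in_keys_iff)
      then have mS: "m \<in> exponents n S" using g by (simp add: laurents_def supported_def)
      have bound: "- coef m i \<le> int k" if "i \<le> n" for i
      proof -
        have "nat (- coef m i) \<le> (\<Sum>i\<le>n. nat (- coef m i))"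
          using that by (intro member_le_sum) auto
        also have "\<dots> \<le> k0" unfolding k0_def using m by (intro member_le_sum) auto
        finally show ?thesis using k by linarith
      qed
      have "v = m + scal k (ind S)" by (simp add: m_def)
      then have cv: "coef v i = coef m i + int k * coef (ind S) i" for i by (simp add: lookup_add)
      have ind: "coef (ind S) i = (if i \<in> S then 1 else 0)" for i by (rule coef_ind[OF fin])
      have "coef v i = 0" if "n < i" for i
        using that mS S unfolding cv ind exponents_iff by auto
      moreover have "0 \<le> coef v i" if "i \<le> n" for i
        using that mS bound[OF that] unfolding cv ind exponents_iff by auto
      ultimately have "v \<in> exponents n {}" unfolding exponents_iff by blast
      then show False using v by blast
    qed
  qed
  then show ?thesis by blast
qed

context hypersurface
begin

abbreviation (input) "HA \<equiv> hypersurface_ring n f"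
abbreviation (input) "HF \<equiv> to_laurent f"
abbreviation (input) "hx \<equiv> (\<lambda>i. residue_class n f (mpoly_var i))"

definition var_prod :: "nat set \<Rightarrow> 'k mpoly" where
  "var_prod S = (\<Prod>i\<in>S. mpoly_var i)"

lemma cring_HA: "cring HA" by (rule cring_hypersurface_ring[OF f_Rc])

lemma var_prod_Rc: "S \<subseteq> {..n} \<Longrightarrow> var_prod S \<in> Rc n"
proof -
  assume S: "S \<subseteq> {..n}"
  have "finite S" using S finite_subset by blast
  then show ?thesis using S
    by (induction S rule: finite_induct) (auto simp: var_prod_def mpoly_var_Rc)
qed

lemma to_laurent_var_prod: "S \<subseteq> {..n} \<Longrightarrow> to_laurent (var_prod S ^ k) = den S k"
proof -
  assume S: "S \<subseteq> {..n}"
  have fin: "finite S" using S finite_subset by blast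
  have "to_laurent (var_prod S) = monomial (ind S) 1"
    using fin
  proof (induction S rule: finite_induct)
    case (insert i S)
    then show ?case
      using to_laurent_var_power[of i 1, where 'a = 'k]
      by (simp add: var_prod_def ind_def to_laurent_mult mult_single)
  qed (simp add: var_prod_def ind_def)
  then show ?thesis by (simp add: den_def to_laurent_power power_laurent_mono)
qed

lemma cech_elt_eq: "S \<subseteq> {..n} \<Longrightarrow> cech_elt HA hx S = residue_class n f (var_prod S)"
proof -
  interpret A: cring HA by (rule cring_HA)
  assume S: "S \<subseteq> {..n}"
  have fin: "finite S" using S finite_subset by blast
  show ?thesis
    using fin S
  proof (induction S rule: finite_induct)
    case (insert i S)
    have "hx \<in> S \<rightarrow> carrier HA" "hx i \<in> carrier HA"
      using insert.prems by (auto intro!: residue_closed[OF f_Rc] mpoly_var_Rc)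
    then show ?case
      using insert var_prod_Rc[of S] mpoly_var_Rc[of i n, where 'a = 'k]
      by (simp add: cech_elt_def var_prod_def residue_mult[OF f_Rc])
  qed (simp add: cech_elt_def var_prod_def residue_one[OF f_Rc])
qed

lemma cech_elt_pow: "S \<subseteq> {..n} \<Longrightarrow> cech_elt HA hx S [^]\<^bsub>HA\<^esub> (k :: nat) = residue_class n f (var_prod S ^ k)"
  by (simp add: cech_elt_eq residue_pow[OF f_Rc] var_prod_Rc)

abbreviation (input) "pows \<equiv> cech_pows HA hx"

lemma pows_eq: "S \<subseteq> {..n} \<Longrightarrow> pows S = {residue_class n f (var_prod S ^ k) | k. True}"
  by (simp add: cech_pows_def cech_elt_pow)

lemma submonoid_pows: "S \<subseteq> {..n} \<Longrightarrow> submonoid (pows S) HA"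
proof -
  assume S: "S \<subseteq> {..n}"
  show ?thesis
    unfolding pows_eq[OF S]
  proof
    show "{residue_class n f (var_prod S ^ k) |k. True} \<subseteq> carrier HA"
      using var_prod_Rc[OF S] by (auto intro!: residue_closed[OF f_Rc])
    show "\<one>\<^bsub>HA\<^esub> \<in> {residue_class n f (var_prod S ^ k) |k. True}"
      by (auto simp: residue_one[OF f_Rc] intro!: exI[of _ 0])
    fix x y assume "x \<in> {residue_class n f (var_prod S ^ k) |k. True}" "y \<in> {residue_class n f (var_prod S ^ k) |k. True}"
    then obtain k l where "x = residue_class n f (var_prod S ^ k)" "y = residue_class n f (var_prod S ^ l)" by blast
    then have "x \<otimes>\<^bsub>HA\<^esub> y = residue_class n f (var_prod S ^ (k + l))"
      using var_prod_Rc[OF S] by (simp add: residue_mult[OF f_Rc] Rc_closed power_add)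
    then show "x \<otimes>\<^bsub>HA\<^esub> y \<in> {residue_class n f (var_prod S ^ k) |k. True}" by blast
  qed
qed

abbreviation (input) "CS \<equiv> cech_ring HA hx"

text \<open>
  The element \<open>a / x\<^sub>S\<^sup>k\<close> of the localization of \<open>R/fR\<close> at \<open>x\<^sub>S\<close>.
\<close>

definition mfrac :: "nat set \<Rightarrow> 'k mpoly \<Rightarrow> nat \<Rightarrow> ('k mpoly set \<times> 'k mpoly set) set" where
  "mfrac S a k = fraction HA (pows S) (residue_class n f a) (residue_class n f (var_prod S ^ k))"

lemma pow_in_pows: "S \<subseteq> {..n} \<Longrightarrow> residue_class n f (var_prod S ^ k) \<in> pows S"
  by (auto simp: pows_eq)

lemma mfrac_eq_iff:
  assumes S: "S \<subseteq> {..n}" and "a \<in> Rc n" "b \<in> Rc n"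
  shows "mfrac S a k = mfrac S b l \<longleftrightarrow>
    (\<exists>m. \<exists>e\<in>Rc n. var_prod S ^ m * (a * var_prod S ^ l) - var_prod S ^ m * (b * var_prod S ^ k) = e * f)"
proof -
  note V = var_prod_Rc[OF S]
  have "mfrac S a k = mfrac S b l \<longleftrightarrow> (\<exists>m. residue_class n f (var_prod S ^ m * (a * var_prod S ^ l)) =
      residue_class n f (var_prod S ^ m * (b * var_prod S ^ k)))"
  proof -
    have 1: "residue_class n f (var_prod S ^ m) \<otimes>\<^bsub>HA\<^esub> (residue_class n f c \<otimes>\<^bsub>HA\<^esub> residue_class n f (var_prod S ^ j)) =
        residue_class n f (var_prod S ^ m * (c * var_prod S ^ j))" if "c \<in> Rc n" for c m j
      using that V by (simp add: residue_mult[OF f_Rc] Rc_closed)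
    have "mfrac S a k = mfrac S b l \<longleftrightarrow> (\<exists>u\<in>pows S.
        u \<otimes>\<^bsub>HA\<^esub> (residue_class n f a \<otimes>\<^bsub>HA\<^esub> residue_class n f (var_prod S ^ l)) =
        u \<otimes>\<^bsub>HA\<^esub> (residue_class n f b \<otimes>\<^bsub>HA\<^esub> residue_class n f (var_prod S ^ k)))"
      unfolding mfrac_def
      by (rule fraction_eq_iff[OF cring_HA submonoid_pows[OF S] residue_closed[OF f_Rc assms(2)]
            residue_closed[OF f_Rc assms(3)] pow_in_pows[OF S] pow_in_pows[OF S]])
    also have "\<dots> \<longleftrightarrow> (\<exists>m.
        residue_class n f (var_prod S ^ m) \<otimes>\<^bsub>HA\<^esub> (residue_class n f a \<otimes>\<^bsub>HA\<^esub> residue_class n f (var_prod S ^ l)) =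
        residue_class n f (var_prod S ^ m) \<otimes>\<^bsub>HA\<^esub> (residue_class n f b \<otimes>\<^bsub>HA\<^esub> residue_class n f (var_prod S ^ k)))"
      unfolding pows_eq[OF S] by blast
    finally show ?thesis unfolding 1[OF assms(2)] 1[OF assms(3)] .
  qed
  also have "\<dots> \<longleftrightarrow> (\<exists>m. \<exists>e\<in>Rc n. var_prod S ^ m * (a * var_prod S ^ l) - var_prod S ^ m * (b * var_prod S ^ k) = e * f)"
    using assms V by (intro ex_cong1 residue_eq_iff[OF f_Rc]) (auto intro!: Rc_closed)
  finally show ?thesis .
qed

lemma mfrac_mult:
  assumes S: "S \<subseteq> {..n}" and "a \<in> Rc n" "b \<in> Rc n"
  shows "mfrac S a k \<otimes>\<^bsub>CS S\<^esub> mfrac S b l = mfrac S (a * b) (k + l)"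
  unfolding mfrac_def using assms var_prod_Rc[OF S]
  by (subst mult_fraction[OF cring_HA submonoid_pows[OF S]])
     (auto simp: residue_closed[OF f_Rc] residue_mult[OF f_Rc] Rc_closed pow_in_pows power_add)

lemma mfrac_add:
  assumes S: "S \<subseteq> {..n}" and "a \<in> Rc n" "b \<in> Rc n"
  shows "mfrac S a k \<oplus>\<^bsub>CS S\<^esub> mfrac S b l = mfrac S (a * var_prod S ^ l + b * var_prod S ^ k) (k + l)"
  unfolding mfrac_def using assms var_prod_Rc[OF S]
  by (subst add_fraction[OF cring_HA submonoid_pows[OF S]])
     (auto simp: residue_closed[OF f_Rc] residue_mult[OF f_Rc] residue_add[OF f_Rc] Rc_closed pow_in_pows power_add)

lemma cech_frac_eq: "S \<subseteq> {..n} \<Longrightarrow> cech_frac HA hx S (residue_class n f a) k = mfrac S a k"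
  by (simp add: mfrac_def cech_elt_pow)

lemma carrier_CS: "S \<subseteq> {..n} \<Longrightarrow> carrier (CS S) = {mfrac S a k | a k. a \<in> Rc n}"
  unfolding carrier_localization[OF cring_HA submonoid_pows] mfrac_def
  by (auto simp: carrier_hypersurface[OF f_Rc] pows_eq)

lemma cring_CS: "S \<subseteq> {..n} \<Longrightarrow> cring (CS S)"
  by (rule cring_localization[OF cring_HA submonoid_pows])

text \<open>
  The residue class of a Laurent polynomial in the localization of \<open>R/fR\<close> at \<open>x\<^sub>S\<close>: the localization of
  \<open>R\<close> at \<open>x\<^sub>S\<close> is \<open>laurents n S\<close>, and \<open>rep S\<close> is the canonical surjection. Its value does not depend on
  the power \<open>x\<^sub>S\<^sup>k\<close> that is used to clear denominators (\<open>rep_eq\<close>).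
\<close>

definition rep :: "nat set \<Rightarrow> 'k laurent \<Rightarrow> ('k mpoly set \<times> 'k mpoly set) set" where
  "rep S g = (let k = (SOME k. den S k * g \<in> polys n) in mfrac S (of_laurent (den S k * g)) k)"

lemma rep_eq:
  assumes S: "S \<subseteq> {..n}" and k: "den S k * g \<in> polys n"
  shows "rep S g = mfrac S (of_laurent (den S k * g)) k"
proof -
  define l where "l = (SOME k. den S k * g \<in> polys n)"
  have l: "den S l * g \<in> polys n" unfolding l_def by (rule someI[where P = "\<lambda>k. den S k * g \<in> polys n", OF k])
  have "to_laurent (of_laurent (den S l * g) * var_prod S ^ k) = to_laurent (of_laurent (den S k * g) * var_prod S ^ l)"
    unfolding to_laurent_mult to_of_laurent[OF l] to_of_laurent[OF k] to_laurent_var_prod[OF S]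
    by (simp only: mult_ac)
  then have eq: "of_laurent (den S l * g) * var_prod S ^ k = of_laurent (den S k * g) * var_prod S ^ l"
    by (simp only: to_laurent_eq_iff)
  have "mfrac S (of_laurent (den S l * g)) l = mfrac S (of_laurent (den S k * g)) k"
    unfolding mfrac_eq_iff[OF S of_laurent_Rc[OF l] of_laurent_Rc[OF k]]
    by (intro exI[of _ 0] bexI[of _ 0]) (simp_all add: eq)
  then show ?thesis by (simp add: rep_def Let_def l_def)
qed

lemma rep_surj:
  assumes S: "S \<subseteq> {..n}" and a: "a \<in> Rc n"
  shows "mfrac S a k = rep S (den_inv S k * to_laurent a)" "den_inv S k * to_laurent a \<in> laurents n S"
proof -
  have eq: "den S k * (den_inv S k * to_laurent a) = to_laurent a"
    unfolding mult.assoc[symmetric] den_inv by simp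
  have "den S k * (den_inv S k * to_laurent a) \<in> polys n" unfolding eq using a by (simp add: Rc_iff)
  from rep_eq[OF S this] show "mfrac S a k = rep S (den_inv S k * to_laurent a)"
    unfolding eq of_to_laurent by (rule sym)
  show "den_inv S k * to_laurent a \<in> laurents n S"
    using den_inv_laurents[OF S] a laurents_mono[of "to_laurent a" n "{}" S] by (auto simp: Rc_iff)
qed

lemma common_denominator:
  assumes S: "S \<subseteq> {..n}" and "g \<in> laurents n S" "h \<in> laurents n S"
  obtains k where "den S k * g \<in> polys n" "den S k * h \<in> polys n"
proof -
  obtain k l where "\<forall>j\<ge>k. den S j * g \<in> polys n" "\<forall>j\<ge>l. den S j * h \<in> polys n"
    using clear_denominators[OF S] assms by metis
  then show thesis using that[of "max k l"] by simp
qed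

lemma rep_carrier:
  assumes S: "S \<subseteq> {..n}" and g: "g \<in> laurents n S"
  shows "rep S g \<in> carrier (CS S)"
proof -
  obtain k where k: "den S k * g \<in> polys n" using common_denominator[OF S g g] by blast
  then show ?thesis using rep_eq[OF S k] of_laurent_Rc[OF k] by (auto simp: carrier_CS[OF S])
qed

lemma rep_exists:
  assumes S: "S \<subseteq> {..n}" and z: "z \<in> carrier (CS S)"
  obtains g where "g \<in> laurents n S" "z = rep S g"
proof -
  obtain a k where "a \<in> Rc n" "z = mfrac S a k" using z by (auto simp: carrier_CS[OF S])
  then show thesis using that[OF rep_surj(2)[OF S]] rep_surj(1)[OF S] by metis
qed

lemma rep_add:
  assumes S: "S \<subseteq> {..n}" and g: "g \<in> laurents n S" "h \<in> laurents n S"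
  shows "rep S g \<oplus>\<^bsub>CS S\<^esub> rep S h = rep S (g + h)"
proof -
  obtain k where k: "den S k * g \<in> polys n" "den S k * h \<in> polys n" using common_denominator[OF S g] .
  let ?a = "of_laurent (den S k * g)" and ?b = "of_laurent (den S k * h)"
  have eq: "den S (k + k) * (g + h) = to_laurent (?a * var_prod S ^ k + ?b * var_prod S ^ k)"
    unfolding to_laurent_add to_laurent_mult to_of_laurent[OF k(1)] to_of_laurent[OF k(2)]
      to_laurent_var_prod[OF S] den_add by (simp add: algebra_simps)
  have R: "?a * var_prod S ^ k + ?b * var_prod S ^ k \<in> Rc n"
    using of_laurent_Rc[OF k(1)] of_laurent_Rc[OF k(2)] var_prod_Rc[OF S] by (auto intro!: Rc_closed)
  then have "den S (k + k) * (g + h) \<in> polys n" unfolding eq by (simp add: Rc_iff)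
  from rep_eq[OF S this] have "rep S (g + h) = mfrac S (?a * var_prod S ^ k + ?b * var_prod S ^ k) (k + k)"
    unfolding eq by simp
  then show ?thesis
    using rep_eq[OF S k(1)] rep_eq[OF S k(2)] mfrac_add[OF S of_laurent_Rc[OF k(1)] of_laurent_Rc[OF k(2)]] by simp
qed

lemma rep_mult:
  assumes S: "S \<subseteq> {..n}" and g: "g \<in> laurents n S" "h \<in> laurents n S"
  shows "rep S g \<otimes>\<^bsub>CS S\<^esub> rep S h = rep S (g * h)"
proof -
  obtain k where k: "den S k * g \<in> polys n" "den S k * h \<in> polys n" using common_denominator[OF S g] .
  let ?a = "of_laurent (den S k * g)" and ?b = "of_laurent (den S k * h)"
  have eq: "den S (k + k) * (g * h) = to_laurent (?a * ?b)"
    unfolding to_laurent_mult to_of_laurent[OF k(1)] to_of_laurent[OF k(2)] den_add by (simp only: mult_ac)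
  have "?a * ?b \<in> Rc n" using of_laurent_Rc[OF k(1)] of_laurent_Rc[OF k(2)] by (rule Rc_closed)
  then have "den S (k + k) * (g * h) \<in> polys n" unfolding eq by (simp add: Rc_iff)
  from rep_eq[OF S this] have "rep S (g * h) = mfrac S (?a * ?b) (k + k)" unfolding eq by simp
  then show ?thesis
    using rep_eq[OF S k(1)] rep_eq[OF S k(2)] mfrac_mult[OF S of_laurent_Rc[OF k(1)] of_laurent_Rc[OF k(2)]] by simp
qed

lemma rep_zero: "S \<subseteq> {..n} \<Longrightarrow> rep S 0 = \<zero>\<^bsub>CS S\<^esub>"
  and rep_one: "S \<subseteq> {..n} \<Longrightarrow> rep S 1 = \<one>\<^bsub>CS S\<^esub>"
  using rep_eq[of S 0 0] rep_eq[of S 0 1] of_to_laurent[of "1 :: 'k mpoly"]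
  by (simp_all add: mfrac_def localization_def residue_zero[OF f_Rc] residue_one[OF f_Rc])

lemma rep_uminus:
  assumes S: "S \<subseteq> {..n}" and g: "g \<in> laurents n S"
  shows "\<ominus>\<^bsub>CS S\<^esub> rep S g = rep S (- g)"
proof -
  interpret C: cring "CS S" by (rule cring_CS[OF S])
  have "rep S (- g) \<oplus>\<^bsub>CS S\<^esub> rep S g = \<zero>\<^bsub>CS S\<^esub>"
    using rep_add[OF S laurents_uminus[OF g] g] rep_zero[OF S] by simp
  then show ?thesis using rep_carrier[OF S] g by (intro C.minus_equality) auto
qed

lemma rep_power:
  assumes S: "S \<subseteq> {..n}" and g: "g \<in> laurents n S"
  shows "rep S g [^]\<^bsub>CS S\<^esub> (q :: nat) = rep S (g ^ q)"
proof -
  interpret C: cring "CS S" by (rule cring_CS[OF S])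
  show ?thesis
    by (induction q) (use S g in \<open>auto simp: rep_one rep_mult laurents_power mult.commute\<close>)
qed

text \<open>
  Localization is exact: the kernel of \<open>rep S\<close> is generated by \<open>f\<close>.
\<close>

lemma rep_eq_iff:
  assumes S: "S \<subseteq> {..n}" and g: "g \<in> laurents n S" "h \<in> laurents n S"
  shows "rep S g = rep S h \<longleftrightarrow> (\<exists>e\<in>laurents n S. g - h = HF * e)"
proof -
  obtain k where k: "den S k * g \<in> polys n" "den S k * h \<in> polys n" using common_denominator[OF S g] .
  let ?a = "of_laurent (den S k * g)" and ?b = "of_laurent (den S k * h)"
  have to: "to_laurent (var_prod S ^ m * (?a * var_prod S ^ k) - var_prod S ^ m * (?b * var_prod S ^ k)) =
      den S (m + (k + k)) * (g - h)" for m
    unfolding to_laurent_diff to_laurent_mult to_of_laurent[OF k(1)] to_of_laurent[OF k(2)]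
      to_laurent_var_prod[OF S] den_add by (simp add: algebra_simps)
  have "rep S g = rep S h \<longleftrightarrow> (\<exists>m. \<exists>e\<in>Rc n. var_prod S ^ m * (?a * var_prod S ^ k) - var_prod S ^ m * (?b * var_prod S ^ k) = e * f)"
    unfolding rep_eq[OF S k(1)] rep_eq[OF S k(2)] by (rule mfrac_eq_iff[OF S of_laurent_Rc[OF k(1)] of_laurent_Rc[OF k(2)]])
  also have "\<dots> \<longleftrightarrow> (\<exists>m. \<exists>e\<in>Rc n. den S (m + (k + k)) * (g - h) = to_laurent e * HF)"
    unfolding to[symmetric] to_laurent_mult[symmetric] to_laurent_eq_iff ..
  also have "\<dots> \<longleftrightarrow> (\<exists>e\<in>laurents n S. g - h = HF * e)"
  proof
    assume "\<exists>m. \<exists>e\<in>Rc n. den S (m + (k + k)) * (g - h) = to_laurent e * HF"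
    then obtain m e where e: "e \<in> Rc n" "den S (m + (k + k)) * (g - h) = to_laurent e * HF" by blast
    have "g - h = den_inv S (m + (k + k)) * (den S (m + (k + k)) * (g - h))"
      unfolding mult.assoc[symmetric] den_inv by simp
    also have "\<dots> = HF * (den_inv S (m + (k + k)) * to_laurent e)" unfolding e(2) by (simp only: mult_ac)
    finally show "\<exists>e\<in>laurents n S. g - h = HF * e" using rep_surj(2)[OF S e(1)] by blast
  next
    assume "\<exists>e\<in>laurents n S. g - h = HF * e"
    then obtain e where e: "e \<in> laurents n S" "g - h = HF * e" by blast
    obtain m where m: "\<forall>j\<ge>m. den S j * e \<in> polys n" using clear_denominators[OF S e(1)] by blast
    then have me: "den S (m + (k + k)) * e \<in> polys n" by simp
    show "\<exists>m. \<exists>e\<in>Rc n. den S (m + (k + k)) * (g - h) = to_laurent e * HF"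
      by (rule exI[of _ m], rule bexI[OF _ of_laurent_Rc[OF me]])
         (simp only: e(2) to_of_laurent[OF me], simp only: mult_ac)
  qed
  finally show ?thesis .
qed

lemma rep_res:
  assumes TS: "T \<subseteq> S" "S \<subseteq> {..n}" and g: "g \<in> laurents n T"
  shows "cech_res HA hx T S (rep T g) = rep S g"
proof -
  have T: "T \<subseteq> {..n}" and D: "S - T \<subseteq> {..n}" using TS by auto
  have fin: "finite S" "finite T" using TS finite_subset[of _ "{..n}"] by auto
  obtain k where k: "den T k * g \<in> polys n" using common_denominator[OF T g g] by blast
  let ?a = "of_laurent (den T k * g)"
  have a: "?a \<in> Rc n" by (rule of_laurent_Rc[OF k])
  have VD: "var_prod (S - T) ^ k \<in> Rc n" using var_prod_Rc[OF D] by (rule Rc_closed)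
  have hx: "hx \<in> S \<rightarrow> carrier HA"
    using TS(2) by (auto intro!: residue_closed[OF f_Rc] mpoly_var_Rc)
  have "cech_res HA hx T S (rep T g) = cech_res HA hx T S (cech_frac HA hx T (residue_class n f ?a) k)"
    unfolding rep_eq[OF T k] cech_frac_eq[OF T] ..
  also have "\<dots> = cech_frac HA hx S (residue_class n f ?a \<otimes>\<^bsub>HA\<^esub> cech_elt HA hx (S - T) [^]\<^bsub>HA\<^esub> k) k"
    by (rule cech_res_fraction[OF cring_HA fin(1) hx TS(1) residue_closed[OF f_Rc a]])
  also have "\<dots> = mfrac S (?a * var_prod (S - T) ^ k) k"
    unfolding cech_elt_pow[OF D] residue_mult[OF f_Rc a VD] by (rule cech_frac_eq[OF TS(2)])
  also have "\<dots> = rep S g"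
  proof -
    have "scal k (ind S) = scal k (ind T) + scal k (ind (S - T))"
      using TS fin by (intro poly_mapping_eqI) (auto simp: lookup_add coef_ind)
    then have "(den S k :: 'k laurent) = den T k * den (S - T) k"
      by (simp add: den_def mult_single)
    then have eq: "den S k * g = to_laurent (?a * var_prod (S - T) ^ k)"
      unfolding to_laurent_mult to_of_laurent[OF k] to_laurent_var_prod[OF D] by (simp only: mult_ac)
    have "den S k * g \<in> polys n" unfolding eq using Rc_closed(2)[OF a VD] by (simp add: Rc_iff)
    from rep_eq[OF TS(2) this] show ?thesis unfolding eq by simp
  qed
  finally show ?thesis .
qed

lemma rep_piece:
  assumes S: "S \<subseteq> {..n}"
  shows "cech_ring_piece HA (hypersurface_piece n f) hx S i = rep S ` (laurents n S \<inter> homog n i)"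
proof (intro equalityI subsetI)
  fix z assume "z \<in> cech_ring_piece HA (hypersurface_piece n f) hx S i"
  then obtain a k where a: "a \<in> Rc n" "homogeneous (i + int k * int (card S)) a"
    "z = cech_frac HA hx S (residue_class n f a) k"
    by (auto simp: cech_ring_piece_def hypersurface_piece_def)
  have "den_inv S k * to_laurent a \<in> homog n (- (int k * int (card S)) + (i + int k * int (card S)))"
    by (rule homog_mult[OF den_inv_homog[OF S] to_laurent_homog[OF a(1,2)]])
  then show "z \<in> rep S ` (laurents n S \<inter> homog n i)"
    using rep_surj[OF S a(1), of k] a(3) cech_frac_eq[OF S] by auto
next
  fix z assume "z \<in> rep S ` (laurents n S \<inter> homog n i)"
  then obtain g where g: "g \<in> laurents n S" "g \<in> homog n i" "z = rep S g" by blast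
  obtain k where k: "den S k * g \<in> polys n" using common_denominator[OF S g(1) g(1)] by blast
  have "den S k * g \<in> homog n (i + int k * int (card S))"
    using homog_mult[OF den_homog[OF S] g(2), of k] by (simp add: add.commute)
  then have "homogeneous (i + int k * int (card S)) (of_laurent (den S k * g))"
    by (rule of_laurent_homogeneous[OF k])
  then have "residue_class n f (of_laurent (den S k * g)) \<in> hypersurface_piece n f (i + int k * int (card S))"
    using of_laurent_Rc[OF k] by (auto simp: hypersurface_piece_def)
  moreover have "z = cech_frac HA hx S (residue_class n f (of_laurent (den S k * g))) k"
    unfolding g(3) rep_eq[OF S k] cech_frac_eq[OF S] ..
  ultimately show "z \<in> cech_ring_piece HA (hypersurface_piece n f) hx S i"
    unfolding cech_ring_piece_def by blast
qed

end

section \<open>Cochains of Laurent polynomials\<close>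

definition cech_sign :: "nat \<Rightarrow> nat set \<Rightarrow> 'k::comm_ring_1 laurent" where
  "cech_sign i S = (- 1) ^ card {l \<in> S. l < i}"

lemma cech_sign_square [simp]: "cech_sign i S * cech_sign i S = 1"
  by (simp add: cech_sign_def flip: power_mult_distrib)

text \<open>
  Removing \<open>j\<close> and inserting \<open>i\<close> anticommute. Both the vanishing of the squared differential and the
  homotopy identity are consequences.
\<close>

lemma cech_sign_swap:
  assumes "finite S" "j \<in> S" "i \<notin> S"
  shows "cech_sign j S * cech_sign i (insert i (S - {j})) = - (cech_sign i (insert i S) * (cech_sign j (insert i S) :: 'k::comm_ring_1 laurent))"
proof -
  have ne: "i \<noteq> j" using assms by auto
  have b: "{l \<in> insert i S. l < i} = {l \<in> S. l < i}" by auto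
  show ?thesis
  proof (cases "i < j")
    case True
    have "{l \<in> insert i (S - {j}). l < i} = {l \<in> S. l < i}" using True by auto
    moreover have "{l \<in> insert i S. l < j} = insert i {l \<in> S. l < j}" using True by auto
    ultimately show ?thesis using assms b by (simp add: cech_sign_def)
  next
    case False
    then have ji: "j < i" using ne by simp
    have "{l \<in> S. l < i} = insert j {l \<in> insert i (S - {j}). l < i}" using ji assms(2) by auto
    then have "card {l \<in> S. l < i} = Suc (card {l \<in> insert i (S - {j}). l < i})"
      using assms(1) by simp
    moreover have "{l \<in> insert i S. l < j} = {l \<in> S. l < j}" using ji by auto
    ultimately show ?thesis using b by (simp add: cech_sign_def)
  qed
qed

lemma cech_sign_swap':
  assumes "finite S" "i \<in> S" "j \<in> S" "i \<noteq> j"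
  shows "cech_sign i S * cech_sign j (S - {i}) = - (cech_sign j S * (cech_sign i (S - {j}) :: 'k::comm_ring_1 laurent))"
proof -
  have "insert i (S - {i} - {j}) = S - {j}" "insert i (S - {i}) = S" using assms by auto
  then have e: "cech_sign j (S - {i}) * cech_sign i (S - {j}) = - (cech_sign i S * (cech_sign j S :: 'k laurent))"
    using cech_sign_swap[of "S - {i}" j i] assms by auto
  have "cech_sign i S * cech_sign j (S - {i}) = cech_sign i S * cech_sign j (S - {i}) * (cech_sign i (S - {j}) * (cech_sign i (S - {j}) :: 'k laurent))"
    by simp
  also have "\<dots> = cech_sign i S * (cech_sign j (S - {i}) * cech_sign i (S - {j})) * cech_sign i (S - {j})" by (simp only: mult.assoc)
  also have "\<dots> = - (cech_sign i S * cech_sign i S) * (cech_sign j S * cech_sign i (S - {j}))"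
    unfolding e by (simp add: mult_ac del: cech_sign_square)
  finally show ?thesis by simp
qed

lemma cech_sign_cases: "(cech_sign i S :: 'k::comm_ring_1 laurent) = 1 \<or> (cech_sign i S :: 'k laurent) = - 1"
  unfolding cech_sign_def by (cases "even (card {l \<in> S. l < i})") auto

lemma cech_sign_supported: "cech_sign i S * g \<in> supported Q \<longleftrightarrow> g \<in> supported Q" for g :: "'k::comm_ring_1 laurent"
  using cech_sign_cases[of i S, where 'k = 'k] by (auto simp: supported_iff)

lemma cech_sign_laurents: "cech_sign i S * g \<in> laurents n T \<longleftrightarrow> g \<in> laurents n T" for g :: "'k::comm_ring_1 laurent"
  by (simp add: laurents_def cech_sign_supported)

text \<open>
  The Cech differential on families of Laurent polynomials, with the restriction maps replaced by
  inclusions.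
\<close>

definition codiff :: "(nat set \<Rightarrow> 'k::comm_ring_1 laurent) \<Rightarrow> nat set \<Rightarrow> 'k laurent" where
  "codiff c S = (\<Sum>i\<in>S. cech_sign i S * c (S - {i}))"

lemma codiff_add: "codiff (\<lambda>S. c S + c' S) S = codiff c S + codiff c' S"
  by (simp add: codiff_def distrib_left sum.distrib)

lemma codiff_uminus: "codiff (\<lambda>S. - c S) S = - codiff c S"
  by (simp add: codiff_def sum_negf)

lemma codiff_diff: "codiff (\<lambda>S. c S - c' S) S = codiff c S - codiff c' S"
  by (simp add: codiff_def right_diff_distrib sum_subtractf)

lemma codiff_mult: "codiff (\<lambda>S. g * c S) S = g * codiff c S"
  by (simp add: codiff_def sum_distrib_left mult_ac)

lemma codiff_codiff:
  assumes "finite S"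
  shows "codiff (codiff c) S = (0 :: 'k::comm_ring_1 laurent)"
proof -
  define t where "t i j = cech_sign i S * cech_sign j (S - {i}) * c (S - {i} - {j})" for i j
  have t: "t i j = - t j i" if "i \<in> S" "j \<in> S" "i \<noteq> j" for i j
  proof -
    have eq: "S - {i} - {j} = S - {j} - {i}" by auto
    show ?thesis unfolding t_def eq cech_sign_swap'[OF assms that] by simp
  qed
  have "codiff (codiff c) S = (\<Sum>i\<in>S. \<Sum>j\<in>S - {i}. t i j)"
    by (simp add: codiff_def t_def sum_distrib_left mult.assoc)
  also have "\<dots> = (\<Sum>i\<in>S. (\<Sum>j\<in>{j \<in> S. i < j}. t i j) + (\<Sum>j\<in>{j \<in> S. j < i}. t i j))"
  proof (rule sum.cong[OF refl])
    fix i assume "i \<in> S"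
    have "S - {i} = {j \<in> S. i < j} \<union> {j \<in> S. j < i}" by auto
    moreover have "(\<Sum>j\<in>{j \<in> S. i < j} \<union> {j \<in> S. j < i}. t i j) =
        (\<Sum>j\<in>{j \<in> S. i < j}. t i j) + (\<Sum>j\<in>{j \<in> S. j < i}. t i j)"
    proof (rule sum.union_disjoint)
      show "{j \<in> S. i < j} \<inter> {j \<in> S. j < i} = {}" by force
    qed (simp_all add: assms)
    ultimately show "(\<Sum>j\<in>S - {i}. t i j) = (\<Sum>j\<in>{j \<in> S. i < j}. t i j) + (\<Sum>j\<in>{j \<in> S. j < i}. t i j)"
      by (simp only:)
  qed
  also have "\<dots> = (\<Sum>i\<in>S. \<Sum>j\<in>{j \<in> S. i < j}. t i j + t j i)"
  proof -
    have "(\<Sum>i\<in>S. \<Sum>j\<in>{j \<in> S. j < i}. t i j) = (\<Sum>j\<in>S. \<Sum>i\<in>{i \<in> S. j < i}. t i j)"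
      by (rule sum.swap_restrict[OF assms assms])
    then show ?thesis unfolding sum.distrib by (rule arg_cong)
  qed
  also have "\<dots> = 0"
  proof (intro sum.neutral ballI)
    fix i j assume "i \<in> S" "j \<in> {j \<in> S. i < j}"
    then show "t i j + t j i = 0" using t[of i j] by simp
  qed
  finally show ?thesis .
qed

text \<open>
  Each monomial with a nonnegative exponent is assigned to the first variable with that property.
  The slices of a Laurent polynomial in which \<open>x\<^sub>i\<close> is inverted then lie in the part where \<open>x\<^sub>i\<close> is
  not inverted, which is what a homotopy for the Cech complex needs.
\<close>

definition first_nonneg :: "nat \<Rightarrow> nat \<Rightarrow> (nat \<Rightarrow>\<^sub>0 int) \<Rightarrow> bool" where
  "first_nonneg n i m \<longleftrightarrow> i \<le> n \<and> 0 \<le> coef m i \<and> (\<forall>j<i. coef m j < 0)"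

abbreviation (input) slice :: "nat \<Rightarrow> nat \<Rightarrow> 'k::comm_ring_1 laurent \<Rightarrow> 'k laurent" where
  "slice n i \<equiv> part (first_nonneg n i)"

lemma slice_eps: "slice n i (cech_sign j S * g) = cech_sign j S * slice n i g" for g :: "'k::comm_ring_1 laurent"
  using cech_sign_cases[of j S, where 'k = 'k] by (auto simp: part_uminus)

lemma slice_laurents: "g \<in> laurents n (insert i T) \<Longrightarrow> slice n i g \<in> laurents n T"
  unfolding laurents_def supported_iff coef_part exponents_iff first_nonneg_def by (auto split: if_splits)

lemma sum_slices:
  assumes "g \<in> boundaries n"
  shows "(\<Sum>i\<le>n. slice n i g) = (g :: 'k::comm_ring_1 laurent)"
proof (rule poly_mapping_eqI)
  fix m
  show "coef (\<Sum>i\<le>n. slice n i g) m = coef g m"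
  proof (cases "\<exists>i\<le>n. 0 \<le> coef m i")
    case True
    define k where "k = (LEAST i. i \<le> n \<and> 0 \<le> coef m i)"
    have k: "k \<le> n" "0 \<le> coef m k" "\<And>j. j < k \<Longrightarrow> coef m j < 0"
    proof -
      have "k \<le> n \<and> 0 \<le> coef m k"
        unfolding k_def by (rule LeastI_ex) (use True in blast)
      then show "k \<le> n" "0 \<le> coef m k" by auto
      show "coef m j < 0" if "j < k" for j
        using not_less_Least[of j "\<lambda>i. i \<le> n \<and> 0 \<le> coef m i"] that \<open>k \<le> n\<close> by (auto simp: k_def not_le)
    qed
    have "first_nonneg n i m \<longleftrightarrow> i = k" for i
      using k unfolding first_nonneg_def by (metis linorder_neqE_nat not_le)
    then show ?thesis using k(1) by (simp add: lookup_sum)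
  next
    case False
    then have "coef g m = 0" using assms by (auto simp: boundaries_def supported_iff)
    then show ?thesis by (auto simp: lookup_sum intro!: sum.neutral)
  qed
qed

text \<open>
  A contracting homotopy of the Cech complex of the polynomial ring away from the monomials all of
  whose exponents are negative. On the monomials assigned to \<open>x\<^sub>i\<close> it is the usual contraction of the
  cochain complex of a simplex onto its vertex \<open>i\<close>.
\<close>

definition homotopy :: "nat \<Rightarrow> (nat set \<Rightarrow> 'k::comm_ring_1 laurent) \<Rightarrow> nat set \<Rightarrow> 'k laurent" where
  "homotopy n c T = (\<Sum>i\<in>{..n} - T. cech_sign i (insert i T) * slice n i (c (insert i T)))"

lemma homotopy_identity:
  assumes S: "S \<subseteq> {..n}"
  shows "codiff (homotopy n c) S + homotopy n (codiff c) S = (\<Sum>i\<le>n. slice n i (c S))"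
proof -
  have fin: "finite S" using S finite_subset by blast
  let ?C = "{..n} - S"
  define x where "x i j = cech_sign i (insert i S) * (cech_sign j (insert i S) * slice n i (c (insert i (S - {j}))))" for i j
  have "codiff (homotopy n c) S = (\<Sum>j\<in>S. slice n j (c S) - (\<Sum>i\<in>?C. x i j))"
    unfolding codiff_def
  proof (rule sum.cong[OF refl])
    fix j assume j: "j \<in> S"
    have C: "{..n} - (S - {j}) = insert j ?C" using j S by auto
    have "homotopy n c (S - {j}) = cech_sign j S * slice n j (c S) +
        (\<Sum>i\<in>?C. cech_sign i (insert i (S - {j})) * slice n i (c (insert i (S - {j}))))"
      unfolding homotopy_def C using j by (simp add: insert_absorb)
    then have "cech_sign j S * homotopy n c (S - {j}) = slice n j (c S) +
        (\<Sum>i\<in>?C. (cech_sign j S * cech_sign i (insert i (S - {j}))) * slice n i (c (insert i (S - {j}))))"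
      by (simp add: distrib_left sum_distrib_left flip: mult.assoc)
    also have "(\<Sum>i\<in>?C. (cech_sign j S * cech_sign i (insert i (S - {j}))) * slice n i (c (insert i (S - {j})))) =
        (\<Sum>i\<in>?C. - x i j)"
      by (rule sum.cong) (auto simp: cech_sign_swap[OF fin j] x_def mult.assoc)
    finally show "cech_sign j S * homotopy n c (S - {j}) = slice n j (c S) - (\<Sum>i\<in>?C. x i j)"
      by (simp add: sum_negf)
  qed
  moreover have "homotopy n (codiff c) S = (\<Sum>i\<in>?C. slice n i (c S) + (\<Sum>j\<in>S. x i j))"
    unfolding homotopy_def
  proof (rule sum.cong[OF refl])
    fix i assume i: "i \<in> ?C"
    have "codiff c (insert i S) = cech_sign i (insert i S) * c S + (\<Sum>j\<in>S. cech_sign j (insert i S) * c (insert i S - {j}))"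
      unfolding codiff_def using i fin by simp
    also have "(\<Sum>j\<in>S. cech_sign j (insert i S) * c (insert i S - {j})) = (\<Sum>j\<in>S. cech_sign j (insert i S) * c (insert i (S - {j})))"
    proof (rule sum.cong[OF refl])
      fix j assume "j \<in> S"
      then have "insert i S - {j} = insert i (S - {j})" using i by auto
      then show "cech_sign j (insert i S) * c (insert i S - {j}) = cech_sign j (insert i S) * c (insert i (S - {j}))" by simp
    qed
    finally have "slice n i (codiff c (insert i S)) = cech_sign i (insert i S) * slice n i (c S) +
        (\<Sum>j\<in>S. cech_sign j (insert i S) * slice n i (c (insert i (S - {j}))))"
      by (simp add: part_add part_sum slice_eps)
    then show "cech_sign i (insert i S) * slice n i (codiff c (insert i S)) = slice n i (c S) + (\<Sum>j\<in>S. x i j)"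
      by (simp add: x_def distrib_left sum_distrib_left flip: mult.assoc)
  qed
  moreover have "(\<Sum>j\<in>S. \<Sum>i\<in>?C. x i j) = (\<Sum>i\<in>?C. \<Sum>j\<in>S. x i j)" by (rule sum.swap)
  moreover have "(\<Sum>i\<le>n. slice n i (c S)) = (\<Sum>j\<in>S. slice n j (c S)) + (\<Sum>i\<in>?C. slice n i (c S))"
    using sum.subset_diff[OF S, of "\<lambda>i. slice n i (c S)"] by (simp add: add.commute)
  ultimately show ?thesis by (simp add: sum.distrib sum_subtractf)
qed

context hypersurface
begin

abbreviation (input) "idx \<equiv> cech_index n"
abbreviation (input) "CG \<equiv> cech_group HA hx n"

definition cochain :: "nat \<Rightarrow> (nat set \<Rightarrow> 'k laurent) \<Rightarrow> bool" where
  "cochain j c \<longleftrightarrow> (\<forall>S\<in>idx j. c S \<in> laurents n S)"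

text \<open>
  The cochain of \<open>R/fR\<close> that a family of Laurent polynomials represents.
\<close>

definition cc :: "nat \<Rightarrow> (nat set \<Rightarrow> 'k laurent) \<Rightarrow> nat set \<Rightarrow> ('k mpoly set \<times> 'k mpoly set) set" where
  "cc j c = (\<lambda>S\<in>idx j. rep S (c S))"

lemma idxD: "S \<in> idx j \<Longrightarrow> S \<subseteq> {..n}" "S \<in> idx j \<Longrightarrow> finite S" "S \<in> idx j \<Longrightarrow> card S = j"
  using finite_subset by (auto simp: cech_index_def)

lemma idx_remove: "S \<in> idx (Suc j) \<Longrightarrow> i \<in> S \<Longrightarrow> S - {i} \<in> idx j"
  by (auto simp: cech_index_def finite_subset)

lemma idx_top: "idx (Suc n) = {{..n}}"
proof -
  have "S = {..n}" if "S \<subseteq> {..n}" "card S = Suc n" for S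
    using card_subset_eq[of "{..n}" S] that by simp
  then show ?thesis by (auto simp: cech_index_def)
qed

lemma cochainD: "cochain j c \<Longrightarrow> S \<in> idx j \<Longrightarrow> c S \<in> laurents n S"
  by (simp add: cochain_def)

lemma cochain_add: "cochain j c \<Longrightarrow> cochain j c' \<Longrightarrow> cochain j (\<lambda>S. c S + c' S)"
  and cochain_uminus: "cochain j c \<Longrightarrow> cochain j (\<lambda>S. - c S)"
  and cochain_0: "cochain j (\<lambda>_. 0)"
  and cochain_power: "cochain j c \<Longrightarrow> cochain j (\<lambda>S. c S ^ q)"
  by (auto simp: cochain_def)

lemma cochain_codiff: "cochain j c \<Longrightarrow> cochain (Suc j) (codiff c)"
  unfolding cochain_def codiff_def
proof
  fix S assume c: "\<forall>S\<in>idx j. c S \<in> laurents n S" and S: "S \<in> idx (Suc j)"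
  show "(\<Sum>i\<in>S. cech_sign i S * c (S - {i})) \<in> laurents n S"
  proof (rule laurents_sum)
    fix i assume i: "i \<in> S"
    have "c (S - {i}) \<in> laurents n (S - {i})" using c idx_remove[OF S i] by blast
    then show "cech_sign i S * c (S - {i}) \<in> laurents n S"
      unfolding cech_sign_laurents by (rule laurents_mono) auto
  qed
qed

lemma cc_carrier: "cochain j c \<Longrightarrow> cc j c \<in> carrier (CG j)"
  by (simp add: cech_group_def cc_def restrict_PiE_iff rep_carrier idxD(1) cochainD)

lemma cc_exists:
  assumes "x \<in> carrier (CG j)"
  obtains c where "cochain j c" "x = cc j c"
proof -
  have x: "x S \<in> carrier (CS S)" if "S \<in> idx j" for S
    using assms that by (auto simp: cech_group_def)
  have "\<forall>S\<in>idx j. \<exists>g. g \<in> laurents n S \<and> x S = rep S g"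
    using x rep_exists idxD(1) by metis
  then obtain c where c: "\<And>S. S \<in> idx j \<Longrightarrow> c S \<in> laurents n S \<and> x S = rep S (c S)" by metis
  have "x = cc j c"
  proof (rule PiE_ext[of x "idx j" "\<lambda>S. carrier (CS S)"])
    show "x \<in> (\<Pi>\<^sub>E S\<in>idx j. carrier (CS S))" using assms by (simp add: cech_group_def)
    show "cc j c \<in> (\<Pi>\<^sub>E S\<in>idx j. carrier (CS S))"
      using cc_carrier[of j c] c by (simp add: cochain_def cech_group_def)
  qed (use c in \<open>auto simp: cc_def\<close>)
  then show thesis using that[of c] c by (simp add: cochain_def)
qed

lemma comm_group_CG: "comm_group (CG j)"
proof -
  have g: "group (add_monoid (CS S))" if "S \<in> idx j" for S
    using abelian_group.a_group cring.axioms(1)[OF cring_CS[OF idxD(1)[OF that]]] by (blast dest: ring.is_abelian_group)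
  show ?thesis
  proof (rule group.group_comm_groupI)
    show "group (CG j)" unfolding cech_group_def by (rule product_group) (rule g)
    fix x y assume "x \<in> carrier (CG j)" "y \<in> carrier (CG j)"
    then obtain c c' where "cochain j c" "x = cc j c" "cochain j c'" "y = cc j c'" by (metis cc_exists)
    then show "x \<otimes>\<^bsub>CG j\<^esub> y = y \<otimes>\<^bsub>CG j\<^esub> x"
      unfolding cech_group_def cc_def mult_product_group
      by (intro restrict_ext) (simp add: rep_add idxD(1) cochainD add.commute)
  qed
qed

lemma cc_mult: "cochain j c \<Longrightarrow> cochain j c' \<Longrightarrow> cc j c \<otimes>\<^bsub>CG j\<^esub> cc j c' = cc j (\<lambda>S. c S + c' S)"
  unfolding cech_group_def cc_def mult_product_group
  by (intro restrict_ext) (simp add: rep_add idxD(1) cochainD)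

lemma cc_one: "\<one>\<^bsub>CG j\<^esub> = cc j (\<lambda>_. 0)"
  unfolding cech_group_def cc_def one_product_group
  by (rule restrict_ext) (simp add: rep_zero idxD(1))

lemma cc_inv: "cochain j c \<Longrightarrow> inv\<^bsub>CG j\<^esub> (cc j c) = cc j (\<lambda>S. - c S)"
proof -
  interpret G: comm_group "CG j" by (rule comm_group_CG)
  assume c: "cochain j c"
  have "cc j (\<lambda>S. - c S) \<otimes>\<^bsub>CG j\<^esub> cc j c = \<one>\<^bsub>CG j\<^esub>"
    using cc_mult[OF cochain_uminus[OF c] c] by (simp add: cc_one)
  then show ?thesis by (rule G.inv_equality) (use c cc_carrier cochain_uminus in auto)
qed

lemma cc_eq_iff:
  assumes "cochain j c" "cochain j c'"
  shows "cc j c = cc j c' \<longleftrightarrow> (\<forall>S\<in>idx j. \<exists>e\<in>laurents n S. c S - c' S = HF * e)"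
proof -
  have "cc j c = cc j c' \<longleftrightarrow> (\<forall>S\<in>idx j. rep S (c S) = rep S (c' S))"
  proof
    assume eq: "cc j c = cc j c'"
    show "\<forall>S\<in>idx j. rep S (c S) = rep S (c' S)"
    proof
      fix S assume "S \<in> idx j"
      then show "rep S (c S) = rep S (c' S)" using fun_cong[OF eq, of S] by (simp add: cc_def)
    qed
  qed (auto simp: cc_def intro: restrict_ext)
  then show ?thesis using rep_eq_iff assms by (simp add: idxD cochainD)
qed

lemma rep_sum:
  assumes S: "S \<subseteq> {..n}" and "finite K" "\<And>i. i \<in> K \<Longrightarrow> g i \<in> laurents n S"
  shows "finsum (CS S) (\<lambda>i. rep S (g i)) K = rep S (sum g K)"
proof -
  interpret C: cring "CS S" by (rule cring_CS[OF S])
  show ?thesis using assms(2,3)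
  proof (induction K rule: finite_induct)
    case (insert i K)
    have "(\<lambda>i. rep S (g i)) \<in> K \<rightarrow> carrier (CS S)" "rep S (g i) \<in> carrier (CS S)"
      using insert.prems rep_carrier[OF S] by auto
    then show ?case using insert by (simp add: rep_add[OF S] laurents_sum)
  qed (simp add: rep_zero[OF S])
qed

lemma cech_diff_cc:
  assumes c: "cochain j c"
  shows "cech_diff HA hx n j (cc j c) = cc (Suc j) (codiff c)"
proof -
  have "finsum (CS S) (\<lambda>i. let z = cech_res HA hx (S - {i}) S (cc j c (S - {i}))
      in if even (card {l \<in> S. l < i}) then z else \<ominus>\<^bsub>CS S\<^esub> z) S = rep S (codiff c S)"
    if S: "S \<in> idx (Suc j)" for S
  proof -
    interpret C: cring "CS S" by (rule cring_CS[OF idxD(1)[OF S]])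
    have l: "c (S - {i}) \<in> laurents n (S - {i})" "c (S - {i}) \<in> laurents n S" if "i \<in> S" for i
      using cochainD[OF c idx_remove[OF S that]] laurents_mono[of "c (S - {i})" n "S - {i}" S] by auto
    have "(let z = cech_res HA hx (S - {i}) S (cc j c (S - {i}))
      in if even (card {l \<in> S. l < i}) then z else \<ominus>\<^bsub>CS S\<^esub> z) = rep S (cech_sign i S * c (S - {i}))" if i: "i \<in> S" for i
    proof -
      have "cech_res HA hx (S - {i}) S (cc j c (S - {i})) = rep S (c (S - {i}))"
        using rep_res[OF _ idxD(1)[OF S] l(1)[OF i]] idx_remove[OF S i] by (auto simp: cc_def)
      then show ?thesis using rep_uminus[OF idxD(1)[OF S] l(2)[OF i]] by (simp add: Let_def cech_sign_def)
    qed
    then have "finsum (CS S) (\<lambda>i. let z = cech_res HA hx (S - {i}) S (cc j c (S - {i}))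
        in if even (card {l \<in> S. l < i}) then z else \<ominus>\<^bsub>CS S\<^esub> z) S =
        finsum (CS S) (\<lambda>i. rep S (cech_sign i S * c (S - {i}))) S"
      using l(2) rep_carrier[OF idxD(1)[OF S]]
      by (intro C.finsum_cong') (auto simp: cech_sign_laurents)
    also have "\<dots> = rep S (codiff c S)"
      unfolding codiff_def using l(2) by (intro rep_sum idxD[OF S]) (auto simp: cech_sign_laurents)
    finally show ?thesis .
  qed
  then show ?thesis
    unfolding cech_diff_def cc_def[of "Suc j"] by (intro restrict_ext) blast
qed

lemma cech_diff_hom: "group_hom (CG j) (CG (Suc j)) (cech_diff HA hx n j)"
proof -
  interpret G: comm_group "CG j" by (rule comm_group_CG)
  interpret G': comm_group "CG (Suc j)" by (rule comm_group_CG)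
  have "cech_diff HA hx n j \<in> hom (CG j) (CG (Suc j))"
  proof (rule homI)
    fix x y assume "x \<in> carrier (CG j)" "y \<in> carrier (CG j)"
    then obtain c c' where *: "cochain j c" "x = cc j c" "cochain j c'" "y = cc j c'" by (metis cc_exists)
    have eq: "codiff (\<lambda>S. c S + c' S) = (\<lambda>S. codiff c S + codiff c' S)" by (simp add: fun_eq_iff codiff_add)
    show "cech_diff HA hx n j (x \<otimes>\<^bsub>CG j\<^esub> y) = cech_diff HA hx n j x \<otimes>\<^bsub>CG (Suc j)\<^esub> cech_diff HA hx n j y"
      using * by (simp add: cc_mult cech_diff_cc cochain_add cochain_codiff eq)
    show "cech_diff HA hx n j x \<in> carrier (CG (Suc j))"
      using * by (simp add: cech_diff_cc cc_carrier cochain_codiff)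
  qed
  then show ?thesis by (simp add: group_hom_def group_hom_axioms_def G.is_group G'.is_group)
qed

abbreviation (input) "ZZ \<equiv> cech_cocycles HA hx n n"
abbreviation (input) "BB \<equiv> cech_coboundaries HA hx n n"
abbreviation (input) "GZ \<equiv> (CG n)\<lparr>carrier := ZZ\<rparr>"

lemma cocycle_iff:
  assumes c: "cochain n c"
  shows "cc n c \<in> ZZ \<longleftrightarrow> (\<exists>\<eta>\<in>laurents n {..n}. codiff c {..n} = HF * \<eta>)"
proof -
  have "cc n c \<in> ZZ \<longleftrightarrow> cc (Suc n) (codiff c) = cc (Suc n) (\<lambda>_. 0)"
    using cc_carrier[OF c] by (simp add: cech_cocycles_def kernel_def cech_diff_cc[OF c] cc_one)
  then show ?thesis
    using cc_eq_iff[OF cochain_codiff[OF c] cochain_0] by (simp add: idx_top)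
qed

lemma subgroup_ZZ: "subgroup ZZ (CG n)"
  unfolding cech_cocycles_def by (rule group_hom.subgroup_kernel[OF cech_diff_hom])

lemma uminus_power_p: "(- x) ^ p = - (x ^ p)" for x :: "'k laurent"
  using laurent_power_p_add[of x "- x"] p_pos by (simp add: power_0_left eq_neg_iff_add_eq_0 add.commute)

lemma diff_power_p: "(x - y) ^ p = x ^ p - y ^ p" for x y :: "'k laurent"
  using laurent_power_p_add[of x "- y"] by (simp add: uminus_power_p)

lemma codiff_power: "codiff c S ^ p = codiff (\<lambda>S. c S ^ p) S" for c :: "nat set \<Rightarrow> 'k laurent"
proof -
  have "(cech_sign i S :: 'k laurent) ^ p = cech_sign i S" for i
    using cech_sign_cases[of i S, where 'k = 'k] by (auto simp: uminus_power_p)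
  then show ?thesis
    unfolding codiff_def
    by (subst freshmans_dream_sum) (use prime_p char_p in \<open>simp_all add: power_mult_distrib\<close>)
qed

text \<open>
  A coboundary has a lift with differential zero, and the \<open>p\<close>-th powers of this lift again represent a
  coboundary. In degree \<open>0\<close> only zero is a coboundary.
\<close>

lemma coboundaryE:
  assumes x: "x \<in> BB"
  obtains h where "cochain n h" "x = cc n h" "codiff h {..n} = 0"
    "codiff (\<lambda>S. h S ^ p) {..n} = 0" "cc n (\<lambda>S. h S ^ p) \<in> BB"
proof (cases n)
  case 0
  have "x = cc n (\<lambda>_. 0)" using x 0 cc_one[of 0] by (simp add: cech_coboundaries_def)
  moreover have "cc n (\<lambda>_. 0 ^ p) \<in> BB"
    using x calculation p_pos by (simp add: power_0_left)
  ultimately show thesis using p_pos by (intro that[of "\<lambda>_. 0"]) (auto simp: cochain_0 codiff_def power_0_left)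
next
  case (Suc m)
  obtain b where b: "cochain m b" "x = cech_diff HA hx n m (cc m b)"
    using x Suc cc_exists by (auto simp: cech_coboundaries_def) metis
  have BBI: "cc n (codiff b') \<in> BB" if "cochain m b'" for b'
    using cech_diff_cc[OF that] cc_carrier[OF that] Suc by (auto simp: cech_coboundaries_def) (metis image_eqI)
  have eq: "(\<lambda>S. codiff b S ^ p) = codiff (\<lambda>S. b S ^ p)" by (simp add: fun_eq_iff codiff_power)
  show thesis
  proof (rule that[of "codiff b"])
    show "cochain n (codiff b)" using cochain_codiff[OF b(1)] Suc by simp
    show "x = cc n (codiff b)" using b cech_diff_cc[OF b(1)] Suc by simp
  qed (use BBI[OF cochain_power[OF b(1)]] in \<open>simp_all add: eq codiff_codiff\<close>)
qed

lemma BB_sub_ZZ: "BB \<subseteq> ZZ"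
proof
  fix x assume "x \<in> BB"
  then obtain h where "cochain n h" "x = cc n h" "codiff h {..n} = 0" by (rule coboundaryE)
  then show "x \<in> ZZ" by (auto simp: cocycle_iff intro!: bexI[of _ 0])
qed

lemma subgroup_BB: "subgroup BB (CG n)"
proof -
  interpret G: comm_group "CG n" by (rule comm_group_CG)
  show ?thesis
  proof (cases n)
    case 0
    have "BB = {\<one>\<^bsub>CG n\<^esub>}" by (simp add: cech_coboundaries_def 0)
    then show ?thesis using G.triv_subgroup by simp
  next
    case (Suc m)
    have "BB = cech_diff HA hx n m ` carrier (CG m)" by (simp add: cech_coboundaries_def Suc)
    then show ?thesis using group_hom.img_is_subgroup[OF cech_diff_hom, of m] Suc by simp
  qed
qed

lemma comm_group_GZ: "comm_group GZ"
proof -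
  interpret G: comm_group "CG n" by (rule comm_group_CG)
  show ?thesis
  proof (rule group.group_comm_groupI)
    show "group GZ" by (rule subgroup.subgroup_is_group[OF subgroup_ZZ G.is_group])
    fix x y assume "x \<in> carrier GZ" "y \<in> carrier GZ"
    then have "x \<in> carrier (CG n)" "y \<in> carrier (CG n)" using subgroup.subset[OF subgroup_ZZ] by auto
    then show "x \<otimes>\<^bsub>GZ\<^esub> y = y \<otimes>\<^bsub>GZ\<^esub> x" using G.m_comm[of x y] by simp
  qed
qed

lemma normal_BB: "BB \<lhd> GZ"
proof -
  interpret GZ: comm_group GZ by (rule comm_group_GZ)
  interpret G: comm_group "CG n" by (rule comm_group_CG)
  have "subgroup BB GZ" using G.subgroup_incl[OF subgroup_BB subgroup_ZZ BB_sub_ZZ] .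
  then show ?thesis by (rule GZ.subgroup_imp_normal)
qed

text \<open>
  A lift \<open>c\<close> of a cocycle of \<open>R/fR\<close> to Laurent polynomials has a differential divisible by \<open>f\<close>. The
  quotient \<open>y\<close> represents the image of the cohomology class under the connecting homomorphism of
  \<open>0 \<rightarrow> R \<rightarrow> R \<rightarrow> R/fR \<rightarrow> 0\<close>, an element of the top local cohomology of \<open>R\<close>.
\<close>

definition lift :: "(nat set \<Rightarrow> 'k laurent) \<Rightarrow> 'k laurent \<Rightarrow> bool" where
  "lift c y \<longleftrightarrow> cochain n c \<and> y \<in> laurents n {..n} \<and> codiff c {..n} = HF * y"

definition hcls :: "(nat set \<Rightarrow> 'k laurent) \<Rightarrow> (nat set \<Rightarrow> ('k mpoly set \<times> 'k mpoly set) set) set" where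
  "hcls c = cohomology_class HA hx n n (cc n c)"

lemma lift_ZZ: "lift c y \<Longrightarrow> cc n c \<in> ZZ"
  by (auto simp: lift_def cocycle_iff)

lemma lift_add: "lift c y \<Longrightarrow> lift c' y' \<Longrightarrow> lift (\<lambda>S. c S + c' S) (y + y')"
  by (auto simp: lift_def cochain_add codiff_add distrib_left)

lemma lift_uminus: "lift c y \<Longrightarrow> lift (\<lambda>S. - c S) (- y)"
  by (auto simp: lift_def cochain_uminus codiff_uminus)

lemma lift_0: "lift (\<lambda>_. 0) 0"
  by (simp add: lift_def cochain_0 codiff_def)

text \<open>
  The connecting homomorphism turns Frobenius into \<open>y \<mapsto> f\<^sup>p\<^sup>-\<^sup>1 y\<^sup>p\<close>, because \<open>(f y)\<^sup>p = f (f\<^sup>p\<^sup>-\<^sup>1 y\<^sup>p)\<close>.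
\<close>

lemma lift_power: "lift c y \<Longrightarrow> lift (\<lambda>S. c S ^ p) (HF ^ (p - 1) * y ^ p)"
proof -
  assume l: "lift c y"
  have "HF ^ (p - 1) \<in> laurents n {..n}" using F_polys laurents_mono[of _ n "{}" "{..n}"] by blast
  moreover have "codiff (\<lambda>S. c S ^ p) {..n} = HF * (HF ^ (p - 1) * y ^ p)"
  proof -
    have "codiff (\<lambda>S. c S ^ p) {..n} = (HF * y) ^ p"
      using l by (simp add: lift_def flip: codiff_power)
    then show ?thesis by (simp only: power_mult_distrib F_power mult.assoc[symmetric])
  qed
  ultimately show ?thesis using l by (auto simp: lift_def cochain_power)
qed

lemma hcls_hom: "group_hom GZ (local_cohomology HA hx n n) (\<lambda>x. BB #>\<^bsub>GZ\<^esub> x)"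
proof -
  interpret N: normal BB GZ by (rule normal_BB)
  show ?thesis
    unfolding local_cohomology_def
    by (rule group_hom.intro[OF comm_group.axioms(2)[OF comm_group_GZ] N.factorgroup_is_group
          group_hom_axioms.intro[OF N.r_coset_hom_Mod]])
qed

lemma hcls_eq_class: "hcls c = BB #>\<^bsub>GZ\<^esub> cc n c"
  by (simp add: hcls_def cohomology_class_def)

lemma hcls_mult:
  assumes "lift c y" "lift c' y'"
  shows "hcls c \<otimes>\<^bsub>local_cohomology HA hx n n\<^esub> hcls c' = hcls (\<lambda>S. c S + c' S)"
proof -
  interpret H: group_hom GZ "local_cohomology HA hx n n" "\<lambda>x. BB #>\<^bsub>GZ\<^esub> x" by (rule hcls_hom)
  have "cc n c \<otimes>\<^bsub>GZ\<^esub> cc n c' = cc n (\<lambda>S. c S + c' S)"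
    using cc_mult[of n c c'] assms by (simp add: lift_def)
  then show ?thesis
    using H.hom_mult[of "cc n c" "cc n c'"] lift_ZZ[OF assms(1)] lift_ZZ[OF assms(2)] by (simp add: hcls_eq_class)
qed

lemma hcls_one: "\<one>\<^bsub>local_cohomology HA hx n n\<^esub> = hcls (\<lambda>_. 0)"
proof -
  interpret H: group_hom GZ "local_cohomology HA hx n n" "\<lambda>x. BB #>\<^bsub>GZ\<^esub> x" by (rule hcls_hom)
  have "\<one>\<^bsub>GZ\<^esub> = cc n (\<lambda>_. 0)" using cc_one by simp
  then show ?thesis using H.hom_one by (simp add: hcls_eq_class)
qed

lemma hcls_inv:
  assumes "lift c y"
  shows "inv\<^bsub>local_cohomology HA hx n n\<^esub> hcls c = hcls (\<lambda>S. - c S)"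
proof -
  interpret H: group_hom GZ "local_cohomology HA hx n n" "\<lambda>x. BB #>\<^bsub>GZ\<^esub> x" by (rule hcls_hom)
  interpret G: comm_group "CG n" by (rule comm_group_CG)
  have "inv\<^bsub>GZ\<^esub> cc n c = cc n (\<lambda>S. - c S)"
    using cc_inv[of n c] assms lift_ZZ[OF assms] G.m_inv_consistent[OF subgroup_ZZ] by (simp add: lift_def)
  then show ?thesis using H.hom_inv[of "cc n c"] lift_ZZ[OF assms] by (simp add: hcls_eq_class)
qed

lemma hcls_zero_iff_BB:
  assumes "lift c y" "lift c' y'"
  shows "hcls c = hcls c' \<longleftrightarrow> cc n (\<lambda>S. c S - c' S) \<in> BB"
proof -
  interpret GZ: comm_group GZ by (rule comm_group_GZ)
  interpret N: normal BB GZ by (rule normal_BB)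
  interpret G: comm_group "CG n" by (rule comm_group_CG)
  have x: "cc n c \<in> carrier GZ" "cc n c' \<in> carrier GZ"
    using lift_ZZ assms by auto
  have "hcls c = hcls c' \<longleftrightarrow> cc n c \<in> BB #>\<^bsub>GZ\<^esub> cc n c'"
    unfolding hcls_eq_class
    using GZ.repr_independence[OF _ x(2) N.is_subgroup] GZ.rcos_self[OF x(1) N.is_subgroup] by metis
  also have "\<dots> \<longleftrightarrow> cc n c \<otimes>\<^bsub>GZ\<^esub> inv\<^bsub>GZ\<^esub> cc n c' \<in> BB"
    using N.rcos_module[OF GZ.is_group x(2,1)] .
  also have "inv\<^bsub>GZ\<^esub> cc n c' = cc n (\<lambda>S. - c' S)"
    using cc_inv[of n c'] assms(2) x(2) G.m_inv_consistent[OF subgroup_ZZ] by (simp add: lift_def)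
  also have "cc n c \<otimes>\<^bsub>GZ\<^esub> cc n (\<lambda>S. - c' S) = cc n (\<lambda>S. c S - c' S)"
    using cc_mult[of n c "\<lambda>S. - c' S"] assms cochain_uminus by (simp add: lift_def)
  finally show ?thesis .
qed

lemma codiff_top_boundaries:
  assumes "cochain n c"
  shows "codiff c {..n} \<in> boundaries n"
  unfolding codiff_def
proof (rule boundaries_sum)
  fix i assume i: "i \<in> {..n}"
  then have "{..n} - {i} \<in> idx n" by (simp add: cech_index_def)
  then have "cech_sign i {..n} * c ({..n} - {i}) \<in> laurents n ({..n} - {i})"
    using cochainD[OF assms] by (simp add: cech_sign_laurents)
  then show "cech_sign i {..n} * c ({..n} - {i}) \<in> boundaries n"
    using i unfolding laurents_def boundaries_def by (elim supported_mono) (auto simp: exponents_iff)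
qed

text \<open>
  A preimage of \<open>g\<close> under the last differential of the Cech complex of \<open>R\<close>, for a boundary \<open>g\<close>.
\<close>

definition split_top :: "'k laurent \<Rightarrow> nat set \<Rightarrow> 'k laurent" where
  "split_top g S = (\<Sum>i\<in>{..n} - S. cech_sign i {..n} * slice n i g)"

lemma split_top_idx: "i \<le> n \<Longrightarrow> split_top g ({..n} - {i}) = cech_sign i {..n} * slice n i g"
proof -
  assume "i \<le> n"
  then have "{..n} - ({..n} - {i}) = {i}" by auto
  then show ?thesis by (simp add: split_top_def)
qed

lemma idx_n: "S \<in> idx n \<longleftrightarrow> (\<exists>i\<le>n. S = {..n} - {i})"
proof
  assume S: "S \<in> idx n"
  have "card ({..n} - S) = 1"
    using card_Diff_subset[of S "{..n}"] idxD[OF S] by simp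
  then obtain i where "{..n} - S = {i}" by (auto simp: card_1_singleton_iff)
  then show "\<exists>i\<le>n. S = {..n} - {i}" using idxD(1)[OF S] by (intro exI[of _ i]) auto
qed (auto simp: cech_index_def)

lemma cochain_split_top:
  assumes "g \<in> laurents n {..n}"
  shows "cochain n (split_top g)"
  unfolding cochain_def
proof
  fix S assume "S \<in> idx n"
  then obtain i where i: "i \<le> n" "S = {..n} - {i}" by (auto simp: idx_n)
  then have "insert i S = {..n}" by auto
  then have "slice n i g \<in> laurents n S" using assms by (intro slice_laurents) simp
  then show "split_top g S \<in> laurents n S" using i by (simp add: split_top_idx cech_sign_laurents)
qed

lemma codiff_split_top:
  assumes "g \<in> boundaries n"
  shows "codiff (split_top g) {..n} = g"
proof -
  have "codiff (split_top g) {..n} = (\<Sum>i\<le>n. slice n i g)"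
    unfolding codiff_def by (rule sum.cong) (simp_all add: split_top_idx flip: mult.assoc)
  then show ?thesis using sum_slices[OF assms] by simp
qed

text \<open>
  The connecting homomorphism is injective. If \<open>y\<close> is the differential of \<open>e\<close>, then \<open>c - f e\<close>
  represents the same cochain of \<open>R/fR\<close> as \<open>c\<close> and is a cocycle over \<open>R\<close>. In degree \<open>n\<close> no set of
  \<open>n\<close> variables contains all the \<open>n+1\<close> variables, so the contracting homotopy shows that it is a
  coboundary.
\<close>

lemma coboundary_iff:
  assumes F0: "HF \<noteq> 0" and l: "lift c y"
  shows "cc n c \<in> BB \<longleftrightarrow> y \<in> boundaries n"
proof
  assume "cc n c \<in> BB"
  then obtain h where h: "cochain n h" "cc n c = cc n h" "codiff h {..n} = 0" by (rule coboundaryE)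
  have c: "cochain n c" using l by (simp add: lift_def)
  obtain e where e: "\<And>S. S \<in> idx n \<Longrightarrow> e S \<in> laurents n S" "\<And>S. S \<in> idx n \<Longrightarrow> c S - h S = HF * e S"
    using cc_eq_iff[OF c h(1)] h(2) by metis
  have "HF * y = codiff (\<lambda>S. c S - h S) {..n}"
    using l h(3) by (simp add: codiff_diff lift_def)
  also have "\<dots> = codiff (\<lambda>S. HF * e S) {..n}"
    unfolding codiff_def
  proof (rule sum.cong[OF refl])
    fix i assume "i \<in> {..n}"
    then have "{..n} - {i} \<in> idx n" by (auto simp: idx_n)
    then show "cech_sign i {..n} * (c ({..n} - {i}) - h ({..n} - {i})) = cech_sign i {..n} * (HF * e ({..n} - {i}))"
      by (simp only: e(2))
  qed
  also have "\<dots> = HF * codiff e {..n}" by (rule codiff_mult)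
  finally have "y = codiff e {..n}" using F0 by simp
  moreover have "cochain n e" using e(1) by (simp add: cochain_def)
  ultimately show "y \<in> boundaries n" using codiff_top_boundaries by simp
next
  assume y: "y \<in> boundaries n"
  have c: "cochain n c" "y \<in> laurents n {..n}" "codiff c {..n} = HF * y" using l by (auto simp: lift_def)
  define e where "e = split_top y"
  define c' where "c' S = c S - HF * e S" for S
  have e: "cochain n e" "codiff e {..n} = y"
    unfolding e_def by (rule cochain_split_top[OF c(2)], rule codiff_split_top[OF y])
  have "HF * e S \<in> laurents n S" if "S \<in> idx n" for S
    using cochainD[OF e(1) that] laurents_mono[OF F_polys, of S] by auto
  then have c': "cochain n c'" using c(1) by (auto simp: cochain_def c'_def)
  have "codiff c' {..n} = 0"
    unfolding c'_def using c(3) e(2) by (simp add: codiff_diff codiff_mult)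
  then have top: "codiff c' (insert i S) = 0" if "S \<in> idx n" "i \<in> {..n} - S" for i S
  proof -
    have "insert i S = {..n}" using that by (auto simp: idx_n)
    then show ?thesis using \<open>codiff c' {..n} = 0\<close> by simp
  qed
  have cc': "cc n c = cc n c'"
    unfolding cc_eq_iff[OF c(1) c'] using cochainD[OF e(1)] by (auto simp: c'_def)
  have exact: "codiff (homotopy n c') S = c' S" if S: "S \<in> idx n" for S
  proof -
    have "homotopy n (codiff c') S = 0"
      unfolding homotopy_def by (rule sum.neutral) (simp add: top[OF S])
    moreover have "c' S \<in> boundaries n"
      using cochainD[OF c' S] S unfolding laurents_def boundaries_def
      by (elim supported_mono) (auto simp: idx_n exponents_iff)
    ultimately show ?thesis
      using homotopy_identity[OF idxD(1)[OF S], of c'] sum_slices by simp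
  qed
  show "cc n c \<in> BB"
  proof (cases n)
    case 0
    have "c' S = 0" if "S \<in> idx n" for S
    proof -
      have "S = {}" using idxD(2,3)[OF that] 0 by simp
      then show ?thesis using exact[OF that] by (simp add: codiff_def)
    qed
    then have "cc n c' = cc n (\<lambda>_. 0)" unfolding cc_def by (intro restrict_ext) simp
    then show ?thesis using cc' cc_one 0 by (simp add: cech_coboundaries_def)
  next
    case (Suc m)
    have b: "cochain m (homotopy n c')"
      unfolding cochain_def homotopy_def
    proof (intro ballI laurents_sum)
      fix T i assume T: "T \<in> idx m" and i: "i \<in> {..n} - T"
      have "insert i T \<in> idx n" using T i idxD(2)[OF T] Suc by (auto simp: cech_index_def)
      then have "slice n i (c' (insert i T)) \<in> laurents n T" by (intro slice_laurents cochainD[OF c'])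
      then show "cech_sign i (insert i T) * slice n i (c' (insert i T)) \<in> laurents n T" by (simp add: cech_sign_laurents)
    qed
    have "cc n c' = cc n (codiff (homotopy n c'))" unfolding cc_def by (intro restrict_ext) (simp add: exact)
    then have "cc n c = cech_diff HA hx n m (cc m (homotopy n c'))"
      using cech_diff_cc[OF b] cc' Suc by simp
    then show ?thesis using cc_carrier[OF b] Suc by (simp add: cech_coboundaries_def)
  qed
qed

lemma hcls_eq_iff:
  assumes F0: "HF \<noteq> 0" and "lift c y" "lift c' y'"
  shows "hcls c = hcls c' \<longleftrightarrow> y - y' \<in> boundaries n"
proof -
  have "lift (\<lambda>S. c S - c' S) (y - y')"
    using lift_add[OF assms(2) lift_uminus[OF assms(3)]] by simp
  then show ?thesis using hcls_zero_iff_BB[OF assms(2,3)] coboundary_iff[OF F0] by simp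
qed

lemma cech_frobenius_cc: "cochain n c \<Longrightarrow> cech_frobenius p HA hx n n (cc n c) = cc n (\<lambda>S. c S ^ p)"
  unfolding cech_frobenius_def cc_def by (intro restrict_ext) (simp add: rep_power idxD cochainD)

text \<open>
  All members of the class \<open>hcls c\<close> have the same image, as a lift of a coboundary has \<open>p\<close>-th powers
  that represent a coboundary.
\<close>

lemma frobenius_hcls:
  assumes "lift c y"
  shows "hypersurface_frobenius p n f n (hcls c) = hcls (\<lambda>S. c S ^ p)"
proof -
  have c: "cochain n c" using assms by (simp add: lift_def)
  have "cohomology_class HA hx n n (cech_frobenius p HA hx n n x) = hcls (\<lambda>S. c S ^ p)"
    if x: "x \<in> hcls c" for x
  proof -
    obtain b where b: "b \<in> BB" "x = b \<otimes>\<^bsub>CG n\<^esub> cc n c"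
      using x by (auto simp: hcls_eq_class r_coset_def)
    obtain h where h: "cochain n h" "b = cc n h" "codiff h {..n} = 0"
        "codiff (\<lambda>S. h S ^ p) {..n} = 0" "cc n (\<lambda>S. h S ^ p) \<in> BB"
      using b(1) by (rule coboundaryE)
    have lh: "lift h 0" "lift (\<lambda>S. h S ^ p) 0" using h by (auto simp: lift_def cochain_power)
    have "cech_frobenius p HA hx n n x = cc n (\<lambda>S. h S ^ p + c S ^ p)"
      using cech_frobenius_cc[OF cochain_add[OF h(1) c]] by (simp add: b(2) h(2) cc_mult[OF h(1) c] laurent_power_p_add)
    moreover have "hcls (\<lambda>S. h S ^ p + c S ^ p) = hcls (\<lambda>S. c S ^ p)"
      using hcls_zero_iff_BB[OF lift_add[OF lh(2) lift_power[OF assms]] lift_power[OF assms]] h(5) by simp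
    ultimately show ?thesis by (simp add: hcls_def)
  qed
  moreover have "cc n c \<in> hcls c"
  proof -
    interpret GZ: comm_group GZ by (rule comm_group_GZ)
    interpret N: normal BB GZ by (rule normal_BB)
    show ?thesis unfolding hcls_eq_class by (rule GZ.rcos_self[OF _ N.is_subgroup]) (simp add: lift_ZZ[OF assms])
  qed
  ultimately show ?thesis
    unfolding hypersurface_frobenius_def frobenius_action_def by blast
qed

end

section \<open>Degrees in the local cohomology of the hypersurface\<close>

context hypersurface
begin

abbreviation (input) "piece \<equiv> local_cohomology_piece HA (hypersurface_piece n f) hx n n"
abbreviation (input) "cohomology_le \<equiv> hypersurface_cohomology_le n f n"

lemma codiff_homog:
  assumes "\<And>S. S \<in> idx n \<Longrightarrow> c S \<in> homog n i"
  shows "codiff c {..n} \<in> homog n i"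
  unfolding codiff_def homog_def
proof (rule supported_sum)
  fix j assume "j \<in> {..n}"
  then have c: "c ({..n} - {j}) \<in> homog n i" by (intro assms) (auto simp: idx_n)
  then show "cech_sign j {..n} * c ({..n} - {j}) \<in> supported (\<lambda>m. tdeg n m = i)"
    by (simp add: cech_sign_supported homog_def)
qed

text \<open>
  The pieces of \<open>H\<^sup>n(R/fR)\<close> are given by homogeneous lifts, and the connecting homomorphism lowers the
  degree by \<open>d\<close>. An arbitrary quotient \<open>\<eta>\<close> of the differential by \<open>f\<close> is replaced by its component of
  the right degree.
\<close>

lemma piece_lift:
  assumes "U \<in> piece i"
  obtains c y where "lift c y" "y \<in> homog n (i - int d)" "\<And>S. S \<in> idx n \<Longrightarrow> c S \<in> homog n i" "U = hcls c"
proof -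
  obtain z where z: "z \<in> ZZ" "U = cohomology_class HA hx n n z"
      "\<And>S. S \<in> idx n \<Longrightarrow> z S \<in> cech_ring_piece HA (hypersurface_piece n f) hx S i"
    using assms by (auto simp: local_cohomology_piece_def)
  have "\<forall>S\<in>idx n. \<exists>g. g \<in> laurents n S \<and> g \<in> homog n i \<and> z S = rep S g"
    using z(3) rep_piece[OF idxD(1)] by blast
  then obtain c where c: "\<And>S. S \<in> idx n \<Longrightarrow> c S \<in> laurents n S" "\<And>S. S \<in> idx n \<Longrightarrow> c S \<in> homog n i"
      "\<And>S. S \<in> idx n \<Longrightarrow> z S = rep S (c S)"
    by metis
  have coch: "cochain n c" using c(1) by (simp add: cochain_def)
  have zc: "z = cc n c"
  proof (rule PiE_ext[of z "idx n" "\<lambda>S. carrier (CS S)"])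
    show "z \<in> (\<Pi>\<^sub>E S\<in>idx n. carrier (CS S))"
      using subsetD[OF subgroup.subset[OF subgroup_ZZ] z(1)] by (simp add: cech_group_def)
    show "cc n c \<in> (\<Pi>\<^sub>E S\<in>idx n. carrier (CS S))"
      using cc_carrier[OF coch] by (simp add: cech_group_def)
  qed (use c(3) in \<open>auto simp: cc_def\<close>)
  obtain \<eta> where \<eta>: "\<eta> \<in> laurents n {..n}" "codiff c {..n} = HF * \<eta>"
    using z(1) unfolding zc cocycle_iff[OF coch] by blast
  define y where "y = component n (i - int d) \<eta>"
  have "component n i (\<eta> * HF) = y * HF"
    unfolding y_def by (rule component_mult[OF F_homog])
  moreover have "component n i (HF * \<eta>) = HF * \<eta>"
    by (rule part_supported) (use codiff_homog[of c i] c(2) in \<open>simp add: \<eta>(2) homog_def\<close>)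
  ultimately have "codiff c {..n} = HF * y" using \<eta>(2) by (metis mult.commute)
  moreover have "y \<in> laurents n {..n}" using \<eta>(1) unfolding y_def laurents_def by (rule part_in')
  ultimately have "lift c y" using coch by (simp add: lift_def)
  moreover have "y \<in> homog n (i - int d)" unfolding y_def homog_def by (rule part_in)
  ultimately show thesis using that c(2) z(2) zc by (simp add: hcls_def)
qed

lemma hcls_piece:
  assumes "lift c y" and "\<And>S. S \<in> idx n \<Longrightarrow> c S \<in> homog n i"
  shows "hcls c \<in> piece i"
  unfolding local_cohomology_piece_def hcls_def
proof (intro imageI CollectI conjI ballI)
  show "cc n c \<in> ZZ" using assms(1) by (rule lift_ZZ)
  fix S assume S: "S \<in> idx n"
  have "c S \<in> laurents n S" using assms(1) S by (auto simp: lift_def cochainD)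
  then show "cc n c S \<in> cech_ring_piece HA (hypersurface_piece n f) hx S i"
    using rep_piece[OF idxD(1)[OF S]] assms(2)[OF S] S by (auto simp: cc_def)
qed

lemma piece_le: "U \<in> piece i \<Longrightarrow> i \<le> M \<Longrightarrow> U \<in> cohomology_le M"
  unfolding hypersurface_cohomology_le_def local_cohomology_le_def by (rule generate.incl) auto

lemma zero_le: "hcls (\<lambda>_. 0) \<in> cohomology_le M"
  unfolding hypersurface_cohomology_le_def local_cohomology_le_def hcls_one[symmetric] by (rule generate.one)

lemma homogeneous_frobenius:
  assumes l: "lift c y" and c: "\<And>S. S \<in> idx n \<Longrightarrow> c S \<in> homog n i" and "i \<le> M"
  shows "hcls (\<lambda>S. c S ^ p) \<in> cohomology_le (int p * M)"
proof (rule piece_le)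
  show "hcls (\<lambda>S. c S ^ p) \<in> piece (int p * i)"
    by (rule hcls_piece[OF lift_power[OF l]]) (rule homog_power[OF c])
  show "int p * i \<le> int p * M" using \<open>i \<le> M\<close> by (simp add: mult_left_mono)
qed

text \<open>
  The image under Frobenius is bounded along with the degrees of the lift, since both follow from the
  homogeneous case by additivity.
\<close>

lemma cohomology_le_lift:
  assumes "U \<in> cohomology_le M"
  obtains c y where "lift c y" "y \<in> supported (\<lambda>m. tdeg n m \<le> M - int d)" "U = hcls c"
    "hcls (\<lambda>S. c S ^ p) \<in> cohomology_le (int p * M)"
proof -
  let ?G = "local_cohomology HA hx n n"
  have le: "cohomology_le N = generate ?G (\<Union>i\<in>{..N}. piece i)" for N
    by (simp add: hypersurface_cohomology_le_def local_cohomology_le_def)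
  have low: "y \<in> supported (\<lambda>m. tdeg n m \<le> M - int d)"
    if "y \<in> homog n (i - int d)" "i \<le> M" for i and y :: "'k laurent"
    using that unfolding homog_def by (elim supported_mono) simp
  have "U \<in> generate ?G (\<Union>i\<in>{..M}. piece i)" using assms by (simp add: le)
  then have "\<exists>c y. lift c y \<and> y \<in> supported (\<lambda>m. tdeg n m \<le> M - int d) \<and> U = hcls c \<and>
      hcls (\<lambda>S. c S ^ p) \<in> cohomology_le (int p * M)"
  proof (induction rule: generate.induct)
    case one
    have "hcls (\<lambda>S. 0 ^ p) \<in> cohomology_le (int p * M)"
      using zero_le p_pos by (simp add: power_0_left)
    then show ?case using lift_0 hcls_one by (intro exI[of _ "\<lambda>_. 0"] exI[of _ 0]) simp
  next
    case (incl h)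
    then obtain i where "h \<in> piece i" and i: "i \<le> M" by auto
    then obtain c y where c: "lift c y" "y \<in> homog n (i - int d)"
      "\<And>S. S \<in> idx n \<Longrightarrow> c S \<in> homog n i" "h = hcls c" by (metis piece_lift)
    then show ?case using low[OF c(2) i] homogeneous_frobenius[OF c(1,3) i] by blast
  next
    case (inv h)
    then obtain i where "h \<in> piece i" and i: "i \<le> M" by auto
    then obtain c y where c: "lift c y" "y \<in> homog n (i - int d)"
      "\<And>S. S \<in> idx n \<Longrightarrow> c S \<in> homog n i" "h = hcls c" by (metis piece_lift)
    have "hcls (\<lambda>S. (- c S) ^ p) \<in> cohomology_le (int p * M)"
      by (rule homogeneous_frobenius[OF lift_uminus[OF c(1)] _ i])
         (use c(3) in \<open>auto simp: homog_def\<close>)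
    moreover have "- y \<in> supported (\<lambda>m. tdeg n m \<le> M - int d)" using low[OF c(2) i] by auto
    ultimately show ?case using lift_uminus[OF c(1)] hcls_inv[OF c(1)] c(4) by blast
  next
    case (eng h1 h2)
    obtain c1 y1 where 1: "lift c1 y1" "y1 \<in> supported (\<lambda>m. tdeg n m \<le> M - int d)" "h1 = hcls c1"
      "hcls (\<lambda>S. c1 S ^ p) \<in> cohomology_le (int p * M)" using eng.IH(1) by blast
    obtain c2 y2 where 2: "lift c2 y2" "y2 \<in> supported (\<lambda>m. tdeg n m \<le> M - int d)" "h2 = hcls c2"
      "hcls (\<lambda>S. c2 S ^ p) \<in> cohomology_le (int p * M)" using eng.IH(2) by blast
    have "hcls (\<lambda>S. (c1 S + c2 S) ^ p) = hcls (\<lambda>S. c1 S ^ p) \<otimes>\<^bsub>?G\<^esub> hcls (\<lambda>S. c2 S ^ p)"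
      unfolding laurent_power_p_add hcls_mult[OF lift_power[OF 1(1)] lift_power[OF 2(1)]] ..
    also have "\<dots> \<in> cohomology_le (int p * M)" using 1(4) 2(4) unfolding le by (rule generate.eng)
    finally have "hcls (\<lambda>S. (c1 S + c2 S) ^ p) \<in> cohomology_le (int p * M)" .
    moreover have "y1 + y2 \<in> supported (\<lambda>m. tdeg n m \<le> M - int d)" using 1(2) 2(2) by auto
    ultimately show ?case using lift_add[OF 1(1) 2(1)] hcls_mult[OF 1(1) 2(1)] 1(3) 2(3) by blast
  qed
  then show thesis using that by blast
qed

text \<open>
  Surjectivity of the connecting homomorphism onto the kernel of \<open>f\<close>, degree by degree.
\<close>

lemma split_top_piece:
  assumes y: "y \<in> laurents n {..n}" "y \<in> homog n j" and b: "HF * y \<in> boundaries n"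
  shows "lift (split_top (HF * y)) y" "hcls (split_top (HF * y)) \<in> piece (j + int d)"
proof -
  have L: "HF * y \<in> laurents n {..n}" using laurents_mono[OF F_polys, of "{..n}"] y(1) by auto
  show l: "lift (split_top (HF * y)) y"
    using cochain_split_top[OF L] codiff_split_top[OF b] y(1) by (simp add: lift_def)
  have h: "HF * y \<in> homog n (j + int d)" using homog_mult[OF F_homog y(2)] by (simp add: add.commute)
  show "hcls (split_top (HF * y)) \<in> piece (j + int d)"
  proof (rule hcls_piece[OF l])
    fix S assume "S \<in> idx n"
    then obtain i where i: "i \<le> n" "S = {..n} - {i}" by (auto simp: idx_n)
    have "slice n i (cech_sign i {..n} * (HF * y)) = split_top (HF * y) S"
      using i by (simp add: split_top_idx slice_eps)
    moreover have "cech_sign i {..n} * (HF * y) \<in> homog n (j + int d)"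
      using h by (simp add: cech_sign_supported homog_def)
    ultimately show "split_top (HF * y) S \<in> homog n (j + int d)"
      unfolding homog_def by (metis part_in')
  qed
qed

text \<open>
  Both directions pass through the representatives \<open>y\<close> of the images under the connecting
  homomorphism: two classes have the same image under Frobenius iff the ideal annihilates the
  difference of their representatives.
\<close>

lemma frobenius_injective_iff:
  assumes f0: "f \<noteq> 0" and d: "d > 0"
  defines "M \<equiv> - (int n * (int d - 1))"
  shows "hypersurface_frobenius p n f n \<in> cohomology_le M \<rightarrow> cohomology_le (int p * M) \<and>
      inj_on (hypersurface_frobenius p n f n) (cohomology_le M) \<longleftrightarrow>
    (\<forall>u\<in>exponents n {}. tdeg n u \<ge> (int n + 1) * (int d - 1) - int n \<longrightarrow> monomial u 1 \<in> gens_ideal)"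
    (is "_ \<longleftrightarrow> ?ideal")
proof -
  let ?\<Phi> = "hypersurface_frobenius p n f n"
  have F0: "HF \<noteq> 0" using f0 to_laurent_eq_iff[of f 0] by simp
  \<comment> \<open>The degree shift by \<open>d\<close> matches the shift by \<open>-n-1\<close> in the duality with the polynomial ring.\<close>
  have deg: "M - int d = - ((int n + 1) * (int d - 1) - int n) - int n - 1"
    by (simp add: M_def algebra_simps)
  have into: "?\<Phi> \<in> cohomology_le M \<rightarrow> cohomology_le (int p * M)"
  proof
    fix U assume "U \<in> cohomology_le M"
    then obtain c y where "lift c y" "U = hcls c" "hcls (\<lambda>S. c S ^ p) \<in> cohomology_le (int p * M)"
      by (rule cohomology_le_lift)
    then show "?\<Phi> U \<in> cohomology_le (int p * M)" by (simp add: frobenius_hcls)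
  qed
  have "inj_on ?\<Phi> (cohomology_le M) \<longleftrightarrow> ?ideal"
  proof
    assume ideal: ?ideal
    show "inj_on ?\<Phi> (cohomology_le M)"
    proof (rule inj_onI)
      fix U V assume U: "U \<in> cohomology_le M" and V: "V \<in> cohomology_le M" and eq: "?\<Phi> U = ?\<Phi> V"
      obtain c y where c: "lift c y" "y \<in> supported (\<lambda>m. tdeg n m \<le> M - int d)" "U = hcls c"
        using U by (rule cohomology_le_lift)
      obtain c' y' where c': "lift c' y'" "y' \<in> supported (\<lambda>m. tdeg n m \<le> M - int d)" "V = hcls c'"
        using V by (rule cohomology_le_lift)
      have "HF ^ (p - 1) * y ^ p - HF ^ (p - 1) * y' ^ p \<in> boundaries n"
        using eq hcls_eq_iff[OF F0 lift_power[OF c(1)] lift_power[OF c'(1)]]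
        by (simp only: c(3) c'(3) frobenius_hcls[OF c(1)] frobenius_hcls[OF c'(1)])
      then have "HF ^ (p - 1) * (y - y') ^ p \<in> boundaries n"
        by (simp only: diff_power_p right_diff_distrib)
      moreover have L: "y - y' \<in> laurents n {..n}" using c(1) c'(1) by (auto simp: lift_def)
      ultimately have ann: "\<forall>x\<in>gens_ideal. x * (y - y') \<in> boundaries n" using frobenius_zero_iff by blast
      have S: "y - y' \<in> supported (\<lambda>m. tdeg n m \<le> M - int d)" using c(2) c'(2) by auto
      have "y - y' \<in> boundaries n"
        by (rule annihilator_boundary[OF _ L S[unfolded deg]]) (use ideal ann in auto)
      then show "U = V" using hcls_eq_iff[OF F0 c(1) c'(1)] c(3) c'(3) by simp
    qed
  next
    assume inj: "inj_on ?\<Phi> (cohomology_le M)"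
    show ?ideal
    proof (intro ballI impI, rule ccontr)
      fix u assume u: "u \<in> exponents n {}" and N: "tdeg n u \<ge> (int n + 1) * (int d - 1) - int n"
        and not: "monomial u 1 \<notin> gens_ideal"
      obtain y where y: "y \<in> laurents n {..n}" "y \<in> homog n (- tdeg n u - int n - 1)"
          "\<And>x. x \<in> gens_ideal \<Longrightarrow> x * y \<in> boundaries n" "y \<notin> boundaries n"
        using annihilator_exists[OF d u not] by blast
      let ?c = "split_top (HF * y)"
      note st = split_top_piece[OF y(1,2) y(3)[OF F_in_ideal]]
      have "hcls ?c \<in> cohomology_le M"
        by (rule piece_le[OF st(2)]) (use N deg in linarith)
      moreover have "?\<Phi> (hcls ?c) = ?\<Phi> (hcls (\<lambda>_. 0))"
      proof -
        have "HF ^ (p - 1) * y ^ p \<in> boundaries n" using frobenius_zero_iff[OF y(1)] y(3) by blast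
        then have "hcls (\<lambda>S. ?c S ^ p) = hcls (\<lambda>_. 0)"
          using hcls_eq_iff[OF F0 lift_power[OF st(1)] lift_0] by simp
        moreover have "hcls (\<lambda>S. 0 ^ p) = hcls (\<lambda>_. 0)" using p_pos by (simp add: power_0_left)
        ultimately show ?thesis using frobenius_hcls[OF st(1)] frobenius_hcls[OF lift_0] by simp
      qed
      ultimately have "hcls ?c = hcls (\<lambda>_. 0)" using inj zero_le by (auto dest: inj_onD)
      then have "y \<in> boundaries n" using hcls_eq_iff[OF F0 st(1) lift_0] by simp
      then show False using y(4) by blast
    qed
  qed
  then show ?thesis using into by blast
qed

end

theorem corollary2p16:
  fixes f :: "'k::field mpoly" and p n d :: nat
  assumes "CHAR('k) = p" and "p > 0"
    and "ring.finite_dimension (ring_on (UNIV :: 'k set)) (range (\<lambda>a. a ^ p)) UNIV"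
    and "f \<in> carrier (mpoly_ring n)"
    and "homogeneous (int d) f"
    and "\<not> F_pure p (hypersurface_local_ring n f (irrelevant_ideal n))"
  shows "isolated_non_F_pure_point p n f \<longleftrightarrow>
    hypersurface_frobenius p n f n
      \<in> hypersurface_cohomology_le n f n (- (int n * (int d - 1)))
        \<rightarrow> hypersurface_cohomology_le n f n (- (int p * int n * (int d - 1))) \<and>
    inj_on (hypersurface_frobenius p n f n)
      (hypersurface_cohomology_le n f n (- (int n * (int d - 1))))"
proof -
  have p: "Factorial_Ring.prime p" using assms(1,2) prime_CHAR_semidom by blast
  obtain B :: "'k set" and \<pi> where B: "finite B" "1 \<in> B" "\<And>b. frob_linear p (\<pi> b)"
      "\<And>v. v = (\<Sum>b\<in>B. \<pi> b v ^ p * b)" "\<And>b. b \<in> B \<Longrightarrow> \<pi> b 1 = (if b = 1 then 1 else 0)"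
    using frobenius_basis[OF p assms(1,3)] by blast
  interpret hypersurface p B \<pi> n d f
    by unfold_locales (use p assms B in auto)
  note iso = isolated_iff[OF assms(6)]
  have "- (int p * int n * (int d - 1)) = int p * (- (int n * (int d - 1)))" by (simp only: mult_minus_right mult.assoc)
  moreover have "d > 0" using iso(2) by simp
  ultimately show ?thesis using iso(3) frobenius_injective_iff[OF iso(1)] by metis
qed

end
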